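(* Let $\delta,\epsilon\in(0,1)$, let $L_0>0$, $\Delta>0$, $\mathbf{x}_0\in\mathbb{R}^d$, and let $f(\mathbf{x})=\mathbb{E}_{\xi\sim\Xi}[F(\mathbf{x};\xi)]$ on $\mathbb{R}^d$. Suppose that for every $\xi$ the function $F(\,\cdot\,;\xi):\mathbb{R}^d\to\mathbb{R}$ is $L(\xi)$-Lipschitz with $\mathbb{E}_{\xi\sim\Xi}[L(\xi)^2]\le L_0^2$, and that $f(\mathbf{x}_0)-\inf_{\mathbf{x}}f(\mathbf{x})\le\Delta$. Then there exists $$T=O\left(\frac{dL_0^2\Delta}{\delta\epsilon^3}\right)$$ such that setting $$\rho=\min\left\{\frac{\delta}{2},\frac{\Delta}{L_0}\right\},\quad \nu=\max\left\{\frac{\delta}{2},\delta-\frac{\Delta}{L_0}\right\},\quad D=\left(\frac{(\Delta+\rho L_0)\sqrt{\nu}}{\sqrt{d}\,L_0T}\right)^{2/3},\quad \eta=\frac{\Delta+\rho L_0}{dL_0^2T},$$ and running the algorithm $\mathcal{A}(\mathbf{x}_0,\rho,\nu,D,\eta,T)$ (defined in the context, with the subroutine GradEstimator defined there) outputs a point $\mathbf{x}^{\mathrm{out}}$ satisfying $$\mathbb{E}\left[\left\|\bar{\partial}_{\delta}f(\mathbf{x}^{\mathrm{out}})\right\|\right]\le\epsilon$$ using $2T$ noisy function evaluations.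
   Context: Here $d\in\mathbb{N}$ is the dimension, $\|\cdot\|$ is the Euclidean norm, $\mathbb{B}(\mathbf{x},\delta)$ is the closed Euclidean ball of radius $\delta$ around $\mathbf{x}$, $\mathbb{S}^{d-1}$ is the unit sphere in $\mathbb{R}^d$, and $\mathrm{Unif}(A)$ is the uniform distribution on $A$. $O(\cdot)$ hides an absolute constant that does not depend on any problem parameter. $\Xi$ is a probability distribution, and $f(\mathbf{x})=\mathbb{E}_{\xi\sim\Xi}[F(\mathbf{x};\xi)]$ is assumed well defined. A noisy function evaluation is one evaluation of $F(\mathbf{x};\xi)$ at a point $\mathbf{x}$ chosen by the algorithm, where $\xi\sim\Xi$ is drawn by the algorithm (the same drawn $\xi$ may be used at several points). For a Lipschitz $f:\mathbb{R}^d\to\mathbb{R}$, the Clarke subdifferential is $\partial f(\mathbf{x}):=\mathrm{conv}\{\mathbf{g}:\mathbf{g}=\lim_{n\to\infty}\nabla f(\mathbf{x}_n),\ \mathbf{x}_n\to\mathbf{x}\}$, over sequences of points $\mathbf{x}_n$ at which $f$ is differentiable. The Goldstein $\delta$-subdifferential is $\partial_\delta f(\mathbf{x}):=\mathrm{conv}\left(\bigcup_{\mathbf{y}\in\mathbb{B}(\mathbf{x},\delta)}\partial f(\mathbf{y})\right)$, and $\bar{\partial}_\delta f(\mathbf{x}):=\arg\min_{\mathbf{g}\in\partial_\delta f(\mathbf{x})}\|\mathbf{g}\|$ is its minimum-norm element. Subroutine GradEstimator$(\mathbf{x},\rho,\xi)$: sample $\mathbf{w}\sim\mathrm{Unif}(\mathbb{S}^{d-1})$,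 evaluate $F(\mathbf{x}+\rho\mathbf{w};\xi)$ and $F(\mathbf{x}-\rho\mathbf{w};\xi)$, and return $\mathbf{g}=\frac{d}{2\rho}\left(F(\mathbf{x}+\rho\mathbf{w};\xi)-F(\mathbf{x}-\rho\mathbf{w};\xi)\right)\mathbf{w}$. Algorithm $\mathcal{A}(\mathbf{x}_0,\rho,\nu,D,\eta,T)$, with inputs $\mathbf{x}_0\in\mathbb{R}^d$, $\rho,\nu,D,\eta>0$, $T\in\mathbb{N}$. Set $\boldsymbol{\Delta}_1=\mathbf{0}$. For $t=1,\dots,T$: sample $\xi_t\sim\Xi$ and $s_t\sim\mathrm{Unif}[0,1]$; set $\mathbf{x}_t=\mathbf{x}_{t-1}+\boldsymbol{\Delta}_t$, $\mathbf{z}_t=\mathbf{x}_{t-1}+s_t\boldsymbol{\Delta}_t$, $\mathbf{g}_t=\text{GradEstimator}(\mathbf{z}_t,\rho,\xi_t)$, and $\boldsymbol{\Delta}_{t+1}=\min\left(1,\frac{D}{\|\boldsymbol{\Delta}_t-\eta\mathbf{g}_t\|}\right)\cdot(\boldsymbol{\Delta}_t-\eta\mathbf{g}_t)$ (i.e. $\boldsymbol{\Delta}_t-\eta\mathbf{g}_t$ is projected onto the ball of radius $D$ around the origin). Then set $M=\lfloor\nu/D\rfloor$, $K=\lfloor T/M\rfloor$, and for $k=1,\dots,K$ set $\overline{\mathbf{x}}_k=\frac1M\sum_{m=1}^M\mathbf{z}_{(k-1)M+m}$. Sample $k_{\mathrm{out}}\sim\mathrm{Unif}\{1,\dots,K\}$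 and output $\mathbf{x}^{\mathrm{out}}=\overline{\mathbf{x}}_{k_{\mathrm{out}}}$ (together with the points $(\mathbf{z}_{(k_{\mathrm{out}}-1)M+m})_{m=1}^M$). All random samples drawn by the algorithm are mutually independent.
   Formalization: The bound is T ≤ max(1, C·dL0²Δ/(δε³)) since T must be a positive integer; if the algorithm has no complete block (K = 0) it outputs x0, and K ≥ 1 is guaranteed only when ε ≤ L0 and δε ≤ Δ. *)

theory Defs
  imports "HOL-Probability.Probability"
begin

definition clarke_subdiff :: "('a::euclidean_space \<Rightarrow> real) \<Rightarrow> 'a \<Rightarrow> 'a set" where
  "clarke_subdiff f x = convex hull
     {g. \<exists>X G. X \<longlonglongrightarrow> x \<and> (\<forall>n::nat. GDERIV f (X n) :> G n) \<and> G \<longlonglongrightarrow> g}"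

definition goldstein_subdiff :: "real \<Rightarrow> ('a::euclidean_space \<Rightarrow> real) \<Rightarrow> 'a \<Rightarrow> 'a set" where
  "goldstein_subdiff \<delta> f x = convex hull (\<Union>y\<in>cball x \<delta>. clarke_subdiff f y)"

definition min_norm_subgrad :: "real \<Rightarrow> ('a::euclidean_space \<Rightarrow> real) \<Rightarrow> 'a \<Rightarrow> 'a" where
  "min_norm_subgrad \<delta> f x = arg_min_on norm (goldstein_subdiff \<delta> f x)"

text \<open>
  The uniform distribution on the unit sphere is taken as the radial projection of the uniform
  distribution on the unit ball (the normalised cone measure, which for the Euclidean norm is the
  normalised surface measure, i.e. the rotation-invariant probability measure). The origin, where
  the projection is not on the sphere, is a null set.
\<close>

definition unif_sphere :: "'a::euclidean_space measure" where
  "unif_sphere = distr (uniform_measure lborel (cball 0 1)) borel (\<lambda>x. x /\<^sub>R norm x)"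

text \<open>
  An algorithm sees the objective only through noisy evaluations. It is a value of the following
  type; the oracle is supplied from outside when the computation is run, so every access to
  it is counted.
\<close>

datatype ('q, 'r, 'a) oracle_comp =
    Done 'a
  | Ask 'q "'r \<Rightarrow> ('q, 'r, 'a) oracle_comp"

primrec bind_comp ::
  "('q, 'r, 'a) oracle_comp \<Rightarrow> ('a \<Rightarrow> ('q, 'r, 'b) oracle_comp) \<Rightarrow> ('q, 'r, 'b) oracle_comp" where
  "bind_comp (Done a) h = h a"
| "bind_comp (Ask q c) h = Ask q (\<lambda>r. bind_comp (c r) h)"

primrec run_comp :: "('q \<Rightarrow> 'r) \<Rightarrow> ('q, 'r, 'a) oracle_comp \<Rightarrow> 'a" where
  "run_comp orc (Done a) = a"
| "run_comp orc (Ask q c) = run_comp orc (c (orc q))"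

primrec num_queries :: "('q \<Rightarrow> 'r) \<Rightarrow> ('q, 'r, 'a) oracle_comp \<Rightarrow> nat" where
  "num_queries orc (Done a) = 0"
| "num_queries orc (Ask q c) = Suc (num_queries orc (c (orc q)))"

text \<open>
  All random samples are explicit arguments: \<open>\<omega> t = (\<xi>\<^sub>t, s\<^sub>t, w\<^sub>t)\<close> for
  \<open>t = 1, \<dots>, T\<close>, where \<open>w\<^sub>t\<close> is the direction drawn by the gradient estimator in
  round \<open>t\<close>, and the block index \<open>k\<close>. Their joint law is \<open>alg_samples\<close>.
\<close>

definition grad_estimator ::
  "real^'n \<Rightarrow> real \<Rightarrow> 'w \<Rightarrow> real^'n \<Rightarrow> ((real^'n) \<times> 'w, real, real^'n) oracle_comp" where
  "grad_estimator x \<rho> \<xi> w =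
     Ask (x + \<rho> *\<^sub>R w, \<xi>) (\<lambda>a.
     Ask (x - \<rho> *\<^sub>R w, \<xi>) (\<lambda>b.
     Done ((real CARD('n) / (2 * \<rho>) * (a - b)) *\<^sub>R w)))"

text \<open>
  After \<open>t\<close> rounds the state is \<open>(x\<^sub>t, \<Delta>\<^sub>t\<^sub>+\<^sub>1, [z\<^sub>1, \<dots>, z\<^sub>t])\<close>.
\<close>

primrec alg_rounds ::
  "real^'n \<Rightarrow> real \<Rightarrow> real \<Rightarrow> real \<Rightarrow> (nat \<Rightarrow> 'w \<times> real \<times> (real^'n)) \<Rightarrow> nat
    \<Rightarrow> ((real^'n) \<times> 'w, real, (real^'n) \<times> (real^'n) \<times> (real^'n) list) oracle_comp" where
  "alg_rounds x0 \<rho> D \<eta> \<omega> 0 = Done (x0, 0, [])"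
| "alg_rounds x0 \<rho> D \<eta> \<omega> (Suc t) =
     bind_comp (alg_rounds x0 \<rho> D \<eta> \<omega> t) (\<lambda>(x, \<Delta>, zs).
       let (\<xi>, s, w) = \<omega> (Suc t);
           z = x + s *\<^sub>R \<Delta>
       in bind_comp (grad_estimator z \<rho> \<xi> w) (\<lambda>g.
            let v = \<Delta> - \<eta> *\<^sub>R g
            in Done (x + \<Delta>, min 1 (D / norm v) *\<^sub>R v, zs @ [z])))"

definition block_length :: "real \<Rightarrow> real \<Rightarrow> nat" where
  "block_length \<nu> D = nat \<lfloor>\<nu> / D\<rfloor>"

definition num_blocks :: "real \<Rightarrow> real \<Rightarrow> nat \<Rightarrow> nat" where
  "num_blocks \<nu> D T = T div block_length \<nu> D"

text \<open>
  If there is no complete block (\<open>M = 0\<close> or \<open>M > T\<close>, hence \<open>K = 0\<close>), there is no block index to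
  sample; the run then returns the starting point. Note \<open>z\<^sub>t = zs ! (t - 1)\<close>.
\<close>

definition algorithm ::
  "real^'n \<Rightarrow> real \<Rightarrow> real \<Rightarrow> real \<Rightarrow> real \<Rightarrow> nat
    \<Rightarrow> (nat \<Rightarrow> 'w \<times> real \<times> (real^'n)) \<times> nat
    \<Rightarrow> ((real^'n) \<times> 'w, real, (real^'n) \<times> (real^'n) list) oracle_comp" where
  "algorithm x0 \<rho> \<nu> D \<eta> T = (\<lambda>(\<omega>, k).
     bind_comp (alg_rounds x0 \<rho> D \<eta> \<omega> T) (\<lambda>(x, \<Delta>, zs).
       let M = block_length \<nu> D;
           K = num_blocks \<nu> D T;
           z = (\<lambda>m. zs ! ((k - 1) * M + m - 1))
       in if K = 0 then Done (x0, [])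
          else Done ((1 / real M) *\<^sub>R (\<Sum>m=1..M. z m), map z [1..<Suc M])))"

text \<open>
  For \<open>K = 0\<close> the law of the (then unused) block index is some unspecified probability
  distribution.
\<close>

definition alg_samples ::
  "'w measure \<Rightarrow> real \<Rightarrow> real \<Rightarrow> nat \<Rightarrow> ((nat \<Rightarrow> 'w \<times> real \<times> (real^'n)) \<times> nat) measure" where
  "alg_samples \<Xi> \<nu> D T =
     (\<Pi>\<^sub>M t\<in>{1..T}. \<Xi> \<Otimes>\<^sub>M uniform_measure lborel {0..1} \<Otimes>\<^sub>M unif_sphere)
       \<Otimes>\<^sub>M measure_pmf (pmf_of_set {1..num_blocks \<nu> D T})"

definition alg_output ::
  "(real^'n \<Rightarrow> 'w \<Rightarrow> real) \<Rightarrow> real^'n \<Rightarrow> real \<Rightarrow> real \<Rightarrow> real \<Rightarrow> real \<Rightarrow> nat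
    \<Rightarrow> (nat \<Rightarrow> 'w \<times> real \<times> (real^'n)) \<times> nat \<Rightarrow> real^'n" where
  "alg_output F x0 \<rho> \<nu> D \<eta> T \<sigma> =
     fst (run_comp (\<lambda>(x, \<xi>). F x \<xi>) (algorithm x0 \<rho> \<nu> D \<eta> T \<sigma>))"

definition alg_evaluations ::
  "(real^'n \<Rightarrow> 'w \<Rightarrow> real) \<Rightarrow> real^'n \<Rightarrow> real \<Rightarrow> real \<Rightarrow> real \<Rightarrow> real \<Rightarrow> nat
    \<Rightarrow> (nat \<Rightarrow> 'w \<times> real \<times> (real^'n)) \<times> nat \<Rightarrow> nat" where
  "alg_evaluations F x0 \<rho> \<nu> D \<eta> T \<sigma> =
     num_queries (\<lambda>(x, \<xi>). F x \<xi>) (algorithm x0 \<rho> \<nu> D \<eta> T \<sigma>)"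

text \<open>
  The absolute constant hidden in the iteration bound. The dimension is a type, so a
  constant bound by an existential quantifier inside a theorem could depend on it; a closed numeral
  cannot. The value is deliberately generous.
\<close>

definition iteration_const :: real where
  "iteration_const = 10 ^ 12"

end

theory Submission
  imports Defs
begin

text \<open>
  Let \<open>f\<^sub>\<rho>\<close> be the average of \<open>f\<close> over balls of radius \<open>\<rho>\<close>. The estimator is unbiased for \<open>\<nabla>f\<^sub>\<rho>\<close>
  and, because a Lipschitz function on the sphere has antipodal variance of order \<open>1/d\<close>, its second
  moment is \<open>O(d L0\<^sup>2)\<close> rather than \<open>O(d\<^sup>2 L0\<^sup>2)\<close>. As \<open>s\<^sub>t\<close> is uniform, the expected change of \<open>f\<^sub>\<rho>\<close> in a
  round is exactly \<open>E \<langle>g\<^sub>t, \<Delta>\<^sub>t\<rangle>\<close>. The increments \<open>\<Delta>\<^sub>t\<close> are the iterates of projected online gradient descent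
  with losses \<open>\<langle>g\<^sub>t, \<cdot>\<rangle>\<close>; comparing them on each block of \<open>M\<close> rounds with the vector of length \<open>D\<close>
  opposite to \<open>\<Sum>\<nabla>f\<^sub>\<rho>(z\<^sub>t)\<close> bounds the expected norm of that sum, up to the norm of a martingale. All \<open>z\<^sub>t\<close> of
  a block lie within \<open>M D \<le> \<nu>\<close> of their mean, and by Rademacher's theorem and separation \<open>\<nabla>f\<^sub>\<rho>(z)\<close> lies
  in the Goldstein \<open>\<rho>\<close>-subdifferential at \<open>z\<close>, so the average gradient of a block lies in the
  \<open>\<delta>\<close>-subdifferential at the output.
\<close>

section \<open>Rademacher's theorem\<close>

text \<open>The delicate point is a second moment linear in the dimension, while the sphere is given
  only as a radial projection, with no rotations at hand. They are found in the doubled space: the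
  uniform law on its unit ball is invariant under rotating the two halves into each other, which a
  product of two uniform balls is not. As \<open>f\<close> has no derivative to start from, the
  gradient of its average is obtained in integrated form, by moving increments from \<open>f\<close>
  to an explicit cutoff. Rademacher's theorem enters only through the Goldstein subdifferential, to
  show that it is nonempty and that it contains the smoothed gradients. The parameter choice needs
  \<open>\<epsilon> \<le> L0\<close> and \<open>\<delta> * \<epsilon> \<le> \<Delta>\<close>;
  otherwise \<open>x0\<close> itself is good enough, either because all subgradients are short or
  because a larger minimal norm would force a decrease by more than \<open>\<Delta>\<close>.
  Finally, the minimal norm is a function defined by choice and evaluated at a random point; its
  expectation is controlled only once it is Borel, which follows from closed sublevel sets.\<close>

lemma AE_not_negligible:
  fixes N :: "'a::euclidean_space set"
  assumes "negligible N"
  shows "AE x in lborel. x \<notin> N"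
proof -
  have "AE x in lebesgue. x \<notin> N"
    using assms unfolding negligible_iff_null_sets by (rule AE_not_in)
  then show ?thesis by (simp add: AE_completion_iff)
qed

lemma inverse_Suc_tendsto_0: "(\<lambda>n. 1 / real (Suc n)) \<longlonglongrightarrow> 0"
  using LIMSEQ_inverse_real_of_nat by (simp add: inverse_eq_divide)

text \<open>The map \<open>h x = g x + (C + 1) x\<close> is bi-Lipschitz, so the image of Lebesgue measure under its
  inverse has a density \<open>r\<close>, of which \<open>h\<close> is a primitive. The library's Lebesgue differentiation theorem
  gives one-sided derivatives; reflection supplies the other side.\<close>

lemma lipschitz_real_AE_DERIV:
  fixes g :: "real \<Rightarrow> real"
  assumes lip: "C-lipschitz_on UNIV g"
  shows "AE x in lborel. \<exists>D. (g has_real_derivative D) (at x)"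
proof -
  define h where "h x = g x + (C + 1) * x" for x
  have g_le: "\<bar>g y - g x\<bar> \<le> C * \<bar>y - x\<bar>" for x y
    using lipschitz_onD[OF lip, of y x] by (simp add: dist_real_def)
  have C0: "0 \<le> C" using lip by (rule lipschitz_on_nonneg)
  have h_lower: "y - x \<le> h y - h x" if "x \<le> y" for x y
    using g_le[of y x] that by (simp add: h_def algebra_simps)
  have h_upper: "\<bar>h y - h x\<bar> \<le> (2 * C + 1) * \<bar>y - x\<bar>" for x y
  proof -
    have "\<bar>h y - h x\<bar> \<le> \<bar>g y - g x\<bar> + \<bar>(C + 1) * (y - x)\<bar>"
      unfolding h_def by (simp add: algebra_simps)
    also have "\<dots> \<le> C * \<bar>y - x\<bar> + (C + 1) * \<bar>y - x\<bar>"
      using g_le[of y x] C0 by (simp add: abs_mult)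
    finally show ?thesis by (simp add: algebra_simps)
  qed
  have "continuous_on UNIV g" using lip by (rule lipschitz_on_continuous_on)
  then have h_cont: "continuous_on UNIV h"
    unfolding h_def by (intro continuous_intros)
  have h_inj: "inj h"
  proof (rule injI)
    fix x y assume "h x = h y"
    then show "x = y" using h_lower[of x y] h_lower[of y x] by linarith
  qed
  have h_mono: "h x \<le> h y \<longleftrightarrow> x \<le> y" for x y
    using h_lower[of x y] h_lower[of y x] by linarith
  have h_surj: "surj h"
  proof -
    have "\<exists>x. h x = z" for z
    proof -
      define B where "B = \<bar>z\<bar> + \<bar>h 0\<bar>"
      have "h (-B) \<le> z" "z \<le> h B" using h_lower[of "-B" 0] h_lower[of 0 B] unfolding B_def by linarith+
      moreover have "- B \<le> B" "continuous_on {-B..B} h"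
        using continuous_on_subset[OF h_cont] by (auto simp: B_def)
      ultimately show ?thesis using IVT'[of h "-B" z B] by blast
    qed
    then show ?thesis by (metis surj_def)
  qed
  define k where "k = inv h"
  have hk [simp]: "h (k z) = z" for z unfolding k_def using h_surj by (simp add: surj_f_inv_f)
  have kh [simp]: "k (h x) = x" for x unfolding k_def using h_inj by simp
  have "1-lipschitz_on UNIV k"
  proof (rule lipschitz_onI)
    fix x y :: real
    show "dist (k x) (k y) \<le> 1 * dist x y"
      using h_lower[of "k x" "k y"] h_lower[of "k y" "k x"] unfolding dist_real_def hk by (cases "k x \<le> k y"; simp)
  qed simp
  then have "continuous_on UNIV k" by (rule lipschitz_on_continuous_on)
  then have k_meas [measurable]: "k \<in> borel_measurable borel"
    by (rule borel_measurable_continuous_onI)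
  define \<mu> where "\<mu> = distr lborel borel k"
  have em: "emeasure \<mu> A = emeasure lborel (k -` A)" if "A \<in> sets borel" for A
    unfolding \<mu>_def using that by (subst emeasure_distr) auto
  \<comment> \<open>The preimage of a null set under \<open>k\<close> is its image under
    \<open>h\<close>, and Lipschitz maps send null sets to null sets.\<close>
  have "absolutely_continuous lborel \<mu>"
    unfolding absolutely_continuous_def
  proof
    fix A :: "real set" assume A: "A \<in> null_sets lborel"
    then have Ab: "A \<in> sets borel" by auto
    have "A \<in> null_sets lebesgue" using A by (rule null_sets_completionI)
    then have "negligible A" by (simp add: negligible_iff_null_sets)
    then have "negligible (h ` A)"
      by (rule negligible_locally_Lipschitz_image[rotated])
         (use h_upper in \<open>auto intro!: exI[of _ UNIV] exI[of _ "2*C+1"]\<close>)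
    moreover have im: "h ` A = k -` A" by (auto simp: image_iff) (metis hk)
    ultimately have "k -` A \<in> null_sets lebesgue" by (simp add: negligible_iff_null_sets)
    moreover have "k -` A \<in> sets borel" using measurable_sets[OF k_meas Ab] by simp
    ultimately have "emeasure lborel (k -` A) = 0"
      by (simp add: null_sets_completion_iff null_setsD1)
    then show "A \<in> null_sets \<mu>" using em[OF Ab] Ab by (auto simp: \<mu>_def)
  qed
  then obtain \<phi> where \<phi> [measurable]: "\<phi> \<in> borel_measurable lborel" and dens: "density lborel \<phi> = \<mu>"
    using sigma_finite_measure.Radon_Nikodym[OF sigma_finite_lborel, of \<mu>] by (auto simp: \<mu>_def)
  \<comment> \<open>The density is finite almost everywhere because its integrals are the finite
    increments of \<open>h\<close>, so real values suffice.\<close>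
  define r where "r x = enn2real (\<phi> x)" for x
  have r_int: "(r has_integral (h b - h a)) {a..b}" if "a \<le> b" for a b
  proof -
    have vim: "k -` {a..b} = {h a..h b}"
      by auto (metis h_mono hk)+
    have "(\<integral>\<^sup>+x. \<phi> x * indicator {a..b} x \<partial>lborel) = emeasure \<mu> {a..b}"
      unfolding dens[symmetric] by (subst emeasure_density) auto
    also have "\<dots> = ennreal (h b - h a)"
      using h_mono that by (subst em) (auto simp: vim)
    finally have eq: "(\<integral>\<^sup>+x. \<phi> x * indicator {a..b} x \<partial>lborel) = ennreal (h b - h a)" .
    then have "AE x in lborel. \<phi> x * indicator {a..b} x \<noteq> \<infinity>"
      by (intro nn_integral_noteq_infinite) auto
    then have "(\<integral>\<^sup>+x. ennreal (r x * indicator {a..b} x) \<partial>lborel) = (\<integral>\<^sup>+x. \<phi> x * indicator {a..b} x \<partial>lborel)"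
      by (intro nn_integral_cong_AE) (auto simp: r_def indicator_def less_top)
    then have "has_bochner_integral lborel (\<lambda>x. r x * indicator {a..b} x) (h b - h a)"
      unfolding eq using h_mono that
      by (intro has_bochner_integral_nn_integral) (auto simp: r_def)
    then have "((\<lambda>x. r x * indicator {a..b} x) has_integral (h b - h a)) UNIV"
      by (metis has_bochner_integral_iff has_integral_integral_lborel)
    moreover have "(\<lambda>x. r x * indicator {a..b} x) = (\<lambda>x. if x \<in> {a..b} then r x else 0)"
      by (auto simp: indicator_def)
    ultimately show ?thesis by (simp only: has_integral_restrict_UNIV)
  qed
  have r_on: "r integrable_on cbox a b" for a b
  proof (cases "a \<le> b")
    case True then show ?thesis using r_int[OF True] by (auto simp: integrable_on_def)
  qed auto
  have r_int': "((\<lambda>x. r (- x)) has_integral (h b - h a)) {-b..-a}" if "a \<le> b" for a b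
    using r_int[OF that] by (simp only: has_integral_reflect_real)
  have r_on': "(\<lambda>x. r (- x)) integrable_on cbox a b" for a b
  proof (cases "a \<le> b")
    case True
    then show ?thesis using r_int'[of "-b" "-a"] by (auto simp: integrable_on_def)
  qed auto
  obtain N where N: "negligible N" "\<And>x e. \<lbrakk>x \<notin> N; 0 < e\<rbrakk> \<Longrightarrow>
       \<exists>d>0. \<forall>h. 0 < h \<and> h < d \<longrightarrow> norm (integral (cbox x (x + h *\<^sub>R One)) r /\<^sub>R h ^ DIM(real) - r x) < e"
    using integrable_ccontinuous_explicit[OF r_on] by blast
  obtain N' where N': "negligible N'" "\<And>x e. \<lbrakk>x \<notin> N'; 0 < e\<rbrakk> \<Longrightarrow>
       \<exists>d>0. \<forall>h. 0 < h \<and> h < d \<longrightarrow> norm (integral (cbox x (x + h *\<^sub>R One)) (\<lambda>x. r (-x)) /\<^sub>R h ^ DIM(real) - r (-x)) < e"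
    using integrable_ccontinuous_explicit[OF r_on'] by blast
  have der: "(g has_real_derivative (r x - (C + 1))) (at x)" if xN: "x \<notin> N" "- x \<notin> N'" for x
  proof -
    have "(h has_real_derivative r x) (at x)"
      unfolding DERIV_def LIM_eq
    proof (intro allI impI)
      fix e :: real assume e: "0 < e"
      obtain d1 where d1: "d1 > 0" "\<And>t. 0 < t \<Longrightarrow> t < d1 \<Longrightarrow> \<bar>integral {x..x+t} r / t - r x\<bar> < e"
        using N(2)[OF xN(1) e] by (auto simp: divide_inverse mult.commute)
      obtain d2 where d2: "d2 > 0" "\<And>t. 0 < t \<Longrightarrow> t < d2 \<Longrightarrow> \<bar>integral {-x..-x+t} (\<lambda>x. r (-x)) / t - r x\<bar> < e"
        using N'(2)[OF xN(2) e] by (auto simp: divide_inverse mult.commute)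
      show "\<exists>s>0. \<forall>t. t \<noteq> 0 \<and> norm (t - 0) < s \<longrightarrow> norm ((h (x + t) - h x) / t - r x) < e"
      proof (intro exI[of _ "min d1 d2"] conjI allI impI)
        fix t :: real assume t: "t \<noteq> 0 \<and> norm (t - 0) < min d1 d2"
        show "norm ((h (x + t) - h x) / t - r x) < e"
        proof (cases "t > 0")
          case True
          have "integral {x..x+t} r = h (x + t) - h x" using r_int[of x "x+t"] True by (simp add: integral_unique)
          then show ?thesis using d1(2)[of t] True t by simp
        next
          case False
          \<comment> \<open>For \<open>t < 0\<close> the quotient is an average of \<open>r\<close>
            over an interval ending at \<open>x\<close>; reflection turns it into one starting at
            \<open>- x\<close>.\<close>
          define u where "u = - t"
          have u: "0 < u" "u < d2" using t False by (auto simp: u_def)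
          have "integral {-x..-x+u} (\<lambda>x. r (-x)) = h x - h (x - u)"
            using r_int'[of "x-u" x] u by (simp add: integral_unique)
          then show ?thesis using d2(2)[of u] u by (simp add: u_def minus_divide_left[symmetric] field_simps)
        qed
      qed (use d1 d2 in auto)
    qed
    then have "((\<lambda>x. h x - (C + 1) * x) has_real_derivative (r x - (C + 1))) (at x)"
      by (auto intro!: derivative_eq_intros)
    then show ?thesis by (simp add: h_def)
  qed
  have "negligible (uminus ` N')"
    using N'(1) 
    by (rule negligible_locally_Lipschitz_image[rotated]) (auto intro!: exI[of _ UNIV] exI[of _ "1::real"])
  then have "negligible (N \<union> uminus ` N')" using N(1) by (rule negligible_Un[rotated])
  then have "AE x in lborel. x \<notin> N \<union> uminus ` N'" by (rule AE_not_negligible)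
  then show ?thesis
  proof (rule AE_mp, intro AE_I2 impI)
    fix x assume "x \<notin> N \<union> uminus ` N'"
    then have "x \<notin> N" "- x \<notin> N'" by (auto simp: image_iff)
    then show "\<exists>D. (g has_real_derivative D) (at x)" using der by blast
  qed
qed


section \<open>Changes of variables, and from directional to total derivatives\<close>

lemma lborel_integral_affine:
  fixes \<phi> :: "'a::euclidean_space \<Rightarrow> 'b::{banach, second_countable_topology}"
  assumes [measurable]: "\<phi> \<in> borel_measurable borel" and c: "c \<noteq> 0"
  shows "(\<integral>x. \<phi> x \<partial>lborel) = \<bar>c\<bar> ^ DIM('a) *\<^sub>R (\<integral>x. \<phi> (t + c *\<^sub>R x) \<partial>lborel)"
  by (subst lborel_affine[OF c, of t]) (simp add: integral_density integral_distr)

lemma lborel_integrable_affine: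
  fixes \<phi> :: "'a::euclidean_space \<Rightarrow> 'b::{banach, second_countable_topology}"
  assumes int: "integrable lborel \<phi>" and c: "c \<noteq> 0"
  shows "integrable lborel (\<lambda>x. \<phi> (t + c *\<^sub>R x))"
proof -
  have m [measurable]: "\<phi> \<in> borel_measurable borel" using int by auto
  have "integrable (density (distr lborel borel (\<lambda>x. t + c *\<^sub>R x)) (\<lambda>_. \<bar>c\<bar> ^ DIM('a))) \<phi>"
    using int by (subst (asm) lborel_affine[OF c, of t])
  then have "integrable (distr lborel borel (\<lambda>x. t + c *\<^sub>R x)) (\<lambda>x. \<bar>c\<bar> ^ DIM('a) *\<^sub>R \<phi> x)"
    by (subst (asm) integrable_density) auto
  then have "integrable lborel (\<lambda>x. \<bar>c\<bar> ^ DIM('a) *\<^sub>R \<phi> (t + c *\<^sub>R x))"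
    by (subst (asm) integrable_distr_eq) auto
  moreover define k where "k = \<bar>c\<bar> ^ DIM('a)"
  ultimately have "integrable lborel (\<lambda>x. k *\<^sub>R \<phi> (t + c *\<^sub>R x))" by simp
  then have "integrable lborel (\<lambda>x. inverse k *\<^sub>R (k *\<^sub>R \<phi> (t + c *\<^sub>R x)))"
    by (rule integrable_scaleR_right)
  moreover have "k \<noteq> 0" using c by (simp add: k_def)
  ultimately show ?thesis by simp
qed

lemma lborel_nn_integral_translate:
  fixes \<phi> :: "'a::euclidean_space \<Rightarrow> ennreal"
  assumes [measurable]: "\<phi> \<in> borel_measurable borel"
  shows "(\<integral>\<^sup>+x. \<phi> (x + t) \<partial>lborel) = (\<integral>\<^sup>+x. \<phi> x \<partial>lborel)"
proof -
  have "(\<integral>\<^sup>+x. \<phi> x \<partial>lborel) = (\<integral>\<^sup>+x. \<phi> x \<partial>distr lborel borel ((+) t))"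
    by (simp add: lborel_distr_plus)
  also have "\<dots> = (\<integral>\<^sup>+x. \<phi> (x + t) \<partial>lborel)"
    by (subst nn_integral_distr) (auto simp: add.commute)
  finally show ?thesis by simp
qed

text \<open>By Lebesgue differentiation almost every value of \<open>\<phi>\<close> is a limit of
  averages over shrinking cubes, and all these averages vanish.\<close>

lemma AE_zero_if_integral_cbox_zero:
  fixes \<phi> :: "'a::euclidean_space \<Rightarrow> real"
  assumes int: "\<And>a b. integrable lborel (\<lambda>x. indicator (cbox a b) x * \<phi> x)"
    and zero: "\<And>a b. (\<integral>x. indicator (cbox a b) x * \<phi> x \<partial>lborel) = 0"
  shows "AE x in lborel. \<phi> x = 0"
proof -
  have hi: "(\<phi> has_integral 0) (cbox a b)" for a b
  proof -
    have "((\<lambda>x. indicator (cbox a b) x * \<phi> x) has_integral 0) UNIV"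
      using has_integral_integral_lborel[OF int[of a b]] by (simp add: zero)
    moreover have "(\<lambda>x. indicator (cbox a b) x * \<phi> x) = (\<lambda>x. if x \<in> cbox a b then \<phi> x else 0)"
      by (auto simp: indicator_def)
    ultimately show ?thesis by (simp only: has_integral_restrict_UNIV)
  qed
  have on: "\<phi> integrable_on cbox a b" for a b using hi by (auto simp: integrable_on_def)
  obtain N where N: "negligible N" "\<And>x e. \<lbrakk>x \<notin> N; 0 < e\<rbrakk> \<Longrightarrow>
       \<exists>d>0. \<forall>h. 0 < h \<and> h < d \<longrightarrow> norm (integral (cbox x (x + h *\<^sub>R One)) \<phi> /\<^sub>R h ^ DIM('a) - \<phi> x) < e"
    using integrable_ccontinuous_explicit[OF on] by blast
  have z: "\<phi> x = 0" if x: "x \<notin> N" for x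
  proof (rule ccontr)
    assume "\<phi> x \<noteq> 0"
    then obtain d where d: "d > 0" "\<And>h. 0 < h \<Longrightarrow> h < d \<Longrightarrow>
        norm (integral (cbox x (x + h *\<^sub>R One)) \<phi> /\<^sub>R h ^ DIM('a) - \<phi> x) < \<bar>\<phi> x\<bar>"
      using N(2)[OF x, of "\<bar>\<phi> x\<bar>"] by auto
    then show False using d(2)[of "d/2"] by (simp add: integral_unique[OF hi])
  qed
  have "AE x in lborel. x \<notin> N" using N(1) by (rule AE_not_negligible)
  then show ?thesis by eventually_elim (use z in auto)
qed

text \<open>Compactness of the unit sphere leaves finitely many directions of \<open>Q\<close> to
  control, which makes the difference quotients uniform; the Lipschitz condition carries the
  estimate from these to all directions.\<close>

lemma GDERIV_if_directional_derivs_dense: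
  fixes f :: "'a::euclidean_space \<Rightarrow> real"
  assumes lip: "L-lipschitz_on UNIV f"
    and dense: "\<And>X. open X \<Longrightarrow> X \<noteq> {} \<Longrightarrow> \<exists>d\<in>Q. d \<in> X"
    and dd: "\<And>v. v \<in> Q \<Longrightarrow> ((\<lambda>t. f (x + t *\<^sub>R v)) has_real_derivative v \<bullet> g) (at 0)"
  shows "GDERIV f x :> g"
  unfolding gderiv_def has_derivative_at_alt
proof (intro conjI allI impI)
  show "bounded_linear (\<lambda>h. h \<bullet> g)" by (rule bounded_linear_inner_left)
  fix e :: real assume e: "0 < e"
  have L0: "0 \<le> L" using lip by (rule lipschitz_on_nonneg)
  \<comment> \<open>Per unit of length, the errors below are \<open>L * e'\<close> for changing the
    direction inside \<open>f\<close>, \<open>e'\<close> for the difference quotient, and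
    \<open>e' * norm g\<close> for changing it in the linear part.\<close>
  define e' where "e' = e / (L + norm g + 1)"
  have pos: "0 < L + norm g + 1" using L0 by (simp add: add_nonneg_pos)
  then have e': "0 < e'" using e by (simp add: e'_def)
  have "sphere 0 1 \<subseteq> (\<Union>v\<in>Q. ball v e')"
  proof
    fix w :: 'a
    obtain v where "v \<in> Q" "v \<in> ball w e'" using dense[of "ball w e'"] e' by auto
    then show "w \<in> (\<Union>v\<in>Q. ball v e')" by (auto simp: dist_commute)
  qed
  then obtain F where F: "F \<subseteq> Q" "finite F" "sphere 0 1 \<subseteq> (\<Union>v\<in>F. ball v e')"
    using compactE_image[OF compact_sphere[of 0 1], of Q "\<lambda>v. ball v e'"] by auto
  have "\<forall>v\<in>F. \<exists>d>0. \<forall>t. \<bar>t\<bar> < d \<longrightarrow> \<bar>f (x + t *\<^sub>R v) - f x - t * (v \<bullet> g)\<bar> \<le> e' * \<bar>t\<bar>"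
  proof
    fix v assume "v \<in> F"
    then have "((\<lambda>t. f (x + t *\<^sub>R v)) has_derivative (\<lambda>t. (v \<bullet> g) * t)) (at 0)"
      using dd F(1) unfolding has_field_derivative_def by blast
    then show "\<exists>d>0. \<forall>t. \<bar>t\<bar> < d \<longrightarrow> \<bar>f (x + t *\<^sub>R v) - f x - t * (v \<bullet> g)\<bar> \<le> e' * \<bar>t\<bar>"
      unfolding has_derivative_at_alt using e' by (auto simp: mult.commute)
  qed
  then obtain d where d: "\<And>v. v \<in> F \<Longrightarrow> 0 < d v"
      "\<And>v t. v \<in> F \<Longrightarrow> \<bar>t\<bar> < d v \<Longrightarrow> \<bar>f (x + t *\<^sub>R v) - f x - t * (v \<bullet> g)\<bar> \<le> e' * \<bar>t\<bar>"
    by metis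
  define d0 where "d0 = Min (insert 1 (d ` F))"
  have d0: "0 < d0" unfolding d0_def using F(2) d(1) by (subst Min_gr_iff) auto
  have d0_le: "d0 \<le> d v" if "v \<in> F" for v unfolding d0_def using F(2) that by (intro Min_le) auto
  show "\<exists>d>0. \<forall>y. norm (y - x) < d \<longrightarrow> norm (f y - f x - (y - x) \<bullet> g) \<le> e * norm (y - x)"
  proof (intro exI[of _ d0] conjI allI impI d0)
    fix y assume y: "norm (y - x) < d0"
    show "norm (f y - f x - (y - x) \<bullet> g) \<le> e * norm (y - x)"
    proof (cases "y = x")
      case False
      define t where "t = norm (y - x)"
      define w where "w = (y - x) /\<^sub>R t"
      have t: "0 < t" using False by (simp add: t_def)
      have yw: "y = x + t *\<^sub>R w" using t by (simp add: w_def)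
      have "w \<in> sphere 0 1" using t by (simp add: w_def t_def)
      then obtain v where v: "v \<in> F" "norm (w - v) < e'" using F(3)
        by (auto simp: dist_norm norm_minus_commute)
      have "\<bar>f y - f (x + t *\<^sub>R v)\<bar> \<le> L * norm (t *\<^sub>R (w - v))"
        using lipschitz_onD[OF lip, of y "x + t *\<^sub>R v"] unfolding yw
        by (simp add: dist_norm algebra_simps)
      also have "\<dots> \<le> L * (t * e')" using t v L0 by (intro mult_left_mono) auto
      finally have 1: "\<bar>f y - f (x + t *\<^sub>R v)\<bar> \<le> L * (t * e')" .
      have 2: "\<bar>f (x + t *\<^sub>R v) - f x - t * (v \<bullet> g)\<bar> \<le> e' * t"
        using d(2)[OF v(1), of t] d0_le[OF v(1)] y t by (simp add: t_def)
      have "\<bar>t * ((v - w) \<bullet> g)\<bar> \<le> t * (norm (v - w) * norm g)"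
        using t Cauchy_Schwarz_ineq2[of "v - w" g] by (simp add: abs_mult)
      also have "\<dots> \<le> t * (e' * norm g)"
        using t v by (intro mult_left_mono mult_right_mono) (auto simp: norm_minus_commute)
      finally have 3: "\<bar>t * ((v - w) \<bullet> g)\<bar> \<le> t * (e' * norm g)" .
      have "f y - f x - (y - x) \<bullet> g = (f y - f (x + t *\<^sub>R v))
          + (f (x + t *\<^sub>R v) - f x - t * (v \<bullet> g)) + t * ((v - w) \<bullet> g)"
        unfolding yw by (simp add: inner_diff_left algebra_simps)
      then have "norm (f y - f x - (y - x) \<bullet> g) \<le> L * (t * e') + e' * t + t * (e' * norm g)"
        using 1 2 3 by simp
      also have "\<dots> = (e' * (L + norm g + 1)) * t" by (simp add: algebra_simps)
      also have "e' * (L + norm g + 1) = e" using pos by (simp add: e'_def)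
      finally show ?thesis by (simp add: t_def)
    qed simp
  qed
qed


text \<open>The one-dimensional theorem settles every line parallel to \<open>v\<close>, and Fubini
  assembles the lines. For Fubini the set of good points must be Borel, which is why
  differentiability is recast below.\<close>

lemma lipschitz_AE_directional_DERIV:
  fixes f :: "'a::euclidean_space \<Rightarrow> real"
  assumes lip: "L-lipschitz_on UNIV f"
  shows "AE x in lborel. \<exists>D. ((\<lambda>t. f (x + t *\<^sub>R v)) has_real_derivative D) (at 0)"
proof -
  have fc: "continuous_on UNIV f" using lip by (rule lipschitz_on_continuous_on)
  have fm [measurable]: "f \<in> borel_measurable borel" using fc by (rule borel_measurable_continuous_onI)
  define q where "q x s = (f (x + s *\<^sub>R v) - f x) / s" for x s
  define near where "near m s \<longleftrightarrow> s \<noteq> 0 \<and> \<bar>s\<bar> < 1 / real (Suc m)" for m and s :: real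
  \<comment> \<open>A Cauchy criterion for the difference quotients, with rational increments only,
    so that \<open>E\<close> is a countable combination of Borel conditions.\<close>
  define E where "E = {x. \<forall>k::nat. \<exists>m::nat. \<forall>s\<in>\<rat>. \<forall>t\<in>\<rat>. near m s \<longrightarrow> near m t \<longrightarrow>
      \<bar>q x s - q x t\<bar> \<le> 1 / real (Suc k)}"
  have [measurable]: "(\<lambda>x. q x s) \<in> borel_measurable borel" for s unfolding q_def by measurable
  have E_sets [measurable]: "E \<in> sets borel"
  proof -
    have Ball_Rats: "(\<forall>s\<in>\<rat>. P s) \<longleftrightarrow> (\<forall>s::rat. P (real_of_rat s))" for P :: "real \<Rightarrow> bool"
      by (auto simp: Rats_def)
    have "Measurable.pred borel (\<lambda>x. \<forall>k::nat. \<exists>m::nat. \<forall>s\<in>\<rat>. \<forall>t\<in>\<rat>. near m s \<longrightarrow> near m t \<longrightarrow>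
      \<bar>q x s - q x t\<bar> \<le> 1 / real (Suc k))"
      unfolding Ball_Rats by measurable
    then show ?thesis unfolding E_def pred_def by simp
  qed
  \<comment> \<open>Continuity in the increment extends the Cauchy estimate from rational to real
    increments.\<close>
  have q_real: "\<exists>s'\<in>\<rat>. near m s' \<and> \<bar>q x s' - q x s\<bar> < e" if "near m s" "0 < e" for m s e x
  proof -
    have s0: "s \<noteq> 0" and s1: "\<bar>s\<bar> < 1 / real (Suc m)" using that by (auto simp: near_def)
    have "isCont (\<lambda>s. f (x + s *\<^sub>R v)) s"
      by (rule isCont_o2[where g=f]) (auto intro!: continuous_intros simp: continuous_on_eq_continuous_at[THEN iffD1, OF _ fc])
    then have "isCont (q x) s" unfolding q_def using s0 by (intro continuous_intros) auto
    then obtain d where d: "d > 0" "\<And>s'. \<bar>s' - s\<bar> < d \<Longrightarrow> \<bar>q x s' - q x s\<bar> < e"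
      unfolding continuous_at_eps_delta using \<open>0 < e\<close> by (auto simp: dist_real_def)
    define d' where "d' = min d (min \<bar>s\<bar> (1 / real (Suc m) - \<bar>s\<bar>))"
    have d': "0 < d'" using d s0 s1 by (auto simp: d'_def)
    obtain s' where s': "s' \<in> \<rat>" "s < s'" "s' < s + d'" using Rats_dense_in_real[of s "s + d'"] d' by auto
    have "\<bar>s' - s\<bar> < d'" using s' by auto
    then have "\<bar>s' - s\<bar> < d" "\<bar>s' - s\<bar> < \<bar>s\<bar>" "\<bar>s' - s\<bar> < 1 / real (Suc m) - \<bar>s\<bar>" by (auto simp: d'_def)
    then show ?thesis using s' d(2) by (intro bexI[of _ s']) (auto simp: near_def)
  qed
  have conv: "\<exists>D. ((\<lambda>t. f (x + t *\<^sub>R v)) has_real_derivative D) (at 0)" if x: "x \<in> E" for x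
  proof -
    have C: "\<exists>m. \<forall>s t. near m s \<longrightarrow> near m t \<longrightarrow> \<bar>q x s - q x t\<bar> \<le> 1 / real (Suc k)" for k
    proof -
      obtain m where m: "\<And>s t. s \<in> \<rat> \<Longrightarrow> t \<in> \<rat> \<Longrightarrow> near m s \<Longrightarrow> near m t \<Longrightarrow> \<bar>q x s - q x t\<bar> \<le> 1 / real (Suc k)"
        using x unfolding E_def by blast
      have "\<bar>q x s - q x t\<bar> \<le> 1 / real (Suc k)" if "near m s" "near m t" for s t
      proof (rule field_le_epsilon)
        fix e :: real assume e: "0 < e"
        obtain s' where s': "s'\<in>\<rat>" "near m s'" "\<bar>q x s' - q x s\<bar> < e/2" using q_real[OF \<open>near m s\<close>, of "e/2"] e by auto
        obtain t' where t': "t'\<in>\<rat>" "near m t'" "\<bar>q x t' - q x t\<bar> < e/2" using q_real[OF \<open>near m t\<close>, of "e/2"] e by auto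
        show "\<bar>q x s - q x t\<bar> \<le> 1 / real (Suc k) + e" using m[OF s'(1) t'(1) s'(2) t'(2)] s'(3) t'(3) by linarith
      qed
      then show ?thesis by blast
    qed
    \<comment> \<open>The shift by two makes \<open>u n\<close> strictly smaller than
      \<open>1 / real (Suc m)\<close> already for \<open>n = m\<close>.\<close>
    define u where "u n = 1 / real (Suc (Suc n))" for n
    have u_near: "near m (u n)" if "m \<le> n" for m n
      using that by (auto simp: near_def u_def intro!: divide_strict_left_mono)
    have "Cauchy (\<lambda>n. q x (u n))"
      unfolding Cauchy_def
    proof (intro allI impI)
      fix e :: real assume "0 < e"
      then obtain k where k: "1 / real (Suc k) < e" using nat_approx_posE by blast
      obtain m where m: "\<And>s t. near m s \<Longrightarrow> near m t \<Longrightarrow> \<bar>q x s - q x t\<bar> \<le> 1 / real (Suc k)" using C by blast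
      show "\<exists>M. \<forall>m\<ge>M. \<forall>n\<ge>M. dist (q x (u m)) (q x (u n)) < e"
        unfolding dist_real_def using le_less_trans[OF m k] u_near by blast
    qed
    then obtain D where D: "(\<lambda>n. q x (u n)) \<longlonglongrightarrow> D" by (auto simp: Cauchy_convergent_iff convergent_def)
    have "(\<lambda>t. q x t) \<midarrow>0\<rightarrow> D"
      unfolding LIM_eq
    proof (intro allI impI)
      fix e :: real assume "0 < e"
      then obtain k where k: "1 / real (Suc k) < e" using nat_approx_posE by blast
      obtain m where m: "\<And>s t. near m s \<Longrightarrow> near m t \<Longrightarrow> \<bar>q x s - q x t\<bar> \<le> 1 / real (Suc k)" using C by blast
      have "\<bar>q x s - D\<bar> \<le> 1 / real (Suc k)" if s: "near m s" for s
      proof (rule LIMSEQ_le_const2)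
        show "(\<lambda>n. \<bar>q x s - q x (u n)\<bar>) \<longlonglongrightarrow> \<bar>q x s - D\<bar>" by (intro tendsto_intros D)
        show "\<exists>N. \<forall>n\<ge>N. \<bar>q x s - q x (u n)\<bar> \<le> 1 / real (Suc k)" using m[OF s] u_near by blast
      qed
      then show "\<exists>s>0. \<forall>t. t \<noteq> 0 \<and> norm (t - 0) < s \<longrightarrow> norm (q x t - D) < e"
        using k by (intro exI[of _ "1 / real (Suc m)"]) (auto simp: near_def intro: le_less_trans)
    qed
    then have "((\<lambda>t. f (x + t *\<^sub>R v)) has_real_derivative D) (at 0)"
      unfolding DERIV_def q_def by simp
    then show ?thesis by blast
  qed
  have diff: "x \<in> E" if "((\<lambda>t. f (x + t *\<^sub>R v)) has_real_derivative D) (at 0)" for x D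
    unfolding E_def
  proof (intro CollectI allI)
    fix k
    have "(\<lambda>t. q x t) \<midarrow>0\<rightarrow> D" using that unfolding DERIV_def q_def by simp
    then obtain d where d: "d > 0" "\<And>t. t \<noteq> 0 \<Longrightarrow> \<bar>t\<bar> < d \<Longrightarrow> \<bar>q x t - D\<bar> < 1 / real (Suc k) / 2"
      unfolding LIM_eq by (metis divide_pos_pos diff_zero of_nat_0_less_iff real_norm_def zero_less_Suc zero_less_numeral zero_less_one)
    obtain m where m: "1 / real (Suc m) < d" using nat_approx_posE[OF d(1)] by blast
    show "\<exists>m. \<forall>s\<in>\<rat>. \<forall>t\<in>\<rat>. near m s \<longrightarrow> near m t \<longrightarrow> \<bar>q x s - q x t\<bar> \<le> 1 / real (Suc k)"
    proof (intro exI[of _ m] ballI impI)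
      fix s t assume "near m s" "near m t"
      then have "\<bar>q x s - D\<bar> < 1 / real (Suc k) / 2" "\<bar>q x t - D\<bar> < 1 / real (Suc k) / 2"
        using d(2) m by (auto simp: near_def)
      moreover define c where "c = 1 / real (Suc k)"
      ultimately show "\<bar>q x s - q x t\<bar> \<le> 1 / real (Suc k)" unfolding c_def[symmetric] by linarith
    qed
  qed
  have line: "AE s in lborel. x + s *\<^sub>R v \<in> E" for x
  proof -
    have "(L * norm v)-lipschitz_on UNIV (\<lambda>s. f (x + s *\<^sub>R v))"
    proof (rule lipschitz_onI)
      fix s t :: real
      have "dist (f (x + s *\<^sub>R v)) (f (x + t *\<^sub>R v)) \<le> L * dist (x + s *\<^sub>R v) (x + t *\<^sub>R v)"
        using lipschitz_onD[OF lip] by blast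
      also have "dist (x + s *\<^sub>R v) (x + t *\<^sub>R v) = norm v * dist s t"
        by (simp add: dist_norm flip: scaleR_diff_left)
      finally show "dist (f (x + s *\<^sub>R v)) (f (x + t *\<^sub>R v)) \<le> L * norm v * dist s t" by simp
    qed (use lipschitz_on_nonneg[OF lip] in auto)
    then have "AE s in lborel. \<exists>D. ((\<lambda>s. f (x + s *\<^sub>R v)) has_real_derivative D) (at s)"
      by (rule lipschitz_real_AE_DERIV)
    then show ?thesis
    proof eventually_elim
      fix s assume "\<exists>D. ((\<lambda>s. f (x + s *\<^sub>R v)) has_real_derivative D) (at s)"
      then obtain D where "((\<lambda>s. f (x + s *\<^sub>R v)) has_real_derivative D) (at (0 + s))" by auto
      then have "((\<lambda>t. f (x + (t + s) *\<^sub>R v)) has_real_derivative D) (at 0)"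
        by (simp only: DERIV_shift)
      then show "x + s *\<^sub>R v \<in> E" by (intro diff[of _ D]) (simp add: scaleR_add_left algebra_simps)
    qed
  qed
  define N where "N = - E"
  \<comment> \<open>Averaging the translates of \<open>N\<close> along \<open>v\<close> reduces its measure to that of its sections by lines.\<close>
  have [measurable]: "N \<in> sets borel" by (simp add: N_def)
  have "(\<integral>\<^sup>+s. (\<integral>\<^sup>+x. indicator {0..1} s * indicator N (x + s *\<^sub>R v) \<partial>lborel) \<partial>lborel)
      = (\<integral>\<^sup>+x. (\<integral>\<^sup>+s. indicator {0..1} s * indicator N (x + s *\<^sub>R v) \<partial>lborel) \<partial>lborel)"
    by (rule lborel_pair.Fubini') measurable
  also have "\<dots> = (\<integral>\<^sup>+(x::'a). 0 \<partial>lborel)"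
  proof (intro nn_integral_cong)
    fix x :: 'a
    have "AE s in lborel. indicator {0..1} s * indicator N (x + s *\<^sub>R v) = (0::ennreal)"
      using line[of x] by eventually_elim (simp add: N_def)
    then show "(\<integral>\<^sup>+s. indicator {0..1} s * indicator N (x + s *\<^sub>R v) \<partial>lborel) = 0"
      by (subst nn_integral_0_iff_AE) auto
  qed
  also have "(\<integral>\<^sup>+s. (\<integral>\<^sup>+x. indicator {0..1} s * indicator N (x + s *\<^sub>R v) \<partial>lborel) \<partial>lborel)
     = (\<integral>\<^sup>+(s::real). indicator {0..1} s * emeasure lborel N \<partial>lborel)"
    by (intro nn_integral_cong) (simp add: nn_integral_cmult lborel_nn_integral_translate)
  also have "\<dots> = emeasure lborel N"
    by (simp add: nn_integral_multc)
  finally have "emeasure lborel N = 0" by simp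
  then have "AE x in lborel. x \<in> E"
    by (intro AE_I[of _ _ N]) (auto simp: N_def)
  then show ?thesis by eventually_elim (use conv in blast)
qed

text \<open>Over every box, the difference quotients in direction \<open>u + v\<close> and those in directions \<open>u\<close> and \<open>v\<close>
  have integrals that differ only by a small translation of the box.\<close>

lemma lipschitz_AE_directional_DERIV_add:
  fixes f :: "'a::euclidean_space \<Rightarrow> real"
  assumes lip: "L-lipschitz_on UNIV f"
  shows "AE x in lborel. \<forall>D E. ((\<lambda>t. f (x + t *\<^sub>R u)) has_real_derivative D) (at 0) \<longrightarrow>
    ((\<lambda>t. f (x + t *\<^sub>R v)) has_real_derivative E) (at 0) \<longrightarrow>
    ((\<lambda>t. f (x + t *\<^sub>R (u + v))) has_real_derivative D + E) (at 0)"
proof -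
  have fc: "continuous_on UNIV f" using lip by (rule lipschitz_on_continuous_on)
  have fm [measurable]: "f \<in> borel_measurable borel" using fc by (rule borel_measurable_continuous_onI)
  have L0: "0 \<le> L" using lip by (rule lipschitz_on_nonneg)
  define h where "h n = 1 / real (Suc n)" for n
  have h0: "h n > 0" "h n \<le> 1" for n by (auto simp: h_def)
  have h_lim: "h \<longlonglongrightarrow> 0" unfolding h_def by (rule inverse_Suc_tendsto_0)
  define q where "q v n x = (f (x + h n *\<^sub>R v) - f x) / h n" for v n x
  define d where "d v x = lim (\<lambda>n. q v n x)" for v x
  have [measurable]: "q v n \<in> borel_measurable borel" for v n unfolding q_def by measurable
  have [measurable]: "d v \<in> borel_measurable borel" for v unfolding d_def by measurable
  have q_bd: "\<bar>q v n x\<bar> \<le> L * norm v" for v n x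
  proof -
    have "\<bar>f (x + h n *\<^sub>R v) - f x\<bar> \<le> L * norm (h n *\<^sub>R v)"
      using lipschitz_onD[OF lip, of "x + h n *\<^sub>R v" x] by (simp add: dist_norm)
    then show ?thesis using h0[of n] by (simp add: q_def field_simps)
  qed
  have q_conv: "(\<lambda>n. q v n x) \<longlonglongrightarrow> D"
    if "((\<lambda>t. f (x + t *\<^sub>R v)) has_real_derivative D) (at 0)" for v x D
  proof -
    have "((\<lambda>t. (f (x + t *\<^sub>R v) - f x) / t) \<longlongrightarrow> D) (at 0)" using that unfolding DERIV_def by simp
    then show ?thesis unfolding q_def
      by (rule filterlim_compose) (use h_lim h0(1) in \<open>auto simp: filterlim_at less_le\<close>)
  qed
  have d_eq: "d v x = D" if "((\<lambda>t. f (x + t *\<^sub>R v)) has_real_derivative D) (at 0)" for v x D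
    unfolding d_def using q_conv[OF that] by (rule limI)
  have q_AE: "AE x in lborel. (\<lambda>n. q v n x) \<longlonglongrightarrow> d v x" for v
    using lipschitz_AE_directional_DERIV[OF lip, of v]
    by eventually_elim (use q_conv d_eq in metis)
  have d_bd: "AE x in lborel. \<bar>d v x\<bar> \<le> L * norm v" for v
    using q_AE[of v]
  proof eventually_elim
    fix x assume "(\<lambda>n. q v n x) \<longlonglongrightarrow> d v x"
    then have "(\<lambda>n. \<bar>q v n x\<bar>) \<longlonglongrightarrow> \<bar>d v x\<bar>" by (rule tendsto_rabs)
    then show "\<bar>d v x\<bar> \<le> L * norm v" by (rule LIMSEQ_le_const2) (use q_bd in auto)
  qed
  let ?I = "\<lambda>a b. indicator (cbox a b) :: 'a \<Rightarrow> real"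
  have ind_int: "integrable lborel (\<lambda>x. indicator (cball 0 R) x * (C::real))" for R :: real and C
    by (intro integrable_mult_left integrable_real_indicator emeasure_bounded_finite) auto
  \<comment> \<open>The shifted boxes have indicators converging off the frontier of the box, which
    is a null set; dominated convergence does the rest.\<close>
  have lim_shift: "(\<lambda>n. \<integral>x. ?I a b (x - h n *\<^sub>R w) * q v n x \<partial>lborel) \<longlonglongrightarrow> (\<integral>x. ?I a b x * d v x \<partial>lborel)"
    and d_int: "integrable lborel (\<lambda>x. ?I a b x * d v x)" for a b w v
  proof -
    obtain R where "\<forall>x\<in>cbox a b. norm x \<le> R" using bounded_cbox bounded_iff by blast
    then have R: "cbox a b \<subseteq> cball 0 R" by auto
    have "negligible (frontier (cbox a b))" by (rule negligible_convex_frontier) (rule convex_box)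
    then have fr: "AE x in lborel. x \<notin> frontier (cbox a b)" by (rule AE_not_negligible)
    have lim: "AE x in lborel. (\<lambda>n. ?I a b (x - h n *\<^sub>R w) * q v n x) \<longlonglongrightarrow> ?I a b x * d v x"
      using fr q_AE[of v]
    proof eventually_elim
      fix x assume x: "x \<notin> frontier (cbox a b)" and q: "(\<lambda>n. q v n x) \<longlonglongrightarrow> d v x"
      have "(\<lambda>n. x - h n *\<^sub>R w) \<longlonglongrightarrow> x - 0 *\<^sub>R w" by (intro tendsto_intros h_lim)
      then have xl: "(\<lambda>n. x - h n *\<^sub>R w) \<longlonglongrightarrow> x" by simp
      have "eventually (\<lambda>n. ?I a b (x - h n *\<^sub>R w) = ?I a b x) sequentially"
      proof (cases "x \<in> cbox a b")
        case True
        then have "x \<in> interior (cbox a b)" using x by (simp add: frontier_def)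
        then have "eventually (\<lambda>n. x - h n *\<^sub>R w \<in> interior (cbox a b)) sequentially"
          by (intro topological_tendstoD[OF xl] open_interior)
        then show ?thesis by eventually_elim (use True interior_subset[of "cbox a b"] in \<open>auto simp del: interior_cbox\<close>)
      next
        case False
        then have "x \<in> - cbox a b" by simp
        then have "eventually (\<lambda>n. x - h n *\<^sub>R w \<in> - cbox a b) sequentially"
          using xl by (intro topological_tendstoD) (auto simp: open_Compl closed_cbox)
        then show ?thesis by eventually_elim (use False in auto)
      qed
      then have "(\<lambda>n. ?I a b (x - h n *\<^sub>R w)) \<longlonglongrightarrow> ?I a b x" by (rule tendsto_eventually)
      then show "(\<lambda>n. ?I a b (x - h n *\<^sub>R w) * q v n x) \<longlonglongrightarrow> ?I a b x * d v x" using q by (rule tendsto_mult)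
    qed
    have bd: "norm (?I a b (x - h n *\<^sub>R w) * q v n x) \<le> indicator (cball 0 (R + norm w)) x * (L * norm v)" for n x
    proof (cases "x - h n *\<^sub>R w \<in> cbox a b")
      case True
      then have "norm (x - h n *\<^sub>R w) \<le> R" using R by auto
      moreover have "norm (h n *\<^sub>R w) \<le> norm w" using h0[of n] mult_right_mono[of "h n" 1 "norm w"] by simp
      moreover have "norm x \<le> norm (x - h n *\<^sub>R w) + norm (h n *\<^sub>R w)" 
        using norm_triangle_ineq[of "x - h n *\<^sub>R w" "h n *\<^sub>R w"] by simp
      ultimately have "norm x \<le> R + norm w" by linarith
      then show ?thesis using True q_bd[of v n x] by simp
    qed (use L0 in simp)
    show "(\<lambda>n. \<integral>x. ?I a b (x - h n *\<^sub>R w) * q v n x \<partial>lborel) \<longlonglongrightarrow> (\<integral>x. ?I a b x * d v x \<partial>lborel)"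
      by (rule integral_dominated_convergence[OF _ _ ind_int lim]) (use bd in \<open>auto\<close>)
    show "integrable lborel (\<lambda>x. ?I a b x * d v x)"
      by (rule integrable_dominated_convergence[OF _ _ ind_int lim]) (use bd in \<open>auto\<close>)
  qed
  have qi: "integrable lborel (\<lambda>x. ?I a b (x - w) * q v n x)" for a b w v n
  proof -
    obtain R where "\<forall>x\<in>cbox a b. norm x \<le> R" using bounded_cbox bounded_iff by blast
    then have R: "cbox a b \<subseteq> cball 0 R" by auto
    show ?thesis
    proof (rule Bochner_Integration.integrable_bound[OF ind_int[of "R + norm w" "L * norm v"]])
      show "AE x in lborel. norm (?I a b (x - w) * q v n x) \<le> norm (indicator (cball 0 (R + norm w)) x * (L * norm v))"
      proof (intro AE_I2)
        fix x
        show "norm (?I a b (x - w) * q v n x) \<le> norm (indicator (cball 0 (R + norm w)) x * (L * norm v))"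
        proof (cases "x - w \<in> cbox a b")
          case True
          then have "norm (x - w) \<le> R" using R by auto
          then have "norm x \<le> R + norm w" using norm_triangle_sub[of x w] by linarith
          then show ?thesis using True q_bd[of v n x] L0 by simp
        qed simp
      qed
    qed measurable
  qed
  \<comment> \<open>Going first along \<open>u\<close> and then along \<open>v\<close> writes
    \<open>q (u + v) n x\<close> as \<open>q v n (x + h n *\<^sub>R u) + q u n x\<close>;
    translation invariance then moves the shift from \<open>q v n\<close> to the box.\<close>
  have eq: "(\<integral>x. ?I a b x * q (u + v) n x \<partial>lborel)
      = (\<integral>x. ?I a b (x - h n *\<^sub>R u) * q v n x \<partial>lborel) + (\<integral>x. ?I a b x * q u n x \<partial>lborel)" for a b n
  proof -
    have "(\<integral>x. ?I a b (x - h n *\<^sub>R u) * q v n x \<partial>lborel) = (\<integral>x. ?I a b x * q v n (x + h n *\<^sub>R u) \<partial>lborel)"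
      by (subst lborel_integral_affine[of _ 1 "h n *\<^sub>R u"]) (auto simp: add.commute)
    moreover have "integrable lborel (\<lambda>x. ?I a b x * q v n (x + h n *\<^sub>R u))"
      using lborel_integrable_affine[OF qi[of a b "h n *\<^sub>R u" v n], of 1 "h n *\<^sub>R u"] by (simp add: add.commute)
    moreover have "integrable lborel (\<lambda>x. ?I a b x * q u n x)" using qi[of a b 0 u n] by simp
    ultimately have "(\<integral>x. ?I a b (x - h n *\<^sub>R u) * q v n x \<partial>lborel) + (\<integral>x. ?I a b x * q u n x \<partial>lborel)
        = (\<integral>x. ?I a b x * q v n (x + h n *\<^sub>R u) + ?I a b x * q u n x \<partial>lborel)"
      by simp
    also have "\<dots> = (\<integral>x. ?I a b x * q (u + v) n x \<partial>lborel)"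
      using h0[of n] by (intro Bochner_Integration.integral_cong)
        (auto simp: q_def indicator_def algebra_simps simp flip: add_divide_distrib)
    finally show ?thesis by simp
  qed
  have int_eq: "(\<integral>x. ?I a b x * d (u + v) x \<partial>lborel) = (\<integral>x. ?I a b x * d v x \<partial>lborel) + (\<integral>x. ?I a b x * d u x \<partial>lborel)" for a b
  proof (rule LIMSEQ_unique)
    show "(\<lambda>n. \<integral>x. ?I a b x * q (u + v) n x \<partial>lborel) \<longlonglongrightarrow> (\<integral>x. ?I a b x * d (u + v) x \<partial>lborel)"
      using lim_shift[of a b 0 "u + v"] by simp
    show "(\<lambda>n. \<integral>x. ?I a b x * q (u + v) n x \<partial>lborel) \<longlonglongrightarrow> (\<integral>x. ?I a b x * d v x \<partial>lborel) + (\<integral>x. ?I a b x * d u x \<partial>lborel)"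
      unfolding eq using lim_shift[of a b u v] lim_shift[of a b 0 u] by (intro tendsto_add) auto
  qed
  have "AE x in lborel. d (u + v) x - d v x - d u x = 0"
  proof (rule AE_zero_if_integral_cbox_zero)
    fix a b :: 'a
    have e: "(\<lambda>x. ?I a b x * (d (u + v) x - d v x - d u x)) =
       (\<lambda>x. ?I a b x * d (u + v) x - ?I a b x * d v x - ?I a b x * d u x)"
      by (auto simp: algebra_simps)
    show "integrable lborel (\<lambda>x. ?I a b x * (d (u + v) x - d v x - d u x))"
      unfolding e by (intro Bochner_Integration.integrable_diff d_int)
    show "(\<integral>x. ?I a b x * (d (u + v) x - d v x - d u x) \<partial>lborel) = 0"
      unfolding e using int_eq[of a b] d_int[of a b] by simp
  qed
  then show ?thesis using lipschitz_AE_directional_DERIV[OF lip, of "u + v"]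
  proof eventually_elim
    fix x assume z: "d (u + v) x - d v x - d u x = 0"
      and ex: "\<exists>D. ((\<lambda>t. f (x + t *\<^sub>R (u + v))) has_real_derivative D) (at 0)"
    then show "\<forall>D E. ((\<lambda>t. f (x + t *\<^sub>R u)) has_real_derivative D) (at 0) \<longrightarrow>
      ((\<lambda>t. f (x + t *\<^sub>R v)) has_real_derivative E) (at 0) \<longrightarrow>
      ((\<lambda>t. f (x + t *\<^sub>R (u + v))) has_real_derivative D + E) (at 0)"
      using d_eq by (auto simp: algebra_simps)
  qed
qed

text \<open>Additivity expresses the derivative in a given direction through the coordinate
  derivatives, off a null set that depends on the direction. A countable dense set of directions
  needs only one common null set, and the Lipschitz condition extends the result to the remaining
  directions.\<close>

theorem rademacher:
  fixes f :: "'a::euclidean_space \<Rightarrow> real"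
  assumes lip: "L-lipschitz_on UNIV f"
  shows "AE x in lborel. \<exists>g. GDERIV f x :> g"
proof -
  let ?dd = "\<lambda>x v D. ((\<lambda>t. f (x + t *\<^sub>R v)) has_real_derivative D) (at 0)"
  have scale: "?dd x (c *\<^sub>R v) (c * D)" if "?dd x v D" for x v c D
  proof -
    have "((\<lambda>t. f (x + t *\<^sub>R v)) has_real_derivative D) (at (c * 0))" using that by simp
    moreover have "((\<lambda>t. c * t) has_real_derivative c) (at 0)" by (auto intro!: derivative_eq_intros)
    ultimately have "((\<lambda>t. f (x + (c * t) *\<^sub>R v)) has_real_derivative D * c) (at 0)"
      by (rule DERIV_chain2)
    then show ?thesis by (simp add: mult.commute)
  qed
  obtain Q :: "'a set" where Q: "countable Q" "\<And>X. open X \<Longrightarrow> X \<noteq> {} \<Longrightarrow> \<exists>d\<in>Q. d \<in> X"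
    using countable_dense_setE by blast
  \<comment> \<open>The values \<open>D\<close> depend on the point \<open>x\<close>, so they are
    quantified inside the almost-everywhere statement.\<close>
  have sums: "AE x in lborel. \<forall>D. (\<forall>i\<in>Basis. ?dd x i (D i)) \<longrightarrow>
      ?dd x (\<Sum>i\<in>S. (v \<bullet> i) *\<^sub>R i) (\<Sum>i\<in>S. (v \<bullet> i) * D i)" if "S \<subseteq> Basis" for S v
    using finite_subset[OF that finite_Basis] that
  proof (induction S rule: finite_induct)
    case empty
    then show ?case by simp
  next
    case (insert j S)
    have "AE x in lborel. \<forall>D. (\<forall>i\<in>Basis. ?dd x i (D i)) \<longrightarrow>
      ?dd x (\<Sum>i\<in>S. (v \<bullet> i) *\<^sub>R i) (\<Sum>i\<in>S. (v \<bullet> i) * D i)" using insert by auto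
    then show ?case
      using lipschitz_AE_directional_DERIV_add[OF lip, of "(v \<bullet> j) *\<^sub>R j" "\<Sum>i\<in>S. (v \<bullet> i) *\<^sub>R i"]
      by eventually_elim (use insert scale in auto)
  qed
  have "AE x in lborel. \<forall>v\<in>Q. \<forall>D. (\<forall>i\<in>Basis. ?dd x i (D i)) \<longrightarrow> ?dd x v (\<Sum>i\<in>Basis. (v \<bullet> i) * D i)"
    using sums[of Basis] unfolding euclidean_representation by (subst AE_ball_countable[OF Q(1)]) auto
  moreover have "AE x in lborel. \<forall>i\<in>Basis. \<exists>D. ?dd x i D"
    by (subst AE_ball_countable) (auto intro: lipschitz_AE_directional_DERIV[OF lip] countable_finite)
  ultimately show ?thesis
  proof eventually_elim
    fix x assume 1: "\<forall>v\<in>Q. \<forall>D. (\<forall>i\<in>Basis. ?dd x i (D i)) \<longrightarrow> ?dd x v (\<Sum>i\<in>Basis. (v \<bullet> i) * D i)"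
      and 2: "\<forall>i\<in>Basis. \<exists>D. ?dd x i D"
    obtain D where D: "\<And>i. i \<in> Basis \<Longrightarrow> ?dd x i (D i)" using 2 by metis
    have "GDERIV f x :> (\<Sum>i\<in>Basis. D i *\<^sub>R i)"
    proof (rule GDERIV_if_directional_derivs_dense[OF lip Q(2)])
      fix v assume "v \<in> Q"
      then show "?dd x v (v \<bullet> (\<Sum>i\<in>Basis. D i *\<^sub>R i))"
        using 1 D by (simp add: inner_sum_right mult.commute)
    qed
    then show "\<exists>g. GDERIV f x :> g" by blast
  qed
qed

section \<open>Smoothing over balls\<close>

lemma cball_borel [measurable]: "cball (a :: 'a::euclidean_space) r \<in> sets borel"
  by (intro borel_closed closed_cball)

lemma integrable_indicator_cball:
  "integrable lborel (\<lambda>z::'a::euclidean_space. indicator (cball 0 R) z * (C::real))"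
  by (intro integrable_mult_left integrable_real_indicator emeasure_bounded_finite) auto

lemma integrable_indicator_cball_mult:
  fixes g :: "'a::euclidean_space \<Rightarrow> real"
  assumes [measurable]: "g \<in> borel_measurable borel" and B: "\<And>z. norm z \<le> R \<Longrightarrow> \<bar>g z\<bar> \<le> B"
  shows "integrable lborel (\<lambda>z. indicator (cball 0 R) z * g z)"
proof (rule Bochner_Integration.integrable_bound[OF integrable_indicator_cball[of R B]])
  have "norm (indicator (cball 0 R) z * g z) \<le> norm (indicator (cball 0 R) z * B)" for z
    using B[of z] by (cases "norm z \<le> R") auto
  then show "AE z in lborel. norm (indicator (cball 0 R) z * g z) \<le> norm (indicator (cball 0 R) z * B)" by auto
qed measurable

abbreviation unif_ball :: "'a::euclidean_space measure" where
  "unif_ball \<equiv> uniform_measure lborel (cball 0 1)"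

abbreviation ball_vol :: "'a::euclidean_space itself \<Rightarrow> real" where
  "ball_vol _ \<equiv> measure lborel (cball (0::'a) 1)"

definition ball_avg :: "real \<Rightarrow> ('a::euclidean_space \<Rightarrow> real) \<Rightarrow> 'a \<Rightarrow> real" where
  "ball_avg \<rho> f x = (\<integral>y. f (x + \<rho> *\<^sub>R y) \<partial>unif_ball)"

text \<open>The gradient of \<open>ball_avg\<close> as the divergence theorem predicts it: a ball of
  radius \<open>\<rho>\<close> has surface-to-volume ratio \<open>DIM('a) / \<rho>\<close>, and
  \<open>w\<close> is its outer normal.\<close>

definition sphere_grad :: "real \<Rightarrow> ('a::euclidean_space \<Rightarrow> real) \<Rightarrow> 'a \<Rightarrow> 'a" where
  "sphere_grad \<rho> f x = (real DIM('a) / \<rho>) *\<^sub>R (\<integral>w. f (x + \<rho> *\<^sub>R w) *\<^sub>R w \<partial>unif_sphere)"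

lemma ball_vol_pos: "0 < ball_vol TYPE('a::euclidean_space)"
  by (simp add: content_cball_pos measure_def[symmetric])

lemma emeasure_unit_cball: "emeasure lborel (cball (0::'a::euclidean_space) 1) = ennreal (ball_vol TYPE('a))"
  using emeasure_bounded_finite[OF bounded_cball, of "0::'a" 1]
  by (intro emeasure_eq_ennreal_measure) (auto simp: less_top)

lemma prob_space_unif_ball: "prob_space (unif_ball :: 'a::euclidean_space measure)"
  using ball_vol_pos[where 'a='a] emeasure_unit_cball[where 'a='a]
  by (intro prob_space_uniform_measure) auto

lemma sets_unif_sphere [simp, measurable_cong]: "sets (unif_sphere :: 'a::euclidean_space measure) = sets borel"
  by (simp add: unif_sphere_def)

lemma space_unif_sphere [simp]: "space (unif_sphere :: 'a::euclidean_space measure) = UNIV"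
  by (simp add: unif_sphere_def)

lemma prob_space_unif_sphere: "prob_space (unif_sphere :: 'a::euclidean_space measure)"
  unfolding unif_sphere_def using prob_space_unif_ball by (rule prob_space.prob_space_distr) measurable

lemma unif_ball_eq_density:
  "unif_ball = density lborel (\<lambda>x::'a::euclidean_space. ennreal (indicator (cball 0 1) x / ball_vol TYPE('a)))"
  unfolding uniform_measure_def emeasure_unit_cball using ball_vol_pos[where 'a='a]
  by (intro arg_cong2[where f=density] refl ext) (auto simp: indicator_def divide_ennreal ennreal_1[symmetric] simp del: ennreal_1)

lemma AE_unif_ball:
  assumes "AE x in lborel. norm x \<le> 1 \<longrightarrow> P x"
  shows "AE x in (unif_ball :: 'a::euclidean_space measure). P x"
  using assms unfolding unif_ball_eq_density
  by (subst AE_density) (auto simp: indicator_def elim!: eventually_mono)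

lemma integral_unif_ball:
  fixes \<phi> :: "'a::euclidean_space \<Rightarrow> 'b::{banach, second_countable_topology}"
  assumes [measurable]: "\<phi> \<in> borel_measurable borel"
  shows "ball_vol TYPE('a) *\<^sub>R (\<integral>x. \<phi> x \<partial>unif_ball) = (\<integral>x. indicator (cball 0 1) x *\<^sub>R \<phi> x \<partial>lborel)"
proof -
  have "(\<integral>x. \<phi> x \<partial>unif_ball) = (\<integral>x. (indicator (cball 0 1) x / ball_vol TYPE('a)) *\<^sub>R \<phi> x \<partial>lborel)"
    unfolding unif_ball_eq_density by (rule integral_density) auto
  also have "\<dots> = (\<integral>x. (1 / ball_vol TYPE('a)) *\<^sub>R (indicator (cball 0 1) x *\<^sub>R \<phi> x) \<partial>lborel)"
    by (intro Bochner_Integration.integral_cong) auto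
  also have "\<dots> = (1 / ball_vol TYPE('a)) *\<^sub>R (\<integral>x. indicator (cball 0 1) x *\<^sub>R \<phi> x \<partial>lborel)"
    by (rule integral_scaleR_right)
  finally show ?thesis using ball_vol_pos[where 'a='a] by simp
qed

lemma integral_unif_sphere:
  fixes \<phi> :: "'a::euclidean_space \<Rightarrow> 'b::{banach, second_countable_topology}"
  assumes [measurable]: "\<phi> \<in> borel_measurable borel"
  shows "(\<integral>w. \<phi> w \<partial>unif_sphere) = (\<integral>x. \<phi> (x /\<^sub>R norm x) \<partial>unif_ball)"
  unfolding unif_sphere_def by (subst integral_distr) auto

lemma AE_unif_sphere_norm: "AE w in (unif_sphere :: 'a::euclidean_space measure). norm w = 1"
proof -
  have "AE x in lborel. x \<noteq> (0::'a)" by (rule AE_lborel_singleton)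
  then have "AE x in (unif_ball :: 'a measure). norm (x /\<^sub>R norm x) = 1"
    by (intro AE_unif_ball) (auto elim!: eventually_mono)
  then show ?thesis unfolding unif_sphere_def by (subst AE_distr_iff) auto
qed

lemma AE_unif_ball_norm: "AE x in (unif_ball :: 'a::euclidean_space measure). norm x \<le> 1"
  by (rule AE_unif_ball) simp

section \<open>Lipschitz functions under the uniform laws on ball and sphere\<close>

lemma lipschitz_abs_diff:
  fixes f :: "'a::real_normed_vector \<Rightarrow> real"
  assumes "L-lipschitz_on UNIV f"
  shows "\<bar>f x - f y\<bar> \<le> L * norm (x - y)"
  using lipschitz_onD[OF assms, of x y] by (simp add: dist_norm)

lemma lipschitz_abs_add:
  fixes f :: "'a::real_normed_vector \<Rightarrow> real"
  assumes lip: "L-lipschitz_on UNIV f" and "norm y \<le> R"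
  shows "\<bar>f (x + y)\<bar> \<le> \<bar>f x\<bar> + L * R"
proof -
  have "L * norm y \<le> L * R" using assms lipschitz_on_nonneg[OF lip] by (intro mult_left_mono) auto
  then show ?thesis using lipschitz_abs_diff[OF lip, of "x + y" x] by simp
qed

lemma lipschitz_on_affine:
  fixes f :: "'a::real_normed_vector \<Rightarrow> real"
  assumes lip: "L-lipschitz_on UNIV f"
  shows "(L * \<bar>\<rho>\<bar>)-lipschitz_on UNIV (\<lambda>z. f (x + \<rho> *\<^sub>R z))"
proof (rule lipschitz_onI)
  show "dist (f (x + \<rho> *\<^sub>R y)) (f (x + \<rho> *\<^sub>R z)) \<le> L * \<bar>\<rho>\<bar> * dist y z" for y z
    using lipschitz_onD[OF lip, of "x + \<rho> *\<^sub>R y" "x + \<rho> *\<^sub>R z"]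
    by (simp add: dist_norm flip: scaleR_diff_right)
qed (use lipschitz_on_nonneg[OF lip] in auto)

lemma lipschitz_borel_measurable:
  fixes f :: "'a::euclidean_space \<Rightarrow> real"
  assumes "L-lipschitz_on UNIV f"
  shows "f \<in> borel_measurable borel"
  by (intro borel_measurable_continuous_onI lipschitz_on_continuous_on[OF assms])

lemma integrable_unif_ball_lipschitz:
  fixes f :: "'a::euclidean_space \<Rightarrow> real"
  assumes lip: "L-lipschitz_on UNIV f"
  shows "integrable unif_ball (\<lambda>y. f (x + \<rho> *\<^sub>R y))"
proof -
  interpret prob_space "unif_ball :: 'a measure" by (rule prob_space_unif_ball)
  have [measurable]: "f \<in> borel_measurable borel" using lip by (rule lipschitz_borel_measurable)
  show ?thesis
  proof (rule integrable_const_bound[where B="\<bar>f x\<bar> + L * \<bar>\<rho>\<bar>"])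
    show "AE y in unif_ball. norm (f (x + \<rho> *\<^sub>R y)) \<le> \<bar>f x\<bar> + L * \<bar>\<rho>\<bar>"
      using AE_unif_ball_norm
    proof eventually_elim
      fix y :: 'a assume "norm y \<le> 1"
      then have "norm (\<rho> *\<^sub>R y) \<le> \<bar>\<rho>\<bar>" using mult_left_mono[of "norm y" 1 "\<bar>\<rho>\<bar>"] by simp
      from lipschitz_abs_add[OF lip this] show "norm (f (x + \<rho> *\<^sub>R y)) \<le> \<bar>f x\<bar> + L * \<bar>\<rho>\<bar>" by simp
    qed
  qed measurable
qed

lemma integrable_unif_sphere_lipschitz:
  fixes f :: "'a::euclidean_space \<Rightarrow> real"
  assumes lip: "L-lipschitz_on UNIV f"
  shows "integrable unif_sphere (\<lambda>w. f (x + \<rho> *\<^sub>R w) *\<^sub>R w)"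
proof -
  interpret prob_space "unif_sphere :: 'a measure" by (rule prob_space_unif_sphere)
  have [measurable]: "f \<in> borel_measurable borel" using lip by (rule lipschitz_borel_measurable)
  show ?thesis
  proof (rule integrable_const_bound[where B="\<bar>f x\<bar> + L * \<bar>\<rho>\<bar>"])
    show "AE w in unif_sphere. norm (f (x + \<rho> *\<^sub>R w) *\<^sub>R w) \<le> \<bar>f x\<bar> + L * \<bar>\<rho>\<bar>"
      using AE_unif_sphere_norm
    proof eventually_elim
      fix w :: 'a assume w: "norm w = 1"
      then have "norm (\<rho> *\<^sub>R w) \<le> \<bar>\<rho>\<bar>" by simp
      from lipschitz_abs_add[OF lip this] show "norm (f (x + \<rho> *\<^sub>R w) *\<^sub>R w) \<le> \<bar>f x\<bar> + L * \<bar>\<rho>\<bar>"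
        using w by simp
    qed
  qed measurable
qed

text \<open>The direction of \<open>x\<close> is unchanged by scaling, so the ball of radius
  \<open>r\<close> reduces to the unit ball, where the radial projection is
  \<open>unif_sphere\<close> by definition. This is the form of polar coordinates used
  below.\<close>

lemma integral_cball_radial:
  fixes \<phi> :: "'a::euclidean_space \<Rightarrow> 'b::{banach, second_countable_topology}"
  assumes [measurable]: "\<phi> \<in> borel_measurable borel" and r: "0 < r"
  shows "(\<integral>x. indicator (cball 0 r) x *\<^sub>R \<phi> (x /\<^sub>R norm x) \<partial>lborel)
    = (r ^ DIM('a) * ball_vol TYPE('a)) *\<^sub>R (\<integral>w. \<phi> w \<partial>unif_sphere)"
proof -
  have "(\<integral>x. indicator (cball 0 r) x *\<^sub>R \<phi> (x /\<^sub>R norm x) \<partial>lborel)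
    = r ^ DIM('a) *\<^sub>R (\<integral>x. indicator (cball 0 r) (r *\<^sub>R x) *\<^sub>R \<phi> ((r *\<^sub>R x) /\<^sub>R norm (r *\<^sub>R x)) \<partial>lborel)"
    using r by (subst lborel_integral_affine[of _ r 0]) auto
  also have "(\<lambda>x::'a. indicator (cball 0 r) (r *\<^sub>R x) *\<^sub>R \<phi> ((r *\<^sub>R x) /\<^sub>R norm (r *\<^sub>R x)))
     = (\<lambda>x. indicator (cball 0 1) x *\<^sub>R \<phi> (x /\<^sub>R norm x))"
    using r by (auto simp: indicator_def fun_eq_iff mult.assoc[symmetric] mult.commute[of _ r])
  also have "(\<integral>x. indicator (cball 0 1) x *\<^sub>R \<phi> (x /\<^sub>R norm x) \<partial>lborel)
     = ball_vol TYPE('a) *\<^sub>R (\<integral>w. \<phi> w \<partial>unif_sphere)"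
    by (subst integral_unif_ball[symmetric]) (auto simp: integral_unif_sphere)
  finally show ?thesis by simp
qed

section \<open>The divergence theorem for balls\<close>

text \<open>Piecewise quadratic approximation of the indicator of the unit ball. Differentiating it along
  a segment and letting \<open>r\<close> tend to \<open>1\<close> replaces the divergence theorem.\<close>

definition plateau :: "real \<Rightarrow> 'a::euclidean_space \<Rightarrow> real" where
  "plateau r y = max 0 (min 1 ((1 - (norm y)\<^sup>2) / (1 - r\<^sup>2)))"

text \<open>The squared norm along \<open>y - s *\<^sub>R u\<close> is a quadratic polynomial in
  \<open>s\<close> with leading coefficient \<open>u \<bullet> u > 0\<close>. Hence only finitely
  many \<open>s\<close> are breakpoints, and the fundamental theorem tolerates a finite exceptional
  set.\<close>

lemma plateau_diff:
  fixes y u :: "'a::euclidean_space"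
  assumes r: "0 < r" "r < 1" and u: "u \<noteq> 0"
  shows "plateau r (y - u) - plateau r y
    = (\<integral>s. indicator {0..1} s * (indicator (cball 0 1 - cball 0 r) (y - s *\<^sub>R u) * (2 / (1 - r\<^sup>2) * ((y - s *\<^sub>R u) \<bullet> u))) \<partial>lborel)"
proof -
  define c where "c = 1 - r\<^sup>2"
  have c: "0 < c" "c < 1" using r by (auto simp: c_def power_less_one_iff)
  define q where "q s = (norm (y - s *\<^sub>R u))\<^sup>2" for s
  have q_eq: "q s = (u \<bullet> u) * s\<^sup>2 - 2 * (y \<bullet> u) * s + y \<bullet> y" for s
    unfolding q_def power2_norm_eq_inner
    by (simp add: inner_diff inner_commute algebra_simps power2_eq_square)
  have q_cont: "continuous_on UNIV q" unfolding q_eq[abs_def] by (intro continuous_intros)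
  define d where "d s = indicator (cball 0 1 - cball 0 r) (y - s *\<^sub>R u) * (2 / c * ((y - s *\<^sub>R u) \<bullet> u))" for s
  have ball_q: "norm (y - s *\<^sub>R u) \<le> 1 \<longleftrightarrow> q s \<le> 1" "norm (y - s *\<^sub>R u) \<le> r \<longleftrightarrow> q s \<le> 1 - c" for s
    using r power_mono_iff[of "norm (y - s *\<^sub>R u)" r 2] power_mono_iff[of "norm (y - s *\<^sub>R u)" 1 2]
    by (auto simp: q_def c_def)
  have d_eq: "d s = (if 1 - c < q s \<and> q s \<le> 1 then 2 / c * ((y - s *\<^sub>R u) \<bullet> u) else 0)" for s
    unfolding d_def using ball_q[of s] by (auto simp: indicator_def)
  define S where "S = {s. q s = 1} \<union> {s. q s = 1 - c}"
  have fin: "finite {s. q s = a}" for a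
  proof -
    have "[: y \<bullet> y - a, - 2 * (y \<bullet> u), u \<bullet> u :] \<noteq> 0" using u by simp
    then have "finite {s. poly [: y \<bullet> y - a, - 2 * (y \<bullet> u), u \<bullet> u :] s = 0}" by (rule poly_roots_finite)
    then show ?thesis
      by (rule rev_finite_subset) (auto simp: q_eq algebra_simps power2_eq_square)
  qed
  have "finite S" unfolding S_def using fin by simp
  define p where "p s = plateau r (y - s *\<^sub>R u)" for s
  have p_eq: "p s = max 0 (min 1 ((1 - q s) / c))" for s by (simp add: p_def plateau_def q_def c_def)
  have p_cont: "continuous_on {0..1} p"
    unfolding p_eq[abs_def] using c by (intro continuous_intros continuous_on_subset[OF q_cont]) auto
  have der: "(p has_real_derivative d s) (at s)" if s: "s \<notin> S" for s
  proof -
    consider "q s < 1 - c" | "1 - c < q s" "q s < 1" | "1 < q s"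
      using s by (force simp: S_def)
    then show ?thesis
    proof cases
      case 1
      have "((\<lambda>_. 1) has_real_derivative 0) (at s)" by simp
      then have "(p has_real_derivative 0) (at s)"
      proof (rule has_field_derivative_transform_within_open)
        show "open {s. q s < 1 - c}" by (intro open_Collect_less q_cont continuous_on_const)
      qed (use 1 c in \<open>auto simp: p_eq\<close>)
      then show ?thesis using 1 by (simp add: d_eq)
    next
      case 3
      have "((\<lambda>_. 0) has_real_derivative 0) (at s)" by simp
      then have "(p has_real_derivative 0) (at s)"
      proof (rule has_field_derivative_transform_within_open)
        show "open {s. 1 < q s}" by (intro open_Collect_less q_cont continuous_on_const)
      qed (use 3 c in \<open>auto simp: p_eq max_def min_def divide_simps\<close>)
      then show ?thesis using 3 by (simp add: d_eq)
    next
      case 2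
      have "((\<lambda>s. (1 - q s) / c) has_real_derivative d s) (at s)"
        unfolding d_eq q_eq[abs_def] using 2 c
        by (auto intro!: derivative_eq_intros simp: q_eq inner_diff algebra_simps diff_divide_distrib)
      then show ?thesis
      proof (rule has_field_derivative_transform_within_open)
        show "open ({s. 1 - c < q s} \<inter> {s. q s < 1})"
          by (intro open_Int open_Collect_less q_cont continuous_on_const)
      qed (use 2 c in \<open>auto simp: p_eq max_def min_def divide_simps\<close>)
    qed
  qed
  have "(d has_integral (p 1 - p 0)) {0..1}"
    by (rule fundamental_theorem_of_calculus_interior_strong[OF \<open>finite S\<close> _ _ p_cont])
       (use der in \<open>auto simp: has_real_derivative_iff_has_vector_derivative\<close>)
  moreover have d_int: "set_integrable lborel {0..1} d"
  proof -
    have [measurable]: "d \<in> borel_measurable borel" unfolding d_def by measurable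
    have "\<bar>d s\<bar> \<le> 2 / c * norm u" for s
    proof (cases "norm (y - s *\<^sub>R u) \<le> 1")
      case True
      have "\<bar>(y - s *\<^sub>R u) \<bullet> u\<bar> \<le> norm (y - s *\<^sub>R u) * norm u" by (rule Cauchy_Schwarz_ineq2)
      also have "\<dots> \<le> 1 * norm u" using True by (intro mult_right_mono) auto
      finally show ?thesis using c unfolding d_def by (auto simp: indicator_def abs_mult divide_right_mono)
    next
      case False
      then show ?thesis using c unfolding d_def by auto
    qed
    then have le: "norm (indicat_real {0..1} s *\<^sub>R d s) \<le> norm (indicat_real {0..1} s * (2 / c * norm u))" for s
      using c by (simp add: indicator_def)
    have "integrable lborel (\<lambda>s::real. indicat_real {0..1} s * (2 / c * norm u))"
      by (intro integrable_mult_left integrable_real_indicator) auto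
    then show ?thesis
      unfolding set_integrable_def
      by (rule Bochner_Integration.integrable_bound) (use le in auto)
  qed
  ultimately have "p 1 - p 0 = (LINT s:{0..1}|lborel. d s)"
    using set_borel_integral_eq_integral(2)[OF d_int] by (simp add: integral_unique)
  then show ?thesis unfolding set_lebesgue_integral_def p_def d_def c_def by simp
qed


lemma integrable_indicator_cball_pair:
  "integrable (lborel \<Otimes>\<^sub>M lborel) (\<lambda>(s::real, y::'a::euclidean_space). indicator {a..b} s * (indicator (cball 0 R) y * (C::real)))"
proof -
  have "integrable (lborel \<Otimes>\<^sub>M lborel) (\<lambda>z. indicator ({a..b} \<times> cball (0::'a) R) z * C)"
  proof (intro integrable_mult_left integrable_real_indicator)
    have "bounded ({a..b} \<times> cball (0::'a) R)" by (intro bounded_Times) auto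
    then show "emeasure (lborel \<Otimes>\<^sub>M lborel) ({a..b} \<times> cball (0::'a) R) < \<infinity>"
      unfolding lborel_prod by (rule emeasure_bounded_finite)
  qed measurable
  then show ?thesis
    by (rule Bochner_Integration.integrable_cong[THEN iffD1, OF refl, rotated]) (auto simp: indicator_def)
qed

lemma plateau_bounds: "0 \<le> plateau r y" "plateau r y \<le> 1" by (auto simp: plateau_def)

lemma plateau_eq_0:
  assumes "0 < r" "r < 1" "1 \<le> norm y" shows "plateau r y = 0"
proof -
  have "1 \<le> (norm y)\<^sup>2" using assms by (simp add: one_le_power)
  moreover have "r\<^sup>2 < 1" using assms by (simp add: power_less_one_iff)
  ultimately show ?thesis by (simp add: plateau_def max_def min_def divide_simps)
qed

lemma plateau_eq_1:
  assumes "0 < r" "r < 1" "norm y \<le> r" shows "plateau r y = 1"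
proof -
  have "(norm y)\<^sup>2 \<le> r\<^sup>2" using assms by (intro power_mono) auto
  moreover have "r\<^sup>2 < 1" using assms by (simp add: power_less_one_iff)
  ultimately show ?thesis by (simp add: plateau_def max_def min_def divide_simps)
qed

lemma borel_measurable_plateau [measurable]: "plateau r \<in> borel_measurable borel"
  unfolding plateau_def by measurable

text \<open>A change of variables moves the increment \<open>u\<close> from \<open>f\<close> to the
  plateau, which can be differentiated along segments where \<open>f\<close> cannot. Fubini then
  exchanges space and segment.\<close>

lemma integral_plateau_diff:
  fixes f :: "'a::euclidean_space \<Rightarrow> real"
  assumes lip: "L-lipschitz_on UNIV f" and r: "0 < r" "r < 1" and u: "u \<noteq> 0"
  defines "J \<equiv> \<lambda>x. 2 / (1 - r\<^sup>2) * (\<integral>z. indicator (cball 0 1 - cball 0 r) z * (f (x + z) * (z \<bullet> u)) \<partial>lborel)"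
  shows "(\<integral>y. (f (x + u + y) - f (x + y)) * plateau r y \<partial>lborel)
       = (\<integral>s. indicator {0..1} s * J (x + s *\<^sub>R u) \<partial>lborel)"
proof -
  have [measurable]: "f \<in> borel_measurable borel" using lip by (rule lipschitz_borel_measurable)
  have L0: "0 \<le> L" using lip by (rule lipschitz_on_nonneg)
  let ?Sh = "cball 0 1 - cball 0 r :: 'a set"
  define c where "c = 1 - r\<^sup>2"
  have c: "0 < c" using r by (simp add: c_def power_less_one_iff)
  define \<Phi> where "\<Phi> s y = indicator {0..1} s * (f (x + y) * (indicator ?Sh (y - s *\<^sub>R u) * (2 / c * ((y - s *\<^sub>R u) \<bullet> u))))" for s y
  have int\<Phi>: "integrable (lborel \<Otimes>\<^sub>M lborel) (\<lambda>(s, y). \<Phi> s y)"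
  proof (rule Bochner_Integration.integrable_bound)
    let ?C = "(\<bar>f x\<bar> + L * (1 + norm u)) * (2 / c * norm u)"
    show "integrable (lborel \<Otimes>\<^sub>M lborel) (\<lambda>(s::real, y::'a). indicator {0..1} s * (indicator (cball 0 (1 + norm u)) y * ?C))"
      by (rule integrable_indicator_cball_pair)
    show "(\<lambda>(s, y). \<Phi> s y) \<in> borel_measurable (lborel \<Otimes>\<^sub>M lborel)" unfolding \<Phi>_def by measurable
    have "\<bar>\<Phi> s y\<bar> \<le> \<bar>indicator {0..1} s * (indicator (cball 0 (1 + norm u)) y * ?C)\<bar>" for s y
    proof (cases "s \<in> {0..1} \<and> y - s *\<^sub>R u \<in> ?Sh")
      case True
      then have s: "0 \<le> s" "s \<le> 1" and z: "norm (y - s *\<^sub>R u) \<le> 1" by auto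
      have "norm (s *\<^sub>R u) \<le> norm u" using s mult_right_mono[of s 1 "norm u"] by simp
      then have y: "norm y \<le> 1 + norm u" using z norm_triangle_ineq[of "y - s *\<^sub>R u" "s *\<^sub>R u"] by simp
      have "\<bar>(y - s *\<^sub>R u) \<bullet> u\<bar> \<le> norm (y - s *\<^sub>R u) * norm u" by (rule Cauchy_Schwarz_ineq2)
      also have "\<dots> \<le> 1 * norm u" using z by (intro mult_right_mono) auto
      finally have "\<bar>2 / c * ((y - s *\<^sub>R u) \<bullet> u)\<bar> \<le> 2 / c * norm u"
        using c by (simp add: abs_mult divide_right_mono)
      then have "\<bar>f (x + y)\<bar> * \<bar>2 / c * ((y - s *\<^sub>R u) \<bullet> u)\<bar> \<le> ?C"
        using lipschitz_abs_add[OF lip y] L0 c by (intro mult_mono) auto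
      then show ?thesis using True y L0 c by (simp add: \<Phi>_def abs_mult)
    qed (auto simp: \<Phi>_def)
    then show "AE z in lborel \<Otimes>\<^sub>M lborel. norm (case z of (s, y) \<Rightarrow> \<Phi> s y)
       \<le> norm (case z of (s::real, y) \<Rightarrow> indicator {0..1} s * (indicator (cball 0 (1 + norm u)) y * ?C))"
      by (auto simp: case_prod_beta)
  qed
  have fint: "integrable lborel (\<lambda>y. f (x' + y) * plateau r y)" for x'
  proof -
    have "\<bar>f (x' + y) * plateau r y\<bar> \<le> (\<bar>f x'\<bar> + L * 1) * 1" if "norm y \<le> 1" for y
      unfolding abs_mult using lipschitz_abs_add[OF lip that, of x'] plateau_bounds[of r y] L0
      by (intro mult_mono) auto
    then have "integrable lborel (\<lambda>y. indicator (cball 0 1) y * (f (x' + y) * plateau r y))"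
      by (intro integrable_indicator_cball_mult[of _ _ "(\<bar>f x'\<bar> + L * 1) * 1"]) auto
    moreover have "indicator (cball 0 1) y * (f (x' + y) * plateau r y) = f (x' + y) * plateau r y" for y
      using plateau_eq_0[OF r, of y] by (cases "norm y \<le> 1") auto
    ultimately show ?thesis by simp
  qed
  have "(\<integral>y. f (x + u + y) * plateau r y \<partial>lborel) = (\<integral>y. f (x + y) * plateau r (y - u) \<partial>lborel)"
    by (subst (2) lborel_integral_affine[of _ 1 u]) (auto simp: add.commute add.left_commute)
  moreover have "integrable lborel (\<lambda>y. f (x + y) * plateau r (y - u))"
    using lborel_integrable_affine[OF fint[of "x + u"], of 1 "- u"] by (simp add: add.commute add.left_commute)
  ultimately have "(\<integral>y. (f (x + u + y) - f (x + y)) * plateau r y \<partial>lborel)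
     = (\<integral>y. f (x + y) * (plateau r (y - u) - plateau r y) \<partial>lborel)"
    using fint[of x] fint[of "x + u"] by (simp add: left_diff_distrib right_diff_distrib)
  also have "\<dots> = (\<integral>y. (\<integral>s. \<Phi> s y \<partial>lborel) \<partial>lborel)"
    unfolding plateau_diff[OF r u] \<Phi>_def c_def
    by (intro Bochner_Integration.integral_cong refl)
       (simp flip: integral_mult_right_zero add: mult.left_commute mult.assoc)
  also have "\<dots> = (\<integral>s. (\<integral>y. \<Phi> s y \<partial>lborel) \<partial>lborel)"
    by (rule lborel_pair.Fubini_integral) (rule int\<Phi>)
  also have "\<dots> = (\<integral>s. indicator {0..1} s * J (x + s *\<^sub>R u) \<partial>lborel)"
  proof (intro Bochner_Integration.integral_cong refl)
    fix s :: real
    have "(\<integral>y. \<Phi> s y \<partial>lborel) = (\<integral>z. \<Phi> s (s *\<^sub>R u + z) \<partial>lborel)"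
      unfolding \<Phi>_def by (subst lborel_integral_affine[of _ 1 "s *\<^sub>R u"]) auto
    also have "\<dots> = (\<integral>z. indicator {0..1} s * (2 / c * (indicator ?Sh z * (f (x + s *\<^sub>R u + z) * (z \<bullet> u)))) \<partial>lborel)"
      unfolding \<Phi>_def by (intro Bochner_Integration.integral_cong refl) (simp add: mult_ac add.assoc)
    also have "\<dots> = indicator {0..1} s * J (x + s *\<^sub>R u)"
      unfolding J_def c_def by (simp only: integral_mult_right_zero)
    finally show "(\<integral>y. \<Phi> s y \<partial>lborel) = indicator {0..1} s * J (x + s *\<^sub>R u)" .
  qed
  finally show ?thesis .
qed

text \<open>In a thin shell every \<open>z\<close> is within \<open>1 - r\<close> of its radial
  projection. Replacing \<open>z\<close> by the projection turns the shell integral into an exact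
  multiple of the spherical mean.\<close>

lemma shell_integral_approx:
  fixes f :: "'a::euclidean_space \<Rightarrow> real" and u :: 'a
  assumes lip: "L-lipschitz_on UNIV f" and r: "0 < r" "r < 1"
  defines "J \<equiv> \<lambda>x. 2 / (1 - r\<^sup>2) * (\<integral>z. indicator (cball 0 1 - cball 0 r) z * (f (x + z) * (z \<bullet> u)) \<partial>lborel)"
    and "a \<equiv> 2 / (1 + r) * (\<Sum>i<DIM('a). r ^ i)"
  shows "\<bar>J x - a * ball_vol TYPE('a) * (\<integral>w. f (x + w) * (w \<bullet> u) \<partial>unif_sphere)\<bar>
     \<le> a * ball_vol TYPE('a) * ((1 - r) * norm u * (\<bar>f x\<bar> + 2 * L))"
proof -
  have [measurable]: "f \<in> borel_measurable borel" using lip by (rule lipschitz_borel_measurable)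
  have L0: "0 \<le> L" using lip by (rule lipschitz_on_nonneg)
  let ?V = "ball_vol TYPE('a)"
  let ?Sh = "cball 0 1 - cball 0 r :: 'a set"
  have sub: "cball 0 r \<subseteq> (cball 0 1 :: 'a set)" using r by auto
  have r2: "0 < 1 - r\<^sup>2" using r by (simp add: power_less_one_iff)
  \<comment> \<open>Numerator and denominator vanish together at \<open>r = 1\<close>; the defining
    form of \<open>a\<close> has \<open>1 - r\<close> cancelled, so its limit \<open>DIM('a)\<close>
    can be read off.\<close>
  have a_eq: "a = 2 / (1 - r\<^sup>2) * (1 - r ^ DIM('a))"
  proof -
    have "1 - r ^ DIM('a) = (1 - r) * (\<Sum>i<DIM('a). r ^ i)" by (rule one_diff_power_eq)
    moreover have "1 - r\<^sup>2 = (1 - r) * (1 + r)" by (simp add: power2_eq_square algebra_simps)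
    ultimately show ?thesis using r by (simp add: a_def)
  qed
  have ind: "indicat_real ?Sh z = indicator (cball 0 1) z - indicator (cball 0 r) z" for z
    using sub by (auto simp: indicator_def)
  define g where "g w = f (x + w) * (w \<bullet> u)" for w
  have [measurable]: "g \<in> borel_measurable borel" unfolding g_def by measurable
  note bi = integrable_indicator_cball
  have g_bd: "\<bar>f (x + z) * (z \<bullet> u)\<bar> \<le> (\<bar>f x\<bar> + L) * norm u" if "norm z \<le> 1" for z
  proof -
    have "\<bar>z \<bullet> u\<bar> \<le> norm z * norm u" by (rule Cauchy_Schwarz_ineq2)
    also have "\<dots> \<le> 1 * norm u" using that by (intro mult_right_mono) auto
    finally show ?thesis using lipschitz_abs_add[OF lip that, of x] L0 unfolding abs_mult by (intro mult_mono) auto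
  qed
  have gi: "integrable lborel (\<lambda>z. indicat_real (cball 0 s) z * g (z /\<^sub>R norm z))" for s :: real
  proof (rule integrable_indicator_cball_mult)
    show "\<bar>g (z /\<^sub>R norm z)\<bar> \<le> (\<bar>f x\<bar> + L) * norm u" for z
      using g_bd[of "z /\<^sub>R norm z"] L0 by (cases "z = 0") (auto simp: g_def)
  qed measurable
  have "(\<integral>z. indicator ?Sh z * g (z /\<^sub>R norm z) \<partial>lborel)
     = (\<integral>z. indicator (cball 0 1) z * g (z /\<^sub>R norm z) \<partial>lborel) - (\<integral>z. indicator (cball 0 r) z * g (z /\<^sub>R norm z) \<partial>lborel)"
    unfolding ind left_diff_distrib by (rule Bochner_Integration.integral_diff[OF gi gi])
  also have "\<dots> = (1 - r ^ DIM('a)) * ?V * (\<integral>w. g w \<partial>unif_sphere)"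
    using integral_cball_radial[of g r] integral_cball_radial[of g 1] r by (simp add: algebra_simps)
  finally have main: "2 / (1 - r\<^sup>2) * (\<integral>z. indicator ?Sh z * g (z /\<^sub>R norm z) \<partial>lborel) = a * ?V * (\<integral>w. g w \<partial>unif_sphere)"
    by (simp add: a_eq)
  have gi': "integrable lborel (\<lambda>z. indicator ?Sh z * g (z /\<^sub>R norm z))"
    unfolding ind left_diff_distrib by (rule Bochner_Integration.integrable_diff[OF gi gi])
  have hi: "integrable lborel (\<lambda>z. indicat_real (cball 0 s) z * g z)" if "s \<le> 1" for s
    using g_bd that by (intro integrable_indicator_cball_mult[of _ _ "(\<bar>f x\<bar> + L) * norm u"]) (auto simp: g_def)
  have hi': "integrable lborel (\<lambda>z. indicator ?Sh z * g z)"
    unfolding ind left_diff_distrib using r by (intro Bochner_Integration.integrable_diff hi) auto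
  let ?E = "(1 - r) * norm u * (\<bar>f x\<bar> + 2 * L)"
  have E0: "0 \<le> ?E" using r L0 by auto
  \<comment> \<open>Moving to the projection changes \<open>f\<close> by at most
    \<open>L * (1 - r)\<close> and the inner product by at most
    \<open>(1 - r) * norm u\<close>.\<close>
  have err: "\<bar>g z - g (z /\<^sub>R norm z)\<bar> \<le> ?E" if z: "z \<in> ?Sh" for z
  proof -
    define w where "w = z /\<^sub>R norm z"
    have nz: "norm z \<le> 1" "r < norm z" using z by auto
    then have z0: "norm z > 0" using r by linarith
    then have nw: "norm w = 1" by (simp add: w_def)
    have "norm z *\<^sub>R w = z" using z0 by (simp add: w_def)
    then have "z - w = (norm z - 1) *\<^sub>R w" by (simp add: scaleR_diff_left)
    then have "norm (z - w) = 1 - norm z" using nw nz by simp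
    then have zw: "norm (z - w) \<le> 1 - r" using nz by simp
    have 1: "\<bar>f (x + z) - f (x + w)\<bar> \<le> L * (1 - r)"
      using lipschitz_abs_diff[OF lip, of "x + z" "x + w"] mult_left_mono[OF zw L0] by simp
    have 2: "\<bar>(z - w) \<bullet> u\<bar> \<le> (1 - r) * norm u"
      using Cauchy_Schwarz_ineq2[of "z - w" u] mult_right_mono[OF zw norm_ge_zero[of u]] by linarith
    have 3: "\<bar>w \<bullet> u\<bar> \<le> norm u" using Cauchy_Schwarz_ineq2[of w u] nw by simp
    have "g z - g w = f (x + z) * ((z - w) \<bullet> u) + (f (x + z) - f (x + w)) * (w \<bullet> u)"
      by (simp add: g_def inner_diff_left algebra_simps)
    also have "\<bar>\<dots>\<bar> \<le> \<bar>f (x + z)\<bar> * \<bar>(z - w) \<bullet> u\<bar> + \<bar>f (x + z) - f (x + w)\<bar> * \<bar>w \<bullet> u\<bar>"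
      using abs_triangle_ineq by (simp flip: abs_mult)
    also have "\<dots> \<le> (\<bar>f x\<bar> + L) * ((1 - r) * norm u) + (L * (1 - r)) * norm u"
      using 1 2 3 lipschitz_abs_add[OF lip nz(1), of x] L0 r by (intro add_mono mult_mono) auto
    finally show ?thesis by (simp add: w_def algebra_simps)
  qed
  have "\<bar>(\<integral>z. indicator ?Sh z * g z \<partial>lborel) - (\<integral>z. indicator ?Sh z * g (z /\<^sub>R norm z) \<partial>lborel)\<bar>
      = \<bar>\<integral>z. indicator ?Sh z * (g z - g (z /\<^sub>R norm z)) \<partial>lborel\<bar>"
    using hi' gi' by (simp add: right_diff_distrib)
  also have "\<dots> \<le> (\<integral>z. indicat_real ?Sh z * ?E \<partial>lborel)"
  proof (rule order_trans[OF integral_abs_bound], rule integral_mono)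
    show "integrable lborel (\<lambda>z. \<bar>indicator ?Sh z * (g z - g (z /\<^sub>R norm z))\<bar>)"
      unfolding right_diff_distrib using hi' gi' by (intro integrable_abs Bochner_Integration.integrable_diff)
    show "integrable lborel (\<lambda>z. indicat_real ?Sh z * ?E)"
      unfolding ind left_diff_distrib by (rule Bochner_Integration.integrable_diff[OF bi bi])
  qed (use err E0 in \<open>auto simp: indicator_def\<close>)
  also have "\<dots> = (\<integral>z. indicat_real (cball (0::'a) 1) z * ?E \<partial>lborel) - (\<integral>z. indicat_real (cball (0::'a) r) z * ?E \<partial>lborel)"
    unfolding ind left_diff_distrib by (rule Bochner_Integration.integral_diff[OF bi bi])
  also have "\<dots> = (1 - r ^ DIM('a)) * ?V * ?E"
  proof -
    interpret S: prob_space "unif_sphere :: 'a measure" by (rule prob_space_unif_sphere)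
    show ?thesis
      using integral_cball_radial[of "\<lambda>_::'a. ?E" r] integral_cball_radial[of "\<lambda>_::'a. ?E" 1] r S.prob_space
      by (simp add: algebra_simps)
  qed
  finally have fin: "\<bar>(\<integral>z. indicator ?Sh z * g z \<partial>lborel) - (\<integral>z. indicator ?Sh z * g (z /\<^sub>R norm z) \<partial>lborel)\<bar>
      \<le> (1 - r ^ DIM('a)) * ?V * ?E" .
  have "J x - a * ?V * (\<integral>w. g w \<partial>unif_sphere) = 2 / (1 - r\<^sup>2) * ((\<integral>z. indicator ?Sh z * g z \<partial>lborel) - (\<integral>z. indicator ?Sh z * g (z /\<^sub>R norm z) \<partial>lborel))"
    unfolding main[symmetric] J_def g_def[symmetric] right_diff_distrib[symmetric] ..
  moreover have "\<bar>2 / (1 - r\<^sup>2)\<bar> = 2 / (1 - r\<^sup>2)" using r2 by simp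
  ultimately have "\<bar>J x - a * ?V * (\<integral>w. g w \<partial>unif_sphere)\<bar> = 2 / (1 - r\<^sup>2) * \<bar>(\<integral>z. indicator ?Sh z * g z \<partial>lborel) - (\<integral>z. indicator ?Sh z * g (z /\<^sub>R norm z) \<partial>lborel)\<bar>"
    by (simp only: abs_mult)
  also have "\<dots> \<le> 2 / (1 - r\<^sup>2) * ((1 - r ^ DIM('a)) * ?V * ?E)"
    using r2 by (intro mult_left_mono[OF fin]) auto
  finally show ?thesis unfolding a_eq g_def by (simp only: mult.assoc)
qed


lemma unit_sphere_integral_bound:
  fixes f :: "'a::euclidean_space \<Rightarrow> real"
  assumes lip: "L-lipschitz_on UNIV f"
  shows "\<bar>\<integral>w. f (x + w) * (w \<bullet> u) \<partial>unif_sphere\<bar> \<le> (\<bar>f x\<bar> + L) * norm u"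
proof -
  interpret S: prob_space "unif_sphere :: 'a measure" by (rule prob_space_unif_sphere)
  have [measurable]: "f \<in> borel_measurable borel" using lip by (rule lipschitz_borel_measurable)
  have L0: "0 \<le> L" using lip by (rule lipschitz_on_nonneg)
  have bd: "AE w in unif_sphere. \<bar>f (x + w) * (w \<bullet> u)\<bar> \<le> (\<bar>f x\<bar> + L) * norm u"
    using AE_unif_sphere_norm
  proof eventually_elim
    fix w :: 'a assume w: "norm w = 1"
    show "\<bar>f (x + w) * (w \<bullet> u)\<bar> \<le> (\<bar>f x\<bar> + L) * norm u"
      unfolding abs_mult using lipschitz_abs_add[OF lip, of w 1 x] Cauchy_Schwarz_ineq2[of w u] w L0
      by (intro mult_mono) auto
  qed
  have "\<bar>\<integral>w. f (x + w) * (w \<bullet> u) \<partial>unif_sphere\<bar> \<le> (\<integral>w. \<bar>f (x + w) * (w \<bullet> u)\<bar> \<partial>unif_sphere)"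
    by (rule integral_abs_bound)
  also have "\<dots> \<le> (\<integral>(w::'a). (\<bar>f x\<bar> + L) * norm u \<partial>unif_sphere)"
  proof (rule integral_mono_AE)
    show "integrable unif_sphere (\<lambda>w. \<bar>f (x + w) * (w \<bullet> u)\<bar>)"
      by (rule S.integrable_const_bound[of _ "(\<bar>f x\<bar> + L) * norm u"]) (use bd in auto)
  qed (use bd in auto)
  finally show ?thesis using S.prob_space by simp
qed

text \<open>Both sides of \<open>integral_plateau_diff\<close> converge as \<open>r\<close> tends to
  1, by dominated convergence: the plateaus to the indicator of the ball off the sphere, the
  normalised shell integrals to spherical means. The ball volume then cancels.\<close>

lemma ball_avg_unit_diff:
  fixes f :: "'a::euclidean_space \<Rightarrow> real"
  assumes lip: "L-lipschitz_on UNIV f"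
  shows "ball_avg 1 f (x + u) - ball_avg 1 f x
    = (\<integral>s. indicator {0..1} s * (real DIM('a) * (\<integral>w. f (x + s *\<^sub>R u + w) * (w \<bullet> u) \<partial>unif_sphere)) \<partial>lborel)"
proof (cases "u = 0")
  case False
  have [measurable]: "f \<in> borel_measurable borel" using lip by (rule lipschitz_borel_measurable)
  have L0: "0 \<le> L" using lip by (rule lipschitz_on_nonneg)
  let ?V = "ball_vol TYPE('a)"
  \<comment> \<open>The shift by two keeps \<open>r 0\<close> positive.\<close>
  define r where "r k = 1 - 1 / real (k + 2)" for k
  have r: "0 < r k" "r k < 1" for k by (auto simp: r_def)
  have r_lim: "r \<longlonglongrightarrow> 1"
  proof -
    have "(\<lambda>k. 1 / real (k + 2)) \<longlonglongrightarrow> 0" using LIMSEQ_ignore_initial_segment[OF lim_1_over_n, of 2] by simp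
    from tendsto_diff[OF tendsto_const[of 1] this] show ?thesis unfolding r_def by simp
  qed
  define J where "J k x = 2 / (1 - (r k)\<^sup>2) * (\<integral>z. indicator (cball 0 1 - cball 0 (r k)) z * (f (x + z) * (z \<bullet> u)) \<partial>lborel)" for k x
  define a where "a k = 2 / (1 + r k) * (\<Sum>i<DIM('a). r k ^ i)" for k
  define S where "S x = (\<integral>w. f (x + w) * (w \<bullet> u) \<partial>unif_sphere)" for x
  have [measurable]: "S \<in> borel_measurable borel"
  proof -
    interpret S: prob_space "unif_sphere :: 'a measure" by (rule prob_space_unif_sphere)
    show ?thesis unfolding S_def by measurable
  qed
  have [measurable]: "J k \<in> borel_measurable borel" for k unfolding J_def by measurable
  have a_lim: "a \<longlonglongrightarrow> real DIM('a)"
  proof -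
    have "a \<longlonglongrightarrow> 2 / (1 + 1) * (\<Sum>i<DIM('a). 1 ^ i)" unfolding a_def by (intro tendsto_intros r_lim) auto
    then show ?thesis by simp
  qed
  have a_bd: "0 \<le> a k" "a k \<le> 2 * real DIM('a)" for k
  proof -
    have "(\<Sum>i<DIM('a). r k ^ i) \<le> (\<Sum>i<DIM('a). 1)" using r[of k] by (intro sum_mono power_le_one) auto
    moreover have s0: "0 \<le> (\<Sum>i<DIM('a). r k ^ i)" using r[of k] by (intro sum_nonneg) auto
    moreover have "2 / (1 + r k) \<le> 2" using r[of k] by (simp add: divide_simps)
    ultimately have "2 / (1 + r k) * (\<Sum>i<DIM('a). r k ^ i) \<le> 2 * real DIM('a)"
      by (intro mult_mono) auto
    then show "0 \<le> a k" "a k \<le> 2 * real DIM('a)" unfolding a_def using r[of k] s0 by auto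
  qed
  have approx: "\<bar>J k x - a k * ?V * S x\<bar> \<le> a k * ?V * ((1 - r k) * norm u * (\<bar>f x\<bar> + 2 * L))" for k x
    unfolding J_def a_def S_def by (rule shell_integral_approx[OF lip r])
  have J_lim: "(\<lambda>k. J k x) \<longlonglongrightarrow> real DIM('a) * ?V * S x" for x
  proof -
    have "(\<lambda>k. a k * ?V * ((1 - r k) * norm u * (\<bar>f x\<bar> + 2 * L))) \<longlonglongrightarrow> real DIM('a) * ?V * ((1 - 1) * norm u * (\<bar>f x\<bar> + 2 * L))"
      by (intro tendsto_intros r_lim a_lim)
    then have "(\<lambda>k. a k * ?V * ((1 - r k) * norm u * (\<bar>f x\<bar> + 2 * L))) \<longlonglongrightarrow> 0" by simp
    then have "(\<lambda>k. J k x - a k * ?V * S x) \<longlonglongrightarrow> 0"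
      by (rule tendsto_0_le[where K=1]) (use approx in \<open>auto intro!: always_eventually order_trans[OF approx] abs_ge_self\<close>)
    moreover have "(\<lambda>k. a k * ?V * S x) \<longlonglongrightarrow> real DIM('a) * ?V * S x" by (intro tendsto_intros a_lim)
    ultimately show ?thesis using tendsto_add by fastforce
  qed
  define B where "B = \<bar>f x\<bar> + L * norm u"
  have fB: "\<bar>f (x + s *\<^sub>R u)\<bar> \<le> B" if "0 \<le> s" "s \<le> 1" for s
    unfolding B_def using that mult_right_mono[of s 1 "norm u"] by (intro lipschitz_abs_add[OF lip]) simp
  have J_bd: "\<bar>J k (x + s *\<^sub>R u)\<bar> \<le> 2 * real DIM('a) * ?V * (norm u * (2 * B + 3 * L))" if s: "0 \<le> s" "s \<le> 1" for k s
  proof -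
    let ?x = "x + s *\<^sub>R u"
    have "\<bar>J k ?x\<bar> \<le> a k * ?V * \<bar>S ?x\<bar> + a k * ?V * ((1 - r k) * norm u * (\<bar>f ?x\<bar> + 2 * L))"
    proof -
      have "\<bar>a k * ?V * S ?x\<bar> = a k * ?V * \<bar>S ?x\<bar>" using a_bd[of k] by (simp add: abs_mult)
      then show ?thesis using approx[of k ?x] by linarith
    qed
    also have "\<dots> = a k * ?V * (\<bar>S ?x\<bar> + (1 - r k) * norm u * (\<bar>f ?x\<bar> + 2 * L))" by (simp add: algebra_simps)
    also have "\<dots> \<le> 2 * real DIM('a) * ?V * ((B + L) * norm u + 1 * norm u * (B + 2 * L))"
    proof (intro mult_mono add_mono)
      show "\<bar>S ?x\<bar> \<le> (B + L) * norm u"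
        using unit_sphere_integral_bound[OF lip, of ?x u] mult_right_mono[of "\<bar>f ?x\<bar> + L" "B + L" "norm u"] fB[OF s]
        by (simp add: S_def)
    qed (use a_bd[of k] r[of k] fB[OF s] L0 in auto)
    also have "\<dots> = 2 * real DIM('a) * ?V * (norm u * (2 * B + 3 * L))" by (simp add: algebra_simps)
    finally show ?thesis .
  qed
  have "(\<lambda>k. \<integral>s. indicator {0..1} s * J k (x + s *\<^sub>R u) \<partial>lborel) \<longlonglongrightarrow> (\<integral>s. indicator {0..1} s * (real DIM('a) * ?V * S (x + s *\<^sub>R u)) \<partial>lborel)"
  proof (rule integral_dominated_convergence[where w="\<lambda>s. indicator {0..1} s * (2 * real DIM('a) * ?V * (norm u * (2 * B + 3 * L)))"])
    show "AE s in lborel. (\<lambda>k. indicator {0..1} s * J k (x + s *\<^sub>R u)) \<longlonglongrightarrow> indicator {0..1} s * (real DIM('a) * ?V * S (x + s *\<^sub>R u))"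
      by (intro AE_I2 tendsto_intros J_lim)
    show "AE s in lborel. norm (indicator {0..1} s * J k (x + s *\<^sub>R u)) \<le> indicator {0..1} s * (2 * real DIM('a) * ?V * (norm u * (2 * B + 3 * L)))" for k
      using J_bd by (intro AE_I2) (auto simp: indicator_def)
    show "integrable lborel (\<lambda>s::real. indicator {0..1} s * (2 * real DIM('a) * ?V * (norm u * (2 * B + 3 * L))))"
      by (intro integrable_mult_left integrable_real_indicator) auto
  qed measurable
  moreover have "(\<integral>s. indicator {0..1} s * J k (x + s *\<^sub>R u) \<partial>lborel) = (\<integral>y. (f (x + u + y) - f (x + y)) * plateau (r k) y \<partial>lborel)" for k
    unfolding J_def by (rule integral_plateau_diff[OF lip r False, symmetric])
  moreover have "(\<lambda>k. \<integral>y. (f (x + u + y) - f (x + y)) * plateau (r k) y \<partial>lborel) \<longlonglongrightarrow> (\<integral>y. (f (x + u + y) - f (x + y)) * indicator (cball 0 1) y \<partial>lborel)"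
  proof (rule integral_dominated_convergence[where w="\<lambda>y. indicator (cball 0 1) y * (L * norm u)"])
    have "AE y in lborel. y \<notin> sphere (0::'a) 1" by (rule AE_not_negligible) (rule negligible_sphere)
    then show "AE y in lborel. (\<lambda>k. (f (x + u + y) - f (x + y)) * plateau (r k) y) \<longlonglongrightarrow> (f (x + u + y) - f (x + y)) * indicator (cball 0 1) y"
    proof eventually_elim
      fix y :: 'a assume y: "y \<notin> sphere 0 1"
      have "(\<lambda>k. plateau (r k) y) \<longlonglongrightarrow> indicator (cball 0 1) y"
      proof (cases "norm y < 1")
        case True
        have "eventually (\<lambda>k. norm y < r k) sequentially" using r_lim True by (rule order_tendstoD)
        then have "eventually (\<lambda>k. plateau (r k) y = indicator (cball 0 1) y) sequentially"
          by eventually_elim (use True in \<open>simp add: plateau_eq_1[OF r] less_imp_le\<close>)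
        then show ?thesis by (rule tendsto_eventually)
      next
        case False
        then show ?thesis using y by (simp add: plateau_eq_0[OF r])
      qed
      then show "(\<lambda>k. (f (x + u + y) - f (x + y)) * plateau (r k) y) \<longlonglongrightarrow> (f (x + u + y) - f (x + y)) * indicator (cball 0 1) y"
        by (intro tendsto_intros)
    qed
    show "AE y in lborel. norm ((f (x + u + y) - f (x + y)) * plateau (r k) y) \<le> indicator (cball 0 1) y * (L * norm u)" for k
    proof (intro AE_I2)
      fix y :: 'a
      show "norm ((f (x + u + y) - f (x + y)) * plateau (r k) y) \<le> indicator (cball 0 1) y * (L * norm u)"
      proof (cases "norm y \<le> 1")
        case True
        have "\<bar>f (x + u + y) - f (x + y)\<bar> * \<bar>plateau (r k) y\<bar> \<le> (L * norm u) * 1"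
          using lipschitz_abs_diff[OF lip, of "x + u + y" "x + y"] plateau_bounds[of "r k" y] by (intro mult_mono) auto
        then show ?thesis using True by (simp add: abs_mult)
      qed (simp add: plateau_eq_0[OF r])
    qed
    show "integrable lborel (\<lambda>y::'a. indicator (cball 0 1) y * (L * norm u))" by (rule integrable_indicator_cball)
  qed measurable
  ultimately have "(\<integral>y. (f (x + u + y) - f (x + y)) * indicator (cball 0 1) y \<partial>lborel)
      = (\<integral>s. indicator {0..1} s * (real DIM('a) * ?V * S (x + s *\<^sub>R u)) \<partial>lborel)"
    using LIMSEQ_unique by simp
  also have "\<dots> = (\<integral>s. ?V * (indicator {0..1} s * (real DIM('a) * S (x + s *\<^sub>R u))) \<partial>lborel)"
    by (simp add: mult_ac)
  also have "\<dots> = ?V * (\<integral>s. indicator {0..1} s * (real DIM('a) * S (x + s *\<^sub>R u)) \<partial>lborel)"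
    by (rule integral_mult_right_zero)
  also have "(\<integral>y. (f (x + u + y) - f (x + y)) * indicator (cball 0 1) y \<partial>lborel)
     = ?V * (\<integral>y. f (x + u + y) - f (x + y) \<partial>unif_ball)"
    using integral_unif_ball[of "\<lambda>y. f (x + u + y) - f (x + y)"] by (simp add: mult.commute)
  also have "(\<integral>y. f (x + u + y) - f (x + y) \<partial>unif_ball) = ball_avg 1 f (x + u) - ball_avg 1 f x"
    unfolding ball_avg_def
    using integrable_unif_ball_lipschitz[OF lip, of "x + u" 1] integrable_unif_ball_lipschitz[OF lip, of x 1] by simp
  finally show ?thesis using ball_vol_pos[where 'a='a] by (simp add: S_def)
qed simp

lemma inner_sphere_grad:
  fixes f :: "'a::euclidean_space \<Rightarrow> real"
  assumes lip: "L-lipschitz_on UNIV f"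
  shows "sphere_grad \<rho> f x \<bullet> u = real DIM('a) / \<rho> * (\<integral>w. f (x + \<rho> *\<^sub>R w) * (w \<bullet> u) \<partial>unif_sphere)"
  unfolding sphere_grad_def
  using integral_inner_left[OF integrable_unif_sphere_lipschitz[OF lip, of x \<rho>], of u] by simp

text \<open>The right side is an expectation over a uniform point of the segment, exactly what one
  round of the algorithm samples, so no Taylor remainder arises later. Rescaling reduces it to
  radius 1.\<close>

lemma ball_avg_diff:
  fixes f :: "'a::euclidean_space \<Rightarrow> real"
  assumes lip: "L-lipschitz_on UNIV f" and \<rho>: "0 < \<rho>"
  shows "ball_avg \<rho> f (x + u) - ball_avg \<rho> f x
    = (\<integral>s. indicator {0..1} s * (sphere_grad \<rho> f (x + s *\<^sub>R u) \<bullet> u) \<partial>lborel)"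
proof -
  have lip': "(L * \<bar>\<rho>\<bar>)-lipschitz_on UNIV (\<lambda>z. f (\<rho> *\<^sub>R z))"
    using lipschitz_on_affine[OF lip, of \<rho> 0] by simp
  have e: "ball_avg 1 (\<lambda>z. f (\<rho> *\<^sub>R z)) (z /\<^sub>R \<rho>) = ball_avg \<rho> f z" for z
    using \<rho> by (simp add: ball_avg_def scaleR_add_right)
  have "real DIM('a) * (\<integral>w. f (\<rho> *\<^sub>R (x /\<^sub>R \<rho> + s *\<^sub>R (u /\<^sub>R \<rho>) + w)) * (w \<bullet> (u /\<^sub>R \<rho>)) \<partial>unif_sphere)
    = sphere_grad \<rho> f (x + s *\<^sub>R u) \<bullet> u" for s
  proof -
    have "(\<integral>w. f (\<rho> *\<^sub>R (x /\<^sub>R \<rho> + s *\<^sub>R (u /\<^sub>R \<rho>) + w)) * (w \<bullet> (u /\<^sub>R \<rho>)) \<partial>unif_sphere)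
      = (\<integral>w. inverse \<rho> * (f (x + s *\<^sub>R u + \<rho> *\<^sub>R w) * (w \<bullet> u)) \<partial>unif_sphere)"
      using \<rho> by (intro Bochner_Integration.integral_cong refl) (simp add: scaleR_add_right mult.left_commute[of \<rho>] mult.left_commute[of _ "inverse \<rho>"])
    then show ?thesis unfolding inner_sphere_grad[OF lip] by (simp add: divide_inverse)
  qed
  then show ?thesis
    using ball_avg_unit_diff[OF lip', of "x /\<^sub>R \<rho>" "u /\<^sub>R \<rho>"] unfolding e[symmetric] scaleR_add_right by simp
qed

text \<open>The dimension in this constant is harmless: the lemma serves continuity, measurability
  and differentiability, and the constant never enters the rate.\<close>

lemma sphere_grad_lipschitz:
  fixes f :: "'a::euclidean_space \<Rightarrow> real"
  assumes lip: "L-lipschitz_on UNIV f" and \<rho>: "0 < \<rho>"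
  shows "(real DIM('a) / \<rho> * L)-lipschitz_on UNIV (sphere_grad \<rho> f)"
proof (rule lipschitz_onI)
  interpret S: prob_space "unif_sphere :: 'a measure" by (rule prob_space_unif_sphere)
  fix x y
  have i: "integrable unif_sphere (\<lambda>w. (f (x + \<rho> *\<^sub>R w) - f (y + \<rho> *\<^sub>R w)) *\<^sub>R w)"
    unfolding scaleR_diff_left by (intro Bochner_Integration.integrable_diff integrable_unif_sphere_lipschitz[OF lip])
  have "sphere_grad \<rho> f x - sphere_grad \<rho> f y = (real DIM('a) / \<rho>) *\<^sub>R (\<integral>w. (f (x + \<rho> *\<^sub>R w) - f (y + \<rho> *\<^sub>R w)) *\<^sub>R w \<partial>unif_sphere)"
    unfolding sphere_grad_def scaleR_diff_left scaleR_diff_right[symmetric]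
    by (subst Bochner_Integration.integral_diff) (auto intro: integrable_unif_sphere_lipschitz[OF lip])
  then have "norm (sphere_grad \<rho> f x - sphere_grad \<rho> f y) = real DIM('a) / \<rho> * norm (\<integral>w. (f (x + \<rho> *\<^sub>R w) - f (y + \<rho> *\<^sub>R w)) *\<^sub>R w \<partial>unif_sphere)"
    using \<rho> by simp
  also have "norm (\<integral>w. (f (x + \<rho> *\<^sub>R w) - f (y + \<rho> *\<^sub>R w)) *\<^sub>R w \<partial>unif_sphere) \<le> (\<integral>w. norm ((f (x + \<rho> *\<^sub>R w) - f (y + \<rho> *\<^sub>R w)) *\<^sub>R w) \<partial>unif_sphere)"
    by (rule integral_norm_bound)
  also have "\<dots> \<le> (\<integral>(w::'a). L * norm (x - y) \<partial>unif_sphere)"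
  proof (rule integral_mono_AE)
    show "AE w in unif_sphere. norm ((f (x + \<rho> *\<^sub>R w) - f (y + \<rho> *\<^sub>R w)) *\<^sub>R w) \<le> L * norm (x - y)"
      using AE_unif_sphere_norm
    proof eventually_elim
      fix w :: 'a assume "norm w = 1"
      then show "norm ((f (x + \<rho> *\<^sub>R w) - f (y + \<rho> *\<^sub>R w)) *\<^sub>R w) \<le> L * norm (x - y)"
        using lipschitz_abs_diff[OF lip, of "x + \<rho> *\<^sub>R w" "y + \<rho> *\<^sub>R w"] by simp
    qed
    show "integrable unif_sphere (\<lambda>w. norm ((f (x + \<rho> *\<^sub>R w) - f (y + \<rho> *\<^sub>R w)) *\<^sub>R w))"
      by (rule integrable_norm[OF i])
  qed auto
  also have "\<dots> = L * norm (x - y)" using S.prob_space by simp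
  finally show "dist (sphere_grad \<rho> f x) (sphere_grad \<rho> f y) \<le> real DIM('a) / \<rho> * L * dist x y"
    using \<rho> by (simp add: dist_norm mult.assoc divide_right_mono)
qed (use lipschitz_on_nonneg[OF lip] \<rho> in auto)

text \<open>As the candidate gradient is Lipschitz, freezing it at \<open>x\<close> in the
  integrated formula leaves a remainder quadratic in the step.\<close>

lemma GDERIV_ball_avg:
  fixes f :: "'a::euclidean_space \<Rightarrow> real"
  assumes lip: "L-lipschitz_on UNIV f" and \<rho>: "0 < \<rho>"
  shows "GDERIV (ball_avg \<rho> f) x :> sphere_grad \<rho> f x"
  unfolding gderiv_def has_derivative_at_alt
proof (intro conjI allI impI)
  let ?G = "sphere_grad \<rho> f"
  define K where "K = real DIM('a) / \<rho> * L"
  have G_lip: "K-lipschitz_on UNIV ?G" unfolding K_def by (rule sphere_grad_lipschitz[OF lip \<rho>])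
  have K0: "0 \<le> K" using G_lip by (rule lipschitz_on_nonneg)
  have [measurable]: "?G \<in> borel_measurable borel"
    by (intro borel_measurable_continuous_onI lipschitz_on_continuous_on[OF G_lip])
  have Gd: "norm (?G a - ?G b) \<le> K * norm (a - b)" for a b
    using lipschitz_onD[OF G_lip, of a b] by (simp add: dist_norm)
  show "bounded_linear (\<lambda>h. h \<bullet> ?G x)" by (rule bounded_linear_inner_left)
  fix e :: real assume e: "0 < e"
  have bd: "\<bar>ball_avg \<rho> f y - ball_avg \<rho> f x - (y - x) \<bullet> ?G x\<bar> \<le> K * (norm (y - x))\<^sup>2" for y
  proof -
    define u where "u = y - x"
    have u: "y = x + u" by (simp add: u_def)
    have ii: "integrable lborel (\<lambda>s::real. indicator {0..1} s * (c::real))" for c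
      by (intro integrable_mult_left integrable_real_indicator) auto
    have i1: "\<bar>(?G (x + s *\<^sub>R u) - ?G x) \<bullet> u\<bar> \<le> K * (norm u)\<^sup>2" if "0 \<le> s" "s \<le> 1" for s
    proof -
      have "\<bar>(?G (x + s *\<^sub>R u) - ?G x) \<bullet> u\<bar> \<le> norm (?G (x + s *\<^sub>R u) - ?G x) * norm u" by (rule Cauchy_Schwarz_ineq2)
      also have "\<dots> \<le> (K * norm (s *\<^sub>R u)) * norm u" using Gd[of "x + s *\<^sub>R u" x] by (intro mult_right_mono) auto
      also have "\<dots> = s * (K * (norm u)\<^sup>2)" using that by (simp add: power2_eq_square)
      also have "\<dots> \<le> 1 * (K * (norm u)\<^sup>2)" using that K0 by (intro mult_right_mono) auto
      finally show ?thesis by simp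
    qed
    have i2: "integrable lborel (\<lambda>s. indicator {0..1} s * ((?G (x + s *\<^sub>R u) - ?G x) \<bullet> u))"
    proof (rule Bochner_Integration.integrable_bound[OF ii[of "K * (norm u)\<^sup>2"]])
      show "AE s in lborel. norm (indicator {0..1} s * ((?G (x + s *\<^sub>R u) - ?G x) \<bullet> u)) \<le> norm (indicator {0..1} s * (K * (norm u)\<^sup>2))"
        using i1 K0 by (intro AE_I2) (auto simp: indicator_def)
    qed measurable
    have "(\<integral>s. indicator {0..1::real} s * (?G x \<bullet> u) \<partial>lborel) = ?G x \<bullet> u" by (simp add: content_real)
    moreover have "ball_avg \<rho> f y - ball_avg \<rho> f x = (\<integral>s. indicator {0..1} s * ((?G (x + s *\<^sub>R u) - ?G x) \<bullet> u) + indicator {0..1} s * (?G x \<bullet> u) \<partial>lborel)"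
      unfolding u ball_avg_diff[OF lip \<rho>] by (intro Bochner_Integration.integral_cong refl) (simp add: inner_diff_left algebra_simps)
    ultimately have "ball_avg \<rho> f y - ball_avg \<rho> f x - (y - x) \<bullet> ?G x = (\<integral>s. indicator {0..1} s * ((?G (x + s *\<^sub>R u) - ?G x) \<bullet> u) \<partial>lborel)"
      using i2 ii[of "?G x \<bullet> u"] by (simp add: u_def inner_commute)
    also have "\<bar>\<dots>\<bar> \<le> (\<integral>s. \<bar>indicator {0..1} s * ((?G (x + s *\<^sub>R u) - ?G x) \<bullet> u)\<bar> \<partial>lborel)" by (rule integral_abs_bound)
    also have "\<dots> \<le> (\<integral>s. indicator {0..1::real} s * (K * (norm u)\<^sup>2) \<partial>lborel)"
      using i2 ii i1 by (intro integral_mono) (auto simp: indicator_def)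
    also have "\<dots> = K * (norm u)\<^sup>2" by (simp add: content_real)
    finally show ?thesis by (simp add: u_def)
  qed
  show "\<exists>d>0. \<forall>y. norm (y - x) < d \<longrightarrow> norm (ball_avg \<rho> f y - ball_avg \<rho> f x - (y - x) \<bullet> ?G x) \<le> e * norm (y - x)"
  proof (intro exI[of _ "e / (K + 1)"] conjI allI impI)
    show "0 < e / (K + 1)" using e K0 by simp
    fix y assume y: "norm (y - x) < e / (K + 1)"
    have "K * norm (y - x) \<le> (K + 1) * norm (y - x)" by (simp add: algebra_simps)
    also have "\<dots> \<le> e" using y K0 by (simp add: field_simps)
    finally have "K * norm (y - x) * norm (y - x) \<le> e * norm (y - x)" by (intro mult_right_mono) auto
    then show "norm (ball_avg \<rho> f y - ball_avg \<rho> f x - (y - x) \<bullet> ?G x) \<le> e * norm (y - x)"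
      using bd[of y] by (simp add: power2_eq_square mult.assoc)
  qed
qed


section \<open>Bounds for the smoothed function and its gradient\<close>

lemma lipschitz_GDERIV_norm_le:
  fixes f :: "'a::euclidean_space \<Rightarrow> real"
  assumes lip: "L-lipschitz_on UNIV f" and g: "GDERIV f x :> g"
  shows "norm g \<le> L"
proof -
  have L0: "0 \<le> L" using lip by (rule lipschitz_on_nonneg)
  have "norm g * norm g \<le> (L + e) * norm g" if e: "0 < e" for e
  proof -
    obtain d where d: "d > 0" "\<And>y. norm (y - x) < d \<Longrightarrow> \<bar>f y - f x - (y - x) \<bullet> g\<bar> \<le> e * norm (y - x)"
      using g e unfolding gderiv_def has_derivative_at_alt by auto
    \<comment> \<open>This makes the step \<open>t *\<^sub>R g\<close> shorter than
      \<open>d\<close>; the added 1 covers \<open>g = 0\<close>.\<close>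
    define t where "t = d / (norm g + 1)"
    have t: "0 < t" using d(1) by (auto simp: t_def intro!: divide_pos_pos add_nonneg_pos)
    have "t * norm g < t * (norm g + 1)" using t by simp
    also have "\<dots> = d" by (simp add: t_def add_nonneg_eq_0_iff)
    finally have "\<bar>f (x + t *\<^sub>R g) - f x - t * (g \<bullet> g)\<bar> \<le> e * (t * norm g)"
      using d(2)[of "x + t *\<^sub>R g"] t by simp
    moreover have "\<bar>f (x + t *\<^sub>R g) - f x\<bar> \<le> L * (t * norm g)"
      using lipschitz_abs_diff[OF lip, of "x + t *\<^sub>R g" x] t by simp
    ultimately have "t * (g \<bullet> g) \<le> L * (t * norm g) + e * (t * norm g)" by linarith
    then have "t * (norm g * norm g) \<le> t * ((L + e) * norm g)"
      by (simp add: dot_square_norm power2_eq_square algebra_simps)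
    then show ?thesis using t by simp
  qed
  then have "norm g \<le> L + e" if "0 < e" for e using that L0 by (cases "norm g = 0") auto
  then show ?thesis by (rule field_le_epsilon)
qed

text \<open>The bound is read off from the Lipschitz constant of the average. Estimating the
  spherical integral term by term would cost a factor \<open>DIM('a)\<close>.\<close>

lemma norm_sphere_grad_le:
  assumes "L-lipschitz_on UNIV (f :: 'a::euclidean_space \<Rightarrow> real)" "0 < \<rho>"
  shows "norm (sphere_grad \<rho> f x) \<le> L"
proof -
  interpret U: prob_space "unif_ball :: 'a measure" by (rule prob_space_unif_ball)
  have "L-lipschitz_on UNIV (ball_avg \<rho> f)"
  proof (rule lipschitz_onI)
    fix x y :: 'a
    have i: "integrable unif_ball (\<lambda>z. f (x + \<rho> *\<^sub>R z) - f (y + \<rho> *\<^sub>R z))"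
      by (intro Bochner_Integration.integrable_diff integrable_unif_ball_lipschitz[OF assms(1)])
    have "ball_avg \<rho> f x - ball_avg \<rho> f y = (\<integral>z. f (x + \<rho> *\<^sub>R z) - f (y + \<rho> *\<^sub>R z) \<partial>unif_ball)"
      unfolding ball_avg_def by (subst Bochner_Integration.integral_diff) (auto intro: integrable_unif_ball_lipschitz[OF assms(1)])
    also have "\<bar>\<dots>\<bar> \<le> (\<integral>z. \<bar>f (x + \<rho> *\<^sub>R z) - f (y + \<rho> *\<^sub>R z)\<bar> \<partial>unif_ball)" by (rule integral_abs_bound)
    also have "\<dots> \<le> (\<integral>(z::'a). L * norm (x - y) \<partial>unif_ball)"
    proof (rule integral_mono)
      fix z
      show "\<bar>f (x + \<rho> *\<^sub>R z) - f (y + \<rho> *\<^sub>R z)\<bar> \<le> L * norm (x - y)"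
        using lipschitz_abs_diff[OF assms(1), of "x + \<rho> *\<^sub>R z" "y + \<rho> *\<^sub>R z"] by simp
    qed (use i in auto)
    also have "\<dots> = L * norm (x - y)" using U.prob_space by simp
    finally show "dist (ball_avg \<rho> f x) (ball_avg \<rho> f y) \<le> L * dist x y" by (simp add: dist_norm)
  qed (rule lipschitz_on_nonneg[OF assms(1)])
  then show ?thesis using GDERIV_ball_avg[OF assms] by (rule lipschitz_GDERIV_norm_le)
qed

lemma ball_avg_approx:
  assumes lip: "L-lipschitz_on UNIV (f :: 'a::euclidean_space \<Rightarrow> real)" and "0 < \<rho>"
  shows "\<bar>ball_avg \<rho> f x - f x\<bar> \<le> L * \<rho>"
proof -
  interpret U: prob_space "unif_ball :: 'a measure" by (rule prob_space_unif_ball)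
  have L0: "0 \<le> L" using lip by (rule lipschitz_on_nonneg)
  note i = integrable_unif_ball_lipschitz[OF lip, of x \<rho>]
  have "ball_avg \<rho> f x - f x = (\<integral>y. f (x + \<rho> *\<^sub>R y) - f x \<partial>unif_ball)"
    unfolding ball_avg_def using i U.prob_space by simp
  also have "\<bar>\<dots>\<bar> \<le> (\<integral>y. \<bar>f (x + \<rho> *\<^sub>R y) - f x\<bar> \<partial>unif_ball)" by (rule integral_abs_bound)
  also have "\<dots> \<le> (\<integral>(y::'a). L * \<rho> \<partial>unif_ball)"
  proof (rule integral_mono_AE)
    show "AE y in unif_ball. \<bar>f (x + \<rho> *\<^sub>R y) - f x\<bar> \<le> L * \<rho>" using AE_unif_ball_norm
    proof eventually_elim
      fix y :: 'a assume "norm y \<le> 1"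
      then have "norm (\<rho> *\<^sub>R y) \<le> \<rho>" using \<open>0 < \<rho>\<close> by simp
      then show "\<bar>f (x + \<rho> *\<^sub>R y) - f x\<bar> \<le> L * \<rho>"
        using lipschitz_abs_diff[OF lip, of "x + \<rho> *\<^sub>R y" x] mult_left_mono[OF _ L0, of "norm (\<rho> *\<^sub>R y)" \<rho>] by simp
    qed
  qed (use i in auto)
  also have "\<dots> = L * \<rho>" using U.prob_space by simp
  finally show ?thesis .
qed

lemma ball_avg_ge:
  assumes lip: "L-lipschitz_on UNIV (f :: 'a::euclidean_space \<Rightarrow> real)" and m: "\<And>x. m \<le> f x"
  shows "m \<le> ball_avg \<rho> f x"
proof -
  interpret U: prob_space "unif_ball :: 'a measure" by (rule prob_space_unif_ball)
  have "(\<integral>(y::'a). m \<partial>unif_ball) \<le> ball_avg \<rho> f x"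
    unfolding ball_avg_def using integrable_unif_ball_lipschitz[OF lip, of x \<rho>] m by (intro integral_mono) auto
  then show ?thesis using U.prob_space by simp
qed

lemma GDERIV_tendsto_quotient:
  fixes f :: "'a::euclidean_space \<Rightarrow> real"
  assumes g: "GDERIV f x :> g"
  shows "(\<lambda>n. (f (x + (1 / real (Suc n)) *\<^sub>R u) - f x) / (1 / real (Suc n))) \<longlonglongrightarrow> u \<bullet> g"
proof -
  have "((\<lambda>t::real. x + t *\<^sub>R u) has_derivative (\<lambda>t. t *\<^sub>R u)) (at 0)" by (auto intro!: derivative_eq_intros)
  moreover have "(f has_derivative (\<lambda>h. h \<bullet> g)) (at (x + 0 *\<^sub>R u))" using g by (simp add: gderiv_def)
  ultimately have "((\<lambda>t. f (x + t *\<^sub>R u)) has_derivative (\<lambda>t. (t *\<^sub>R u) \<bullet> g)) (at 0)"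
    by (rule has_derivative_compose)
  then have "((\<lambda>t. f (x + t *\<^sub>R u)) has_real_derivative (u \<bullet> g)) (at 0)"
    by (simp add: has_field_derivative_def mult_commute_abs)
  then have "((\<lambda>t. (f (x + t *\<^sub>R u) - f x) / t) \<longlongrightarrow> u \<bullet> g) (at 0)" unfolding DERIV_def by simp
  then show ?thesis
  proof (rule filterlim_compose)
    show "filterlim (\<lambda>n. 1 / real (Suc n)) (at 0) sequentially"
      using inverse_Suc_tendsto_0 by (auto simp: filterlim_at)
  qed
qed

lemma AE_unif_ball_GDERIV:
  fixes f :: "'a::euclidean_space \<Rightarrow> real"
  assumes lip: "L-lipschitz_on UNIV f" and \<rho>: "0 < \<rho>"
  shows "AE y in unif_ball. \<exists>g. GDERIV f (x + \<rho> *\<^sub>R y) :> g"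
proof (rule AE_unif_ball)
  have "AE y in lborel. \<exists>g. GDERIV (\<lambda>y. f (x + \<rho> *\<^sub>R y)) y :> g"
    by (rule rademacher[OF lipschitz_on_affine[OF lip]])
  then show "AE y in lborel. norm y \<le> 1 \<longrightarrow> (\<exists>g. GDERIV f (x + \<rho> *\<^sub>R y) :> g)"
  proof eventually_elim
    fix y assume "\<exists>g. GDERIV (\<lambda>y. f (x + \<rho> *\<^sub>R y)) y :> g"
    then obtain g where g: "((\<lambda>y. f (x + \<rho> *\<^sub>R y)) has_derivative (\<lambda>h. h \<bullet> g)) (at y)"
      by (auto simp: gderiv_def)
    have inv: "(x + \<rho> *\<^sub>R y - x) /\<^sub>R \<rho> = y" for y using \<rho> by simp
    have "((\<lambda>z. (z - x) /\<^sub>R \<rho>) has_derivative (\<lambda>h. h /\<^sub>R \<rho>)) (at (x + \<rho> *\<^sub>R y))"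
      by (auto intro!: derivative_eq_intros)
    moreover have "((\<lambda>y. f (x + \<rho> *\<^sub>R y)) has_derivative (\<lambda>h. h \<bullet> g)) (at ((x + \<rho> *\<^sub>R y - x) /\<^sub>R \<rho>))"
      using g unfolding inv .
    ultimately have "((\<lambda>z. f (x + \<rho> *\<^sub>R ((z - x) /\<^sub>R \<rho>))) has_derivative (\<lambda>h. (h /\<^sub>R \<rho>) \<bullet> g)) (at (x + \<rho> *\<^sub>R y))"
      by (rule has_derivative_compose)
    then have "(f has_derivative (\<lambda>h. (h /\<^sub>R \<rho>) \<bullet> g)) (at (x + \<rho> *\<^sub>R y))" using \<rho> by simp
    then have "GDERIV f (x + \<rho> *\<^sub>R y) :> (g /\<^sub>R \<rho>)" unfolding gderiv_def by simp
    then show "norm y \<le> 1 \<longrightarrow> (\<exists>g. GDERIV f (x + \<rho> *\<^sub>R y) :> g)" by blast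
  qed
qed

text \<open>By Rademacher's theorem and dominated convergence, the derivative of the average in
  direction \<open>u\<close> is the average of the derivatives of \<open>f\<close>. The half-space
  form is what separation from a convex set requires, and it avoids integrating a vector field of
  gradients.\<close>

lemma sphere_grad_inner_le:
  fixes f :: "'a::euclidean_space \<Rightarrow> real"
  assumes lip: "L-lipschitz_on UNIV f" and \<rho>: "0 < \<rho>"
    and c: "\<And>y g. norm (y - x) \<le> \<rho> \<Longrightarrow> GDERIV f y :> g \<Longrightarrow> g \<bullet> u \<le> c"
  shows "sphere_grad \<rho> f x \<bullet> u \<le> c"
proof -
  interpret U: prob_space "unif_ball :: 'a measure" by (rule prob_space_unif_ball)
  have [measurable]: "f \<in> borel_measurable borel" using lip by (rule lipschitz_borel_measurable)
  define h where "h n = 1 / real (Suc n)" for n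
  have h0: "0 < h n" for n by (simp add: h_def)
  define q where "q n y = (f (x + h n *\<^sub>R u + \<rho> *\<^sub>R y) - f (x + \<rho> *\<^sub>R y)) / h n" for n y
  \<comment> \<open>The limit is the directional derivative where the quotients converge, and is
    Borel without any measurable choice of gradients.\<close>
  define d where "d y = lim (\<lambda>n. q n y)" for y
  have [measurable]: "q n \<in> borel_measurable borel" for n unfolding q_def by measurable
  have [measurable]: "d \<in> borel_measurable borel" unfolding d_def by measurable
  have AEd: "AE y in unif_ball. (\<lambda>n. q n y) \<longlonglongrightarrow> d y \<and> d y \<le> c"
    using AE_unif_ball_GDERIV[OF lip \<rho>, of x] AE_unif_ball_norm
  proof eventually_elim
    fix y :: 'a assume "\<exists>g. GDERIV f (x + \<rho> *\<^sub>R y) :> g" and y: "norm y \<le> 1"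
    then obtain g where g: "GDERIV f (x + \<rho> *\<^sub>R y) :> g" by blast
    have "(\<lambda>n. q n y) \<longlonglongrightarrow> u \<bullet> g"
      unfolding q_def h_def using GDERIV_tendsto_quotient[OF g, of u] by (simp add: add_ac)
    moreover from this have "d y = u \<bullet> g" unfolding d_def by (rule limI)
    moreover have "g \<bullet> u \<le> c" using y \<rho> by (intro c[OF _ g]) simp
    ultimately show "(\<lambda>n. q n y) \<longlonglongrightarrow> d y \<and> d y \<le> c" by (simp add: inner_commute)
  qed
  have lim: "(\<lambda>n. \<integral>y. q n y \<partial>unif_ball) \<longlonglongrightarrow> (\<integral>y. d y \<partial>unif_ball)"
    and di: "integrable unif_ball d"
  proof -
    have b: "AE y in unif_ball. norm (q n y) \<le> L * norm u" for n
    proof (intro AE_I2)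
      fix y
      have "\<bar>f (x + h n *\<^sub>R u + \<rho> *\<^sub>R y) - f (x + \<rho> *\<^sub>R y)\<bar> \<le> L * (h n * norm u)"
        using lipschitz_abs_diff[OF lip, of "x + h n *\<^sub>R u + \<rho> *\<^sub>R y" "x + \<rho> *\<^sub>R y"] h0[of n] by simp
      then show "norm (q n y) \<le> L * norm u" using h0[of n] by (simp add: q_def field_simps)
    qed
    have a: "AE y in unif_ball. (\<lambda>n. q n y) \<longlonglongrightarrow> d y" using AEd by eventually_elim simp
    show "(\<lambda>n. \<integral>y. q n y \<partial>unif_ball) \<longlonglongrightarrow> (\<integral>y. d y \<partial>unif_ball)"
      by (rule integral_dominated_convergence[OF _ _ _ a b]) auto
    show "integrable unif_ball d"
      by (rule integrable_dominated_convergence[OF _ _ _ a b]) auto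
  qed
  have "(\<integral>y. q n y \<partial>unif_ball) = (ball_avg \<rho> f (x + h n *\<^sub>R u) - ball_avg \<rho> f x) / h n" for n
    unfolding q_def ball_avg_def
    using integrable_unif_ball_lipschitz[OF lip, of "x + h n *\<^sub>R u" \<rho>] integrable_unif_ball_lipschitz[OF lip, of x \<rho>]
    by simp
  then have "(\<lambda>n. (ball_avg \<rho> f (x + h n *\<^sub>R u) - ball_avg \<rho> f x) / h n) \<longlonglongrightarrow> (\<integral>y. d y \<partial>unif_ball)"
    using lim by simp
  moreover have "(\<lambda>n. (ball_avg \<rho> f (x + h n *\<^sub>R u) - ball_avg \<rho> f x) / h n) \<longlonglongrightarrow> u \<bullet> sphere_grad \<rho> f x"
    unfolding h_def by (rule GDERIV_tendsto_quotient[OF GDERIV_ball_avg[OF lip \<rho>]])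
  ultimately have "sphere_grad \<rho> f x \<bullet> u = (\<integral>y. d y \<partial>unif_ball)"
    using LIMSEQ_unique by (metis inner_commute)
  also have "\<dots> \<le> (\<integral>(y::'a). c \<partial>unif_ball)"
    by (intro integral_mono_AE di) (use AEd in auto)
  also have "\<dots> = c" using U.prob_space by simp
  finally show ?thesis .
qed

section \<open>Antipodal variance of Lipschitz functions on the sphere\<close>

lemma nn_integral_shear_fst:
  fixes \<phi> :: "'a::euclidean_space \<Rightarrow> 'a \<Rightarrow> ennreal"
  assumes [measurable]: "(\<lambda>(x, y). \<phi> x y) \<in> borel_measurable (borel \<Otimes>\<^sub>M borel)"
  shows "(\<integral>\<^sup>+y. \<integral>\<^sup>+x. \<phi> (x + a *\<^sub>R y) y \<partial>lborel \<partial>lborel) = (\<integral>\<^sup>+y. \<integral>\<^sup>+x. \<phi> x y \<partial>lborel \<partial>lborel)"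
  by (intro nn_integral_cong lborel_nn_integral_translate) measurable

lemma nn_integral_swap:
  fixes \<phi> :: "'a::euclidean_space \<Rightarrow> 'a \<Rightarrow> ennreal"
  assumes [measurable]: "(\<lambda>(x, y). \<phi> x y) \<in> borel_measurable (borel \<Otimes>\<^sub>M borel)"
  shows "(\<integral>\<^sup>+y. \<integral>\<^sup>+x. \<phi> x y \<partial>lborel \<partial>lborel) = (\<integral>\<^sup>+x. \<integral>\<^sup>+y. \<phi> x y \<partial>lborel \<partial>lborel)"
  by (rule lborel_pair.Fubini') measurable

lemma nn_integral_shear_snd:
  fixes \<phi> :: "'a::euclidean_space \<Rightarrow> 'a \<Rightarrow> ennreal"
  assumes [measurable]: "(\<lambda>(x, y). \<phi> x y) \<in> borel_measurable (borel \<Otimes>\<^sub>M borel)"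
  shows "(\<integral>\<^sup>+y. \<integral>\<^sup>+x. \<phi> x (y + a *\<^sub>R x) \<partial>lborel \<partial>lborel) = (\<integral>\<^sup>+y. \<integral>\<^sup>+x. \<phi> x y \<partial>lborel \<partial>lborel)"
proof -
  have "(\<integral>\<^sup>+y. \<integral>\<^sup>+x. \<phi> x (y + a *\<^sub>R x) \<partial>lborel \<partial>lborel) = (\<integral>\<^sup>+x. \<integral>\<^sup>+y. \<phi> x (y + a *\<^sub>R x) \<partial>lborel \<partial>lborel)"
    by (rule nn_integral_swap) measurable
  also have "\<dots> = (\<integral>\<^sup>+x. \<integral>\<^sup>+y. \<phi> x y \<partial>lborel \<partial>lborel)"
    by (intro nn_integral_cong lborel_nn_integral_translate) measurable
  also have "\<dots> = (\<integral>\<^sup>+y. \<integral>\<^sup>+x. \<phi> x y \<partial>lborel \<partial>lborel)"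
    by (rule nn_integral_swap[symmetric]) measurable
  finally show ?thesis .
qed

text \<open>A plane rotation is a product of three shears, each of which preserves the measure by Fubini.\<close>

lemma nn_integral_rotation:
  fixes \<phi> :: "'a::euclidean_space \<Rightarrow> 'a \<Rightarrow> ennreal"
  assumes [measurable]: "(\<lambda>(x, y). \<phi> x y) \<in> borel_measurable (borel \<Otimes>\<^sub>M borel)"
    and t: "0 < t" "t < pi"
  shows "(\<integral>\<^sup>+y. \<integral>\<^sup>+x. \<phi> (cos t *\<^sub>R x + sin t *\<^sub>R y) (cos t *\<^sub>R y - sin t *\<^sub>R x) \<partial>lborel \<partial>lborel)
    = (\<integral>\<^sup>+y. \<integral>\<^sup>+x. \<phi> x y \<partial>lborel \<partial>lborel)"
proof -
  define c s where "c = cos t" and "s = sin t"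
  have s: "0 < s" unfolding s_def using t by (rule sin_gt_zero)
  \<comment> \<open>This is the tangent of \<open>t / 2\<close>, the coefficient of the two outer
    shears; the middle one has coefficient \<open>- s\<close>.\<close>
  define a where "a = (1 - c) / s"
  have cs: "c\<^sup>2 + s\<^sup>2 = 1" by (simp add: c_def s_def)
  have as: "a * s = 1 - c" using s by (simp add: a_def)
  have ac: "a + a * c = s"
  proof -
    have "(a + a * c) * s = (a * s) * (1 + c)" by (simp add: algebra_simps)
    also have "\<dots> = s * s" unfolding as using cs by (simp add: algebra_simps power2_eq_square)
    finally show ?thesis using s by simp
  qed
  have e1: "(y - s *\<^sub>R (x + a *\<^sub>R y)) = c *\<^sub>R y - s *\<^sub>R x" for x y :: 'a
  proof -
    have "y - s *\<^sub>R (x + a *\<^sub>R y) = (1 - a * s) *\<^sub>R y - s *\<^sub>R x" by (simp add: algebra_simps)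
    then show ?thesis by (simp add: as)
  qed
  have e2: "(x + a *\<^sub>R y) + a *\<^sub>R (c *\<^sub>R y - s *\<^sub>R x) = c *\<^sub>R x + s *\<^sub>R y" for x y :: 'a
  proof -
    have "(x + a *\<^sub>R y) + a *\<^sub>R (c *\<^sub>R y - s *\<^sub>R x) = (1 - a * s) *\<^sub>R x + (a + a * c) *\<^sub>R y" by (simp add: algebra_simps)
    then show ?thesis by (simp add: as ac)
  qed
  have "(\<integral>\<^sup>+y. \<integral>\<^sup>+x. \<phi> x y \<partial>lborel \<partial>lborel) = (\<integral>\<^sup>+y. \<integral>\<^sup>+x. \<phi> (x + a *\<^sub>R y) y \<partial>lborel \<partial>lborel)"
    by (rule nn_integral_shear_fst[symmetric]) measurable
  also have "\<dots> = (\<integral>\<^sup>+y. \<integral>\<^sup>+x. \<phi> (x + a *\<^sub>R (y + (- s) *\<^sub>R x)) (y + (- s) *\<^sub>R x) \<partial>lborel \<partial>lborel)"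
    by (rule nn_integral_shear_snd[symmetric, of "\<lambda>x y. \<phi> (x + a *\<^sub>R y) y"]) measurable
  also have "\<dots> = (\<integral>\<^sup>+y. \<integral>\<^sup>+x. \<phi> ((x + a *\<^sub>R y) + a *\<^sub>R (y + (- s) *\<^sub>R (x + a *\<^sub>R y))) (y + (- s) *\<^sub>R (x + a *\<^sub>R y)) \<partial>lborel \<partial>lborel)"
    by (rule nn_integral_shear_fst[symmetric, of "\<lambda>x y. \<phi> (x + a *\<^sub>R (y + (- s) *\<^sub>R x)) (y + (- s) *\<^sub>R x)"]) measurable
  also have "\<dots> = (\<integral>\<^sup>+y. \<integral>\<^sup>+x. \<phi> (c *\<^sub>R x + s *\<^sub>R y) (c *\<^sub>R y - s *\<^sub>R x) \<partial>lborel \<partial>lborel)"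
  proof -
    have "y + (- s) *\<^sub>R (x + a *\<^sub>R y) = c *\<^sub>R y - s *\<^sub>R x" for x y :: 'a using e1[of y x] by simp
    then show ?thesis by (simp only: e2)
  qed
  finally show ?thesis by (simp add: c_def s_def)
qed

section \<open>Second moments of balls, and independence of radius and direction\<close>

lemma lborel_swap_coordinates:
  fixes i j :: "'a::euclidean_space"
  assumes ij: "i \<in> Basis" "j \<in> Basis"
  defines "T \<equiv> \<lambda>x::'a. \<Sum>b\<in>Basis. (x \<bullet> Transposition.transpose i j b) *\<^sub>R b"
  shows "lborel = distr lborel borel T"
proof (rule lborel_eqI)
  let ?p = "Transposition.transpose i j"
  have pB: "?p b \<in> Basis" if "b \<in> Basis" for b using that ij by (auto simp: Transposition.transpose_def)
  have Tm [measurable]: "T \<in> borel_measurable borel" unfolding T_def by measurable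
  have Tb: "T x \<bullet> b = x \<bullet> ?p b" if "b \<in> Basis" for x b
    unfolding T_def using that by (simp add: inner_sum_left inner_Basis if_distrib sum.delta cong: if_cong)
  show "sets (distr lborel borel T) = sets borel" by simp
  fix l u :: 'a assume lu: "\<And>b. b \<in> Basis \<Longrightarrow> l \<bullet> b \<le> u \<bullet> b"
  have vim: "T -` box l u = box (T l) (T u)"
  proof -
    have "(\<forall>b\<in>Basis. l \<bullet> b < x \<bullet> ?p b \<and> x \<bullet> ?p b < u \<bullet> b) \<longleftrightarrow> (\<forall>b\<in>Basis. l \<bullet> ?p b < x \<bullet> b \<and> x \<bullet> b < u \<bullet> ?p b)" for x
    proof safe
      fix b :: 'a assume b: "b \<in> Basis" and *: "\<forall>b\<in>Basis. l \<bullet> b < x \<bullet> ?p b \<and> x \<bullet> ?p b < u \<bullet> b"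
      from *[rule_format, OF pB[OF b]] show "l \<bullet> ?p b < x \<bullet> b" "x \<bullet> b < u \<bullet> ?p b" by auto
    next
      fix b :: 'a assume b: "b \<in> Basis" and *: "\<forall>b\<in>Basis. l \<bullet> ?p b < x \<bullet> b \<and> x \<bullet> b < u \<bullet> ?p b"
      from *[rule_format, OF pB[OF b]] show "l \<bullet> b < x \<bullet> ?p b" "x \<bullet> ?p b < u \<bullet> b" by auto
    qed
    then show ?thesis by (auto simp: mem_box Tb)
  qed
  have "emeasure (distr lborel borel T) (box l u) = emeasure lborel (box (T l) (T u))"
    by (subst emeasure_distr) (auto simp: vim)
  also have "\<dots> = (\<Prod>b\<in>Basis. (T u - T l) \<bullet> b)"
    using lu pB by (intro emeasure_lborel_box) (simp add: Tb)
  also have "(\<Prod>b\<in>Basis. (T u - T l) \<bullet> b) = (\<Prod>b\<in>Basis. (u - l) \<bullet> ?p b)"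
    by (intro prod.cong) (auto simp: Tb inner_diff_left)
  also have "\<dots> = (\<Prod>b\<in>Basis. (u - l) \<bullet> b)"
    by (rule prod.reindex_bij_witness[where i="?p" and j="?p"]) (use pB in auto)
  finally show "emeasure (distr lborel borel T) (box l u) = (\<Prod>b\<in>Basis. (u - l) \<bullet> b)" .
qed

text \<open>Flips and swaps of coordinates are enough symmetry to make the second-moment matrix of a
  ball scalar, so general orthogonal maps are avoided.\<close>

lemma lborel_flip_coordinate:
  fixes i :: "'a::euclidean_space"
  assumes i: "i \<in> Basis"
  defines "T \<equiv> \<lambda>x::'a. x - (2 * (x \<bullet> i)) *\<^sub>R i"
  shows "lborel = distr lborel borel T"
proof -
  define c where "c j = (if j = i then -1 else 1 :: real)" for j
  have T_eq: "T x = 0 + (\<Sum>j\<in>Basis. (c j * (x \<bullet> j)) *\<^sub>R j)" for x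
  proof (rule euclidean_eqI)
    fix b :: 'a assume b: "b \<in> Basis"
    have "(\<Sum>j\<in>Basis. (c j * (x \<bullet> j)) *\<^sub>R j) \<bullet> b = c b * (x \<bullet> b)"
      using b by (simp add: inner_sum_left inner_Basis if_distrib sum.delta cong: if_cong)
    then show "T x \<bullet> b = (0 + (\<Sum>j\<in>Basis. (c j * (x \<bullet> j)) *\<^sub>R j)) \<bullet> b"
      using b i by (auto simp: T_def c_def inner_diff_left inner_Basis)
  qed
  have "(\<Prod>j\<in>Basis. \<bar>c j\<bar>) = 1" by (intro prod.neutral) (auto simp: c_def)
  then show ?thesis
    using lborel_affine_euclidean[of c 0] unfolding T_eq[abs_def] by (simp add: c_def density_1)
qed

text \<open>Flips annihilate the mixed moments and swaps equate the diagonal ones. The factor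
  \<open>1 / DIM('a)\<close> of the whole argument originates here.\<close>

lemma integral_cball_inner_square:
  fixes v :: "'a::euclidean_space"
  shows "(\<integral>y. indicator (cball 0 r) y * (v \<bullet> y)\<^sup>2 \<partial>lborel)
    = (norm v)\<^sup>2 / real DIM('a) * (\<integral>y. indicator (cball (0::'a) r) y * (norm y)\<^sup>2 \<partial>lborel)"
proof -
  define I where "I i j = (\<integral>y. indicator (cball (0::'a) r) y * ((y \<bullet> i) * (y \<bullet> j)) \<partial>lborel)" for i j
  have int: "integrable lborel (\<lambda>y. indicator (cball (0::'a) r) y * ((y \<bullet> i) * (y \<bullet> j)))" for i j
  proof (rule integrable_indicator_cball_mult)
    fix y :: 'a assume y: "norm y \<le> r"
    have r0: "0 \<le> r" using y norm_ge_zero order_trans by blast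
    have "\<bar>y \<bullet> k\<bar> \<le> r * norm k" for k
      using Cauchy_Schwarz_ineq2[of y k] mult_right_mono[OF y norm_ge_zero[of k]] by linarith
    then show "\<bar>(y \<bullet> i) * (y \<bullet> j)\<bar> \<le> r * norm i * (r * norm j)" unfolding abs_mult using r0 by (intro mult_mono) auto
  qed measurable
  have inv: "(\<integral>y. \<phi> y \<partial>lborel) = (\<integral>y. \<phi> (T y) \<partial>lborel)"
    if T: "lborel = distr lborel borel T" and [measurable]: "T \<in> borel_measurable borel" "\<phi> \<in> borel_measurable borel"
    for \<phi> :: "'a \<Rightarrow> real" and T :: "'a \<Rightarrow> 'a"
    by (subst T) (rule integral_distr; measurable)
  have off: "I i j = 0" if "i \<in> Basis" "j \<in> Basis" "i \<noteq> j" for i j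
  proof -
    let ?T = "\<lambda>x::'a. x - (2 * (x \<bullet> i)) *\<^sub>R i"
    have "norm (?T y) = norm y" for y
    proof -
      have "(norm (?T y))\<^sup>2 = (norm y)\<^sup>2"
        unfolding power2_norm_eq_inner using that by (simp add: inner_diff inner_commute algebra_simps)
      then show ?thesis by simp
    qed
    moreover have "?T y \<bullet> i = - (y \<bullet> i)" "?T y \<bullet> j = y \<bullet> j" for y
      using that by (auto simp: inner_diff_left inner_Basis)
    ultimately have "I i j = (\<integral>y. indicator (cball (0::'a) r) y * (- (y \<bullet> i) * (y \<bullet> j)) \<partial>lborel)"
      unfolding I_def by (subst inv[OF lborel_flip_coordinate[OF that(1)]]) (auto simp: indicator_def)
    also have "\<dots> = - I i j" unfolding I_def by simp
    finally show ?thesis by simp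
  qed
  have diag: "I i i = I j j" if "i \<in> Basis" "j \<in> Basis" for i j
  proof -
    let ?p = "Transposition.transpose i j"
    let ?T = "\<lambda>x::'a. \<Sum>b\<in>Basis. (x \<bullet> ?p b) *\<^sub>R b"
    have pB: "?p b \<in> Basis" if "b \<in> Basis" for b using that \<open>i \<in> Basis\<close> \<open>j \<in> Basis\<close> by (auto simp: Transposition.transpose_def)
    have Tb: "?T x \<bullet> b = x \<bullet> ?p b" if "b \<in> Basis" for x b
      using that by (simp add: inner_sum_left inner_Basis if_distrib sum.delta cong: if_cong)
    have nT: "norm (?T y) = norm y" for y
    proof -
      have "?T y \<bullet> ?T y = (\<Sum>b\<in>Basis. (y \<bullet> ?p b) * (y \<bullet> ?p b))"
        by (subst euclidean_inner) (simp add: Tb)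
      also have "\<dots> = (\<Sum>b\<in>Basis. (y \<bullet> b) * (y \<bullet> b))"
        by (rule sum.reindex_bij_witness[where i="?p" and j="?p"]) (use pB in auto)
      also have "\<dots> = y \<bullet> y" by (subst euclidean_inner) simp
      finally show ?thesis by (simp add: norm_eq_sqrt_inner)
    qed
    have pi: "?p i = j" by simp
    have "I i i = (\<integral>y. indicator (cball (0::'a) r) (?T y) * ((?T y \<bullet> i) * (?T y \<bullet> i)) \<partial>lborel)"
      unfolding I_def by (rule inv[OF lborel_swap_coordinates[OF that]]) measurable
    also have "\<dots> = I j j"
      unfolding I_def Tb[OF that(1)] pi by (intro Bochner_Integration.integral_cong refl) (simp only: indicator_def mem_cball_0 nT)
    finally show ?thesis .
  qed
  obtain k :: 'a where k: "k \<in> Basis" using nonempty_Basis by blast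
  have norm2: "(\<integral>y. indicator (cball (0::'a) r) y * (norm y)\<^sup>2 \<partial>lborel) = real DIM('a) * I k k"
  proof -
    have "(\<integral>y. indicator (cball (0::'a) r) y * (norm y)\<^sup>2 \<partial>lborel) = (\<integral>y. (\<Sum>i\<in>Basis. indicator (cball (0::'a) r) y * ((y \<bullet> i) * (y \<bullet> i))) \<partial>lborel)"
    proof (intro Bochner_Integration.integral_cong refl)
      fix y :: 'a
      have "(norm y)\<^sup>2 = (\<Sum>i\<in>Basis. (y \<bullet> i) * (y \<bullet> i))"
        unfolding power2_norm_eq_inner by (rule euclidean_inner)
      then show "indicator (cball (0::'a) r) y * (norm y)\<^sup>2 = (\<Sum>i\<in>Basis. indicator (cball (0::'a) r) y * ((y \<bullet> i) * (y \<bullet> i)))"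
        by (simp only: sum_distrib_left)
    qed
    also have "\<dots> = (\<Sum>i\<in>Basis. I i i)" unfolding I_def by (rule Bochner_Integration.integral_sum) (rule int)
    also have "\<dots> = (\<Sum>i\<in>(Basis::'a set). I k k)" by (intro sum.cong refl diag k)
    finally show ?thesis by simp
  qed
  have "(\<integral>y. indicator (cball 0 r) y * (v \<bullet> y)\<^sup>2 \<partial>lborel)
      = (\<integral>y. (\<Sum>i\<in>Basis. \<Sum>j\<in>Basis. ((v \<bullet> i) * (v \<bullet> j)) * (indicator (cball (0::'a) r) y * ((y \<bullet> i) * (y \<bullet> j)))) \<partial>lborel)"
  proof (intro Bochner_Integration.integral_cong refl)
    fix y :: 'a
    have "(v \<bullet> y)\<^sup>2 = (\<Sum>b\<in>Basis. (v \<bullet> b) * (y \<bullet> b))\<^sup>2" by (subst euclidean_inner) (rule refl)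
    also have "\<dots> = (\<Sum>i\<in>Basis. \<Sum>j\<in>Basis. ((v \<bullet> i) * (v \<bullet> j)) * ((y \<bullet> i) * (y \<bullet> j)))"
      unfolding power2_eq_square sum_product by (intro sum.cong refl) (simp only: mult_ac)
    finally show "indicator (cball 0 r) y * (v \<bullet> y)\<^sup>2 = (\<Sum>i\<in>Basis. \<Sum>j\<in>Basis. ((v \<bullet> i) * (v \<bullet> j)) * (indicator (cball (0::'a) r) y * ((y \<bullet> i) * (y \<bullet> j))))"
      by (simp only: sum_distrib_left mult.left_commute[of "indicator (cball 0 r) y"])
  qed
  also have "\<dots> = (\<Sum>i\<in>Basis. \<Sum>j\<in>Basis. ((v \<bullet> i) * (v \<bullet> j)) * I i j)"
    unfolding I_def using int by (simp add: Bochner_Integration.integral_sum)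
  also have "\<dots> = (\<Sum>i\<in>Basis. \<Sum>j\<in>Basis. if j = i then (v \<bullet> i)\<^sup>2 * I k k else 0)"
    using off diag[OF _ k] by (intro sum.cong refl) (auto simp: power2_eq_square)
  also have "\<dots> = (\<Sum>i\<in>Basis. (v \<bullet> i)\<^sup>2) * I k k" by (simp add: sum.delta sum_distrib_right)
  also have "\<dots> = (norm v)\<^sup>2 * I k k"
    unfolding power2_norm_eq_inner euclidean_inner[of v v] by (simp only: power2_eq_square)
  also have "\<dots> = (norm v)\<^sup>2 / real DIM('a) * (real DIM('a) * I k k)" by simp
  finally show ?thesis unfolding norm2 .
qed


text \<open>On a shell with inner radius \<open>t\<close>, averaging a function of the direction is
  a difference of two instances of \<open>integral_cball_radial\<close>. The weight
  \<open>(norm x)\<^sup>2\<close> is a superposition of the indicators of \<open>t < norm x\<close>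
  with density \<open>2 * t\<close>, so the same spherical mean factors out for every
  weight.\<close>

lemma nn_integral_cball_radial:
  fixes \<phi> :: "'a::euclidean_space \<Rightarrow> real"
  assumes [measurable]: "\<phi> \<in> borel_measurable borel" and \<phi>: "\<And>x. 0 \<le> \<phi> x" "\<And>x. norm x \<le> 1 \<Longrightarrow> \<phi> x \<le> B"
  shows "(\<integral>\<^sup>+x. indicator (cball 0 r) x * ennreal ((norm x)\<^sup>2 * \<phi> (x /\<^sub>R norm x)) \<partial>lborel)
    = (\<integral>\<^sup>+x. indicator (cball (0::'a) r) x * ennreal ((norm x)\<^sup>2) \<partial>lborel) * ennreal (\<integral>w. \<phi> w \<partial>unif_sphere)"
proof -
  interpret S: prob_space "unif_sphere :: 'a measure" by (rule prob_space_unif_sphere)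
  let ?V = "ball_vol TYPE('a)"
  define sh where "sh t x = (if norm x \<le> r \<and> t < norm x then 1 else 0 :: real)" for t and x :: 'a
  have [measurable]: "(\<lambda>(t, x). sh t x) \<in> borel_measurable (borel \<Otimes>\<^sub>M borel)" unfolding sh_def by measurable
  have [measurable]: "sh t \<in> borel_measurable borel" for t unfolding sh_def by measurable
  have sh0: "0 \<le> sh t x" for t x by (simp add: sh_def)
  have B: "0 \<le> B" using \<phi>[of 0] by simp
  have \<phi>': "\<phi> (x /\<^sub>R norm x) \<le> B" for x using \<phi>(2)[of "x /\<^sub>R norm x"] by (cases "x = 0") auto
  have E0: "0 \<le> (\<integral>w. \<phi> w \<partial>unif_sphere)" by (intro Bochner_Integration.integral_nonneg) (use \<phi> in auto)
  have shell: "(\<integral>\<^sup>+x. ennreal (sh t x * \<psi> (x /\<^sub>R norm x)) \<partial>lborel)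
      = ennreal ((r ^ DIM('a) - t ^ DIM('a)) * ?V * (\<integral>w. \<psi> w \<partial>unif_sphere))"
    if t: "0 < t" "t < r" and [measurable]: "\<psi> \<in> borel_measurable borel" and \<psi>: "\<And>x. 0 \<le> \<psi> x" "\<And>x. \<psi> (x /\<^sub>R norm x) \<le> B'"
    for t B' and \<psi> :: "'a \<Rightarrow> real"
  proof -
    have B': "0 \<le> B'" using \<psi>(1) \<psi>(2)[of 0] order_trans by blast
    have ind: "sh t z = indicator (cball 0 r) z - indicator (cball 0 t) z" for z
      using t by (auto simp: indicator_def sh_def)
    have i: "integrable lborel (\<lambda>x. indicat_real (cball 0 s) x * \<psi> (x /\<^sub>R norm x))" for s :: real
      by (rule integrable_indicator_cball_mult[of _ _ B']) (use \<psi> in auto)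
    have i': "integrable lborel (\<lambda>x. sh t x * \<psi> (x /\<^sub>R norm x))"
      unfolding ind left_diff_distrib by (rule Bochner_Integration.integrable_diff[OF i i])
    have "(\<integral>\<^sup>+x. ennreal (sh t x * \<psi> (x /\<^sub>R norm x)) \<partial>lborel) = ennreal (\<integral>x. sh t x * \<psi> (x /\<^sub>R norm x) \<partial>lborel)"
      using i' \<psi> sh0 by (intro nn_integral_eq_integral) auto
    also have "(\<integral>x. sh t x * \<psi> (x /\<^sub>R norm x) \<partial>lborel)
       = (\<integral>x. indicat_real (cball 0 r) x * \<psi> (x /\<^sub>R norm x) \<partial>lborel) - (\<integral>x. indicat_real (cball 0 t) x * \<psi> (x /\<^sub>R norm x) \<partial>lborel)"
      unfolding ind left_diff_distrib by (rule Bochner_Integration.integral_diff[OF i i])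
    also have "\<dots> = (r ^ DIM('a) - t ^ DIM('a)) * ?V * (\<integral>w. \<psi> w \<partial>unif_sphere)"
      using integral_cball_radial[of \<psi> r] integral_cball_radial[of \<psi> t] t by (simp add: algebra_simps)
    finally show ?thesis .
  qed
  have shell': "(\<integral>\<^sup>+x. ennreal (sh t x * \<phi> (x /\<^sub>R norm x)) \<partial>lborel)
      = (\<integral>\<^sup>+x. ennreal (sh t x * 1) \<partial>lborel) * ennreal (\<integral>w. \<phi> w \<partial>unif_sphere)" if t: "0 < t" for t
  proof (cases "t < r")
    case True
    have "t ^ DIM('a) \<le> r ^ DIM('a)" using t True by (intro power_mono) auto
    then have c: "0 \<le> (r ^ DIM('a) - t ^ DIM('a)) * ?V" by simp
    have "(\<integral>\<^sup>+x. ennreal (sh t x * 1) \<partial>lborel) = ennreal ((r ^ DIM('a) - t ^ DIM('a)) * ?V * (\<integral>(w::'a). 1 \<partial>unif_sphere))"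
      by (rule shell[OF t True, of "\<lambda>_. 1" 1]) auto
    also have "(\<integral>(w::'a). 1 \<partial>unif_sphere) = (1::real)" using S.prob_space by simp
    finally have "(\<integral>\<^sup>+x. ennreal (sh t x * 1) \<partial>lborel) = ennreal ((r ^ DIM('a) - t ^ DIM('a)) * ?V)" by simp
    moreover have "(\<integral>\<^sup>+x. ennreal (sh t x * \<phi> (x /\<^sub>R norm x)) \<partial>lborel) = ennreal ((r ^ DIM('a) - t ^ DIM('a)) * ?V * (\<integral>w. \<phi> w \<partial>unif_sphere))"
      by (rule shell[OF t True, of \<phi> B]) (use \<phi> \<phi>' in auto)
    ultimately show ?thesis using ennreal_mult[OF c E0] by (simp only:)
  next
    case False
    then have "sh t x = 0" for x by (simp add: sh_def)
    then show ?thesis by simp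
  qed
  \<comment> \<open>Layer-cake decomposition of the factor \<open>(norm x)\<^sup>2\<close>.\<close>
  have layer: "(\<integral>\<^sup>+x. indicator (cball 0 r) x * ennreal ((norm x)\<^sup>2 * \<psi> x) \<partial>lborel)
     = (\<integral>\<^sup>+t. indicator {0<..} t * (2 * ennreal t * (\<integral>\<^sup>+x. ennreal (sh t x * \<psi> x) \<partial>lborel)) \<partial>lborel)"
    if [measurable]: "\<psi> \<in> borel_measurable borel" and \<psi>: "\<And>x. 0 \<le> \<psi> x" for \<psi> :: "'a \<Rightarrow> real"
  proof -
    define k where "k a t = indicator {0<..} t * (2 * ennreal t * (if t < a then 1 else 0))" for a t :: real
    have [measurable]: "(\<lambda>(a, t). k a t) \<in> borel_measurable (borel \<Otimes>\<^sub>M borel)" unfolding k_def by measurable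
    have [measurable]: "k a \<in> borel_measurable borel" for a unfolding k_def by measurable
    have sq: "(\<integral>\<^sup>+t. k a t \<partial>lborel) = ennreal (a\<^sup>2)" if "0 \<le> a" for a :: real
    proof -
      have "(\<integral>\<^sup>+t. k a t \<partial>lborel) = (\<integral>\<^sup>+t. ennreal (2 * t) * indicator {0..a} t \<partial>lborel)"
      proof (rule nn_integral_cong_AE)
        have "AE t in lborel. t \<noteq> (0::real)" "AE t in lborel. t \<noteq> a" by (rule AE_lborel_singleton)+
        then show "AE t in lborel. k a t = ennreal (2 * t) * indicator {0..a} t"
          by eventually_elim (auto simp: k_def indicator_def ennreal_mult'')
      qed
      also have "\<dots> = ennreal (a\<^sup>2 - 0\<^sup>2)"
        by (rule nn_integral_FTC_Icc) (use that in \<open>auto intro!: derivative_eq_intros\<close>)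
      finally show ?thesis by simp
    qed
    have "(\<integral>\<^sup>+x. indicator (cball 0 r) x * ennreal ((norm x)\<^sup>2 * \<psi> x) \<partial>lborel)
       = (\<integral>\<^sup>+x. (\<integral>\<^sup>+t. k (norm x) t * (indicator (cball 0 r) x * ennreal (\<psi> x)) \<partial>lborel) \<partial>lborel)"
    proof (intro nn_integral_cong)
      fix x :: 'a
      have "(\<integral>\<^sup>+t. k (norm x) t * (indicator (cball 0 r) x * ennreal (\<psi> x)) \<partial>lborel)
         = (\<integral>\<^sup>+t. k (norm x) t \<partial>lborel) * (indicator (cball 0 r) x * ennreal (\<psi> x))"
        by (rule nn_integral_multc) measurable
      also have "\<dots> = ennreal ((norm x)\<^sup>2) * (indicator (cball 0 r) x * ennreal (\<psi> x))" by (simp add: sq)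
      also have "\<dots> = indicator (cball 0 r) x * ennreal ((norm x)\<^sup>2 * \<psi> x)" using \<psi> by (simp add: ennreal_mult mult_ac)
      finally show "indicator (cball 0 r) x * ennreal ((norm x)\<^sup>2 * \<psi> x) = (\<integral>\<^sup>+t. k (norm x) t * (indicator (cball 0 r) x * ennreal (\<psi> x)) \<partial>lborel)" ..
    qed
    also have "\<dots> = (\<integral>\<^sup>+t. (\<integral>\<^sup>+x. k (norm x) t * (indicator (cball 0 r) x * ennreal (\<psi> x)) \<partial>lborel) \<partial>lborel)"
      by (rule lborel_pair.Fubini'[symmetric]) measurable
    also have "\<dots> = (\<integral>\<^sup>+t. (\<integral>\<^sup>+x. (indicator {0<..} t * (2 * ennreal t)) * ennreal (sh t x * \<psi> x) \<partial>lborel) \<partial>lborel)"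
      by (intro nn_integral_cong) (auto simp: indicator_def k_def sh_def)
    also have "\<dots> = (\<integral>\<^sup>+t. indicator {0<..} t * (2 * ennreal t * (\<integral>\<^sup>+x. ennreal (sh t x * \<psi> x) \<partial>lborel)) \<partial>lborel)"
      by (intro nn_integral_cong) (subst nn_integral_cmult, auto simp: mult.assoc)
    finally show ?thesis .
  qed
  have "(\<integral>\<^sup>+x. indicator (cball 0 r) x * ennreal ((norm x)\<^sup>2 * \<phi> (x /\<^sub>R norm x)) \<partial>lborel)
    = (\<integral>\<^sup>+t. indicator {0<..} t * (2 * ennreal t * (\<integral>\<^sup>+x. ennreal (sh t x * \<phi> (x /\<^sub>R norm x)) \<partial>lborel)) \<partial>lborel)"
    by (rule layer) (use \<phi> in auto)
  also have "\<dots> = (\<integral>\<^sup>+t. (indicator {0<..} t * (2 * ennreal t * (\<integral>\<^sup>+x. ennreal (sh t x * 1) \<partial>lborel))) * ennreal (\<integral>w. \<phi> w \<partial>unif_sphere) \<partial>lborel)"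
    by (intro nn_integral_cong) (simp add: indicator_def shell' mult.assoc del: mult_1_right)
  also have "\<dots> = (\<integral>\<^sup>+t. indicator {0<..} t * (2 * ennreal t * (\<integral>\<^sup>+x. ennreal (sh t x * 1) \<partial>lborel)) \<partial>lborel) * ennreal (\<integral>w. \<phi> w \<partial>unif_sphere)"
    by (rule nn_integral_multc) measurable
  also have "(\<integral>\<^sup>+t. indicator {0<..} t * (2 * ennreal t * (\<integral>\<^sup>+x. ennreal (sh t x * 1) \<partial>lborel)) \<partial>lborel)
     = (\<integral>\<^sup>+x. indicator (cball (0::'a) r) x * ennreal ((norm x)\<^sup>2 * 1) \<partial>lborel)"
    by (rule layer[symmetric]) auto
  finally show ?thesis by simp
qed

text \<open>Along the path \<open>cos t x + sin t y\<close> from \<open>x\<close> to \<open>- x\<close> (Maurey and Pisier), position and velocity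
  are a rotation of the pair \<open>(x, y)\<close>. Under a rotation invariant law only a directional derivative in
  a symmetrically distributed direction \<open>y\<close> remains, which gains the factor \<open>1/d\<close>.\<close>

lemma antipodal_square_le:
  fixes H :: "'a::euclidean_space \<Rightarrow> real"
  assumes H: "\<And>x. GDERIV H x :> G x" and G: "continuous_on UNIV G"
  shows "ennreal ((H (- x) - H x)\<^sup>2)
    \<le> ennreal pi * (\<integral>\<^sup>+t. indicator {0..pi} t * ennreal ((G (cos t *\<^sub>R x + sin t *\<^sub>R y) \<bullet> (cos t *\<^sub>R y - sin t *\<^sub>R x))\<^sup>2) \<partial>lborel)"
proof -
  define k where "k t = G (cos t *\<^sub>R x + sin t *\<^sub>R y) \<bullet> (cos t *\<^sub>R y - sin t *\<^sub>R x)" for t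
  have k: "continuous_on S k" for S
    unfolding k_def by (intro continuous_intros continuous_on_compose2[OF G]) auto
  have der: "((\<lambda>t. H (cos t *\<^sub>R x + sin t *\<^sub>R y)) has_vector_derivative k t) (at t within {0..pi})" for t
  proof -
    have "((\<lambda>t. cos t *\<^sub>R x + sin t *\<^sub>R y) has_derivative (\<lambda>h. h *\<^sub>R (cos t *\<^sub>R y - sin t *\<^sub>R x))) (at t within {0..pi})"
      by (auto intro!: derivative_eq_intros simp: algebra_simps)
    from has_derivative_compose[OF this, of H] H[unfolded gderiv_def]
    have "((\<lambda>t. H (cos t *\<^sub>R x + sin t *\<^sub>R y)) has_derivative (\<lambda>h. (h *\<^sub>R (cos t *\<^sub>R y - sin t *\<^sub>R x)) \<bullet> G (cos t *\<^sub>R x + sin t *\<^sub>R y))) (at t within {0..pi})"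
      by blast
    then show ?thesis unfolding has_vector_derivative_def k_def by (simp add: inner_commute)
  qed
  have ints: "set_integrable lborel {0..pi} g" if "continuous_on {0..pi} g" for g :: "real \<Rightarrow> real"
    using that by (rule borel_integrable_atLeastAtMost')
  have i1: "integrable lborel (\<lambda>t. indicator {0..pi} t * k t)" and i2: "integrable lborel (\<lambda>t. indicator {0..pi} t * (k t)\<^sup>2)"
    using ints[OF k] ints[of "\<lambda>t. (k t)\<^sup>2"] k by (auto simp: set_integrable_def intro!: continuous_intros)
  define I where "I = (\<integral>t. indicator {0..pi} t * k t \<partial>lborel)"
  have I: "I = H (- x) - H x"
    using integral_FTC_atLeastAtMost[of 0 pi "\<lambda>t. H (cos t *\<^sub>R x + sin t *\<^sub>R y)" k, OF _ der k] by (simp add: I_def)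
  have c: "integrable lborel (\<lambda>t::real. indicator {0..pi} t * (c::real))" "(\<integral>t. indicator {0..pi} (t::real) * c \<partial>lborel) = pi * c" for c
    by (auto simp: content_real intro!: integrable_mult_left)
  define m where "m = I / pi"
  \<comment> \<open>Cauchy-Schwarz on an interval of length \<open>pi\<close>, in the guise of a
    nonnegative variance about the mean \<open>m\<close>.\<close>
  have "0 \<le> (\<integral>t. indicator {0..pi} t * (k t - m)\<^sup>2 \<partial>lborel)" by (intro Bochner_Integration.integral_nonneg) auto
  also have "\<dots> = (\<integral>t. indicator {0..pi} t * (k t)\<^sup>2 - (2 * m) * (indicator {0..pi} t * k t) + indicator {0..pi} t * m\<^sup>2 \<partial>lborel)"
    by (intro Bochner_Integration.integral_cong refl) (simp add: power2_eq_square algebra_simps)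
  also have "\<dots> = (\<integral>t. indicator {0..pi} t * (k t)\<^sup>2 \<partial>lborel) - (2 * m) * I + pi * m\<^sup>2"
    using i1 i2 c by (simp add: I_def)
  finally have "I\<^sup>2 \<le> pi * (\<integral>t. indicator {0..pi} t * (k t)\<^sup>2 \<partial>lborel)"
    unfolding m_def using pi_gt_zero by (simp add: field_simps power2_eq_square)
  then have "ennreal (I\<^sup>2) \<le> ennreal (pi * (\<integral>t. indicator {0..pi} t * (k t)\<^sup>2 \<partial>lborel))" by (rule ennreal_leI)
  also have "\<dots> = ennreal pi * ennreal (\<integral>t. indicator {0..pi} t * (k t)\<^sup>2 \<partial>lborel)"
    by (intro ennreal_mult Bochner_Integration.integral_nonneg) auto
  also have "ennreal (\<integral>t. indicator {0..pi} t * (k t)\<^sup>2 \<partial>lborel) = (\<integral>\<^sup>+t. ennreal (indicator {0..pi} t * (k t)\<^sup>2) \<partial>lborel)"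
    using i2 by (intro nn_integral_eq_integral[symmetric]) auto
  also have "\<dots> = (\<integral>\<^sup>+t. indicator {0..pi} t * ennreal ((k t)\<^sup>2) \<partial>lborel)"
    by (intro nn_integral_cong) (auto simp: indicator_def)
  finally show ?thesis by (simp add: I k_def)
qed


section \<open>Rotations of the ball in the doubled space\<close>

lemma nn_integral_cball_inner_square:
  fixes v :: "'a::euclidean_space"
  shows "(\<integral>\<^sup>+y. indicator (cball 0 r) y * ennreal ((v \<bullet> y)\<^sup>2) \<partial>lborel)
    = ennreal ((norm v)\<^sup>2 / real DIM('a)) * (\<integral>\<^sup>+y. indicator (cball (0::'a) r) y * ennreal ((norm y)\<^sup>2) \<partial>lborel)"
proof -
  have nn: "(\<integral>\<^sup>+y. indicator (cball 0 r) y * ennreal (g y) \<partial>lborel) = ennreal (\<integral>y. indicator (cball 0 r) y * g y \<partial>lborel)"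
    if [measurable]: "g \<in> borel_measurable borel" and g: "\<And>y. 0 \<le> g y" "\<And>y. norm y \<le> r \<Longrightarrow> g y \<le> B" for g :: "'a \<Rightarrow> real" and B
  proof -
    have "integrable lborel (\<lambda>y. indicator (cball 0 r) y * g y)"
      by (rule integrable_indicator_cball_mult[of _ _ B]) (use g in auto)
    then have "(\<integral>\<^sup>+y. ennreal (indicator (cball 0 r) y * g y) \<partial>lborel) = ennreal (\<integral>y. indicator (cball 0 r) y * g y \<partial>lborel)"
      using g by (intro nn_integral_eq_integral) auto
    moreover have "(\<integral>\<^sup>+y. indicator (cball 0 r) y * ennreal (g y) \<partial>lborel) = (\<integral>\<^sup>+y. ennreal (indicator (cball 0 r) y * g y) \<partial>lborel)"
      by (intro nn_integral_cong) (simp add: indicator_def)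
    ultimately show ?thesis by simp
  qed
  have "(v \<bullet> y)\<^sup>2 \<le> (norm v * r)\<^sup>2" if "norm y \<le> r" for y
  proof -
    have "\<bar>v \<bullet> y\<bar> \<le> norm v * r"
      using Cauchy_Schwarz_ineq2[of v y] mult_left_mono[OF that norm_ge_zero[of v]] by linarith
    then show ?thesis using abs_le_square_iff[of "v \<bullet> y" "norm v * r"] by simp
  qed
  then have 1: "(\<integral>\<^sup>+y. indicator (cball 0 r) y * ennreal ((v \<bullet> y)\<^sup>2) \<partial>lborel) = ennreal (\<integral>y. indicator (cball 0 r) y * (v \<bullet> y)\<^sup>2 \<partial>lborel)"
    by (intro nn[of _ "(norm v * r)\<^sup>2"]) auto
  have 2: "(\<integral>\<^sup>+y. indicator (cball (0::'a) r) y * ennreal ((norm y)\<^sup>2) \<partial>lborel) = ennreal (\<integral>y. indicator (cball (0::'a) r) y * (norm y)\<^sup>2 \<partial>lborel)"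
    by (intro nn[of _ "r\<^sup>2"]) (auto intro: power_mono)
  show ?thesis
    unfolding 1 2 integral_cball_inner_square by (intro ennreal_mult Bochner_Integration.integral_nonneg) auto
qed

text \<open>The indicator of the unit ball of the doubled space, with two separate arguments so that
  a shear can translate one while the other is fixed.\<close>

definition pair_ball :: "'a::euclidean_space \<Rightarrow> 'a \<Rightarrow> ennreal" where
  "pair_ball x y = (if (norm x)\<^sup>2 + (norm y)\<^sup>2 \<le> 1 then 1 else 0)"

lemma borel_measurable_pair_ball [measurable]:
  "(\<lambda>(x, y). pair_ball x y) \<in> borel_measurable (borel \<Otimes>\<^sub>M borel)"
  "pair_ball x \<in> borel_measurable borel"
  unfolding pair_ball_def by measurable

lemma pair_ball_commute: "pair_ball x y = pair_ball y x"
  by (simp add: pair_ball_def add.commute)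

lemma pair_ball_section: "\<exists>r. \<forall>y. pair_ball x y = indicator (cball 0 r) y"
proof (cases "norm x \<le> 1")
  case True
  then have "0 \<le> 1 - (norm x)\<^sup>2" by (simp add: power_le_one)
  then have "(norm x)\<^sup>2 + (norm y)\<^sup>2 \<le> 1 \<longleftrightarrow> norm y \<le> sqrt (1 - (norm x)\<^sup>2)" for y
    using real_le_rsqrt[of "norm y" "1 - (norm x)\<^sup>2"] real_sqrt_le_iff[of "(norm y)\<^sup>2" "1 - (norm x)\<^sup>2"] by auto
  then show ?thesis by (intro exI[of _ "sqrt (1 - (norm x)\<^sup>2)"]) (auto simp: pair_ball_def indicator_def)
next
  case False
  then have "1 < (norm x)\<^sup>2" by (simp add: one_less_power)
  then have "\<not> (norm x)\<^sup>2 + (norm y)\<^sup>2 \<le> 1" for y using zero_le_power2[of "norm y"] by linarith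
  \<comment> \<open>Beyond the unit ball the section is empty, and so is a ball of negative
    radius.\<close>
  then show ?thesis by (intro exI[of _ "-1"]) (auto simp: pair_ball_def indicator_def not_le intro: less_le_trans)
qed

text \<open>A normalising factor that appears on both sides of the variance estimate and cancels; it
  only has to be positive and finite, its value is never computed.\<close>

definition pair_moment :: "'a::euclidean_space itself \<Rightarrow> ennreal" where
  "pair_moment _ = (\<integral>\<^sup>+(y::'a). \<integral>\<^sup>+x. pair_ball x y * ennreal ((norm x)\<^sup>2) \<partial>lborel \<partial>lborel)"

text \<open>The endpoints of the path do not depend on \<open>y\<close>, so the path bound may be
  averaged over \<open>y\<close>. Once the rotation at time \<open>t\<close> is undone,
  \<open>y\<close> ranges over a centred ball for each fixed \<open>x\<close>, and the second
  moments of that ball apply.\<close>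

lemma pair_ball_antipodal_le:
  fixes H :: "'a::euclidean_space \<Rightarrow> real"
  assumes H: "\<And>x. GDERIV H x :> G x" and G: "continuous_on UNIV G" and l: "\<And>x. norm (G x) \<le> l"
  shows "(\<integral>\<^sup>+y. \<integral>\<^sup>+x. pair_ball x y * ennreal ((H (- x) - H x)\<^sup>2) \<partial>lborel \<partial>lborel)
    \<le> ennreal (pi\<^sup>2 * l\<^sup>2 / real DIM('a)) * pair_moment TYPE('a)"
proof -
  have [measurable]: "G \<in> borel_measurable borel" using G by (rule borel_measurable_continuous_onI)
  define \<psi> where "\<psi> a b = pair_ball a b * ennreal ((G a \<bullet> b)\<^sup>2)" for a b
  have [measurable]: "(\<lambda>(x, y). \<psi> x y) \<in> borel_measurable (borel \<Otimes>\<^sub>M borel)" unfolding \<psi>_def by measurable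
  define X where "X t x y = cos t *\<^sub>R x + sin t *\<^sub>R y" for t and x y :: 'a
  define Y where "Y t x y = cos t *\<^sub>R y - sin t *\<^sub>R x" for t and x y :: 'a
  have rot: "pair_ball (X t x y) (Y t x y) = pair_ball x y" for t x y
  proof -
    define c s where "c = cos t" and "s = sin t"
    have cs: "c\<^sup>2 + s\<^sup>2 = 1" by (simp add: c_def s_def)
    have "(norm (X t x y))\<^sup>2 + (norm (Y t x y))\<^sup>2 = (c\<^sup>2 + s\<^sup>2) * ((norm x)\<^sup>2 + (norm y)\<^sup>2)"
      unfolding X_def Y_def power2_norm_eq_inner c_def[symmetric] s_def[symmetric]
      by (simp add: inner_add inner_diff inner_commute algebra_simps power2_eq_square)
    then show ?thesis by (simp add: pair_ball_def cs)
  qed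
  define Q where "Q = (\<integral>\<^sup>+y. \<integral>\<^sup>+x. \<psi> x y \<partial>lborel \<partial>lborel)"
  have "(\<integral>\<^sup>+y. \<integral>\<^sup>+x. pair_ball x y * ennreal ((H (- x) - H x)\<^sup>2) \<partial>lborel \<partial>lborel)
    \<le> (\<integral>\<^sup>+y. \<integral>\<^sup>+x. \<integral>\<^sup>+t. ennreal pi * (indicator {0..pi} t * \<psi> (X t x y) (Y t x y)) \<partial>lborel \<partial>lborel \<partial>lborel)"
  proof (intro nn_integral_mono)
    fix x y
    have "pair_ball x y * ennreal ((H (- x) - H x)\<^sup>2) \<le> pair_ball x y * (ennreal pi * (\<integral>\<^sup>+t. indicator {0..pi} t * ennreal ((G (X t x y) \<bullet> Y t x y)\<^sup>2) \<partial>lborel))"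
      unfolding X_def Y_def by (intro mult_left_mono antipodal_square_le[OF H G]) auto
    also have "\<dots> = (\<integral>\<^sup>+t. (pair_ball x y * ennreal pi) * (indicator {0..pi} t * ennreal ((G (X t x y) \<bullet> Y t x y)\<^sup>2)) \<partial>lborel)"
      unfolding mult.assoc[symmetric, of "pair_ball x y"] X_def Y_def by (rule nn_integral_cmult[symmetric]) measurable
    also have "\<dots> = (\<integral>\<^sup>+t. ennreal pi * (indicator {0..pi} t * \<psi> (X t x y) (Y t x y)) \<partial>lborel)"
      unfolding \<psi>_def rot by (intro nn_integral_cong) (simp only: mult_ac)
    finally show "pair_ball x y * ennreal ((H (- x) - H x)\<^sup>2) \<le> (\<integral>\<^sup>+t. ennreal pi * (indicator {0..pi} t * \<psi> (X t x y) (Y t x y)) \<partial>lborel)" .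
  qed
  also have "\<dots> = (\<integral>\<^sup>+y. \<integral>\<^sup>+t. \<integral>\<^sup>+x. ennreal pi * (indicator {0..pi} t * \<psi> (X t x y) (Y t x y)) \<partial>lborel \<partial>lborel \<partial>lborel)"
    unfolding X_def Y_def by (intro nn_integral_cong lborel_pair.Fubini') measurable
  also have "\<dots> = (\<integral>\<^sup>+t. \<integral>\<^sup>+y. \<integral>\<^sup>+x. ennreal pi * (indicator {0..pi} t * \<psi> (X t x y) (Y t x y)) \<partial>lborel \<partial>lborel \<partial>lborel)"
    unfolding X_def Y_def by (intro lborel_pair.Fubini') measurable
  also have "\<dots> = (\<integral>\<^sup>+t. (ennreal pi * Q) * indicator {0..pi} t \<partial>lborel)"
  proof (rule nn_integral_cong_AE)
    \<comment> \<open>The shear decomposition needs \<open>sin t > 0\<close>, which fails at the two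
      endpoints.\<close>
    have "AE t in lborel. t \<noteq> (0::real)" "AE t in lborel. t \<noteq> pi" by (rule AE_lborel_singleton)+
    then show "AE t in lborel. (\<integral>\<^sup>+y. \<integral>\<^sup>+x. ennreal pi * (indicator {0..pi} t * \<psi> (X t x y) (Y t x y)) \<partial>lborel \<partial>lborel) = (ennreal pi * Q) * indicator {0..pi} t"
    proof eventually_elim
      fix t :: real assume t: "t \<noteq> 0" "t \<noteq> pi"
      show "(\<integral>\<^sup>+y. \<integral>\<^sup>+x. ennreal pi * (indicator {0..pi} t * \<psi> (X t x y) (Y t x y)) \<partial>lborel \<partial>lborel) = (ennreal pi * Q) * indicator {0..pi} t"
      proof (cases "t \<in> {0..pi}")
        case True
        then have t': "0 < t" "t < pi" using t by auto
        have [measurable]: "(\<lambda>(x, y). \<psi> (X t x y) (Y t x y)) \<in> borel_measurable (borel \<Otimes>\<^sub>M borel)"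
          unfolding X_def Y_def by measurable
        have "(\<integral>\<^sup>+y. \<integral>\<^sup>+x. ennreal pi * \<psi> (X t x y) (Y t x y) \<partial>lborel \<partial>lborel)
          = (\<integral>\<^sup>+y. ennreal pi * (\<integral>\<^sup>+x. \<psi> (X t x y) (Y t x y) \<partial>lborel) \<partial>lborel)"
          by (intro nn_integral_cong nn_integral_cmult) measurable
        also have "\<dots> = ennreal pi * (\<integral>\<^sup>+y. (\<integral>\<^sup>+x. \<psi> (X t x y) (Y t x y) \<partial>lborel) \<partial>lborel)"
          by (intro nn_integral_cmult) measurable
        also have "(\<integral>\<^sup>+y. (\<integral>\<^sup>+x. \<psi> (X t x y) (Y t x y) \<partial>lborel) \<partial>lborel) = Q"
          unfolding X_def Y_def Q_def by (rule nn_integral_rotation[OF _ t']) measurable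
        finally show ?thesis using True by simp
      qed simp
    qed
  qed
  \<comment> \<open>One factor \<open>pi\<close> stems from Cauchy-Schwarz, the other is the length
    of the time interval.\<close>
  also have "\<dots> = ennreal pi * Q * ennreal pi" by (subst nn_integral_cmult_indicator) auto
  also have "Q \<le> ennreal (l\<^sup>2 / real DIM('a)) * pair_moment TYPE('a)"
  proof -
    have l0: "0 \<le> l" using l[of 0] norm_ge_zero order_trans by blast
    have "Q = (\<integral>\<^sup>+x. \<integral>\<^sup>+y. \<psi> x y \<partial>lborel \<partial>lborel)" unfolding Q_def by (rule nn_integral_swap) measurable
    also have "\<dots> \<le> (\<integral>\<^sup>+x. ennreal (l\<^sup>2 / real DIM('a)) * (\<integral>\<^sup>+y. pair_ball y x * ennreal ((norm (y::'a))\<^sup>2) \<partial>lborel) \<partial>lborel)"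
    proof (intro nn_integral_mono)
      fix x :: 'a
      obtain r where r: "\<And>y. pair_ball x y = indicator (cball 0 r) y" using pair_ball_section by blast
      have "(\<integral>\<^sup>+y. \<psi> x y \<partial>lborel) = ennreal ((norm (G x))\<^sup>2 / real DIM('a)) * (\<integral>\<^sup>+y. pair_ball y x * ennreal ((norm (y::'a))\<^sup>2) \<partial>lborel)"
        unfolding \<psi>_def pair_ball_commute[of _ x] r by (rule nn_integral_cball_inner_square)
      also have "\<dots> \<le> ennreal (l\<^sup>2 / real DIM('a)) * (\<integral>\<^sup>+y. pair_ball y x * ennreal ((norm (y::'a))\<^sup>2) \<partial>lborel)"
        using l[of x] by (intro mult_right_mono ennreal_leI divide_right_mono power_mono) auto
      finally show "(\<integral>\<^sup>+y. \<psi> x y \<partial>lborel) \<le> ennreal (l\<^sup>2 / real DIM('a)) * (\<integral>\<^sup>+y. pair_ball y x * ennreal ((norm (y::'a))\<^sup>2) \<partial>lborel)" .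
    qed
    also have "\<dots> = ennreal (l\<^sup>2 / real DIM('a)) * pair_moment TYPE('a)"
      unfolding pair_moment_def by (rule nn_integral_cmult) measurable
    finally show ?thesis .
  qed
  then have "ennreal pi * Q * ennreal pi \<le> ennreal pi * (ennreal (l\<^sup>2 / real DIM('a)) * pair_moment TYPE('a)) * ennreal pi"
    by (intro mult_left_mono mult_right_mono) auto
  also have "\<dots> = ennreal (pi\<^sup>2 * l\<^sup>2 / real DIM('a)) * pair_moment TYPE('a)"
  proof -
    have "ennreal (pi\<^sup>2 * l\<^sup>2 / real DIM('a)) = ennreal pi * (ennreal (l\<^sup>2 / real DIM('a)) * ennreal pi)"
      by (simp add: ennreal_mult[symmetric] power2_eq_square mult_ac)
    then show ?thesis by (simp only: mult_ac)
  qed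
  finally show ?thesis .
qed

lemma pair_ball_finite: "(\<integral>\<^sup>+(y::'a::euclidean_space). \<integral>\<^sup>+x. pair_ball x y \<partial>lborel \<partial>lborel) < top"
proof -
  have le: "pair_ball x y \<le> indicator (cball 0 1) x * indicator (cball 0 1) y" for x y :: 'a
  proof (cases "(norm x)\<^sup>2 + (norm y)\<^sup>2 \<le> 1")
    case True
    then have "(norm x)\<^sup>2 \<le> 1" "(norm y)\<^sup>2 \<le> 1" using zero_le_power2[of "norm x"] zero_le_power2[of "norm y"] by linarith+
    then have "norm x \<le> 1" "norm y \<le> 1" by (simp_all add: abs_square_le_1)
    then show ?thesis by (simp add: pair_ball_def)
  qed (simp add: pair_ball_def)
  have "(\<integral>\<^sup>+(y::'a). \<integral>\<^sup>+x. pair_ball x y \<partial>lborel \<partial>lborel) \<le> (\<integral>\<^sup>+(y::'a). \<integral>\<^sup>+(x::'a). indicator (cball 0 1) x * indicator (cball 0 1) y \<partial>lborel \<partial>lborel)"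
    by (intro nn_integral_mono le)
  also have "\<dots> = emeasure lborel (cball (0::'a) 1) * emeasure lborel (cball (0::'a) 1)"
    by (simp add: nn_integral_multc nn_integral_cmult)
  also have "\<dots> < top" unfolding emeasure_unit_cball by (simp add: ennreal_mult_less_top)
  finally show ?thesis .
qed

lemma pair_moment_finite: "pair_moment TYPE('a::euclidean_space) < top"
proof -
  have "pair_moment TYPE('a) \<le> (\<integral>\<^sup>+(y::'a). \<integral>\<^sup>+x. pair_ball x y \<partial>lborel \<partial>lborel)"
    unfolding pair_moment_def
  proof (intro nn_integral_mono)
    fix x y :: 'a
    show "pair_ball x y * ennreal ((norm x)\<^sup>2) \<le> pair_ball x y"
    proof (cases "(norm x)\<^sup>2 + (norm y)\<^sup>2 \<le> 1")
      case True
      then have "(norm x)\<^sup>2 \<le> 1" using zero_le_power2[of "norm y"] by linarith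
      then show ?thesis by (simp add: pair_ball_def)
    qed (simp add: pair_ball_def)
  qed
  then show ?thesis using pair_ball_finite by (rule le_less_trans)
qed

lemma pair_moment_pos: "0 < pair_moment TYPE('a::euclidean_space)"
proof -
  let ?I = "indicator (cball (0::'a) (1/2)) :: 'a \<Rightarrow> ennreal"
  have le: "?I x * ennreal ((norm x)\<^sup>2) * ?I y \<le> pair_ball x y * ennreal ((norm x)\<^sup>2)" for x y :: 'a
  proof (cases "norm x \<le> 1/2 \<and> norm y \<le> 1/2")
    case True
    then have "(norm x)\<^sup>2 \<le> (1/2)\<^sup>2" "(norm y)\<^sup>2 \<le> (1/2)\<^sup>2" by (auto intro: power_mono)
    then have "(norm x)\<^sup>2 + (norm y)\<^sup>2 \<le> 1" by (simp add: power2_eq_square)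
    then show ?thesis using True by (simp add: pair_ball_def)
  qed auto
  have vol: "emeasure lborel (cball (0::'a) (1/2)) \<noteq> 0"
    using content_cball_pos[of "1/2" "0::'a"] by (auto simp: measure_def enn2real_positive_iff)
  have "(\<integral>\<^sup>+x. ?I x * ennreal ((norm x)\<^sup>2) \<partial>lborel) \<noteq> 0"
  proof
    assume "(\<integral>\<^sup>+x. ?I x * ennreal ((norm x)\<^sup>2) \<partial>lborel) = 0"
    then have "AE x in lborel. ?I x * ennreal ((norm x)\<^sup>2) = 0" by (subst (asm) nn_integral_0_iff_AE) auto
    moreover have "AE x in lborel. x \<noteq> (0::'a)" by (rule AE_lborel_singleton)
    ultimately have "AE x in lborel. ?I x = 0" by eventually_elim auto
    then have "(\<integral>\<^sup>+x. ?I x \<partial>lborel) = 0" by (subst nn_integral_0_iff_AE) auto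
    then show False using vol by simp
  qed
  then have "0 < (\<integral>\<^sup>+x. ?I x * ennreal ((norm x)\<^sup>2) \<partial>lborel) * emeasure lborel (cball (0::'a) (1/2))"
    using vol by (simp add: zero_less_iff_neq_zero)
  also have "\<dots> = (\<integral>\<^sup>+y. \<integral>\<^sup>+x. ?I x * ennreal ((norm x)\<^sup>2) * ?I y \<partial>lborel \<partial>lborel)"
    by (simp add: nn_integral_multc nn_integral_cmult)
  also have "\<dots> \<le> pair_moment TYPE('a)" unfolding pair_moment_def by (intro nn_integral_mono le)
  finally show ?thesis .
qed

text \<open>The odd part of \<open>h\<close> on the sphere is extended homogeneously, so that its antipodal variance can
  be computed on the ball of the doubled space, where rotations are available.\<close>

lemma odd_homogeneous_lipschitz:
  fixes h :: "'a::euclidean_space \<Rightarrow> real"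
  assumes lip: "l-lipschitz_on UNIV h"
  shows "(6 * l)-lipschitz_on UNIV (\<lambda>x. norm x * (h (x /\<^sub>R norm x) - h (- (x /\<^sub>R norm x))))"
proof -
  define o' where "o' w = h w - h (- w)" for w
  define g where "g x = norm x * o' (x /\<^sub>R norm x)" for x
  have l0: "0 \<le> l" using lip by (rule lipschitz_on_nonneg)
  have o_bd: "\<bar>o' (x /\<^sub>R norm x)\<bar> \<le> 2 * l" for x
  proof -
    have "\<bar>o' (x /\<^sub>R norm x)\<bar> \<le> l * norm (x /\<^sub>R norm x - - (x /\<^sub>R norm x))"
      unfolding o'_def by (rule lipschitz_abs_diff[OF lip])
    also have "x /\<^sub>R norm x - - (x /\<^sub>R norm x) = 2 *\<^sub>R (x /\<^sub>R norm x)" by (simp only: scaleR_2 diff_minus_eq_add)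
    also have "l * norm (2 *\<^sub>R (x /\<^sub>R norm x)) \<le> l * 2" using l0 by (intro mult_left_mono) (cases "x = 0", auto)
    finally show ?thesis by simp
  qed
  have main: "\<bar>g x - g y\<bar> \<le> 6 * l * norm (x - y)" if le: "norm y \<le> norm x" for x y
  proof (cases "y = 0")
    case True
    have "\<bar>g x\<bar> \<le> norm x * (2 * l)" unfolding g_def abs_mult using o_bd[of x] by (intro mult_mono) auto
    also have "\<dots> \<le> 6 * l * norm x" using mult_nonneg_nonneg[OF l0 norm_ge_zero[of x]] by simp
    finally show ?thesis using True by (simp add: g_def)
  next
    case False
    define u v where "u = x /\<^sub>R norm x" and "v = y /\<^sub>R norm y"
    have y0: "0 < norm y" and x0: "0 < norm x" using False le by (auto simp: norm_le_zero_iff dest: order_trans)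
    have xu: "norm x *\<^sub>R u = x" and yv: "norm y *\<^sub>R v = y" and nu: "norm u = 1" using x0 y0 by (auto simp: u_def v_def)
    have d: "norm x - norm y \<le> norm (x - y)" by (rule norm_triangle_ineq2)
    have "norm y *\<^sub>R (u - v) = (x - y) - (norm x - norm y) *\<^sub>R u"
      by (simp add: scaleR_diff_right scaleR_diff_left xu yv)
    then have "norm (norm y *\<^sub>R (u - v)) \<le> norm (x - y) + norm ((norm x - norm y) *\<^sub>R u)"
      using norm_triangle_ineq4[of "x - y" "(norm x - norm y) *\<^sub>R u"] by (simp only:)
    also have "\<dots> \<le> 2 * norm (x - y)" using nu le d by simp
    finally have uv: "norm y * norm (u - v) \<le> 2 * norm (x - y)" by simp
    have "\<bar>o' u - o' v\<bar> \<le> \<bar>h u - h v\<bar> + \<bar>h (- u) - h (- v)\<bar>" by (simp add: o'_def)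
    also have "\<dots> \<le> l * norm (u - v) + l * norm (u - v)"
      using lipschitz_abs_diff[OF lip, of u v] lipschitz_abs_diff[OF lip, of "- u" "- v"] by (simp add: norm_minus_commute)
    finally have "norm y * \<bar>o' u - o' v\<bar> \<le> norm y * (2 * l * norm (u - v))" by (intro mult_left_mono) auto
    also have "\<dots> = 2 * l * (norm y * norm (u - v))" by simp
    also have "\<dots> \<le> 2 * l * (2 * norm (x - y))" using uv l0 by (intro mult_left_mono) auto
    finally have 1: "norm y * \<bar>o' u - o' v\<bar> \<le> 4 * l * norm (x - y)" by simp
    have 2: "(norm x - norm y) * \<bar>o' u\<bar> \<le> norm (x - y) * (2 * l)"
      using d le o_bd[of x] by (intro mult_mono) (auto simp: u_def)
    \<comment> \<open>An angular and a radial part, of sizes \<open>4 * l\<close> and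
      \<open>2 * l\<close> per unit of distance; their sum is the constant 6.\<close>
    have "g x - g y = norm y * (o' u - o' v) + (norm x - norm y) * o' u"
      by (simp add: g_def u_def v_def algebra_simps)
    then have "\<bar>g x - g y\<bar> \<le> norm y * \<bar>o' u - o' v\<bar> + (norm x - norm y) * \<bar>o' u\<bar>"
      using abs_triangle_ineq[of "norm y * (o' u - o' v)" "(norm x - norm y) * o' u"] le by (simp add: abs_mult)
    also have "\<dots> \<le> 4 * l * norm (x - y) + norm (x - y) * (2 * l)" using 1 2 by (rule add_mono)
    finally show ?thesis by (simp add: algebra_simps)
  qed
  have "\<bar>g x - g y\<bar> \<le> 6 * l * norm (x - y)" for x y
    using main[of x y] main[of y x] by (cases "norm y \<le> norm x") (auto simp: norm_minus_commute abs_minus_commute)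
  then show ?thesis using l0 unfolding g_def o'_def by (intro lipschitz_onI) (auto simp: dist_norm)
qed

text \<open>For the odd function \<open>g\<close> the difference between antipodes is
  \<open>- 2 * g x\<close>, whence the factor 4 in \<open>E\<close>. As \<open>g\<close> is merely
  Lipschitz, the path bound is applied to its average \<open>H\<close> over balls of radius
  \<open>\<rho>\<close>, at a cost linear in \<open>\<rho>\<close>, and \<open>\<rho>\<close> then
  tends to 0.\<close>

theorem sphere_antipodal_variance:
  fixes h :: "'a::euclidean_space \<Rightarrow> real"
  assumes lip: "l-lipschitz_on UNIV h"
  shows "(\<integral>w. (h w - h (- w))\<^sup>2 \<partial>unif_sphere) \<le> 90 * l\<^sup>2 / real DIM('a)"
proof -
  have l0: "0 \<le> l" using lip by (rule lipschitz_on_nonneg)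
  have [measurable]: "h \<in> borel_measurable borel" using lip by (rule lipschitz_borel_measurable)
  let ?n = "real DIM('a)"
  let ?M = "pair_moment TYPE('a)"
  define g where "g x = norm x * (h (x /\<^sub>R norm x) - h (- (x /\<^sub>R norm x)))" for x
  define L where "L = 6 * l"
  have L0: "0 \<le> L" using l0 by (simp add: L_def)
  have g_lip: "L-lipschitz_on UNIV g" unfolding g_def L_def by (rule odd_homogeneous_lipschitz[OF lip])
  have [measurable]: "g \<in> borel_measurable borel" using g_lip by (rule lipschitz_borel_measurable)
  have g_odd: "g (- x) = - g x" for x by (simp add: g_def right_diff_distrib)
  define E where "E = (\<integral>w. 4 * (h w - h (- w))\<^sup>2 \<partial>unif_sphere)"
  define V where "V = (\<integral>\<^sup>+(y::'a). \<integral>\<^sup>+x. pair_ball x y \<partial>lborel \<partial>lborel)"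
  have XM: "(\<integral>\<^sup>+y. \<integral>\<^sup>+x. pair_ball x y * ennreal (4 * (g x)\<^sup>2) \<partial>lborel \<partial>lborel) = ?M * ennreal E"
  proof -
    have "(\<integral>\<^sup>+x. pair_ball x y * ennreal (4 * (g x)\<^sup>2) \<partial>lborel) = (\<integral>\<^sup>+x. pair_ball x y * ennreal ((norm x)\<^sup>2) \<partial>lborel) * ennreal E" for y
    proof -
      obtain r where r: "\<And>x. pair_ball y x = indicator (cball 0 r) x" using pair_ball_section by blast
      have bd: "4 * (h x - h (- x))\<^sup>2 \<le> 16 * l\<^sup>2" if "norm x \<le> 1" for x
      proof -
        have "\<bar>h x - h (- x)\<bar> \<le> l * norm (2 *\<^sub>R x)" using lipschitz_abs_diff[OF lip, of x "- x"] by (simp add: scaleR_2)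
        also have "\<dots> \<le> l * 2" using that l0 by (intro mult_left_mono) auto
        finally have "(h x - h (- x))\<^sup>2 \<le> (2 * l)\<^sup>2" using abs_le_square_iff[of "h x - h (- x)" "2 * l"] l0 by simp
        then show ?thesis by (simp add: power_mult_distrib)
      qed
      have "(\<integral>\<^sup>+x. indicator (cball 0 r) x * ennreal ((norm x)\<^sup>2 * (4 * (h (x /\<^sub>R norm x) - h (- (x /\<^sub>R norm x)))\<^sup>2)) \<partial>lborel)
         = (\<integral>\<^sup>+x. indicator (cball (0::'a) r) x * ennreal ((norm x)\<^sup>2) \<partial>lborel) * ennreal E"
        unfolding E_def
        by (rule nn_integral_cball_radial[of "\<lambda>w. 4 * (h w - h (- w))\<^sup>2" "16 * l\<^sup>2"]) (use bd in auto)
      then show ?thesis unfolding pair_ball_commute[of _ y] r by (simp add: g_def power_mult_distrib mult_ac)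
    qed
    then have "(\<integral>\<^sup>+y. \<integral>\<^sup>+x. pair_ball x y * ennreal (4 * (g x)\<^sup>2) \<partial>lborel \<partial>lborel) = (\<integral>\<^sup>+(y::'a). (\<integral>\<^sup>+x. pair_ball x y * ennreal ((norm x)\<^sup>2) \<partial>lborel) * ennreal E \<partial>lborel)"
      by simp
    also have "\<dots> = ?M * ennreal E" unfolding pair_moment_def by (rule nn_integral_multc) measurable
    finally show ?thesis .
  qed
  have step: "?M * ennreal E \<le> ennreal (pi\<^sup>2 * L\<^sup>2 / ?n) * ?M + ennreal (20 * L\<^sup>2 * \<rho>) * V" if \<rho>: "0 < \<rho>" "\<rho> \<le> 1" for \<rho>
  proof -
    define H where "H = ball_avg \<rho> g"
    define d where "d x = H (- x) - H x" for x
    have Hc: "continuous_on UNIV H"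
      unfolding H_def by (intro continuous_at_imp_continuous_on ballI GDERIV_ball_avg[OF g_lip \<rho>(1), unfolded gderiv_def, THEN has_derivative_continuous])
    have [measurable]: "H \<in> borel_measurable borel" using Hc by (rule borel_measurable_continuous_onI)
    have Hg: "\<bar>H x - g x\<bar> \<le> L * \<rho>" for x unfolding H_def by (rule ball_avg_approx[OF g_lip \<rho>(1)])
    have pt: "4 * (g x)\<^sup>2 \<le> (d x)\<^sup>2 + 20 * L\<^sup>2 * \<rho>" if x: "norm x \<le> 1" for x
    proof -
      have "\<bar>g x\<bar> \<le> L * norm x" using lipschitz_abs_diff[OF g_lip, of x 0] by (simp add: g_def)
      also have "\<dots> \<le> L * 1" using x L0 by (intro mult_left_mono) auto
      finally have gx: "\<bar>g x\<bar> \<le> L" by simp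
      define e where "e = 2 * L * \<rho>"
      have e: "0 \<le> e" "e \<le> 2 * L" using \<rho> L0 mult_left_mono[of \<rho> 1 "2 * L"] by (auto simp: e_def)
      have "\<bar>2 * \<bar>g x\<bar> - \<bar>d x\<bar>\<bar> \<le> e" using Hg[of x] Hg[of "- x"] unfolding g_odd d_def e_def by linarith
      then have "2 * \<bar>g x\<bar> \<le> \<bar>d x\<bar> + e" "\<bar>d x\<bar> \<le> 2 * L + e" using gx by linarith+
      then have "(2 * \<bar>g x\<bar>)\<^sup>2 \<le> (\<bar>d x\<bar> + e)\<^sup>2" by (intro power_mono) auto
      also have "\<dots> = (d x)\<^sup>2 + (2 * \<bar>d x\<bar> + e) * e" by (simp add: power2_eq_square algebra_simps)
      \<comment> \<open>From \<open>\<bar>d x\<bar> \<le> 2 * L + e\<close> and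
        \<open>e \<le> 2 * L\<close>; inserting \<open>e = 2 * L * \<rho>\<close> produces the error
        \<open>20 * L\<^sup>2 * \<rho>\<close>.\<close>
      also have "(2 * \<bar>d x\<bar> + e) * e \<le> (10 * L) * e" using \<open>\<bar>d x\<bar> \<le> 2 * L + e\<close> e by (intro mult_right_mono) auto
      finally have "4 * (g x)\<^sup>2 \<le> (d x)\<^sup>2 + 20 * L\<^sup>2 * \<rho>" by (simp add: e_def power_mult_distrib power2_eq_square algebra_simps)
      then show ?thesis .
    qed
    have "(\<integral>\<^sup>+y. \<integral>\<^sup>+x. pair_ball x y * ennreal (4 * (g x)\<^sup>2) \<partial>lborel \<partial>lborel)
       \<le> (\<integral>\<^sup>+y. \<integral>\<^sup>+x. pair_ball x y * ennreal ((d x)\<^sup>2) + ennreal (20 * L\<^sup>2 * \<rho>) * pair_ball x y \<partial>lborel \<partial>lborel)"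
    proof (intro nn_integral_mono)
      fix x y :: 'a
      show "pair_ball x y * ennreal (4 * (g x)\<^sup>2) \<le> pair_ball x y * ennreal ((d x)\<^sup>2) + ennreal (20 * L\<^sup>2 * \<rho>) * pair_ball x y"
      proof (cases "(norm x)\<^sup>2 + (norm y)\<^sup>2 \<le> 1")
        case True
        then have "(norm x)\<^sup>2 \<le> 1" using zero_le_power2[of "norm y"] by linarith
        then have "norm x \<le> 1" by (simp add: abs_square_le_1)
        from ennreal_leI[OF pt[OF this]] show ?thesis using True \<rho> L0 by (simp add: pair_ball_def)
      qed (simp add: pair_ball_def)
    qed
    also have "\<dots> = (\<integral>\<^sup>+y. (\<integral>\<^sup>+x. pair_ball x y * ennreal ((d x)\<^sup>2) \<partial>lborel) + ennreal (20 * L\<^sup>2 * \<rho>) * (\<integral>\<^sup>+x. pair_ball x y \<partial>lborel) \<partial>lborel)"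
      unfolding d_def by (intro nn_integral_cong) (subst nn_integral_add, auto simp: nn_integral_cmult)
    also have "\<dots> = (\<integral>\<^sup>+y. \<integral>\<^sup>+x. pair_ball x y * ennreal ((d x)\<^sup>2) \<partial>lborel \<partial>lborel) + ennreal (20 * L\<^sup>2 * \<rho>) * V"
      unfolding d_def V_def by (subst nn_integral_add) (auto simp: nn_integral_cmult)
    also have "(\<integral>\<^sup>+y. \<integral>\<^sup>+x. pair_ball x y * ennreal ((d x)\<^sup>2) \<partial>lborel \<partial>lborel) \<le> ennreal (pi\<^sup>2 * L\<^sup>2 / ?n) * ?M"
      unfolding d_def H_def
      by (rule pair_ball_antipodal_le[OF GDERIV_ball_avg[OF g_lip \<rho>(1)] lipschitz_on_continuous_on[OF sphere_grad_lipschitz[OF g_lip \<rho>(1)]] norm_sphere_grad_le[OF g_lip \<rho>(1)]])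
    finally show ?thesis unfolding XM by (simp add: add_right_mono)
  qed
  obtain m where m: "?M = ennreal m" "0 < m"
    using pair_moment_finite[where 'a='a] pair_moment_pos[where 'a='a] by (cases ?M) (auto simp: less_top)
  obtain v where v: "V = ennreal v" "0 \<le> v"
    using pair_ball_finite[where 'a='a] unfolding V_def[symmetric] by (cases V) auto
  have E0: "0 \<le> E" unfolding E_def by (intro Bochner_Integration.integral_nonneg) auto
  have real_step: "m * E \<le> pi\<^sup>2 * L\<^sup>2 / ?n * m + 20 * L\<^sup>2 * \<rho> * v" if "0 < \<rho>" "\<rho> \<le> 1" for \<rho>
    using step[OF that] m v E0 that L0 unfolding m(1) v(1)
    by (simp add: ennreal_mult'[symmetric] ennreal_plus[symmetric] del: ennreal_plus)
  have "m * E \<le> pi\<^sup>2 * L\<^sup>2 / ?n * m"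
  proof (rule field_le_epsilon)
    fix e :: real assume e: "0 < e"
    define c where "c = 20 * L\<^sup>2 * v + 1"
    have c: "0 < c" using v by (simp add: c_def add_nonneg_pos)
    define \<rho> where "\<rho> = min 1 (e / c)"
    have \<rho>: "0 < \<rho>" "\<rho> \<le> 1" using e c by (auto simp: \<rho>_def)
    have "20 * L\<^sup>2 * \<rho> * v \<le> c * \<rho>" using \<rho> by (simp add: c_def algebra_simps)
    also have "\<dots> \<le> c * (e / c)" using c by (intro mult_left_mono) (auto simp: \<rho>_def)
    also have "\<dots> = e" using c by simp
    finally show "m * E \<le> pi\<^sup>2 * L\<^sup>2 / ?n * m + e" using real_step[OF \<rho>] by linarith
  qed
  then have "m * E \<le> m * (pi\<^sup>2 * L\<^sup>2 / ?n)" by (simp add: mult.commute)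
  then have "E \<le> pi\<^sup>2 * L\<^sup>2 / ?n" using m(2) by (rule mult_left_le_imp_le)
  also have "E = 4 * (\<integral>w. (h w - h (- w))\<^sup>2 \<partial>unif_sphere)" unfolding E_def by simp
  finally have "(\<integral>w. (h w - h (- w))\<^sup>2 \<partial>unif_sphere) \<le> pi\<^sup>2 * (9 * l\<^sup>2) / ?n"
    by (simp add: L_def power_mult_distrib field_simps)
  \<comment> \<open>The 9 is 36 / 4: the squared Lipschitz factor 6 of \<open>g\<close>, divided by
    the 4 in \<open>E\<close>. With \<open>pi\<^sup>2 \<le> 10\<close> this gives 90.\<close>
  also have "\<dots> \<le> 10 * (9 * l\<^sup>2) / ?n"
  proof -
    have "pi\<^sup>2 \<le> (3.15)\<^sup>2" using pi_approx by (intro power_mono) auto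
    also have "\<dots> \<le> 10" by (simp add: power2_eq_square)
    finally show ?thesis by (intro divide_right_mono mult_right_mono) auto
  qed
  finally show ?thesis by simp
qed

section \<open>The Goldstein subdifferential\<close>

text \<open>The generators of the Goldstein subdifferential before any hull is taken. Compactness is
  a subsequence argument for this set and passes to its hull in finite dimension.\<close>

definition limit_grads :: "real \<Rightarrow> ('a::euclidean_space \<Rightarrow> real) \<Rightarrow> 'a \<Rightarrow> 'a set" where
  "limit_grads \<delta> f x =
    {g. \<exists>y\<in>cball x \<delta>. \<exists>X G. X \<longlonglongrightarrow> y \<and> (\<forall>n::nat. GDERIV f (X n) :> G n) \<and> G \<longlonglongrightarrow> g}"

lemma goldstein_eq_hull_limit_grads: "goldstein_subdiff \<delta> f x = convex hull (limit_grads \<delta> f x)"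
proof
  have "clarke_subdiff f y \<subseteq> convex hull (limit_grads \<delta> f x)" if "y \<in> cball x \<delta>" for y
    unfolding clarke_subdiff_def limit_grads_def using that by (intro hull_mono) blast
  then show "goldstein_subdiff \<delta> f x \<subseteq> convex hull (limit_grads \<delta> f x)"
    unfolding goldstein_subdiff_def by (intro hull_minimal convex_convex_hull) blast
  have "limit_grads \<delta> f x \<subseteq> (\<Union>y\<in>cball x \<delta>. clarke_subdiff f y)"
  proof
    fix g assume "g \<in> limit_grads \<delta> f x"
    then obtain y X G where y: "y \<in> cball x \<delta>" and "X \<longlonglongrightarrow> y" "\<forall>n::nat. GDERIV f (X n) :> G n" "G \<longlonglongrightarrow> g"
      unfolding limit_grads_def by blast
    then have "g \<in> clarke_subdiff f y" unfolding clarke_subdiff_def by (intro hull_inc) blast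
    then show "g \<in> (\<Union>y\<in>cball x \<delta>. clarke_subdiff f y)" using y by blast
  qed
  then show "convex hull (limit_grads \<delta> f x) \<subseteq> goldstein_subdiff \<delta> f x"
    unfolding goldstein_subdiff_def by (rule hull_mono)
qed

lemma GDERIV_in_limit_grads:
  assumes "norm (y - x) \<le> \<delta>" "GDERIV f y :> g"
  shows "g \<in> limit_grads \<delta> f x"
  unfolding limit_grads_def
proof (intro CollectI bexI exI conjI allI)
  show "(\<lambda>_. y) \<longlonglongrightarrow> y" "(\<lambda>_. g) \<longlonglongrightarrow> g" by simp_all
  show "y \<in> cball x \<delta>" using assms(1) by (simp add: dist_norm norm_minus_commute)
  show "GDERIV f y :> g" by fact
qed

lemma limit_grads_approx:
  assumes "g \<in> limit_grads \<delta> f x" "0 < e"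
  shows "\<exists>y h. GDERIV f y :> h \<and> norm (y - x) < \<delta> + e \<and> norm (h - g) < e"
proof -
  obtain y X G where "y \<in> cball x \<delta>" and X: "X \<longlonglongrightarrow> y" and "\<forall>n::nat. GDERIV f (X n) :> G n" and "G \<longlonglongrightarrow> g"
    using assms(1) unfolding limit_grads_def by blast
  then have y: "norm (y - x) \<le> \<delta>" and G: "\<And>n. GDERIV f (X n) :> G n" "G \<longlonglongrightarrow> g"
    by (auto simp: dist_norm norm_minus_commute)
  have "eventually (\<lambda>n. dist (X n) y < e) sequentially" "eventually (\<lambda>n. dist (G n) g < e) sequentially"
    using X G(2) assms(2) by (auto simp: tendsto_iff)
  then have "eventually (\<lambda>n. dist (X n) y < e \<and> dist (G n) g < e) sequentially" by (rule eventually_conj)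
  then obtain n where n: "dist (X n) y < e" "dist (G n) g < e" by (auto simp: eventually_sequentially)
  have "norm (X n - x) \<le> norm (X n - y) + norm (y - x)" using norm_triangle_ineq[of "X n - y" "y - x"] by simp
  then have "norm (X n - x) < \<delta> + e" using n(1) y by (simp add: dist_norm)
  then show ?thesis using G(1) n(2) by (auto simp: dist_norm)
qed

text \<open>Gradients of a Lipschitz function are bounded, so base points and gradients converge
  together along a subsequence. The slack \<open>e n\<close> admits base points slightly outside the
  ball.\<close>

lemma limit_grads_subseq:
  fixes f :: "'a::euclidean_space \<Rightarrow> real"
  assumes lip: "L-lipschitz_on UNIV f" and h: "\<And>n::nat. GDERIV f (y n) :> h n"
    and y: "\<And>n. norm (y n - x) \<le> \<delta> + e n" and e: "e \<longlonglongrightarrow> 0"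
  shows "\<exists>r g. strict_mono r \<and> (h \<circ> r) \<longlonglongrightarrow> g \<and> g \<in> limit_grads \<delta> f x"
proof -
  have h_bd: "norm (h n) \<le> L" for n using lip h by (rule lipschitz_GDERIV_norm_le)
  obtain E where E: "\<And>n. norm (e n) \<le> E"
    using convergent_imp_Bseq[of e] e by (auto simp: convergent_def Bseq_def)
  have y_bd: "norm (y n) \<le> norm x + (\<delta> + E)" for n
    using norm_triangle_sub[of "y n" x] y[of n] E[of n] by simp
  have "norm (y n, h n) \<le> (norm x + (\<delta> + E)) + L" for n
    using norm_Pair_le[of "y n" "h n"] y_bd[of n] h_bd[of n] by linarith
  then have "bounded (range (\<lambda>n. (y n, h n)))" by (auto simp: bounded_iff)
  then obtain l r where r: "strict_mono r" and l: "((\<lambda>n. (y n, h n)) \<circ> r) \<longlonglongrightarrow> l"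
    using bounded_imp_convergent_subsequence by blast
  have yl: "(y \<circ> r) \<longlonglongrightarrow> fst l" using tendsto_fst[OF l] by (simp add: o_def)
  have hl: "(h \<circ> r) \<longlonglongrightarrow> snd l" using tendsto_snd[OF l] by (simp add: o_def)
  have "norm (fst l - x) \<le> \<delta> + 0"
  proof (rule LIMSEQ_le)
    show "(\<lambda>n. norm ((y \<circ> r) n - x)) \<longlonglongrightarrow> norm (fst l - x)" by (intro tendsto_intros yl)
    show "(\<lambda>n. \<delta> + (e \<circ> r) n) \<longlonglongrightarrow> \<delta> + 0" by (intro tendsto_intros LIMSEQ_subseq_LIMSEQ[OF e r])
  qed (use y in auto)
  then have "snd l \<in> limit_grads \<delta> f x"
    unfolding limit_grads_def using yl hl h
    by (intro CollectI bexI[of _ "fst l"] exI[of _ "y \<circ> r"] exI[of _ "h \<circ> r"]) (auto simp: dist_norm norm_minus_commute)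
  then show ?thesis using r hl by blast
qed

lemma norm_limit_grads_le:
  fixes f :: "'a::euclidean_space \<Rightarrow> real"
  assumes lip: "L-lipschitz_on UNIV f" and g: "g \<in> limit_grads \<delta> f x"
  shows "norm g \<le> L"
proof (rule field_le_epsilon)
  fix e :: real assume "0 < e"
  then obtain y h where "GDERIV f y :> h" "norm (h - g) < e" using limit_grads_approx[OF g] by blast
  then show "norm g \<le> L + e"
    using lipschitz_GDERIV_norm_le[OF lip, of y h] norm_triangle_sub[of g h] by (simp add: norm_minus_commute)
qed

lemma compact_limit_grads:
  fixes f :: "'a::euclidean_space \<Rightarrow> real"
  assumes lip: "L-lipschitz_on UNIV f"
  shows "compact (limit_grads \<delta> f x)"
proof (subst compact_eq_bounded_closed, intro conjI)
  show "bounded (limit_grads \<delta> f x)" using norm_limit_grads_le[OF lip] by (auto simp: bounded_iff)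
  show "closed (limit_grads \<delta> f x)"
    unfolding closed_sequential_limits
  proof (intro allI impI)
    fix G g assume "(\<forall>n. G n \<in> limit_grads \<delta> f x) \<and> G \<longlonglongrightarrow> g"
    then have G: "\<And>n. G n \<in> limit_grads \<delta> f x" and Gg: "G \<longlonglongrightarrow> g" by auto
    \<comment> \<open>A diagonal choice: each limiting gradient is replaced by a true gradient
      within \<open>1 / real (Suc n)\<close>, with the same limit.\<close>
    have "\<forall>n. \<exists>y h. GDERIV f y :> h \<and> norm (y - x) < \<delta> + 1 / real (Suc n) \<and> norm (h - G n) < 1 / real (Suc n)"
      using limit_grads_approx[OF G] by simp
    then obtain y h where yh: "\<And>n. GDERIV f (y n) :> h n" "\<And>n. norm (y n - x) < \<delta> + 1 / real (Suc n)"
       "\<And>n. norm (h n - G n) < 1 / real (Suc n)" by metis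
    have "(\<lambda>n. h n - G n) \<longlonglongrightarrow> 0"
      by (rule Lim_null_comparison[OF _ inverse_Suc_tendsto_0]) (use yh(3) in \<open>auto intro!: always_eventually less_imp_le\<close>)
    then have hg: "h \<longlonglongrightarrow> g" using Gg tendsto_add by fastforce
    obtain r g' where r: "strict_mono r" "(h \<circ> r) \<longlonglongrightarrow> g'" "g' \<in> limit_grads \<delta> f x"
      using limit_grads_subseq[OF lip yh(1) less_imp_le[OF yh(2)] inverse_Suc_tendsto_0] by blast
    have "(h \<circ> r) \<longlonglongrightarrow> g" using hg r(1) by (rule LIMSEQ_subseq_LIMSEQ)
    then have "g = g'" using r(2) by (rule LIMSEQ_unique)
    then show "g \<in> limit_grads \<delta> f x" using r(3) by simp
  qed
qed

text \<open>Points of differentiability have full measure in the ball by Rademacher's theorem, and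
  \<open>\<delta> > 0\<close> gives the ball positive measure.\<close>

lemma limit_grads_nonempty:
  fixes f :: "'a::euclidean_space \<Rightarrow> real"
  assumes lip: "L-lipschitz_on UNIV f" and \<delta>: "0 < \<delta>"
  shows "limit_grads \<delta> f x \<noteq> {}"
proof -
  interpret U: prob_space "unif_ball :: 'a measure" by (rule prob_space_unif_ball)
  have "\<exists>y g. GDERIV f (x + \<delta> *\<^sub>R y) :> g \<and> norm y \<le> 1"
  proof (rule ccontr)
    assume none: "\<nexists>y g. GDERIV f (x + \<delta> *\<^sub>R y) :> g \<and> norm y \<le> 1"
    have "AE y in (unif_ball :: 'a measure). False"
      using AE_unif_ball_GDERIV[OF lip \<delta>, of x] AE_unif_ball_norm by eventually_elim (use none in blast)
    then show False by simp
  qed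
  then obtain y g where y: "GDERIV f (x + \<delta> *\<^sub>R y) :> g" "norm y \<le> 1" by blast
  have "g \<in> limit_grads \<delta> f x"
    by (rule GDERIV_in_limit_grads[OF _ y(1)]) (use y(2) \<delta> in simp)
  then show ?thesis by blast
qed

context
  fixes f :: "'a::euclidean_space \<Rightarrow> real" and L \<delta> :: real
  assumes lip: "L-lipschitz_on UNIV f" and \<delta>: "0 < \<delta>"
begin

lemma compact_goldstein: "compact (goldstein_subdiff \<delta> f x)"
  unfolding goldstein_eq_hull_limit_grads by (intro compact_convex_hull compact_limit_grads[OF lip])

lemma convex_goldstein: "convex (goldstein_subdiff \<delta> f x)"
  unfolding goldstein_subdiff_def by (rule convex_convex_hull)

lemma goldstein_nonempty: "goldstein_subdiff \<delta> f x \<noteq> {}"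
  unfolding goldstein_eq_hull_limit_grads using limit_grads_nonempty[OF lip \<delta>] by simp

lemma GDERIV_in_goldstein:
  assumes "norm (y - x) \<le> \<delta>" "GDERIV f y :> g"
  shows "g \<in> goldstein_subdiff \<delta> f x"
  unfolding goldstein_eq_hull_limit_grads by (intro hull_inc GDERIV_in_limit_grads[OF assms])

text \<open>\<open>arg_min_on\<close> is a choice that means something only once a minimiser exists;
  compactness and nonemptiness provide one.\<close>

lemma min_norm_subgrad_props:
  shows min_norm_subgrad_in: "min_norm_subgrad \<delta> f x \<in> goldstein_subdiff \<delta> f x"
    and min_norm_subgrad_le: "g \<in> goldstein_subdiff \<delta> f x \<Longrightarrow> norm (min_norm_subgrad \<delta> f x) \<le> norm g"
proof -
  obtain g0 where "g0 \<in> goldstein_subdiff \<delta> f x" "\<And>g. g \<in> goldstein_subdiff \<delta> f x \<Longrightarrow> norm g0 \<le> norm g"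
    using continuous_attains_inf[OF compact_goldstein goldstein_nonempty, where f=norm] continuous_on_norm_id by blast
  then have "is_arg_min norm (\<lambda>g. g \<in> goldstein_subdiff \<delta> f x) g0" by (auto simp: is_arg_min_def not_less)
  then have "is_arg_min norm (\<lambda>g. g \<in> goldstein_subdiff \<delta> f x) (min_norm_subgrad \<delta> f x)"
    unfolding min_norm_subgrad_def arg_min_on_def arg_min_def by (rule someI)
  then show "min_norm_subgrad \<delta> f x \<in> goldstein_subdiff \<delta> f x"
    and "g \<in> goldstein_subdiff \<delta> f x \<Longrightarrow> norm (min_norm_subgrad \<delta> f x) \<le> norm g"
    by (auto simp: is_arg_min_def not_less)
qed

lemma norm_min_norm_subgrad_le: "norm (min_norm_subgrad \<delta> f x) \<le> L"
proof -
  have "limit_grads \<delta> f x \<subseteq> cball 0 L" using norm_limit_grads_le[OF lip] by auto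
  then have "goldstein_subdiff \<delta> f x \<subseteq> cball 0 L"
    unfolding goldstein_eq_hull_limit_grads by (intro hull_minimal) auto
  then show ?thesis using min_norm_subgrad_in by (meson mem_cball_0 subsetD)
qed

lemma sphere_grad_in_goldstein:
  assumes \<rho>: "0 < \<rho>" and z: "norm (z - x) + \<rho> \<le> \<delta>"
  shows "sphere_grad \<rho> f z \<in> goldstein_subdiff \<delta> f x"
proof (rule ccontr)
  assume "sphere_grad \<rho> f z \<notin> goldstein_subdiff \<delta> f x"
  then obtain a b where ab: "a \<bullet> sphere_grad \<rho> f z < b" "\<And>g. g \<in> goldstein_subdiff \<delta> f x \<Longrightarrow> b < a \<bullet> g"
    using separating_hyperplane_closed_point[OF convex_goldstein compact_imp_closed[OF compact_goldstein]] by blast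
  \<comment> \<open>Every gradient of \<open>f\<close> in the smaller ball lies in the separating
    half-space, hence so does their average.\<close>
  have "sphere_grad \<rho> f z \<bullet> (- a) \<le> - b"
  proof (rule sphere_grad_inner_le[OF lip \<rho>])
    fix y g assume y: "norm (y - z) \<le> \<rho>" and g: "GDERIV f y :> g"
    have "norm (y - x) \<le> \<delta>" using norm_triangle_ineq[of "y - z" "z - x"] y z by simp
    from ab(2)[OF GDERIV_in_goldstein[OF this g]] show "g \<bullet> (- a) \<le> - b" by (simp add: inner_commute)
  qed
  then show False using ab(1) by (simp add: inner_commute)
qed

text \<open>The Goldstein subdifferential is outer semicontinuous in \<open>x\<close>: a limit of
  its elements at \<open>X n\<close> belongs to it at \<open>x\<close>. The minimal norm is
  therefore lower semicontinuous, which yields its Borel measurability.\<close>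

lemma closed_min_norm_subgrad_sublevel: "closed {x. norm (min_norm_subgrad \<delta> f x) \<le> c}"
  unfolding closed_sequential_limits
proof (intro allI impI)
  fix X x assume "(\<forall>n. X n \<in> {x. norm (min_norm_subgrad \<delta> f x) \<le> c}) \<and> X \<longlonglongrightarrow> x"
  then have Xc: "\<And>n. norm (min_norm_subgrad \<delta> f (X n)) \<le> c" and Xx: "X \<longlonglongrightarrow> x" by auto
  have "bounded (range (\<lambda>n. min_norm_subgrad \<delta> f (X n)))" using Xc by (auto simp: bounded_iff)
  then obtain g r where r: "strict_mono r" and g: "((\<lambda>n. min_norm_subgrad \<delta> f (X n)) \<circ> r) \<longlonglongrightarrow> g"
    using bounded_imp_convergent_subsequence by blast
  have gc: "norm g \<le> c"
    by (rule LIMSEQ_le_const2[OF tendsto_norm[OF g]]) (use Xc in auto)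
  have "g \<in> goldstein_subdiff \<delta> f x"
  proof (rule ccontr)
    assume "g \<notin> goldstein_subdiff \<delta> f x"
    then obtain a b where ab: "a \<bullet> g < b" "\<And>h. h \<in> goldstein_subdiff \<delta> f x \<Longrightarrow> b < a \<bullet> h"
      using separating_hyperplane_closed_point[OF convex_goldstein compact_imp_closed[OF compact_goldstein]] by blast
    \<comment> \<open>The half-space that strictly contains the subdifferential still contains all
      gradients at distance slightly above \<open>\<delta>\<close>; otherwise violating gradients
      would accumulate at an element of the subdifferential.\<close>
    have "\<exists>e>0. \<forall>y h. GDERIV f y :> h \<longrightarrow> norm (y - x) < \<delta> + e \<longrightarrow> b \<le> a \<bullet> h"
    proof (rule ccontr)
      assume neg: "\<not> (\<exists>e>0. \<forall>y h. GDERIV f y :> h \<longrightarrow> norm (y - x) < \<delta> + e \<longrightarrow> b \<le> a \<bullet> h)"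
      have "\<exists>y h. GDERIV f y :> h \<and> norm (y - x) < \<delta> + 1 / real (Suc n) \<and> a \<bullet> h < b" for n
      proof -
        have "0 < 1 / real (Suc n)" by simp
        then show ?thesis using neg by (meson not_le)
      qed
      then obtain y h where yh: "\<And>n. GDERIV f (y n) :> h n" "\<And>n. norm (y n - x) < \<delta> + 1 / real (Suc n)" "\<And>n. a \<bullet> h n < b"
        by metis
      obtain s h' where s: "strict_mono s" "(h \<circ> s) \<longlonglongrightarrow> h'" "h' \<in> limit_grads \<delta> f x"
        using limit_grads_subseq[OF lip yh(1) less_imp_le[OF yh(2)] inverse_Suc_tendsto_0] by blast
      have "a \<bullet> h' \<le> b"
        by (rule LIMSEQ_le_const2[OF tendsto_inner[OF tendsto_const s(2)]]) (use yh(3) in \<open>auto intro!: less_imp_le\<close>)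
      moreover have "h' \<in> goldstein_subdiff \<delta> f x" unfolding goldstein_eq_hull_limit_grads by (rule hull_inc[OF s(3)])
      ultimately show False using ab(2) by force
    qed
    then obtain e where e: "0 < e" "\<And>y h. GDERIV f y :> h \<Longrightarrow> norm (y - x) < \<delta> + e \<Longrightarrow> b \<le> a \<bullet> h" by blast
    \<comment> \<open>For \<open>X n\<close> close to \<open>x\<close> the ball around
      \<open>X n\<close> lies in the enlarged ball around \<open>x\<close>, so its whole hull stays
      in the half-space, and so does the limit \<open>g\<close>.\<close>
    have half: "b \<le> a \<bullet> h" if n: "norm (X n - x) < e / 2" and h: "h \<in> goldstein_subdiff \<delta> f (X n)" for n h
    proof -
      have "limit_grads \<delta> f (X n) \<subseteq> {h. a \<bullet> h \<ge> b}"
      proof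
        fix h assume h: "h \<in> limit_grads \<delta> f (X n)"
        have "b \<le> a \<bullet> h"
        proof (rule field_le_epsilon)
          fix d :: real assume d: "0 < d"
          \<comment> \<open>The first bound keeps the approximating point within
            \<open>\<delta> + e\<close> of \<open>x\<close>, the second limits the error in the
            inner product to \<open>d\<close>.\<close>
          define d' where "d' = min (e / 2) (d / (norm a + 1))"
          have d': "0 < d'" using e(1) d by (auto simp: d'_def intro!: divide_pos_pos add_nonneg_pos)
          obtain y k where k: "GDERIV f y :> k" "norm (y - X n) < \<delta> + d'" "norm (k - h) < d'"
            using limit_grads_approx[OF h d'] by blast
          have "norm (y - x) \<le> norm (y - X n) + norm (X n - x)" using norm_triangle_ineq[of "y - X n" "X n - x"] by simp
          then have "norm (y - x) < \<delta> + e" using k(2) n by (simp add: d'_def)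
          then have "b \<le> a \<bullet> k" using e(2) k(1) by blast
          moreover have "a \<bullet> k - a \<bullet> h \<le> norm a * norm (k - h)"
            using norm_cauchy_schwarz[of a "k - h"] by (simp add: inner_diff_right)
          moreover have "norm a * norm (k - h) \<le> (norm a + 1) * d'" using k(3) by (intro mult_mono) auto
          moreover have "(norm a + 1) * d' \<le> (norm a + 1) * (d / (norm a + 1))" by (intro mult_left_mono) (auto simp: d'_def)
          moreover have "(norm a + 1) * (d / (norm a + 1)) = d" by (simp add: add_nonneg_eq_0_iff)
          ultimately show "b \<le> a \<bullet> h + d" by linarith
        qed
        then show "h \<in> {h. a \<bullet> h \<ge> b}" by simp
      qed
      then have "goldstein_subdiff \<delta> f (X n) \<subseteq> {h. a \<bullet> h \<ge> b}"
        unfolding goldstein_eq_hull_limit_grads by (intro hull_minimal convex_halfspace_ge)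
      then show ?thesis using h by blast
    qed
    have "eventually (\<lambda>n. dist ((X \<circ> r) n) x < e / 2) sequentially"
      using e(1) by (intro tendstoD[OF LIMSEQ_subseq_LIMSEQ[OF Xx r]]) simp
    then have "eventually (\<lambda>n. b \<le> a \<bullet> ((\<lambda>n. min_norm_subgrad \<delta> f (X n)) \<circ> r) n) sequentially"
      by eventually_elim (use half min_norm_subgrad_in in \<open>auto simp: dist_norm\<close>)
    then have "b \<le> a \<bullet> g"
      by (rule tendsto_lowerbound[OF tendsto_inner[OF tendsto_const g]]) auto
    then show False using ab(1) by simp
  qed
  then show "x \<in> {x. norm (min_norm_subgrad \<delta> f x) \<le> c}" using min_norm_subgrad_le gc by force
qed

lemma borel_measurable_min_norm_subgrad: "(\<lambda>x. norm (min_norm_subgrad \<delta> f x)) \<in> borel_measurable borel"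
  by (subst borel_measurable_iff_le) (auto intro!: borel_closed closed_min_norm_subgrad_sublevel)

text \<open>Walking against the element of minimal norm \<open>m\<close> lowers the function at rate
  at least \<open>m\<close>. As \<open>f\<close> need not be differentiable along the path, the walk
  is done for its average over radius \<open>r\<close>; it has length \<open>\<delta> - r\<close>,
  so that all balls involved stay within \<open>\<delta>\<close> of \<open>x\<close>, and
  \<open>r\<close> tends to 0.\<close>

lemma min_norm_subgrad_descent:
  assumes c: "\<And>y. c \<le> f y"
  shows "\<delta> * norm (min_norm_subgrad \<delta> f x) \<le> f x - c"
proof (cases "min_norm_subgrad \<delta> f x = 0")
  case False
  define g0 where "g0 = min_norm_subgrad \<delta> f x"
  define m where "m = norm g0"
  have m: "0 < m" using False by (simp add: m_def g0_def)
  define u where "u = g0 /\<^sub>R m"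
  have nu: "norm u = 1" using m by (simp add: u_def m_def)
  \<comment> \<open>The minimal element is the projection of 0 onto a closed convex set, so the
    whole set lies beyond the hyperplane through it with normal \<open>u\<close>.\<close>
  have gu: "m \<le> g \<bullet> u" if "g \<in> goldstein_subdiff \<delta> f x" for g
  proof -
    have "(0 - g0) \<bullet> (g - g0) \<le> 0"
      by (rule any_closest_point_dot[OF convex_goldstein compact_imp_closed[OF compact_goldstein]])
         (use that min_norm_subgrad_in min_norm_subgrad_le in \<open>auto simp: g0_def\<close>)
    then have "m * m \<le> g0 \<bullet> g" unfolding m_def by (simp add: inner_diff_right dot_square_norm power2_eq_square)
    then show ?thesis using m by (simp add: u_def inner_commute field_simps)
  qed
  have L0: "0 \<le> L" using lip by (rule lipschitz_on_nonneg)
  have step: "(\<delta> - r) * m \<le> f x + L * r - c" if r: "0 < r" "r < \<delta>" for r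
  proof -
    define v where "v = - ((\<delta> - r) *\<^sub>R u)"
    have der: "DERIV (\<lambda>t. ball_avg r f (x + t *\<^sub>R v)) t :> v \<bullet> sphere_grad r f (x + t *\<^sub>R v)" for t
    proof -
      have "((\<lambda>t::real. x + t *\<^sub>R v) has_derivative (\<lambda>t. t *\<^sub>R v)) (at t)" by (auto intro!: derivative_eq_intros)
      from has_derivative_compose[OF this GDERIV_ball_avg[OF lip r(1), unfolded gderiv_def]]
      show ?thesis by (simp add: has_field_derivative_def mult_commute_abs)
    qed
    obtain t where t: "0 < t" "t < 1" and eq: "ball_avg r f (x + 1 *\<^sub>R v) - ball_avg r f (x + 0 *\<^sub>R v) = (1 - 0) * (v \<bullet> sphere_grad r f (x + t *\<^sub>R v))"
      using MVT2[of 0 1 "\<lambda>t. ball_avg r f (x + t *\<^sub>R v)" "\<lambda>t. v \<bullet> sphere_grad r f (x + t *\<^sub>R v)"] der by auto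
    have "norm (t *\<^sub>R v) \<le> \<delta> - r" using t r nu mult_right_mono[of t 1 "\<delta> - r"] by (simp add: v_def)
    then have "sphere_grad r f (x + t *\<^sub>R v) \<in> goldstein_subdiff \<delta> f x"
      by (intro sphere_grad_in_goldstein r) simp
    then have "m \<le> sphere_grad r f (x + t *\<^sub>R v) \<bullet> u" by (rule gu)
    then have "(\<delta> - r) * m \<le> (\<delta> - r) * (sphere_grad r f (x + t *\<^sub>R v) \<bullet> u)" using r by (intro mult_left_mono) auto
    also have "\<dots> = ball_avg r f x - ball_avg r f (x + v)" using eq by (simp add: v_def inner_commute)
    also have "\<dots> \<le> f x + L * r - c"
      using ball_avg_approx[OF lip r(1), of x] ball_avg_ge[OF lip c, of r "x + v"] by linarith
    finally show ?thesis .
  qed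
  have "\<delta> * m \<le> f x - c"
  proof (rule field_le_epsilon)
    fix e :: real assume e: "0 < e"
    define r where "r = min (\<delta> / 2) (e / (L + m))"
    have Lm: "0 < L + m" using L0 m by simp
    have r: "0 < r" "r < \<delta>" using e \<delta> Lm by (auto simp: r_def)
    have "(L + m) * r \<le> (L + m) * (e / (L + m))" using Lm by (intro mult_left_mono) (auto simp: r_def)
    also have "\<dots> = e" using Lm by simp
    finally show "\<delta> * m \<le> f x - c + e" using step[OF r] by (simp add: algebra_simps)
  qed
  then show ?thesis by (simp add: m_def g0_def)
qed (use c in simp)

end

section \<open>The gradient estimator\<close>

text \<open>Simple functions approximating the first coordinate take finitely many values, so only
  measurability of \<open>F\<close> at fixed points is used before the limit; continuity in
  \<open>x\<close> identifies the limit.\<close>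

lemma borel_measurable_Caratheodory:
  fixes F :: "'a::euclidean_space \<Rightarrow> 'w \<Rightarrow> real"
  assumes F [measurable]: "\<And>x. F x \<in> borel_measurable M" and cont: "\<And>\<xi>. \<xi> \<in> space M \<Longrightarrow> continuous_on UNIV (\<lambda>x. F x \<xi>)"
  shows "(\<lambda>(x, \<xi>). F x \<xi>) \<in> borel_measurable (borel \<Otimes>\<^sub>M M)"
proof -
  let ?P = "borel \<Otimes>\<^sub>M M :: ('a \<times> 'w) measure"
  have "fst \<in> borel_measurable ?P" by measurable
  from borel_measurable_implies_sequence_metric[OF this, of 0]
  obtain S where S: "\<And>i. simple_function ?P (S i)" "\<And>z. z \<in> space ?P \<Longrightarrow> (\<lambda>i. S i z) \<longlonglongrightarrow> fst z"
    by auto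
  have meas: "(\<lambda>z. F (S i z) (snd z)) \<in> borel_measurable ?P" for i
  proof (rule measurable_compose_countable'[where I="S i ` space ?P"])
    show "(\<lambda>z. F v (snd z)) \<in> borel_measurable ?P" for v by measurable
    have fin: "finite (S i ` space ?P)" using S(1) by (rule simple_functionD)
    then show "countable (S i ` space ?P)" by (rule countable_finite)
    show "S i \<in> measurable ?P (count_space (S i ` space ?P))"
      unfolding measurable_count_space_eq2[OF fin] using S(1) by (auto intro: simple_functionD)
  qed
  have "(\<lambda>z. F (fst z) (snd z)) \<in> borel_measurable ?P"
  proof (rule borel_measurable_LIMSEQ_metric[OF meas])
    fix z assume z: "z \<in> space ?P"
    then have "snd z \<in> space M" by (auto simp: space_pair_measure)
    then have "isCont (\<lambda>x. F x (snd z)) (fst z)"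
      using cont by (simp add: continuous_on_eq_continuous_at)
    then show "(\<lambda>i. F (S i z) (snd z)) \<longlonglongrightarrow> F (fst z) (snd z)"
      using S(2)[OF z] by (rule isCont_tendsto_compose)
  qed
  then show ?thesis by (simp add: case_prod_beta')
qed

lemma integral_unif_sphere_uminus:
  fixes \<phi> :: "'a::euclidean_space \<Rightarrow> 'b::{banach, second_countable_topology}"
  assumes [measurable]: "\<phi> \<in> borel_measurable borel"
  shows "(\<integral>w. \<phi> (- w) \<partial>unif_sphere) = (\<integral>w. \<phi> w \<partial>unif_sphere)"
proof -
  have "ball_vol TYPE('a) *\<^sub>R (\<integral>x. \<phi> (x /\<^sub>R norm x) \<partial>unif_ball) = (\<integral>x. indicator (cball 0 1) x *\<^sub>R \<phi> (x /\<^sub>R norm x) \<partial>lborel)"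
    by (rule integral_unif_ball) measurable
  also have "\<dots> = (\<integral>x. indicator (cball 0 1) x *\<^sub>R \<phi> (- (x /\<^sub>R norm x)) \<partial>lborel)"
    by (subst lborel_integral_affine[of _ "-1" 0]) (auto simp: indicator_def)
  also have "\<dots> = ball_vol TYPE('a) *\<^sub>R (\<integral>x. \<phi> (- (x /\<^sub>R norm x)) \<partial>unif_ball)"
    by (rule integral_unif_ball[symmetric]) measurable
  finally show ?thesis
    using ball_vol_pos[where 'a='a] by (simp add: integral_unif_sphere)
qed

lemma integral_uniform_unit_interval:
  fixes \<phi> :: "real \<Rightarrow> real"
  assumes [measurable]: "\<phi> \<in> borel_measurable borel"
  shows "(\<integral>s. \<phi> s \<partial>uniform_measure lborel {0..1}) = (\<integral>s. indicator {0..1} s * \<phi> s \<partial>lborel)"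
proof -
  have "uniform_measure lborel {0..1} = density lborel (\<lambda>s::real. ennreal (indicator {0..1} s))"
    unfolding uniform_measure_def by (intro arg_cong2[where f=density] refl ext) (auto simp: indicator_def divide_ennreal_def)
  then show ?thesis by (simp add: integral_density)
qed

lemma prob_space_uniform_unit_interval: "prob_space (uniform_measure lborel {0..1::real})"
  by (rule prob_space_uniform_measure) auto

section \<open>Mean and second moment of the estimator\<close>

locale stochastic_objective =
  fixes \<Xi> :: "'w measure" and F :: "real^'n \<Rightarrow> 'w \<Rightarrow> real" and L :: "'w \<Rightarrow> real"
    and f :: "real^'n \<Rightarrow> real" and L0 :: real
  assumes prob: "prob_space \<Xi>"
    and L0_pos: "0 < L0"
    and F_int: "\<And>x. integrable \<Xi> (F x)"
    and f_eq: "\<And>x. f x = (\<integral>\<xi>. F x \<xi> \<partial>\<Xi>)"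
    and F_lip: "\<And>\<xi>. \<xi> \<in> space \<Xi> \<Longrightarrow> (L \<xi>)-lipschitz_on UNIV (\<lambda>x. F x \<xi>)"
    and L2_int: "integrable \<Xi> (\<lambda>\<xi>. (L \<xi>)\<^sup>2)"
    and L2_le: "(\<integral>\<xi>. (L \<xi>)\<^sup>2 \<partial>\<Xi>) \<le> L0\<^sup>2"
begin

sublocale \<Xi>: prob_space \<Xi> by (rule prob)

lemma dn_ge1: "1 \<le> real CARD('n)" by (simp add: Suc_le_eq)

lemma L_nonneg: "\<xi> \<in> space \<Xi> \<Longrightarrow> 0 \<le> L \<xi>"
  using F_lip by (rule lipschitz_on_nonneg)

text \<open>Measurability is assumed through the square of \<open>L\<close>; nonnegativity, which
  comes with the Lipschitz condition, recovers \<open>L\<close> as its root.\<close>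

lemma L_measurable [measurable]: "L \<in> borel_measurable \<Xi>"
proof -
  have "(\<lambda>\<xi>. sqrt ((L \<xi>)\<^sup>2)) \<in> borel_measurable \<Xi>" 
    by (rule borel_measurable_continuous_on[OF continuous_on_real_sqrt[OF continuous_on_id] borel_measurable_integrable[OF L2_int]])
  then show ?thesis by (rule measurable_cong[THEN iffD1, rotated]) (simp add: L_nonneg)
qed

lemma L_int: "integrable \<Xi> L"
  by (rule \<Xi>.square_integrable_imp_integrable[OF L_measurable L2_int])

lemma L_le: "(\<integral>\<xi>. L \<xi> \<partial>\<Xi>) \<le> L0"
proof -
  \<comment> \<open>Jensen's inequality as nonnegativity of the variance.\<close>
  have "(\<integral>\<xi>. L \<xi> \<partial>\<Xi>)\<^sup>2 \<le> (\<integral>\<xi>. (L \<xi>)\<^sup>2 \<partial>\<Xi>)"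
    using \<Xi>.variance_eq[OF L_int L2_int] \<Xi>.variance_positive[of L] by simp
  also have "\<dots> \<le> L0\<^sup>2" by (rule L2_le)
  finally show ?thesis by (rule power2_le_imp_le) (use L0_pos in simp)
qed

lemma F_measurable [measurable]: "(\<lambda>(x, \<xi>). F x \<xi>) \<in> borel_measurable (borel \<Otimes>\<^sub>M \<Xi>)"
proof (rule borel_measurable_Caratheodory)
  show "F x \<in> borel_measurable \<Xi>" for x by (rule borel_measurable_integrable[OF F_int])
  show "continuous_on UNIV (\<lambda>x. F x \<xi>)" if "\<xi> \<in> space \<Xi>" for \<xi>
    by (rule lipschitz_on_continuous_on[OF F_lip[OF that]])
qed

lemma f_lip: "L0-lipschitz_on UNIV f"
proof (rule lipschitz_onI)
  fix x y
  have "f x - f y = (\<integral>\<xi>. F x \<xi> - F y \<xi> \<partial>\<Xi>)" using F_int by (simp add: f_eq)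
  also have "\<bar>\<dots>\<bar> \<le> (\<integral>\<xi>. \<bar>F x \<xi> - F y \<xi>\<bar> \<partial>\<Xi>)" by (rule integral_abs_bound)
  also have "\<dots> \<le> (\<integral>\<xi>. L \<xi> * norm (x - y) \<partial>\<Xi>)"
  proof (rule integral_mono)
    show "integrable \<Xi> (\<lambda>\<xi>. \<bar>F x \<xi> - F y \<xi>\<bar>)"
      by (intro integrable_abs Bochner_Integration.integrable_diff F_int)
    show "integrable \<Xi> (\<lambda>\<xi>. L \<xi> * norm (x - y))" by (intro integrable_mult_left L_int)
    show "\<bar>F x \<xi> - F y \<xi>\<bar> \<le> L \<xi> * norm (x - y)" if "\<xi> \<in> space \<Xi>" for \<xi>
      by (rule lipschitz_abs_diff[OF F_lip[OF that]])
  qed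
  also have "\<dots> = (\<integral>\<xi>. L \<xi> \<partial>\<Xi>) * norm (x - y)" by simp
  also have "\<dots> \<le> L0 * norm (x - y)" using L_le by (intro mult_right_mono) auto
  finally show "dist (f x) (f y) \<le> L0 * dist x y" by (simp add: dist_norm)
qed (use L0_pos in simp)

text \<open>The value returned by \<open>grad_estimator\<close> when \<open>F\<close> answers its
  two queries.\<close>

definition grad_est :: "real \<Rightarrow> real^'n \<Rightarrow> 'w \<Rightarrow> real^'n \<Rightarrow> real^'n" where
  "grad_est \<rho> z \<xi> w = (real CARD('n) / (2 * \<rho>) * (F (z + \<rho> *\<^sub>R w) \<xi> - F (z - \<rho> *\<^sub>R w) \<xi>)) *\<^sub>R w"

definition samples :: "('w \<times> real \<times> (real^'n)) measure" where
  "samples = \<Xi> \<Otimes>\<^sub>M uniform_measure lborel {0..1} \<Otimes>\<^sub>M unif_sphere"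

abbreviation interval_sphere :: "(real \<times> (real^'n)) measure" where
  "interval_sphere \<equiv> uniform_measure lborel {0..1} \<Otimes>\<^sub>M unif_sphere"

lemma prob_space_interval_sphere: "prob_space interval_sphere"
proof -
  interpret U: prob_space "uniform_measure lborel {0..1::real}" by (rule prob_space_uniform_unit_interval)
  interpret S: prob_space "unif_sphere :: (real^'n) measure" by (rule prob_space_unif_sphere)
  interpret pair_prob_space "uniform_measure lborel {0..1::real}" "unif_sphere :: (real^'n) measure" ..
  show ?thesis by unfold_locales
qed

lemma prob_space_samples: "prob_space samples"
proof -
  interpret I: prob_space interval_sphere by (rule prob_space_interval_sphere)
  interpret pair_prob_space \<Xi> interval_sphere ..
  show ?thesis unfolding samples_def by unfold_locales
qed

lemma sets_samples [measurable_cong]: "sets samples = sets (\<Xi> \<Otimes>\<^sub>M borel \<Otimes>\<^sub>M borel)"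
  unfolding samples_def by (intro sets_pair_measure_cong) auto

lemma grad_est_measurable [measurable (raw)]:
  assumes [measurable]: "z \<in> borel_measurable M" "\<xi> \<in> measurable M \<Xi>" "w \<in> borel_measurable M"
  shows "(\<lambda>a. grad_est \<rho> (z a) (\<xi> a) (w a)) \<in> borel_measurable M"
  unfolding grad_est_def by measurable

lemma nn_integral_samples:
  assumes [measurable]: "\<phi> \<in> borel_measurable samples"
  shows "(\<integral>\<^sup>+a. \<phi> a \<partial>samples) = (\<integral>\<^sup>+\<xi>. \<integral>\<^sup>+s. \<integral>\<^sup>+w. \<phi> (\<xi>, s, w) \<partial>unif_sphere \<partial>uniform_measure lborel {0..1} \<partial>\<Xi>)"
proof -
  interpret S: prob_space "unif_sphere :: (real^'n) measure" by (rule prob_space_unif_sphere)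
  interpret I: prob_space interval_sphere by (rule prob_space_interval_sphere)
  have "(\<integral>\<^sup>+a. \<phi> a \<partial>samples) = (\<integral>\<^sup>+\<xi>. \<integral>\<^sup>+b. \<phi> (\<xi>, b) \<partial>interval_sphere \<partial>\<Xi>)"
    unfolding samples_def by (rule I.nn_integral_fst[symmetric]) measurable
  also have "\<dots> = (\<integral>\<^sup>+\<xi>. \<integral>\<^sup>+s. \<integral>\<^sup>+w. \<phi> (\<xi>, s, w) \<partial>unif_sphere \<partial>uniform_measure lborel {0..1} \<partial>\<Xi>)"
    by (intro nn_integral_cong S.nn_integral_fst[symmetric]) measurable
  finally show ?thesis .
qed

lemma grad_est_sphere_moment:
  assumes \<xi>: "\<xi> \<in> space \<Xi>" and \<rho>: "0 < \<rho>"
  shows "(\<integral>\<^sup>+w. ennreal ((norm (grad_est \<rho> z \<xi> w))\<^sup>2) \<partial>unif_sphere) \<le> ennreal (23 * real CARD('n) * (L \<xi>)\<^sup>2)"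
proof -
  interpret S: prob_space "unif_sphere :: (real^'n) measure" by (rule prob_space_unif_sphere)
  define h where "h w = F (z + \<rho> *\<^sub>R w) \<xi>" for w
  have h_lip: "(L \<xi> * \<rho>)-lipschitz_on UNIV h"
    unfolding h_def using lipschitz_on_affine[OF F_lip[OF \<xi>], of \<rho> z] \<rho> by simp
  have [measurable]: "h \<in> borel_measurable borel" using h_lip by (rule lipschitz_borel_measurable)
  let ?c = "(real CARD('n) / (2 * \<rho>))\<^sup>2"
  have i: "integrable unif_sphere (\<lambda>w. ?c * (h w - h (- w))\<^sup>2)"
  proof (rule S.integrable_const_bound[where B="?c * (2 * (L \<xi> * \<rho>))\<^sup>2"])
    show "AE w in unif_sphere. norm (?c * (h w - h (- w))\<^sup>2) \<le> ?c * (2 * (L \<xi> * \<rho>))\<^sup>2"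
      using AE_unif_sphere_norm
    proof eventually_elim
      fix w :: "real^'n" assume "norm w = 1"
      then have "\<bar>h w - h (- w)\<bar> \<le> 2 * (L \<xi> * \<rho>)"
        using lipschitz_abs_diff[OF h_lip, of w "- w"] by (simp add: scaleR_2[symmetric])
      then have "(h w - h (- w))\<^sup>2 \<le> (2 * (L \<xi> * \<rho>))\<^sup>2" by (subst abs_le_square_iff[symmetric]) auto
      then show "norm (?c * (h w - h (- w))\<^sup>2) \<le> ?c * (2 * (L \<xi> * \<rho>))\<^sup>2"
        by (simp add: mult_left_mono)
    qed
  qed measurable
  have "(\<integral>\<^sup>+w. ennreal ((norm (grad_est \<rho> z \<xi> w))\<^sup>2) \<partial>unif_sphere) = (\<integral>\<^sup>+w. ennreal (?c * (h w - h (- w))\<^sup>2) \<partial>unif_sphere)"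
  proof (rule nn_integral_cong_AE)
    show "AE w in unif_sphere. ennreal ((norm (grad_est \<rho> z \<xi> w))\<^sup>2) = ennreal (?c * (h w - h (- w))\<^sup>2)"
      using AE_unif_sphere_norm by eventually_elim (simp add: grad_est_def h_def power_mult_distrib power_divide)
  qed
  also have "\<dots> = ennreal (\<integral>w. ?c * (h w - h (- w))\<^sup>2 \<partial>unif_sphere)"
    by (rule nn_integral_eq_integral[OF i]) auto
  also have "(\<integral>w. ?c * (h w - h (- w))\<^sup>2 \<partial>unif_sphere) = ?c * (\<integral>w. (h w - h (- w))\<^sup>2 \<partial>unif_sphere)" by simp
  also have "\<dots> \<le> ?c * (90 * (L \<xi> * \<rho>)\<^sup>2 / real CARD('n))"
    using sphere_antipodal_variance[OF h_lip] by (intro mult_left_mono) auto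
  \<comment> \<open>The exact constant is 90 / 4 = 22.5; the radius cancels because \<open>h\<close>
    has Lipschitz constant \<open>L \<xi> * \<rho>\<close>.\<close>
  also have "\<dots> \<le> 23 * real CARD('n) * (L \<xi>)\<^sup>2"
    using \<rho> dn_ge1 L_nonneg[OF \<xi>] by (simp add: power2_eq_square field_simps)
  finally show ?thesis by (simp add: ennreal_leI)
qed

lemma grad_est_samples_moment:
  assumes \<rho>: "0 < \<rho>"
  shows "(\<integral>\<^sup>+a. ennreal ((norm (grad_est \<rho> (x + fst (snd a) *\<^sub>R v) (fst a) (snd (snd a))))\<^sup>2) \<partial>samples) \<le> ennreal (23 * real CARD('n) * L0\<^sup>2)"
proof -
  interpret U: prob_space "uniform_measure lborel {0..1::real}" by (rule prob_space_uniform_unit_interval)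
  have "(\<integral>\<^sup>+a. ennreal ((norm (grad_est \<rho> (x + fst (snd a) *\<^sub>R v) (fst a) (snd (snd a))))\<^sup>2) \<partial>samples)
     = (\<integral>\<^sup>+\<xi>. \<integral>\<^sup>+s. \<integral>\<^sup>+w. ennreal ((norm (grad_est \<rho> (x + s *\<^sub>R v) \<xi> w))\<^sup>2) \<partial>unif_sphere \<partial>uniform_measure lborel {0..1} \<partial>\<Xi>)"
    by (subst nn_integral_samples) simp_all
  also have "\<dots> \<le> (\<integral>\<^sup>+\<xi>. \<integral>\<^sup>+(s::real). ennreal (23 * real CARD('n) * (L \<xi>)\<^sup>2) \<partial>uniform_measure lborel {0..1} \<partial>\<Xi>)"
    by (intro nn_integral_mono grad_est_sphere_moment[OF _ \<rho>])
  also have "\<dots> = (\<integral>\<^sup>+\<xi>. ennreal (23 * real CARD('n) * (L \<xi>)\<^sup>2) \<partial>\<Xi>)"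
    using U.emeasure_space_1 by simp
  also have "\<dots> = ennreal (\<integral>\<xi>. 23 * real CARD('n) * (L \<xi>)\<^sup>2 \<partial>\<Xi>)"
    using L2_int by (intro nn_integral_eq_integral) auto
  also have "\<dots> \<le> ennreal (23 * real CARD('n) * L0\<^sup>2)" using L2_le by (intro ennreal_leI) simp
  finally show ?thesis .
qed

lemma grad_est_samples_integrable:
  assumes \<rho>: "0 < \<rho>"
  shows "integrable samples (\<lambda>a. grad_est \<rho> (x + fst (snd a) *\<^sub>R v) (fst a) (snd (snd a)) \<bullet> c)"
proof -
  interpret S: prob_space samples by (rule prob_space_samples)
  let ?g = "\<lambda>a. grad_est \<rho> (x + fst (snd a) *\<^sub>R v) (fst a) (snd (snd a))"
  have "integrable samples (\<lambda>a. (norm (?g a))\<^sup>2)"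
    using grad_est_samples_moment[OF \<rho>, of x v] by (intro integrableI_bounded) (measurable, auto intro: le_less_trans)
  then have "integrable samples (\<lambda>a. norm (?g a))"
    by (rule S.square_integrable_imp_integrable[rotated]) measurable
  then have "integrable samples ?g" by (subst (asm) integrable_norm_iff) measurable
  then show ?thesis by (rule integrable_inner_left) 
qed

text \<open>Averaging over \<open>\<xi>\<close> first replaces \<open>F\<close> by \<open>f\<close>.
  The symmetry of the sphere then makes both halves of the symmetric difference contribute equally,
  which cancels the 2 in \<open>2 * \<rho>\<close> and leaves \<open>sphere_grad\<close> at a
  uniform point of the segment.\<close>

lemma grad_est_samples_integral:
  assumes \<rho>: "0 < \<rho>"
  shows "(\<integral>a. grad_est \<rho> (x + fst (snd a) *\<^sub>R v) (fst a) (snd (snd a)) \<bullet> c \<partial>samples)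
    = (\<integral>s. indicator {0..1} s * (sphere_grad \<rho> f (x + s *\<^sub>R v) \<bullet> c) \<partial>lborel)"
proof -
  interpret U: prob_space "uniform_measure lborel {0..1::real}" by (rule prob_space_uniform_unit_interval)
  interpret S: prob_space "unif_sphere :: (real^'n) measure" by (rule prob_space_unif_sphere)
  interpret US: pair_prob_space "uniform_measure lborel {0..1::real}" "unif_sphere :: (real^'n) measure" ..
  interpret I: prob_space interval_sphere by (rule prob_space_interval_sphere)
  interpret P: pair_prob_space \<Xi> interval_sphere ..
  have [measurable]: "f \<in> borel_measurable borel" using f_lip by (rule lipschitz_borel_measurable)
  have "continuous_on UNIV (sphere_grad \<rho> f)" by (rule lipschitz_on_continuous_on[OF sphere_grad_lipschitz[OF f_lip \<rho>]])
  then have [measurable]: "sphere_grad \<rho> f \<in> borel_measurable borel" by (rule borel_measurable_continuous_onI)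
  define \<phi> where "\<phi> \<xi> b = grad_est \<rho> (x + fst b *\<^sub>R v) \<xi> (snd b) \<bullet> c" for \<xi> b
  define k where "k b = real CARD('n) / (2 * \<rho>) * (f (x + fst b *\<^sub>R v + \<rho> *\<^sub>R snd b) - f (x + fst b *\<^sub>R v - \<rho> *\<^sub>R snd b)) * (snd b \<bullet> c)" for b
  have i: "integrable (\<Xi> \<Otimes>\<^sub>M interval_sphere) (\<lambda>(\<xi>, b). \<phi> \<xi> b)"
    using grad_est_samples_integrable[OF \<rho>, of x v c] by (simp add: samples_def \<phi>_def case_prod_beta')
  have k: "(\<integral>\<xi>. \<phi> \<xi> b \<partial>\<Xi>) = k b" for b
  proof -
    have "(\<integral>\<xi>. \<phi> \<xi> b \<partial>\<Xi>) = (\<integral>\<xi>. (real CARD('n) / (2 * \<rho>) * (snd b \<bullet> c)) * (F (x + fst b *\<^sub>R v + \<rho> *\<^sub>R snd b) \<xi> - F (x + fst b *\<^sub>R v - \<rho> *\<^sub>R snd b) \<xi>) \<partial>\<Xi>)"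
      by (intro Bochner_Integration.integral_cong refl) (simp add: \<phi>_def grad_est_def)
    also have "\<dots> = k b" using F_int by (simp add: k_def f_eq)
    finally show ?thesis .
  qed
  have ki: "integrable interval_sphere k"
    using P.integrable_snd[OF i] unfolding k .
  have "(\<integral>a. grad_est \<rho> (x + fst (snd a) *\<^sub>R v) (fst a) (snd (snd a)) \<bullet> c \<partial>samples) = (\<integral>b. \<integral>\<xi>. \<phi> \<xi> b \<partial>\<Xi> \<partial>interval_sphere)"
    unfolding P.integral_snd[OF i] by (simp add: samples_def \<phi>_def case_prod_beta')
  also have "\<dots> = (\<integral>b. k b \<partial>interval_sphere)" unfolding k ..
  also have "\<dots> = (\<integral>s. \<integral>w. k (s, w) \<partial>unif_sphere \<partial>uniform_measure lborel {0..1})"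
    by (rule US.integral_fst'[OF ki, symmetric])
  also have "\<dots> = (\<integral>s. sphere_grad \<rho> f (x + s *\<^sub>R v) \<bullet> c \<partial>uniform_measure lborel {0..1})"
  proof (intro Bochner_Integration.integral_cong refl)
    fix s :: real
    define z where "z = x + s *\<^sub>R v"
    have iw: "integrable unif_sphere (\<lambda>w. f (z + r *\<^sub>R w) * (w \<bullet> c))" for r
      using integrable_inner_left[OF integrable_unif_sphere_lipschitz[OF f_lip, of z r], of c] by simp
    have "(\<integral>w. k (s, w) \<partial>unif_sphere) = (\<integral>w. real CARD('n) / (2 * \<rho>) * (f (z + \<rho> *\<^sub>R w) * (w \<bullet> c) - f (z + (- \<rho>) *\<^sub>R w) * (w \<bullet> c)) \<partial>unif_sphere)"
      by (intro Bochner_Integration.integral_cong refl) (simp add: k_def z_def algebra_simps)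
    also have "\<dots> = real CARD('n) / (2 * \<rho>) * ((\<integral>w. f (z + \<rho> *\<^sub>R w) * (w \<bullet> c) \<partial>unif_sphere) - (\<integral>w. f (z + (- \<rho>) *\<^sub>R w) * (w \<bullet> c) \<partial>unif_sphere))"
      by (simp only: integral_mult_right_zero Bochner_Integration.integral_diff[OF iw iw])
    also have "(\<integral>w. f (z + (- \<rho>) *\<^sub>R w) * (w \<bullet> c) \<partial>unif_sphere) = - (\<integral>w. f (z + \<rho> *\<^sub>R w) * (w \<bullet> c) \<partial>unif_sphere)"
      using integral_unif_sphere_uminus[of "\<lambda>w. f (z + \<rho> *\<^sub>R w) * (w \<bullet> c)"] by simp
    also have "real CARD('n) / (2 * \<rho>) * ((\<integral>w. f (z + \<rho> *\<^sub>R w) * (w \<bullet> c) \<partial>unif_sphere) - - (\<integral>w. f (z + \<rho> *\<^sub>R w) * (w \<bullet> c) \<partial>unif_sphere))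
       = sphere_grad \<rho> f z \<bullet> c"
      unfolding inner_sphere_grad[OF f_lip] using \<rho> by (simp add: field_simps)
    finally show "(\<integral>w. k (s, w) \<partial>unif_sphere) = sphere_grad \<rho> f (x + s *\<^sub>R v) \<bullet> c" by (simp add: z_def)
  qed
  also have "\<dots> = (\<integral>s. indicator {0..1} s * (sphere_grad \<rho> f (x + s *\<^sub>R v) \<bullet> c) \<partial>lborel)"
    by (rule integral_uniform_unit_interval) measurable
  finally show ?thesis .
qed

end

section \<open>Regret and expected progress along a run\<close>

text \<open>Resampling a single coordinate replaces conditioning on the past in the martingale arguments.\<close>

lemma distr_PiM_resample:
  assumes "prob_space M" "t \<in> I"
  shows measurable_PiM_resample: "(\<lambda>(x, X). fun_upd X t x) \<in> M \<Otimes>\<^sub>M PiM I (\<lambda>_. M) \<rightarrow>\<^sub>M PiM I (\<lambda>_. M)"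
    and "distr (M \<Otimes>\<^sub>M PiM I (\<lambda>_. M)) (PiM I (\<lambda>_. M)) (\<lambda>(x, X). fun_upd X t x) = PiM I (\<lambda>_. M)"
proof -
  have I: "insert t I = I" using assms(2) by auto
  have "(\<lambda>z. (\<lambda>(f, y). fun_upd f t y) (snd z, fst z)) \<in> M \<Otimes>\<^sub>M PiM I (\<lambda>_. M) \<rightarrow>\<^sub>M PiM (insert t I) (\<lambda>_. M)"
    by (rule measurable_compose[OF _ measurable_add_dim]) measurable
  then show "(\<lambda>(x, X). fun_upd X t x) \<in> M \<Otimes>\<^sub>M PiM I (\<lambda>_. M) \<rightarrow>\<^sub>M PiM I (\<lambda>_. M)"
    unfolding I by (simp add: case_prod_beta')
  show "distr (M \<Otimes>\<^sub>M PiM I (\<lambda>_. M)) (PiM I (\<lambda>_. M)) (\<lambda>(x, X). fun_upd X t x) = PiM I (\<lambda>_. M)"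
    using distr_pair_PiM_eq_PiM[of I "\<lambda>_. M" t] assms(1) unfolding I by simp
qed

lemma nn_integral_PiM_resample:
  assumes M: "prob_space M" and t: "t \<in> I" and \<psi>: "\<psi> \<in> borel_measurable (PiM I (\<lambda>_. M))"
  shows "(\<integral>\<^sup>+\<omega>. \<psi> \<omega> \<partial>PiM I (\<lambda>_. M)) = (\<integral>\<^sup>+\<omega>. \<integral>\<^sup>+a. \<psi> (fun_upd \<omega> t a) \<partial>M \<partial>PiM I (\<lambda>_. M))"
proof -
  interpret M: prob_space M by fact
  interpret P: prob_space "PiM I (\<lambda>_. M)" by (rule prob_space_PiM) (rule M)
  interpret MP: pair_prob_space M "PiM I (\<lambda>_. M)" ..
  note m = measurable_PiM_resample[OF M t]
  have "(\<integral>\<^sup>+\<omega>. \<psi> \<omega> \<partial>PiM I (\<lambda>_. M)) = (\<integral>\<^sup>+\<omega>. \<psi> \<omega> \<partial>distr (M \<Otimes>\<^sub>M PiM I (\<lambda>_. M)) (PiM I (\<lambda>_. M)) (\<lambda>(x, X). fun_upd X t x))"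
    unfolding distr_PiM_resample(2)[OF M t] ..
  also have "\<dots> = (\<integral>\<^sup>+z. \<psi> (case z of (x, X) \<Rightarrow> fun_upd X t x) \<partial>(M \<Otimes>\<^sub>M PiM I (\<lambda>_. M)))"
    by (rule nn_integral_distr[OF m]) (simp add: \<psi>)
  also have "\<dots> = (\<integral>\<^sup>+\<omega>. \<integral>\<^sup>+a. \<psi> (fun_upd \<omega> t a) \<partial>M \<partial>PiM I (\<lambda>_. M))"
    using MP.nn_integral_snd[OF measurable_compose[OF m \<psi>]] by simp
  finally show ?thesis .
qed

lemma integral_PiM_resample:
  fixes \<psi> :: "_ \<Rightarrow> real"
  assumes M: "prob_space M" and t: "t \<in> I" and int: "integrable (PiM I (\<lambda>_. M)) \<psi>"
  shows "(\<integral>\<omega>. \<psi> \<omega> \<partial>PiM I (\<lambda>_. M)) = (\<integral>\<omega>. \<integral>a. \<psi> (fun_upd \<omega> t a) \<partial>M \<partial>PiM I (\<lambda>_. M))"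
proof -
  interpret M: prob_space M by fact
  interpret P: prob_space "PiM I (\<lambda>_. M)" by (rule prob_space_PiM) (rule M)
  interpret MP: pair_prob_space M "PiM I (\<lambda>_. M)" ..
  note m = measurable_PiM_resample[OF M t]
  have "integrable (distr (M \<Otimes>\<^sub>M PiM I (\<lambda>_. M)) (PiM I (\<lambda>_. M)) (\<lambda>(x, X). fun_upd X t x)) \<psi>"
    unfolding distr_PiM_resample(2)[OF M t] by (rule int)
  from integrable_distr[OF m this]
  have i: "integrable (M \<Otimes>\<^sub>M PiM I (\<lambda>_. M)) (\<lambda>(x, X). \<psi> (fun_upd X t x))"
    by (simp add: case_prod_beta')
  have "(\<integral>\<omega>. \<psi> \<omega> \<partial>PiM I (\<lambda>_. M)) = (\<integral>\<omega>. \<psi> \<omega> \<partial>distr (M \<Otimes>\<^sub>M PiM I (\<lambda>_. M)) (PiM I (\<lambda>_. M)) (\<lambda>(x, X). fun_upd X t x))"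
    unfolding distr_PiM_resample(2)[OF M t] ..
  also have "\<dots> = (\<integral>z. \<psi> (case z of (x, X) \<Rightarrow> fun_upd X t x) \<partial>(M \<Otimes>\<^sub>M PiM I (\<lambda>_. M)))"
    by (rule integral_distr[OF m borel_measurable_integrable[OF int]])
  also have "\<dots> = (\<integral>z. (case z of (x, X) \<Rightarrow> \<psi> (fun_upd X t x)) \<partial>(M \<Otimes>\<^sub>M PiM I (\<lambda>_. M)))"
    by (simp add: case_prod_beta')
  also have "\<dots> = (\<integral>\<omega>. \<integral>a. \<psi> (fun_upd \<omega> t a) \<partial>M \<partial>PiM I (\<lambda>_. M))"
    by (rule MP.integral_snd[OF i, symmetric])
  finally show ?thesis .
qed

section \<open>Oracle computations and projected gradient descent\<close>

lemma run_comp_bind: "run_comp orc (bind_comp c h) = run_comp orc (h (run_comp orc c))"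
  by (induction c) auto

lemma num_queries_bind: "num_queries orc (bind_comp c h) = num_queries orc c + num_queries orc (h (run_comp orc c))"
  by (induction c) auto

text \<open>Projection onto the ball of radius \<open>D\<close>. At \<open>v = 0\<close> the
  quotient is 0 by convention, and the result is 0 as it should be.\<close>

definition clip :: "real \<Rightarrow> 'a::real_normed_vector \<Rightarrow> 'a" where
  "clip D v = min 1 (D / norm v) *\<^sub>R v"

lemma clip_cases:
  assumes "0 < D"
  shows "clip D v = (if norm v \<le> D then v else (D / norm v) *\<^sub>R v)"
  using assms by (cases "v = 0") (auto simp: clip_def min_def divide_simps)

lemma norm_clip: "0 < D \<Longrightarrow> norm (clip D v) \<le> D"
  by (auto simp: clip_cases)

lemma borel_measurable_clip [measurable]:
  "(clip D :: 'a::euclidean_space \<Rightarrow> 'a) \<in> borel_measurable borel"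
  unfolding clip_def by measurable

text \<open>At the projection \<open>p\<close> of an outer point \<open>v\<close>, the vector
  \<open>v - p\<close> makes no acute angle with \<open>u - p\<close> for any \<open>u\<close> in
  the ball; expanding \<open>norm (v - u)\<close> about \<open>p\<close> gives the claim.\<close>

lemma clip_nonexpansive:
  fixes v u :: "'a::real_inner"
  assumes D: "0 < D" and u: "norm u \<le> D"
  shows "norm (clip D v - u) \<le> norm (v - u)"
proof (cases "norm v \<le> D")
  case False
  define p where "p = (D / norm v) *\<^sub>R v"
  have nv: "0 < norm v" using False D by linarith
  have "v \<bullet> u \<le> norm v * D"
    using norm_cauchy_schwarz[of v u] mult_left_mono[OF u norm_ge_zero[of v]] by linarith
  then have "v \<bullet> (u - p) \<le> 0"
    using nv by (simp add: p_def inner_diff_right dot_square_norm power2_eq_square mult.commute)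
  moreover have "v - p = (1 - D / norm v) *\<^sub>R v" by (simp add: p_def scaleR_diff_left)
  moreover have "0 \<le> 1 - D / norm v" using False nv by (simp add: divide_simps)
  ultimately have neg: "(v - p) \<bullet> (u - p) \<le> 0" by (simp add: mult_nonneg_nonpos)
  have "(norm (v - u))\<^sup>2 = (norm (v - p))\<^sup>2 + (norm (p - u))\<^sup>2 - 2 * ((v - p) \<bullet> (u - p))"
    unfolding power2_norm_eq_inner by (simp add: inner_diff inner_commute algebra_simps)
  then have "(norm (p - u))\<^sup>2 \<le> (norm (v - u))\<^sup>2" using neg zero_le_power2[of "norm (v - p)"] by linarith
  then have "norm (p - u) \<le> norm (v - u)" by (rule power2_le_imp_le) simp
  moreover have "clip D v = p" using False by (simp add: clip_cases[OF D] p_def)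
  ultimately show ?thesis by simp
qed (simp add: clip_cases[OF D])

text \<open>The squared distance to the comparator is the potential and telescopes. The algorithm
  does not restart at block boundaries, so the initial distance is only known to be at most
  \<open>2 * D\<close>; this gives the term \<open>2 * D\<^sup>2 / \<eta>\<close>.\<close>

lemma clipped_gradient_regret:
  fixes \<Delta> g :: "nat \<Rightarrow> 'a::real_inner"
  assumes D: "0 < D" and \<eta>: "0 < \<eta>" and u: "norm u \<le> D" and bd: "\<And>j. norm (\<Delta> j) \<le> D"
    and step: "\<And>j. \<Delta> (Suc j) = clip D (\<Delta> j - \<eta> *\<^sub>R g j)" and ab: "a \<le> b"
  shows "(\<Sum>j=a..<b. g j \<bullet> (\<Delta> j - u)) \<le> 2 * D\<^sup>2 / \<eta> + \<eta> / 2 * (\<Sum>j=a..<b. (norm (g j))\<^sup>2)"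
proof -
  have one: "2 * \<eta> * (g j \<bullet> (\<Delta> j - u)) \<le> ((norm (\<Delta> j - u))\<^sup>2 - (norm (\<Delta> (Suc j) - u))\<^sup>2) + \<eta>\<^sup>2 * (norm (g j))\<^sup>2" for j
  proof -
    have "(norm (\<Delta> (Suc j) - u))\<^sup>2 \<le> (norm (\<Delta> j - \<eta> *\<^sub>R g j - u))\<^sup>2"
      unfolding step by (intro power_mono clip_nonexpansive[OF D u]) auto
    also have "\<dots> = (norm (\<Delta> j - u))\<^sup>2 - 2 * \<eta> * (g j \<bullet> (\<Delta> j - u)) + \<eta>\<^sup>2 * (norm (g j))\<^sup>2"
      unfolding power2_norm_eq_inner by (simp add: inner_diff inner_commute algebra_simps power2_eq_square)
    finally show ?thesis by simp
  qed
  have tele: "(\<Sum>j=a..<b. (norm (\<Delta> j - u))\<^sup>2 - (norm (\<Delta> (Suc j) - u))\<^sup>2) = (norm (\<Delta> a - u))\<^sup>2 - (norm (\<Delta> b - u))\<^sup>2"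
    using sum_Suc_diff'[OF ab, of "\<lambda>j. - (norm (\<Delta> j - u))\<^sup>2"] by simp
  have "norm (\<Delta> a - u) \<le> 2 * D" using norm_triangle_ineq4[of "\<Delta> a" u] bd[of a] u by linarith
  then have start: "(norm (\<Delta> a - u))\<^sup>2 \<le> (2 * D)\<^sup>2" by (intro power_mono) auto
  have "2 * \<eta> * (\<Sum>j=a..<b. g j \<bullet> (\<Delta> j - u)) \<le> (\<Sum>j=a..<b. ((norm (\<Delta> j - u))\<^sup>2 - (norm (\<Delta> (Suc j) - u))\<^sup>2) + \<eta>\<^sup>2 * (norm (g j))\<^sup>2)"
    unfolding sum_distrib_left by (intro sum_mono one)
  also have "\<dots> = (norm (\<Delta> a - u))\<^sup>2 - (norm (\<Delta> b - u))\<^sup>2 + \<eta>\<^sup>2 * (\<Sum>j=a..<b. (norm (g j))\<^sup>2)"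
    by (simp add: sum.distrib tele sum_distrib_left)
  also have "\<dots> \<le> (2 * D)\<^sup>2 + \<eta>\<^sup>2 * (\<Sum>j=a..<b. (norm (g j))\<^sup>2)"
    using start zero_le_power2[of "norm (\<Delta> b - u)"] by linarith
  also have "\<dots> = 2 * \<eta> * (2 * D\<^sup>2 / \<eta> + \<eta> / 2 * (\<Sum>j=a..<b. (norm (g j))\<^sup>2))"
    using \<eta> by (simp add: field_simps power2_eq_square)
  finally show ?thesis using \<eta> by simp
qed

section \<open>The run as a random process\<close>

locale zero_order_run = stochastic_objective \<Xi> F L f L0
  for \<Xi> :: "'w measure" and F :: "real^'n \<Rightarrow> 'w \<Rightarrow> real" and L f L0 +
  fixes x0 :: "real^'n" and \<rho> D \<eta> :: real
  assumes \<rho>_pos: "0 < \<rho>" and D_pos: "0 < D" and \<eta>_pos: "0 < \<eta>"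
begin

abbreviation "f\<rho> \<equiv> ball_avg \<rho> f"
abbreviation "G \<equiv> sphere_grad \<rho> f"

definition query_point :: "'w \<times> real \<times> (real^'n) \<Rightarrow> (real^'n) \<times> (real^'n) \<Rightarrow> real^'n" where
  "query_point a p = fst p + fst (snd a) *\<^sub>R snd p"

definition query_grad :: "'w \<times> real \<times> (real^'n) \<Rightarrow> (real^'n) \<times> (real^'n) \<Rightarrow> real^'n" where
  "query_grad a p = grad_est \<rho> (fst p + fst (snd a) *\<^sub>R snd p) (fst a) (snd (snd a))"

text \<open>The pair of position and next increment, free of the oracle and of the list of queried
  points. Measurability and expectations are handled in this form, to which
  \<open>run_alg_rounds\<close> reduces the program.\<close>

primrec state :: "(nat \<Rightarrow> 'w \<times> real \<times> (real^'n)) \<Rightarrow> nat \<Rightarrow> (real^'n) \<times> (real^'n)" where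
  "state \<omega> 0 = (x0, 0)"
| "state \<omega> (Suc j) = (fst (state \<omega> j) + snd (state \<omega> j),
     clip D (snd (state \<omega> j) - \<eta> *\<^sub>R query_grad (\<omega> (Suc j)) (state \<omega> j)))"

text \<open>Rounds are indexed from \<open>0\<close>: round \<open>j\<close> uses the sample \<open>\<omega> (Suc j)\<close>.\<close>

definition "pos \<omega> j = fst (state \<omega> j)"
definition "vel \<omega> j = snd (state \<omega> j)"
definition "qp \<omega> j = query_point (\<omega> (Suc j)) (state \<omega> j)"
definition "qg \<omega> j = query_grad (\<omega> (Suc j)) (state \<omega> j)"
text \<open>A martingale difference: \<open>G\<close> is taken at the same random point as the
  estimate, and the mean over the sample of round \<open>j\<close> vanishes when the earlier samples
  are fixed.\<close>

definition "noise \<omega> j = qg \<omega> j - G (qp \<omega> j)"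

lemma pos_Suc: "pos \<omega> (Suc j) = pos \<omega> j + vel \<omega> j"
  and vel_Suc: "vel \<omega> (Suc j) = clip D (vel \<omega> j - \<eta> *\<^sub>R qg \<omega> j)"
  by (simp_all add: pos_def vel_def qg_def)

lemma vel_bound: "norm (vel \<omega> j) \<le> D"
proof (cases j)
  case 0
  then show ?thesis using D_pos by (simp add: vel_def)
next
  case (Suc i)
  then show ?thesis by (simp add: vel_Suc norm_clip[OF D_pos] del: state.simps)
qed

text \<open>Adaptedness, on which every resampling argument rests: the first \<open>j\<close> rounds
  read no sample with a later index.\<close>

lemma state_upd: "j < t \<Longrightarrow> state (fun_upd \<omega> t a) j = state \<omega> j"
  by (induction j) auto

lemma run_alg_rounds:
  "run_comp (\<lambda>(x, \<xi>). F x \<xi>) (alg_rounds x0 \<rho> D \<eta> \<omega> t) = (pos \<omega> t, vel \<omega> t, map (qp \<omega>) [0..<t])"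
proof -
  show ?thesis
    by (induction t)
       (auto simp: run_comp_bind grad_estimator_def pos_def vel_def qp_def query_point_def query_grad_def grad_est_def clip_def
          Let_def split: prod.splits)
qed

context
  fixes T :: nat
begin

definition "P = PiM {1..T} (\<lambda>_. samples)"

lemma prob_space_P: "prob_space P"
  unfolding P_def by (rule prob_space_PiM) (rule prob_space_samples)

lemma sample_measurable [measurable]: "t \<in> {1..T} \<Longrightarrow> (\<lambda>\<omega>. \<omega> t) \<in> P \<rightarrow>\<^sub>M samples"
  unfolding P_def by (rule measurable_component_singleton)

lemma G_measurable [measurable]: "G \<in> borel_measurable borel"
  by (intro borel_measurable_continuous_onI lipschitz_on_continuous_on[OF sphere_grad_lipschitz[OF f_lip \<rho>_pos]])

lemma f\<rho>_measurable [measurable]: "f\<rho> \<in> borel_measurable borel"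
  by (intro borel_measurable_continuous_onI continuous_at_imp_continuous_on ballI
     GDERIV_ball_avg[OF f_lip \<rho>_pos, unfolded gderiv_def, THEN has_derivative_continuous])

lemma fst_sample [measurable]: "fst \<in> samples \<rightarrow>\<^sub>M \<Xi>"
  and snd_sample [measurable]: "snd \<in> samples \<rightarrow>\<^sub>M borel \<Otimes>\<^sub>M borel"
  unfolding measurable_cong_sets[OF sets_samples refl] by measurable

lemma query_grad_measurable [measurable (raw)]:
  assumes [measurable]: "a \<in> N \<rightarrow>\<^sub>M samples" "p \<in> N \<rightarrow>\<^sub>M borel \<Otimes>\<^sub>M borel"
  shows "(\<lambda>z. query_grad (a z) (p z)) \<in> borel_measurable N"
  unfolding query_grad_def by measurable

lemma query_point_measurable [measurable (raw)]:
  assumes [measurable]: "a \<in> N \<rightarrow>\<^sub>M samples" "p \<in> N \<rightarrow>\<^sub>M borel \<Otimes>\<^sub>M borel"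
  shows "(\<lambda>z. query_point (a z) (p z)) \<in> borel_measurable N"
  unfolding query_point_def by measurable

lemma state_measurable: "j \<le> T \<Longrightarrow> (\<lambda>\<omega>. state \<omega> j) \<in> P \<rightarrow>\<^sub>M borel \<Otimes>\<^sub>M borel"
proof (induction j)
  case (Suc j)
  then have [measurable]: "(\<lambda>\<omega>. state \<omega> j) \<in> P \<rightarrow>\<^sub>M borel \<Otimes>\<^sub>M borel" "(\<lambda>\<omega>. \<omega> (Suc j)) \<in> P \<rightarrow>\<^sub>M samples"
    by auto
  show ?case unfolding state.simps by measurable
qed simp

lemma run_measurable:
  shows pos_measurable: "j \<le> T \<Longrightarrow> (\<lambda>\<omega>. pos \<omega> j) \<in> borel_measurable P"
    and vel_measurable: "j \<le> T \<Longrightarrow> (\<lambda>\<omega>. vel \<omega> j) \<in> borel_measurable P"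
    and qp_measurable: "j < T \<Longrightarrow> (\<lambda>\<omega>. qp \<omega> j) \<in> borel_measurable P"
    and qg_measurable: "j < T \<Longrightarrow> (\<lambda>\<omega>. qg \<omega> j) \<in> borel_measurable P"
    and noise_measurable: "j < T \<Longrightarrow> (\<lambda>\<omega>. noise \<omega> j) \<in> borel_measurable P"
proof -
  show "j \<le> T \<Longrightarrow> (\<lambda>\<omega>. pos \<omega> j) \<in> borel_measurable P" "j \<le> T \<Longrightarrow> (\<lambda>\<omega>. vel \<omega> j) \<in> borel_measurable P"
    unfolding pos_def vel_def using state_measurable[of j] by measurable
  assume j: "j < T"
  have [measurable]: "(\<lambda>\<omega>. state \<omega> j) \<in> P \<rightarrow>\<^sub>M borel \<Otimes>\<^sub>M borel" "(\<lambda>\<omega>. \<omega> (Suc j)) \<in> P \<rightarrow>\<^sub>M samples"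
    using j state_measurable[of j] by auto
  show "(\<lambda>\<omega>. qp \<omega> j) \<in> borel_measurable P" "(\<lambda>\<omega>. qg \<omega> j) \<in> borel_measurable P" "(\<lambda>\<omega>. noise \<omega> j) \<in> borel_measurable P"
    unfolding noise_def qp_def qg_def by measurable
qed

text \<open>Integrating out the current sample first keeps position and velocity fixed, and the
  one-round bound is uniform in both.\<close>

lemma qg_moment:
  assumes j: "j < T"
  shows "(\<integral>\<^sup>+\<omega>. ennreal ((norm (qg \<omega> j))\<^sup>2) \<partial>P) \<le> ennreal (23 * real CARD('n) * L0\<^sup>2)"
proof -
  interpret P: prob_space P by (rule prob_space_P)
  have [measurable]: "(\<lambda>\<omega>. qg \<omega> j) \<in> borel_measurable P" using j by (rule qg_measurable)
  have "(\<integral>\<^sup>+\<omega>. ennreal ((norm (qg \<omega> j))\<^sup>2) \<partial>P) = (\<integral>\<^sup>+\<omega>. \<integral>\<^sup>+a. ennreal ((norm (qg (fun_upd \<omega> (Suc j) a) j))\<^sup>2) \<partial>samples \<partial>P)"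
  proof -
    have "(\<lambda>\<omega>. ennreal ((norm (qg \<omega> j))\<^sup>2)) \<in> borel_measurable P" by measurable
    moreover have "Suc j \<in> {1..T}" using j by simp
    ultimately show ?thesis unfolding P_def by (intro nn_integral_PiM_resample prob_space_samples)
  qed
  also have "\<dots> \<le> (\<integral>\<^sup>+\<omega>. ennreal (23 * real CARD('n) * L0\<^sup>2) \<partial>P)"
  proof (intro nn_integral_mono)
    fix \<omega>
    have "qg (fun_upd \<omega> (Suc j) a) j = grad_est \<rho> (pos \<omega> j + fst (snd a) *\<^sub>R vel \<omega> j) (fst a) (snd (snd a))" for a
      by (simp add: qg_def query_grad_def state_upd pos_def vel_def)
    then show "(\<integral>\<^sup>+a. ennreal ((norm (qg (fun_upd \<omega> (Suc j) a) j))\<^sup>2) \<partial>samples) \<le> ennreal (23 * real CARD('n) * L0\<^sup>2)"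
      by (simp only: grad_est_samples_moment[OF \<rho>_pos])
  qed
  also have "\<dots> = ennreal (23 * real CARD('n) * L0\<^sup>2)" by (simp add: P.emeasure_space_1)
  finally show ?thesis .
qed

lemma qg_square_integrable: "j < T \<Longrightarrow> integrable P (\<lambda>\<omega>. (norm (qg \<omega> j))\<^sup>2)"
  using qg_moment[of j] qg_measurable[of j] by (intro integrableI_bounded) (auto intro: le_less_trans)

lemma qg_square_integral_le:
  assumes j: "j < T"
  shows "(\<integral>\<omega>. (norm (qg \<omega> j))\<^sup>2 \<partial>P) \<le> 23 * real CARD('n) * L0\<^sup>2"
proof -
  have "ennreal (\<integral>\<omega>. (norm (qg \<omega> j))\<^sup>2 \<partial>P) = (\<integral>\<^sup>+\<omega>. ennreal ((norm (qg \<omega> j))\<^sup>2) \<partial>P)"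
    by (rule nn_integral_eq_integral[symmetric, OF qg_square_integrable[OF j]]) auto
  then have "ennreal (\<integral>\<omega>. (norm (qg \<omega> j))\<^sup>2 \<partial>P) \<le> ennreal (23 * real CARD('n) * L0\<^sup>2)" using qg_moment[OF j] by (simp only:)
  then show ?thesis by (subst (asm) ennreal_le_iff) auto
qed

lemma qg_norm_integrable:
  assumes j: "j < T" shows "integrable P (\<lambda>\<omega>. norm (qg \<omega> j))"
proof -
  interpret P: prob_space P by (rule prob_space_P)
  show ?thesis
    by (rule P.square_integrable_imp_integrable[OF _ qg_square_integrable[OF j]])
       (use qg_measurable[OF j] in measurable)
qed

lemma qg_vel_integrable:
  assumes j: "j < T" shows "integrable P (\<lambda>\<omega>. qg \<omega> j \<bullet> vel \<omega> j)"
proof (rule Bochner_Integration.integrable_bound[of _ "\<lambda>\<omega>. D * norm (qg \<omega> j)"])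
  show "integrable P (\<lambda>\<omega>. D * norm (qg \<omega> j))" by (intro integrable_mult_right qg_norm_integrable j)
  have [measurable]: "(\<lambda>\<omega>. qg \<omega> j) \<in> borel_measurable P" "(\<lambda>\<omega>. vel \<omega> j) \<in> borel_measurable P"
    using j by (auto intro: qg_measurable vel_measurable)
  show "(\<lambda>\<omega>. qg \<omega> j \<bullet> vel \<omega> j) \<in> borel_measurable P" by measurable
  show "AE \<omega> in P. norm (qg \<omega> j \<bullet> vel \<omega> j) \<le> norm (D * norm (qg \<omega> j))"
  proof (intro AE_I2)
    fix \<omega>
    have "\<bar>qg \<omega> j \<bullet> vel \<omega> j\<bar> \<le> norm (qg \<omega> j) * norm (vel \<omega> j)" by (rule Cauchy_Schwarz_ineq2)
    also have "\<dots> \<le> norm (qg \<omega> j) * D" by (intro mult_left_mono vel_bound) auto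
    finally show "norm (qg \<omega> j \<bullet> vel \<omega> j) \<le> norm (D * norm (qg \<omega> j))" using D_pos by (simp add: mult.commute)
  qed
qed

text \<open>The reach of a run is deterministic. This bounds the smoothed values at the iterates,
  and so makes them integrable, even where \<open>f\<close> is unbounded.\<close>

lemma pos_dist: "norm (pos \<omega> j - x0) \<le> real j * D"
proof (induction j)
  case (Suc j)
  have "norm (pos \<omega> (Suc j) - x0) \<le> norm (pos \<omega> j - x0) + norm (vel \<omega> j)"
    using norm_triangle_ineq[of "pos \<omega> j - x0" "vel \<omega> j"] by (simp add: pos_Suc algebra_simps)
  then show ?case using Suc vel_bound[of \<omega> j] by (simp add: algebra_simps)
qed (simp add: pos_def)

lemma f\<rho>_pos_integrable:
  assumes j: "j \<le> T" shows "integrable P (\<lambda>\<omega>. f\<rho> (pos \<omega> j))"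
proof -
  interpret P: prob_space P by (rule prob_space_P)
  have [measurable]: "(\<lambda>\<omega>. pos \<omega> j) \<in> borel_measurable P" using j by (rule pos_measurable)
  have "\<bar>f\<rho> (pos \<omega> j)\<bar> \<le> \<bar>f x0\<bar> + L0 * (real j * D) + L0 * \<rho>" for \<omega>
    using ball_avg_approx[OF f_lip \<rho>_pos, of "pos \<omega> j"] lipschitz_abs_add[OF f_lip pos_dist, of x0 \<omega> j] by simp
  then show ?thesis by (intro P.integrable_const_bound[of _ "\<bar>f x0\<bar> + L0 * (real j * D) + L0 * \<rho>"]) auto
qed

lemma expected_decrease:
  assumes j: "j < T"
  shows "(\<integral>\<omega>. qg \<omega> j \<bullet> vel \<omega> j \<partial>P) = (\<integral>\<omega>. f\<rho> (pos \<omega> (Suc j)) \<partial>P) - (\<integral>\<omega>. f\<rho> (pos \<omega> j) \<partial>P)"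
proof -
  have "(\<integral>\<omega>. qg \<omega> j \<bullet> vel \<omega> j \<partial>P) = (\<integral>\<omega>. \<integral>a. qg (fun_upd \<omega> (Suc j) a) j \<bullet> vel (fun_upd \<omega> (Suc j) a) j \<partial>samples \<partial>P)"
    unfolding P_def by (rule integral_PiM_resample[OF prob_space_samples]) (use j qg_vel_integrable[OF j] in \<open>auto simp: P_def\<close>)
  also have "\<dots> = (\<integral>\<omega>. f\<rho> (pos \<omega> (Suc j)) - f\<rho> (pos \<omega> j) \<partial>P)"
  proof (intro Bochner_Integration.integral_cong refl)
    fix \<omega>
    have "(\<integral>a. qg (fun_upd \<omega> (Suc j) a) j \<bullet> vel (fun_upd \<omega> (Suc j) a) j \<partial>samples)
       = (\<integral>a. grad_est \<rho> (pos \<omega> j + fst (snd a) *\<^sub>R vel \<omega> j) (fst a) (snd (snd a)) \<bullet> vel \<omega> j \<partial>samples)"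
      by (simp add: qg_def vel_def pos_def query_grad_def state_upd)
    also have "\<dots> = f\<rho> (pos \<omega> j + vel \<omega> j) - f\<rho> (pos \<omega> j)"
      unfolding grad_est_samples_integral[OF \<rho>_pos] by (rule ball_avg_diff[OF f_lip \<rho>_pos, symmetric])
    finally show "(\<integral>a. qg (fun_upd \<omega> (Suc j) a) j \<bullet> vel (fun_upd \<omega> (Suc j) a) j \<partial>samples) = f\<rho> (pos \<omega> (Suc j)) - f\<rho> (pos \<omega> j)"
      by (simp add: pos_Suc)
  qed
  also have "\<dots> = (\<integral>\<omega>. f\<rho> (pos \<omega> (Suc j)) \<partial>P) - (\<integral>\<omega>. f\<rho> (pos \<omega> j) \<partial>P)"
    using j by (intro Bochner_Integration.integral_diff f\<rho>_pos_integrable) auto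
  finally show ?thesis .
qed

lemma G_bound: "norm (G z) \<le> L0"
  by (rule norm_sphere_grad_le[OF f_lip \<rho>_pos])

lemma noise_square_le: "(norm (noise \<omega> j))\<^sup>2 \<le> 2 * (norm (qg \<omega> j))\<^sup>2 + 2 * L0\<^sup>2"
proof -
  have "norm (noise \<omega> j) \<le> norm (qg \<omega> j) + L0"
    unfolding noise_def using norm_triangle_ineq4[of "qg \<omega> j" "G (qp \<omega> j)"] G_bound[of "qp \<omega> j"] by linarith
  then have "(norm (noise \<omega> j))\<^sup>2 \<le> (norm (qg \<omega> j) + L0)\<^sup>2" by (intro power_mono) auto
  also have "\<dots> \<le> 2 * (norm (qg \<omega> j))\<^sup>2 + 2 * L0\<^sup>2"
    using zero_le_power2[of "norm (qg \<omega> j) - L0"] by (simp add: power2_eq_square algebra_simps)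
  finally show ?thesis .
qed

lemma noise_square_integrable:
  assumes j: "j < T" shows "integrable P (\<lambda>\<omega>. (norm (noise \<omega> j))\<^sup>2)"
proof -
  interpret P: prob_space P by (rule prob_space_P)
  have [measurable]: "(\<lambda>\<omega>. noise \<omega> j) \<in> borel_measurable P" using j by (rule noise_measurable)
  show ?thesis
  proof (rule Bochner_Integration.integrable_bound[of _ "\<lambda>\<omega>. 2 * (norm (qg \<omega> j))\<^sup>2 + 2 * L0\<^sup>2"])
    show "integrable P (\<lambda>\<omega>. 2 * (norm (qg \<omega> j))\<^sup>2 + 2 * L0\<^sup>2)" using qg_square_integrable[OF j] by simp
  qed (measurable, use noise_square_le in auto)
qed

lemma noise_square_integral_le:
  assumes j: "j < T" shows "(\<integral>\<omega>. (norm (noise \<omega> j))\<^sup>2 \<partial>P) \<le> 49 * real CARD('n) * L0\<^sup>2"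
proof -
  interpret P: prob_space P by (rule prob_space_P)
  have "(\<integral>\<omega>. (norm (noise \<omega> j))\<^sup>2 \<partial>P) \<le> (\<integral>\<omega>. 2 * (norm (qg \<omega> j))\<^sup>2 + 2 * L0\<^sup>2 \<partial>P)"
    using noise_square_integrable[OF j] qg_square_integrable[OF j] by (intro integral_mono noise_square_le) auto
  also have "\<dots> = 2 * (\<integral>\<omega>. (norm (qg \<omega> j))\<^sup>2 \<partial>P) + 2 * L0\<^sup>2"
    using qg_square_integrable[OF j] P.prob_space by simp
  also have "\<dots> \<le> 2 * (23 * real CARD('n) * L0\<^sup>2) + 2 * (real CARD('n) * L0\<^sup>2)"
    using qg_square_integral_le[OF j] mult_right_mono[OF dn_ge1, of "L0\<^sup>2"] by simp
  \<comment> \<open>The sum is 48; it is raised to 49 to have the integral root 7 later.\<close>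
  also have "\<dots> \<le> 49 * real CARD('n) * L0\<^sup>2" by simp
  finally show ?thesis .
qed

lemma noise_inner_integrable:
  assumes "i < T" "j < T" shows "integrable P (\<lambda>\<omega>. noise \<omega> i \<bullet> noise \<omega> j)"
proof (rule Bochner_Integration.integrable_bound[of _ "\<lambda>\<omega>. (norm (noise \<omega> i))\<^sup>2 + (norm (noise \<omega> j))\<^sup>2"])
  have [measurable]: "(\<lambda>\<omega>. noise \<omega> i) \<in> borel_measurable P" "(\<lambda>\<omega>. noise \<omega> j) \<in> borel_measurable P"
    using assms by (auto intro: noise_measurable)
  show "integrable P (\<lambda>\<omega>. (norm (noise \<omega> i))\<^sup>2 + (norm (noise \<omega> j))\<^sup>2)" using assms noise_square_integrable by simp
  show "(\<lambda>\<omega>. noise \<omega> i \<bullet> noise \<omega> j) \<in> borel_measurable P" by measurable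
  show "AE \<omega> in P. norm (noise \<omega> i \<bullet> noise \<omega> j) \<le> norm ((norm (noise \<omega> i))\<^sup>2 + (norm (noise \<omega> j))\<^sup>2)"
  proof (intro AE_I2)
    fix \<omega>
    have "\<bar>noise \<omega> i \<bullet> noise \<omega> j\<bar> \<le> norm (noise \<omega> i) * norm (noise \<omega> j)" by (rule Cauchy_Schwarz_ineq2)
    also have "\<dots> \<le> (norm (noise \<omega> i))\<^sup>2 + (norm (noise \<omega> j))\<^sup>2"
      using sum_squares_bound[of "norm (noise \<omega> i)" "norm (noise \<omega> j)"] mult_nonneg_nonneg[OF norm_ge_zero[of "noise \<omega> i"] norm_ge_zero[of "noise \<omega> j"]] by linarith
    finally show "norm (noise \<omega> i \<bullet> noise \<omega> j) \<le> norm ((norm (noise \<omega> i))\<^sup>2 + (norm (noise \<omega> j))\<^sup>2)" by simp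
  qed
qed

lemma integral_samples_interval:
  fixes \<phi> :: "real \<Rightarrow> real"
  assumes [measurable]: "\<phi> \<in> borel_measurable borel" and bd: "\<And>s. \<bar>\<phi> s\<bar> \<le> B"
  shows "integrable samples (\<lambda>a. \<phi> (fst (snd a)))"
    and "(\<integral>a. \<phi> (fst (snd a)) \<partial>samples) = (\<integral>s. indicator {0..1} s * \<phi> s \<partial>lborel)"
proof -
  interpret S: prob_space "unif_sphere :: (real^'n) measure" by (rule prob_space_unif_sphere)
  interpret U: prob_space "uniform_measure lborel {0..1::real}" by (rule prob_space_uniform_unit_interval)
  interpret US: pair_prob_space "uniform_measure lborel {0..1::real}" "unif_sphere :: (real^'n) measure" ..
  interpret I: prob_space interval_sphere by (rule prob_space_interval_sphere)
  interpret IP: pair_prob_space \<Xi> interval_sphere ..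
  interpret A: prob_space samples by (rule prob_space_samples)
  show i: "integrable samples (\<lambda>a. \<phi> (fst (snd a)))"
    by (rule A.integrable_const_bound[of _ B]) (use bd in auto)
  have i2: "integrable interval_sphere (\<lambda>b. \<phi> (fst b))"
    by (rule US.integrable_const_bound[of _ B]) (use bd in auto)
  have "(\<integral>a. \<phi> (fst (snd a)) \<partial>samples) = (\<integral>\<xi>. \<integral>b. \<phi> (fst b) \<partial>interval_sphere \<partial>\<Xi>)"
    using IP.integral_fst'[of "\<lambda>a. \<phi> (fst (snd a))"] i by (simp add: samples_def)
  also have "\<dots> = (\<integral>b. \<phi> (fst b) \<partial>interval_sphere)" using \<Xi>.prob_space by simp
  also have "\<dots> = (\<integral>s. \<integral>(w::real^'n). \<phi> s \<partial>unif_sphere \<partial>uniform_measure lborel {0..1})"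
    using US.integral_fst'[OF i2] by simp
  also have "\<dots> = (\<integral>s. \<phi> s \<partial>uniform_measure lborel {0..1})" using S.prob_space by simp
  finally show "(\<integral>a. \<phi> (fst (snd a)) \<partial>samples) = (\<integral>s. indicator {0..1} s * \<phi> s \<partial>lborel)"
    by (simp add: integral_uniform_unit_interval)
qed

text \<open>Resampling the sample of round \<open>j\<close> leaves the earlier
  \<open>noise \<omega> i\<close> unchanged. It acts as a constant vector \<open>c\<close>, against
  which the estimate and the smoothed gradient have equal means.\<close>

lemma noise_orthogonal_less:
  assumes ij: "i < j" and j: "j < T"
  shows "(\<integral>\<omega>. noise \<omega> i \<bullet> noise \<omega> j \<partial>P) = 0"
proof -
  have "(\<integral>\<omega>. noise \<omega> i \<bullet> noise \<omega> j \<partial>P) = (\<integral>\<omega>. \<integral>a. noise (fun_upd \<omega> (Suc j) a) i \<bullet> noise (fun_upd \<omega> (Suc j) a) j \<partial>samples \<partial>P)"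
    unfolding P_def by (rule integral_PiM_resample[OF prob_space_samples])
      (use ij j noise_inner_integrable[of i j] in \<open>auto simp: P_def\<close>)
  also have "\<dots> = (\<integral>\<omega>. 0 \<partial>P)"
  proof (intro Bochner_Integration.integral_cong refl)
    fix \<omega>
    define c where "c = noise \<omega> i"
    let ?z = "\<lambda>s. pos \<omega> j + s *\<^sub>R vel \<omega> j"
    let ?g = "\<lambda>a. grad_est \<rho> (?z (fst (snd a))) (fst a) (snd (snd a)) \<bullet> c"
    have "\<bar>G z \<bullet> c\<bar> \<le> L0 * norm c" for z
      using Cauchy_Schwarz_ineq2[of "G z" c] mult_right_mono[OF G_bound norm_ge_zero[of c]] by (rule order_trans)
    note iv = integral_samples_interval[of "\<lambda>s. G (?z s) \<bullet> c", OF _ this]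
    have "(\<integral>a. noise (fun_upd \<omega> (Suc j) a) i \<bullet> noise (fun_upd \<omega> (Suc j) a) j \<partial>samples) = (\<integral>a. ?g a - G (?z (fst (snd a))) \<bullet> c \<partial>samples)"
      using ij by (intro Bochner_Integration.integral_cong refl)
        (simp add: noise_def c_def qg_def qp_def vel_def pos_def query_grad_def query_point_def state_upd inner_commute inner_diff)
    also have "\<dots> = (\<integral>a. ?g a \<partial>samples) - (\<integral>a. G (?z (fst (snd a))) \<bullet> c \<partial>samples)"
      by (intro Bochner_Integration.integral_diff grad_est_samples_integrable[OF \<rho>_pos] iv) measurable
    also have "\<dots> = 0"
      unfolding grad_est_samples_integral[OF \<rho>_pos] by (subst iv(2)) auto
    finally show "(\<integral>a. noise (fun_upd \<omega> (Suc j) a) i \<bullet> noise (fun_upd \<omega> (Suc j) a) j \<partial>samples) = 0" .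
  qed
  finally show ?thesis by simp
qed

lemma noise_orthogonal:
  assumes "i \<noteq> j" "i < T" "j < T"
  shows "(\<integral>\<omega>. noise \<omega> i \<bullet> noise \<omega> j \<partial>P) = 0"
  using assms noise_orthogonal_less[of i j] noise_orthogonal_less[of j i] by (cases "i < j") (auto simp: inner_commute)

text \<open>Orthogonality makes second moments additive, so the norm of the sum grows only with the
  root of the number of rounds. Nonnegativity of the variance passes from the second moment to the
  mean.\<close>

lemma noise_sum:
  assumes b: "b \<le> T" and ab: "a \<le> b"
  shows noise_sum_integrable: "integrable P (\<lambda>\<omega>. norm (\<Sum>j=a..<b. noise \<omega> j))"
    and noise_sum_expectation_le: "(\<integral>\<omega>. norm (\<Sum>j=a..<b. noise \<omega> j) \<partial>P) \<le> 7 * sqrt (real CARD('n) * real (b - a)) * L0"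
proof -
  interpret P: prob_space P by (rule prob_space_P)
  have lt: "j < T" if "j \<in> {a..<b}" for j using that b by simp
  let ?N = "\<lambda>\<omega>. norm (\<Sum>j=a..<b. noise \<omega> j)"
  have Nm [measurable]: "(\<lambda>\<omega>. \<Sum>j=a..<b. noise \<omega> j) \<in> borel_measurable P"
    by (intro borel_measurable_sum noise_measurable lt)
  have sq: "(?N \<omega>)\<^sup>2 = (\<Sum>i=a..<b. \<Sum>j=a..<b. noise \<omega> i \<bullet> noise \<omega> j)" for \<omega>
    unfolding power2_norm_eq_inner inner_sum_left inner_sum_right by (rule sum.swap)
  have i2: "integrable P (\<lambda>\<omega>. (?N \<omega>)\<^sup>2)"
    unfolding sq by (intro Bochner_Integration.integrable_sum noise_inner_integrable lt)
  show i1: "integrable P ?N"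
    by (rule P.square_integrable_imp_integrable[OF _ i2]) measurable
  have "(\<integral>\<omega>. (?N \<omega>)\<^sup>2 \<partial>P) = (\<Sum>i=a..<b. \<Sum>j=a..<b. \<integral>\<omega>. noise \<omega> i \<bullet> noise \<omega> j \<partial>P)"
    unfolding sq by (subst Bochner_Integration.integral_sum, intro Bochner_Integration.integrable_sum noise_inner_integrable lt; assumption?)
      (intro sum.cong refl Bochner_Integration.integral_sum noise_inner_integrable lt)
  also have "\<dots> = (\<Sum>i=a..<b. \<Sum>j=a..<b. if j = i then (\<integral>\<omega>. (norm (noise \<omega> i))\<^sup>2 \<partial>P) else 0)"
    using noise_orthogonal lt by (intro sum.cong refl) (auto simp: power2_norm_eq_inner)
  also have "\<dots> = (\<Sum>i=a..<b. \<integral>\<omega>. (norm (noise \<omega> i))\<^sup>2 \<partial>P)" by (simp add: sum.delta)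
  also have "\<dots> \<le> (\<Sum>i=a..<b. 49 * real CARD('n) * L0\<^sup>2)" by (intro sum_mono noise_square_integral_le lt)
  also have "\<dots> = (7 * sqrt (real CARD('n) * real (b - a)) * L0)\<^sup>2" by (simp add: power_mult_distrib)
  finally have "(\<integral>\<omega>. (?N \<omega>)\<^sup>2 \<partial>P) \<le> (7 * sqrt (real CARD('n) * real (b - a)) * L0)\<^sup>2" .
  moreover have "(\<integral>\<omega>. ?N \<omega> \<partial>P)\<^sup>2 \<le> (\<integral>\<omega>. (?N \<omega>)\<^sup>2 \<partial>P)"
    using P.variance_eq[OF i1 i2] P.variance_positive[of ?N] by simp
  ultimately have "(\<integral>\<omega>. ?N \<omega> \<partial>P)\<^sup>2 \<le> (7 * sqrt (real CARD('n) * real (b - a)) * L0)\<^sup>2" by (rule order_trans[rotated])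
  then show "(\<integral>\<omega>. ?N \<omega> \<partial>P) \<le> 7 * sqrt (real CARD('n) * real (b - a)) * L0"
    by (rule power2_le_imp_le) (use L0_pos in simp)
qed

text \<open>The comparator \<open>u\<close> depends on all samples of the block, so its product with
  the noise need not have mean zero. Cauchy-Schwarz keeps the norm of the noise sum instead, and the
  inequality holds for each outcome.\<close>

lemma block_gradient_sum_le:
  assumes ab: "a \<le> b"
  shows "D * norm (\<Sum>j=a..<b. G (qp \<omega> j)) \<le> 2 * D\<^sup>2 / \<eta> + \<eta> / 2 * (\<Sum>j=a..<b. (norm (qg \<omega> j))\<^sup>2)
     + D * norm (\<Sum>j=a..<b. noise \<omega> j) - (\<Sum>j=a..<b. qg \<omega> j \<bullet> vel \<omega> j)"
proof -
  define S where "S = (\<Sum>j=a..<b. G (qp \<omega> j))"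
  \<comment> \<open>For \<open>S = 0\<close> this is 0, with both sides of the identity below
    vanishing.\<close>
  define u where "u = - ((D / norm S) *\<^sub>R S)"
  have u: "norm u \<le> D" unfolding u_def using D_pos by (cases "S = 0") simp_all
  have Su: "S \<bullet> u = - (D * norm S)"
  proof (cases "S = 0")
    case False
    have "S \<bullet> u = - (D / norm S * (S \<bullet> S))" unfolding u_def by simp
    also have "S \<bullet> S = norm S * norm S" by (simp only: dot_square_norm power2_eq_square)
    finally show ?thesis using False by simp
  qed simp
  have sum_g: "(\<Sum>j=a..<b. qg \<omega> j) = S + (\<Sum>j=a..<b. noise \<omega> j)" by (simp add: S_def noise_def sum_subtractf)
  have "(\<Sum>j=a..<b. noise \<omega> j) \<bullet> u \<le> norm (\<Sum>j=a..<b. noise \<omega> j) * norm u" by (rule norm_cauchy_schwarz)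
  also have "\<dots> \<le> norm (\<Sum>j=a..<b. noise \<omega> j) * D" using u by (intro mult_left_mono) auto
  finally have Nu: "(\<Sum>j=a..<b. noise \<omega> j) \<bullet> u \<le> D * norm (\<Sum>j=a..<b. noise \<omega> j)" by (simp add: mult.commute)
  have "(\<Sum>j=a..<b. qg \<omega> j \<bullet> (vel \<omega> j - u)) = (\<Sum>j=a..<b. qg \<omega> j \<bullet> vel \<omega> j) - (\<Sum>j=a..<b. qg \<omega> j) \<bullet> u"
    by (simp add: inner_diff_right sum_subtractf inner_sum_left)
  moreover have "(\<Sum>j=a..<b. qg \<omega> j \<bullet> (vel \<omega> j - u)) \<le> 2 * D\<^sup>2 / \<eta> + \<eta> / 2 * (\<Sum>j=a..<b. (norm (qg \<omega> j))\<^sup>2)"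
    by (rule clipped_gradient_regret[where \<Delta>="vel \<omega>" and g="qg \<omega>", OF D_pos \<eta>_pos u vel_bound vel_Suc ab])
  ultimately show ?thesis using Su Nu unfolding sum_g inner_add_left S_def[symmetric] by linarith
qed

end

end

section \<open>From blocks to the output of the algorithm\<close>

context zero_order_run
begin

lemma AE_samples_interval: "AE a in samples. 0 \<le> fst (snd a) \<and> fst (snd a) \<le> 1"
proof -
  interpret U: prob_space "uniform_measure lborel {0..1::real}" by (rule prob_space_uniform_unit_interval)
  interpret S: prob_space "unif_sphere :: (real^'n) measure" by (rule prob_space_unif_sphere)
  let ?b = "\<lambda>s::real. if 0 \<le> s \<and> s \<le> 1 then 0 else 1 :: ennreal"
  have "AE s in uniform_measure lborel {0..1::real}. ?b s = 0" by (rule AE_uniform_measureI) auto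
  then have "(\<integral>\<^sup>+s. ?b s \<partial>uniform_measure lborel {0..1}) = 0" by (subst nn_integral_0_iff_AE) auto
  then have "(\<integral>\<^sup>+a. ?b (fst (snd a)) \<partial>samples) = 0"
    by (subst nn_integral_samples) (simp_all add: S.emeasure_space_1[simplified])
  then have "AE a in samples. ?b (fst (snd a)) = 0" by (subst (asm) nn_integral_0_iff_AE) auto
  then show ?thesis by eventually_elim (auto split: if_splits)
qed

text \<open>Query points lie on the segments of the path only almost surely; the distance bounds
  below hold on this event.\<close>

lemma AE_P_interval: "AE \<omega> in P T. \<forall>j<T. 0 \<le> fst (snd (\<omega> (Suc j))) \<and> fst (snd (\<omega> (Suc j))) \<le> 1"
proof -
  have "AE \<omega> in P T. j < T \<longrightarrow> 0 \<le> fst (snd (\<omega> (Suc j))) \<and> fst (snd (\<omega> (Suc j))) \<le> 1" for j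
  proof (cases "j < T")
    case True
    have "AE \<omega> in P T. 0 \<le> fst (snd (\<omega> (Suc j))) \<and> fst (snd (\<omega> (Suc j))) \<le> 1"
      unfolding P_def by (rule AE_PiM_component[OF prob_space_samples _ AE_samples_interval]) (use True in auto)
    then show ?thesis by eventually_elim simp
  qed simp
  then show ?thesis by (simp add: AE_all_countable)
qed

lemma pos_diff_le: "i \<le> j \<Longrightarrow> norm (pos \<omega> j - pos \<omega> i) \<le> real (j - i) * D"
proof (induction j)
  case (Suc j)
  show ?case
  proof (cases "i = Suc j")
    case False
    then have ij: "i \<le> j" using Suc by simp
    have "norm (pos \<omega> (Suc j) - pos \<omega> i) \<le> norm (pos \<omega> j - pos \<omega> i) + norm (vel \<omega> j)"
      using norm_triangle_ineq[of "pos \<omega> j - pos \<omega> i" "vel \<omega> j"] by (simp add: pos_Suc algebra_simps)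
    also have "\<dots> \<le> real (j - i) * D + D" using Suc.IH[OF ij] vel_bound[of \<omega> j] by simp
    also have "\<dots> = real (Suc j - i) * D" using ij by (simp add: Suc_diff_le algebra_simps)
    finally show ?thesis .
  qed simp
qed simp

lemma qp_diff_le:
  assumes s: "\<And>j. j < T \<Longrightarrow> 0 \<le> fst (snd (\<omega> (Suc j))) \<and> fst (snd (\<omega> (Suc j))) \<le> 1"
    and ij: "a \<le> i" "i < a + M" "a \<le> j" "j < a + M" and T: "a + M \<le> T"
  shows "norm (qp \<omega> i - qp \<omega> j) \<le> real M * D"
proof -
  have less: "norm (qp \<omega> i - qp \<omega> j) \<le> real M * D" if "a \<le> i" "i < j" "j < a + M" for i j
  proof -
    define t where "t j = fst (snd (\<omega> (Suc j)))" for j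
    have ti: "0 \<le> t i" "t i \<le> 1" and tj: "0 \<le> t j" "t j \<le> 1" using s[of i] s[of j] that T by (auto simp: t_def)
    have q: "qp \<omega> l = pos \<omega> l + t l *\<^sub>R vel \<omega> l" for l by (simp add: qp_def query_point_def pos_def vel_def t_def)
    have "qp \<omega> j - qp \<omega> i = (pos \<omega> j - pos \<omega> (Suc i)) + t j *\<^sub>R vel \<omega> j + (1 - t i) *\<^sub>R vel \<omega> i"
      by (simp add: q pos_Suc algebra_simps)
    then have "norm (qp \<omega> j - qp \<omega> i) \<le> norm (pos \<omega> j - pos \<omega> (Suc i)) + norm (t j *\<^sub>R vel \<omega> j) + norm ((1 - t i) *\<^sub>R vel \<omega> i)"
      using norm_triangle_ineq[of "(pos \<omega> j - pos \<omega> (Suc i)) + t j *\<^sub>R vel \<omega> j" "(1 - t i) *\<^sub>R vel \<omega> i"]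
        norm_triangle_ineq[of "pos \<omega> j - pos \<omega> (Suc i)" "t j *\<^sub>R vel \<omega> j"] by simp
    moreover have "norm (pos \<omega> j - pos \<omega> (Suc i)) \<le> real (j - Suc i) * D" using that by (intro pos_diff_le) simp
    moreover have "norm (t j *\<^sub>R vel \<omega> j) \<le> 1 * D"
      using tj vel_bound[of \<omega> j] mult_mono[of "t j" 1 "norm (vel \<omega> j)" D] by simp
    moreover have "norm ((1 - t i) *\<^sub>R vel \<omega> i) \<le> 1 * D"
      using ti vel_bound[of \<omega> i] mult_mono[of "1 - t i" 1 "norm (vel \<omega> i)" D] by simp
    moreover have "real (j - Suc i) * D + 1 * D + 1 * D \<le> real M * D"
    proof -
      \<comment> \<open>The rest of step \<open>i\<close>, the full steps in between and the
        beginning of step \<open>j\<close>: at most \<open>j - i + 1\<close> increments in all,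
        which is why \<open>M\<close> of them suffice.\<close>
      have "real (j - Suc i) + 2 \<le> real M" using that by linarith
      then have "(real (j - Suc i) + 2) * D \<le> real M * D" using D_pos by (intro mult_right_mono) auto
      then show ?thesis by (simp add: algebra_simps)
    qed
    ultimately show ?thesis by (simp add: norm_minus_commute)
  qed
  consider "i < j" | "j < i" | "i = j" by linarith
  then show ?thesis
  proof cases
    case 2
    then show ?thesis using less[of j i] ij by (simp add: norm_minus_commute)
  qed (use less[of i j] ij D_pos in auto)
qed

lemma qp_mean_diff_le:
  assumes s: "\<And>j. j < T \<Longrightarrow> 0 \<le> fst (snd (\<omega> (Suc j))) \<and> fst (snd (\<omega> (Suc j))) \<le> 1"
    and i: "a \<le> i" "i < a + M" and T: "a + M \<le> T"
  shows "norm (qp \<omega> i - (1 / real M) *\<^sub>R (\<Sum>j=a..<a+M. qp \<omega> j)) \<le> real M * D"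
proof -
  have M: "0 < M" using i by simp
  have "(\<Sum>j=a..<a+M. qp \<omega> i - qp \<omega> j) = real M *\<^sub>R qp \<omega> i - (\<Sum>j=a..<a+M. qp \<omega> j)"
    unfolding sum_subtractf sum_constant_scaleR by simp
  then have "qp \<omega> i - (1 / real M) *\<^sub>R (\<Sum>j=a..<a+M. qp \<omega> j) = (1 / real M) *\<^sub>R (\<Sum>j=a..<a+M. qp \<omega> i - qp \<omega> j)"
    using M by (simp add: scaleR_diff_right)
  also have "norm \<dots> = norm (\<Sum>j=a..<a+M. qp \<omega> i - qp \<omega> j) / real M" by simp
  also have "\<dots> \<le> (\<Sum>j=a..<a+M. real M * D) / real M"
    by (intro divide_right_mono order_trans[OF norm_sum] sum_mono qp_diff_le[where \<omega>=\<omega> and T=T, OF s]) (use i T in auto)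
  also have "\<dots> = real M * D" using M by simp
  finally show ?thesis .
qed

lemma block_stationarity:
  assumes s: "\<And>j. j < T \<Longrightarrow> 0 \<le> fst (snd (\<omega> (Suc j))) \<and> fst (snd (\<omega> (Suc j))) \<le> 1"
    and M: "0 < M" and T: "a + M \<le> T" and \<delta>: "real M * D + \<rho> \<le> \<delta>"
  shows "norm (min_norm_subgrad \<delta> f ((1 / real M) *\<^sub>R (\<Sum>j=a..<a+M. qp \<omega> j))) \<le> norm (\<Sum>j=a..<a+M. G (qp \<omega> j)) / real M"
proof -
  have \<delta>0: "0 < \<delta>" using \<delta> \<rho>_pos mult_nonneg_nonneg[of "real M" D] D_pos by linarith
  let ?x = "(1 / real M) *\<^sub>R (\<Sum>j=a..<a+M. qp \<omega> j)"
  have "(\<Sum>j\<in>{a..<a+M}. (1 / real M) *\<^sub>R G (qp \<omega> j)) \<in> goldstein_subdiff \<delta> f ?x"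
  proof (rule convex_sum[OF _ convex_goldstein[OF f_lip \<delta>0]])
    show "G (qp \<omega> j) \<in> goldstein_subdiff \<delta> f ?x" if "j \<in> {a..<a+M}" for j
    proof (rule sphere_grad_in_goldstein[OF f_lip \<delta>0 \<rho>_pos])
      have "norm (qp \<omega> j - ?x) \<le> real M * D" by (rule qp_mean_diff_le[where \<omega>=\<omega> and T=T, OF s]) (use that T in auto)
      then show "norm (qp \<omega> j - ?x) + \<rho> \<le> \<delta>" using \<delta> by linarith
    qed
  qed (use M in auto)
  then have "(1 / real M) *\<^sub>R (\<Sum>j=a..<a+M. G (qp \<omega> j)) \<in> goldstein_subdiff \<delta> f ?x"
    by (simp add: scaleR_sum_right)
  from min_norm_subgrad_le[OF f_lip \<delta>0 this] show ?thesis by simp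
qed

lemma block_gradient_integrable:
  assumes "b \<le> T"
  shows "integrable (P T) (\<lambda>\<omega>. norm (\<Sum>j=a..<b. G (qp \<omega> j)))"
proof -
  interpret P: prob_space "P T" by (rule prob_space_P)
  have [measurable]: "(\<lambda>\<omega>. \<Sum>j=a..<b. G (qp \<omega> j)) \<in> borel_measurable (P T)"
    by (intro borel_measurable_sum measurable_compose[OF qp_measurable G_measurable]) (use assms in auto)
  have "norm (\<Sum>j=a..<b. G (qp \<omega> j)) \<le> (\<Sum>j=a..<b. L0)" for \<omega>
    by (intro order_trans[OF norm_sum] sum_mono G_bound)
  then show ?thesis by (intro P.integrable_const_bound[of _ "\<Sum>j=a..<b. L0"]) auto
qed

lemma block_gradient_expectation_le:
  assumes b: "b \<le> T" and ab: "a \<le> b"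
  shows "D * (\<integral>\<omega>. norm (\<Sum>j=a..<b. G (qp \<omega> j)) \<partial>P T)
    \<le> 2 * D\<^sup>2 / \<eta> + \<eta> / 2 * (real (b - a) * (23 * real CARD('n) * L0\<^sup>2)) + D * (7 * sqrt (real CARD('n) * real (b - a)) * L0)
      - ((\<integral>\<omega>. f\<rho> (pos \<omega> b) \<partial>P T) - (\<integral>\<omega>. f\<rho> (pos \<omega> a) \<partial>P T))"
proof -
  interpret P: prob_space "P T" by (rule prob_space_P)
  have lt: "j < T" if "j \<in> {a..<b}" for j using that b by simp
  note iS = block_gradient_integrable[OF b, of a]
  have iq: "integrable (P T) (\<lambda>\<omega>. \<Sum>j=a..<b. (norm (qg \<omega> j))\<^sup>2)"
    by (intro Bochner_Integration.integrable_sum qg_square_integrable lt)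
  have iv: "integrable (P T) (\<lambda>\<omega>. \<Sum>j=a..<b. qg \<omega> j \<bullet> vel \<omega> j)"
    by (intro Bochner_Integration.integrable_sum qg_vel_integrable lt)
  note iN = noise_sum_integrable[OF b ab]
  have "D * (\<integral>\<omega>. norm (\<Sum>j=a..<b. G (qp \<omega> j)) \<partial>P T) = (\<integral>\<omega>. D * norm (\<Sum>j=a..<b. G (qp \<omega> j)) \<partial>P T)"
    by simp
  also have "\<dots> \<le> (\<integral>\<omega>. 2 * D\<^sup>2 / \<eta> + \<eta> / 2 * (\<Sum>j=a..<b. (norm (qg \<omega> j))\<^sup>2)
     + D * norm (\<Sum>j=a..<b. noise \<omega> j) - (\<Sum>j=a..<b. qg \<omega> j \<bullet> vel \<omega> j) \<partial>P T)"
  proof (rule integral_mono)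
    show "integrable (P T) (\<lambda>\<omega>. D * norm (\<Sum>j=a..<b. G (qp \<omega> j)))" by (intro integrable_mult_right iS)
    show "integrable (P T) (\<lambda>\<omega>. 2 * D\<^sup>2 / \<eta> + \<eta> / 2 * (\<Sum>j=a..<b. (norm (qg \<omega> j))\<^sup>2)
     + D * norm (\<Sum>j=a..<b. noise \<omega> j) - (\<Sum>j=a..<b. qg \<omega> j \<bullet> vel \<omega> j))"
      by (intro Bochner_Integration.integrable_add Bochner_Integration.integrable_diff integrable_mult_right iq iv iN P.integrable_const)
  qed (rule block_gradient_sum_le[OF ab])
  also have "\<dots> = 2 * D\<^sup>2 / \<eta> + \<eta> / 2 * (\<integral>\<omega>. (\<Sum>j=a..<b. (norm (qg \<omega> j))\<^sup>2) \<partial>P T)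
     + D * (\<integral>\<omega>. norm (\<Sum>j=a..<b. noise \<omega> j) \<partial>P T) - (\<integral>\<omega>. (\<Sum>j=a..<b. qg \<omega> j \<bullet> vel \<omega> j) \<partial>P T)"
    using iq iv iN P.prob_space by simp
  also have "(\<integral>\<omega>. (\<Sum>j=a..<b. qg \<omega> j \<bullet> vel \<omega> j) \<partial>P T) = (\<Sum>j=a..<b. \<integral>\<omega>. qg \<omega> j \<bullet> vel \<omega> j \<partial>P T)"
    by (intro Bochner_Integration.integral_sum qg_vel_integrable lt)
  also have "\<dots> = (\<Sum>j=a..<b. (\<integral>\<omega>. f\<rho> (pos \<omega> (Suc j)) \<partial>P T) - (\<integral>\<omega>. f\<rho> (pos \<omega> j) \<partial>P T))"
    by (intro sum.cong refl expected_decrease lt)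
  also have "\<dots> = (\<integral>\<omega>. f\<rho> (pos \<omega> b) \<partial>P T) - (\<integral>\<omega>. f\<rho> (pos \<omega> a) \<partial>P T)"
    by (rule sum_Suc_diff'[OF ab])
  also have "(\<integral>\<omega>. (\<Sum>j=a..<b. (norm (qg \<omega> j))\<^sup>2) \<partial>P T) = (\<Sum>j=a..<b. \<integral>\<omega>. (norm (qg \<omega> j))\<^sup>2 \<partial>P T)"
    by (intro Bochner_Integration.integral_sum qg_square_integrable lt)
  finally have *: "D * (\<integral>\<omega>. norm (\<Sum>j=a..<b. G (qp \<omega> j)) \<partial>P T) \<le> 2 * D\<^sup>2 / \<eta> + \<eta> / 2 * (\<Sum>j=a..<b. \<integral>\<omega>. (norm (qg \<omega> j))\<^sup>2 \<partial>P T)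
     + D * (\<integral>\<omega>. norm (\<Sum>j=a..<b. noise \<omega> j) \<partial>P T) - ((\<integral>\<omega>. f\<rho> (pos \<omega> b) \<partial>P T) - (\<integral>\<omega>. f\<rho> (pos \<omega> a) \<partial>P T))" .
  have "(\<Sum>j=a..<b. \<integral>\<omega>. (norm (qg \<omega> j))\<^sup>2 \<partial>P T) \<le> (\<Sum>j=a..<b. 23 * real CARD('n) * L0\<^sup>2)"
    by (intro sum_mono qg_square_integral_le lt)
  then have "\<eta> / 2 * (\<Sum>j=a..<b. \<integral>\<omega>. (norm (qg \<omega> j))\<^sup>2 \<partial>P T) \<le> \<eta> / 2 * (real (b - a) * (23 * real CARD('n) * L0\<^sup>2))"
    using \<eta>_pos by (intro mult_left_mono) auto
  moreover have "D * (\<integral>\<omega>. norm (\<Sum>j=a..<b. noise \<omega> j) \<partial>P T) \<le> D * (7 * sqrt (real CARD('n) * real (b - a)) * L0)"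
    using D_pos by (intro mult_left_mono noise_sum_expectation_le[OF b ab]) auto
  ultimately show ?thesis using * by linarith
qed

text \<open>The decreases of consecutive blocks telescope, and rounds after the last complete block
  are discarded. Passing from \<open>f\<rho>\<close> to \<open>f\<close> costs
  \<open>L0 * \<rho>\<close> at the start only, since averaging preserves the lower bound
  \<open>c\<close>.\<close>

lemma sum_block_gradients_le:
  assumes KM: "K * M \<le> T" and c: "\<And>x. c \<le> f x"
  shows "D * (\<Sum>k<K. \<integral>\<omega>. norm (\<Sum>j=k*M..<k*M+M. G (qp \<omega> j)) \<partial>P T)
    \<le> real K * (2 * D\<^sup>2 / \<eta> + \<eta> / 2 * (real M * (23 * real CARD('n) * L0\<^sup>2)) + D * (7 * sqrt (real CARD('n) * real M) * L0))
      + (f x0 + L0 * \<rho> - c)"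
proof -
  interpret P: prob_space "P T" by (rule prob_space_P)
  define h where "h j = (\<integral>\<omega>. f\<rho> (pos \<omega> j) \<partial>P T)" for j
  define B where "B = 2 * D\<^sup>2 / \<eta> + \<eta> / 2 * (real M * (23 * real CARD('n) * L0\<^sup>2)) + D * (7 * sqrt (real CARD('n) * real M) * L0)"
  have "D * (\<Sum>k<K. \<integral>\<omega>. norm (\<Sum>j=k*M..<k*M+M. G (qp \<omega> j)) \<partial>P T) \<le> (\<Sum>k<K. B - (h (Suc k * M) - h (k * M)))"
    unfolding sum_distrib_left
  proof (rule sum_mono)
    fix k assume k: "k \<in> {..<K}"
    then have "Suc k * M \<le> K * M" by (intro mult_right_mono) auto
    then have le: "k * M + M \<le> T" using KM by simp
    show "D * (\<integral>\<omega>. norm (\<Sum>j=k*M..<k*M+M. G (qp \<omega> j)) \<partial>P T) \<le> B - (h (Suc k * M) - h (k * M))"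
      using block_gradient_expectation_le[OF le, of "k * M"] by (simp add: B_def h_def add.commute)
  qed
  also have "\<dots> = real K * B - (h (K * M) - h 0)"
    using sum_lessThan_telescope[of "\<lambda>k. h (k * M)" K] by (simp add: sum_subtractf)
  also have "\<dots> \<le> real K * B + (f x0 + L0 * \<rho> - c)"
  proof -
    have "h 0 = f\<rho> x0" using P.prob_space by (simp add: h_def pos_def)
    then have "h 0 \<le> f x0 + L0 * \<rho>" using ball_avg_approx[OF f_lip \<rho>_pos, of x0] by linarith
    moreover have "(\<integral>\<omega>. c \<partial>P T) \<le> h (K * M)"
      unfolding h_def using ball_avg_ge[OF f_lip c] f\<rho>_pos_integrable[OF KM] by (intro integral_mono) auto
    then have "c \<le> h (K * M)" using P.prob_space by simp
    ultimately show ?thesis by linarith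
  qed
  finally show ?thesis by (simp add: B_def)
qed

lemma num_queries_alg_rounds:
  fixes orc :: "(real^'n) \<times> 'w \<Rightarrow> real"
  shows "num_queries orc (alg_rounds x0 \<rho> D \<eta> \<omega> t) = 2 * t"
proof -
  show ?thesis
    by (induction t) (auto simp: num_queries_bind run_comp_bind grad_estimator_def Let_def split: prod.splits)
qed

lemma alg_evaluations_eq: "alg_evaluations F x0 \<rho> \<nu> D \<eta> T \<sigma> = 2 * T"
proof -
  show ?thesis
    unfolding alg_evaluations_def algorithm_def
    by (auto simp: num_queries_bind num_queries_alg_rounds Let_def split: prod.splits)
qed

lemma alg_output_eq:
  "alg_output F x0 \<rho> \<nu> D \<eta> T (\<omega>, k) = (if num_blocks \<nu> D T = 0 then x0
     else (1 / real (block_length \<nu> D)) *\<^sub>R (\<Sum>m=1..block_length \<nu> D. map (qp \<omega>) [0..<T] ! ((k - 1) * block_length \<nu> D + m - 1)))"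
proof -
  show ?thesis
    unfolding alg_output_def algorithm_def by (simp add: run_comp_bind run_alg_rounds Let_def)
qed

lemma alg_samples_eq: "alg_samples \<Xi> \<nu> D T = P T \<Otimes>\<^sub>M measure_pmf (pmf_of_set {1..num_blocks \<nu> D T})"
  unfolding alg_samples_def P_def samples_def ..

lemma prob_space_alg_samples: "prob_space (alg_samples \<Xi> \<nu> D T :: ((nat \<Rightarrow> 'w \<times> real \<times> (real^'n)) \<times> nat) measure)"
proof -
  interpret P: prob_space "P T" by (rule prob_space_P)
  interpret PQ: pair_prob_space "P T" "measure_pmf (pmf_of_set {1..num_blocks \<nu> D T})" ..
  show ?thesis unfolding alg_samples_eq by unfold_locales
qed

lemma alg_output_section_measurable: "(\<lambda>\<omega>. alg_output F x0 \<rho> \<nu> D \<eta> T (\<omega>, k)) \<in> borel_measurable (P T)"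
proof -
  have nth: "(\<lambda>\<omega>. map (qp \<omega>) [0..<T] ! i) \<in> borel_measurable (P T)" for i
  proof (cases "i < T")
    case True
    then show ?thesis using qp_measurable[OF True] by simp
  next
    case False
    \<comment> \<open>Out of range, the entry is some default that depends on the index but not on
      the sample, so it is measurable as a constant.\<close>
    have "map (qp \<omega>) [0..<T] ! i = [] ! (i - T)" for \<omega>
      using False nth_append[of "map (qp \<omega>) [0..<T]" "[]" i] by simp
    then show ?thesis by simp
  qed
  show ?thesis unfolding alg_output_eq using nth by measurable
qed

lemma alg_output_measurable: "alg_output F x0 \<rho> \<nu> D \<eta> T \<in> borel_measurable (alg_samples \<Xi> \<nu> D T)"
proof -
  have "(\<lambda>\<sigma>. alg_output F x0 \<rho> \<nu> D \<eta> T (fst \<sigma>, snd \<sigma>)) \<in> borel_measurable (alg_samples \<Xi> \<nu> D T)"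
    unfolding alg_samples_eq
  proof (rule measurable_compose_countable[where f="\<lambda>k \<sigma>. alg_output F x0 \<rho> \<nu> D \<eta> T (fst \<sigma>, k)"])
    show "(\<lambda>\<sigma>. alg_output F x0 \<rho> \<nu> D \<eta> T (fst \<sigma>, k)) \<in> borel_measurable (P T \<Otimes>\<^sub>M measure_pmf (pmf_of_set {1..num_blocks \<nu> D T}))" for k
      by (rule measurable_compose[OF measurable_fst alg_output_section_measurable])
    show "snd \<in> P T \<Otimes>\<^sub>M measure_pmf (pmf_of_set {1..num_blocks \<nu> D T}) \<rightarrow>\<^sub>M count_space UNIV"
      by (rule measurable_compose[OF measurable_snd]) simp
  qed
  then show ?thesis by simp
qed

context
  fixes \<delta> :: real
  assumes \<delta>_pos: "0 < \<delta>"
begin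

definition "stat x = norm (min_norm_subgrad \<delta> f x)"

lemma stat_bound: "0 \<le> stat x" "stat x \<le> L0"
  unfolding stat_def using norm_min_norm_subgrad_le[OF f_lip \<delta>_pos] by auto

lemma stat_measurable [measurable]: "stat \<in> borel_measurable borel"
  unfolding stat_def using borel_measurable_min_norm_subgrad[OF f_lip \<delta>_pos] .

lemma stat_output_integrable: "integrable (alg_samples \<Xi> \<nu> D T) (\<lambda>\<sigma>. stat (alg_output F x0 \<rho> \<nu> D \<eta> T \<sigma>))"
proof -
  interpret A: prob_space "(alg_samples \<Xi> \<nu> D T :: ((nat \<Rightarrow> 'w \<times> real \<times> (real^'n)) \<times> nat) measure)" by (rule prob_space_alg_samples)
  show ?thesis
    by (rule A.integrable_const_bound[of _ L0])
       (use stat_bound in \<open>auto intro!: measurable_compose[OF alg_output_measurable stat_measurable]\<close>)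
qed

lemma stat_output_expectation:
  assumes K: "1 \<le> num_blocks \<nu> D T"
  shows "(\<integral>\<sigma>. stat (alg_output F x0 \<rho> \<nu> D \<eta> T \<sigma>) \<partial>alg_samples \<Xi> \<nu> D T)
    = (\<integral>\<omega>. (\<Sum>k=1..num_blocks \<nu> D T. stat (alg_output F x0 \<rho> \<nu> D \<eta> T (\<omega>, k))) / real (num_blocks \<nu> D T) \<partial>P T)"
proof -
  let ?Q = "measure_pmf (pmf_of_set {1..num_blocks \<nu> D T})"
  interpret P: prob_space "P T" by (rule prob_space_P)
  interpret PQ: pair_prob_space "P T" ?Q ..
  have "(\<integral>\<sigma>. stat (alg_output F x0 \<rho> \<nu> D \<eta> T \<sigma>) \<partial>alg_samples \<Xi> \<nu> D T)
     = (\<integral>\<omega>. \<integral>k. stat (alg_output F x0 \<rho> \<nu> D \<eta> T (\<omega>, k)) \<partial>?Q \<partial>P T)"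
    using stat_output_integrable[of \<nu> T] unfolding alg_samples_eq by (rule PQ.integral_fst'[symmetric])
  also have "\<dots> = (\<integral>\<omega>. (\<Sum>k=1..num_blocks \<nu> D T. stat (alg_output F x0 \<rho> \<nu> D \<eta> T (\<omega>, k))) / real (num_blocks \<nu> D T) \<partial>P T)"
    using K by (intro Bochner_Integration.integral_cong refl) (simp add: integral_pmf_of_set)
  finally show ?thesis .
qed

text \<open>The first increment is 0, so the only query point is \<open>x0\<close> whatever is
  sampled. Both the fallback without blocks and a block of length one therefore output
  \<open>x0\<close>; this serves the degenerate regimes.\<close>

lemma stat_output_one_round:
  assumes T: "T = 1"
  shows "(\<integral>\<sigma>. stat (alg_output F x0 \<rho> \<nu> D \<eta> T \<sigma>) \<partial>alg_samples \<Xi> \<nu> D T) = stat x0"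
proof (cases "num_blocks \<nu> D T = 0")
  case True
  interpret A: prob_space "(alg_samples \<Xi> \<nu> D T :: ((nat \<Rightarrow> 'w \<times> real \<times> (real^'n)) \<times> nat) measure)" by (rule prob_space_alg_samples)
  have "alg_output F x0 \<rho> \<nu> D \<eta> T \<sigma> = x0" for \<sigma> using True by (cases \<sigma>) (simp add: alg_output_eq)
  then show ?thesis using A.prob_space by simp
next
  case False
  interpret P: prob_space "P T" by (rule prob_space_P)
  \<comment> \<open>A complete block exists and fits into a single round.\<close>
  have M: "block_length \<nu> D = 1"
  proof -
    have "block_length \<nu> D \<noteq> 0" "\<not> T < block_length \<nu> D"
      using False unfolding num_blocks_def by (intro notI; simp)+
    then show ?thesis using T by simp
  qed
  then have K: "num_blocks \<nu> D T = 1" using T by (simp add: num_blocks_def)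
  have "alg_output F x0 \<rho> \<nu> D \<eta> T (\<omega>, 1) = x0" for \<omega>
    unfolding alg_output_eq K M using T by (simp add: qp_def query_point_def)
  then show ?thesis using P.prob_space by (subst stat_output_expectation) (simp_all add: K)
qed

text \<open>The four terms are the function gap, the initial distance in the regret of each block,
  the second moments of the estimates, and the noise.\<close>

lemma stat_output_expectation_le:
  fixes \<nu> :: real and T :: nat
  defines "M \<equiv> block_length \<nu> D" and "K \<equiv> num_blocks \<nu> D T"
  assumes K: "1 \<le> K" and \<delta>: "real M * D + \<rho> \<le> \<delta>" and c: "\<And>x. c \<le> f x"
  shows "(\<integral>\<sigma>. stat (alg_output F x0 \<rho> \<nu> D \<eta> T \<sigma>) \<partial>alg_samples \<Xi> \<nu> D T)
    \<le> (f x0 + L0 * \<rho> - c) / (D * real K * real M) + 2 * D / (\<eta> * real M)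
      + 23 * real CARD('n) * L0\<^sup>2 * \<eta> / (2 * D) + 7 * sqrt (real CARD('n) * real M) * L0 / real M"
proof -
  interpret P: prob_space "P T" by (rule prob_space_P)
  have M: "0 < M"
  proof (rule ccontr)
    assume "\<not> 0 < M"
    then show False using K by (simp add: K_def M_def num_blocks_def)
  qed
  have KM: "K * M \<le> T" unfolding K_def M_def num_blocks_def by simp
  \<comment> \<open>Block \<open>Suc k\<close> in the numbering of the algorithm, which starts at 1,
    consists of the rounds from \<open>k * M\<close> on in the numbering from 0.\<close>
  have out: "alg_output F x0 \<rho> \<nu> D \<eta> T (\<omega>, Suc k) = (1 / real M) *\<^sub>R (\<Sum>j=k*M..<k*M+M. qp \<omega> j)" if k: "k < K" for \<omega> k
  proof -
    have "Suc k * M \<le> K * M" using k by (intro mult_right_mono) auto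
    then have le: "k * M + M \<le> T" using KM by simp
    have "(\<Sum>m=1..M. map (qp \<omega>) [0..<T] ! ((Suc k - 1) * M + m - 1)) = (\<Sum>j=k*M..<k*M+M. qp \<omega> j)"
      by (rule sum.reindex_bij_witness[where i="\<lambda>j. Suc j - k * M" and j="\<lambda>m. k * M + m - 1"]) (use le in auto)
    then show ?thesis using K unfolding alg_output_eq K_def[symmetric] M_def[symmetric] by simp
  qed
  define Y where "Y k \<omega> = norm (\<Sum>j=k*M..<k*M+M. G (qp \<omega> j))" for k \<omega>
  have Y_int: "integrable (P T) (Y k)" if "k < K" for k
  proof -
    have "Suc k * M \<le> K * M" using that by (intro mult_right_mono) auto
    then show ?thesis unfolding Y_def using KM by (intro block_gradient_integrable) simp
  qed
  have "(\<integral>\<sigma>. stat (alg_output F x0 \<rho> \<nu> D \<eta> T \<sigma>) \<partial>alg_samples \<Xi> \<nu> D T)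
    = (\<integral>\<omega>. (\<Sum>k=1..K. stat (alg_output F x0 \<rho> \<nu> D \<eta> T (\<omega>, k))) / real K \<partial>P T)"
    using K unfolding K_def by (rule stat_output_expectation)
  also have "\<dots> \<le> (\<integral>\<omega>. (\<Sum>k<K. Y k \<omega> / real M) / real K \<partial>P T)"
  proof (rule integral_mono_AE)
    have m: "(\<lambda>\<omega>. stat (alg_output F x0 \<rho> \<nu> D \<eta> T (\<omega>, k))) \<in> borel_measurable (P T)" for k
      by (rule measurable_compose[OF alg_output_section_measurable stat_measurable])
    show "integrable (P T) (\<lambda>\<omega>. (\<Sum>k=1..K. stat (alg_output F x0 \<rho> \<nu> D \<eta> T (\<omega>, k))) / real K)"
      using stat_bound by (intro integrable_divide Bochner_Integration.integrable_sum P.integrable_const_bound[of _ L0] m) auto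
    show "integrable (P T) (\<lambda>\<omega>. (\<Sum>k<K. Y k \<omega> / real M) / real K)"
      using Y_int by (intro integrable_divide Bochner_Integration.integrable_sum) auto
    show "AE \<omega> in P T. (\<Sum>k=1..K. stat (alg_output F x0 \<rho> \<nu> D \<eta> T (\<omega>, k))) / real K \<le> (\<Sum>k<K. Y k \<omega> / real M) / real K"
      using AE_P_interval
    proof eventually_elim
      fix \<omega> :: "nat \<Rightarrow> 'w \<times> real \<times> (real^'n)" assume s: "\<forall>j<T. 0 \<le> fst (snd (\<omega> (Suc j))) \<and> fst (snd (\<omega> (Suc j))) \<le> 1"
      have "(\<Sum>k=1..K. stat (alg_output F x0 \<rho> \<nu> D \<eta> T (\<omega>, k))) = (\<Sum>k<K. stat (alg_output F x0 \<rho> \<nu> D \<eta> T (\<omega>, Suc k)))"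
        by (rule sum.reindex_bij_witness[where i=Suc and j="\<lambda>k. k - 1"]) auto
      also have "\<dots> \<le> (\<Sum>k<K. Y k \<omega> / real M)"
      proof (rule sum_mono)
        fix k assume "k \<in> {..<K}"
        then have k: "k < K" by simp
        have "Suc k * M \<le> K * M" using k by (intro mult_right_mono) auto
        then have le: "k * M + M \<le> T" using KM by simp
        show "stat (alg_output F x0 \<rho> \<nu> D \<eta> T (\<omega>, Suc k)) \<le> Y k \<omega> / real M"
          unfolding out[OF k] stat_def Y_def using s by (intro block_stationarity[OF _ M le \<delta>]) auto
      qed
      finally show "(\<Sum>k=1..K. stat (alg_output F x0 \<rho> \<nu> D \<eta> T (\<omega>, k))) / real K \<le> (\<Sum>k<K. Y k \<omega> / real M) / real K"
        by (rule divide_right_mono) simp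
    qed
  qed
  also have "\<dots> = (\<Sum>k<K. \<integral>\<omega>. Y k \<omega> \<partial>P T) / (real M * real K)"
    using Y_int by (simp add: Bochner_Integration.integral_sum sum_divide_distrib)
  also have "\<dots> = (D * (\<Sum>k<K. \<integral>\<omega>. Y k \<omega> \<partial>P T)) / (D * real M * real K)"
    using D_pos by simp
  also have "\<dots> \<le> (real K * (2 * D\<^sup>2 / \<eta> + \<eta> / 2 * (real M * (23 * real CARD('n) * L0\<^sup>2)) + D * (7 * sqrt (real CARD('n) * real M) * L0))
      + (f x0 + L0 * \<rho> - c)) / (D * real M * real K)"
    unfolding Y_def using D_pos by (intro divide_right_mono sum_block_gradients_le[OF KM c]) auto
  also have "\<dots> = (f x0 + L0 * \<rho> - c) / (D * real K * real M) + 2 * D / (\<eta> * real M)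
      + 23 * real CARD('n) * L0\<^sup>2 * \<eta> / (2 * D) + 7 * sqrt (real CARD('n) * real M) * L0 / real M"
    using D_pos \<eta>_pos M K by (simp add: field_simps power2_eq_square)
  finally show ?thesis .
qed

end

end

section \<open>Choice of the parameters and conclusion\<close>

text \<open>With \<open>y\<^sup>3\<close> the base of the power defining \<open>D\<close>, every term of the error bound is a constant
  multiple of \<open>Y = L0 sqrt n y / sqrt \<nu>\<close>.\<close>

lemma parameter_bound:
  fixes n L0 \<delta> \<epsilon> \<Delta> :: real
  assumes n: "1 \<le> n" and L0: "0 < L0" and \<delta>: "0 < \<delta>" and \<epsilon>: "0 < \<epsilon>" and \<Delta>: "0 < \<Delta>"
    and \<epsilon>L0: "\<epsilon> \<le> L0" and \<delta>\<epsilon>: "\<delta> * \<epsilon> \<le> \<Delta>"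
  defines "X \<equiv> n * L0\<^sup>2 * \<Delta> / (\<delta> * \<epsilon> ^ 3)"
  defines "T \<equiv> nat \<lfloor>10 ^ 12 * X\<rfloor>"
  defines "\<rho> \<equiv> min (\<delta> / 2) (\<Delta> / L0)" and "\<nu> \<equiv> max (\<delta> / 2) (\<delta> - \<Delta> / L0)"
  defines "D \<equiv> ((\<Delta> + \<rho> * L0) * sqrt \<nu> / (sqrt n * L0 * real T)) powr (2 / 3)"
    and "\<eta> \<equiv> (\<Delta> + \<rho> * L0) / (n * L0\<^sup>2 * real T)"
  defines "M \<equiv> block_length \<nu> D" and "K \<equiv> num_blocks \<nu> D T"
  shows "1 \<le> T" and "1 \<le> K" and "real M * D + \<rho> \<le> \<delta>"
    and "(\<Delta> + \<rho> * L0) / (D * real K * real M) + 2 * D / (\<eta> * real M)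
      + 23 * n * L0\<^sup>2 * \<eta> / (2 * D) + 7 * sqrt (n * real M) * L0 / real M \<le> \<epsilon>"
proof -
  define A where "A = \<Delta> + \<rho> * L0"
  have \<rho>: "0 < \<rho>" "\<rho> * L0 \<le> \<Delta>" using \<delta> \<Delta> L0 by (auto simp: \<rho>_def min_def field_simps)
  have A: "\<Delta> \<le> A" "A \<le> 2 * \<Delta>" "0 < A" using \<rho> L0 \<Delta> by (auto simp: A_def add_pos_pos)
  \<comment> \<open>The maximum and the minimum complement each other: \<open>\<delta>\<close> is
    split exactly into the diameter allowed to a block and the smoothing radius.\<close>
  have \<nu>\<rho>: "\<nu> + \<rho> = \<delta>" by (auto simp: \<nu>_def \<rho>_def min_def max_def)
  have \<nu>: "0 < \<nu>" "\<delta> / 2 \<le> \<nu>" "\<nu> \<le> \<delta>" using \<delta> \<rho> \<nu>\<rho> by (auto simp: \<nu>_def)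
  \<comment> \<open>Both regime hypotheses enter here: the factors \<open>\<epsilon>\<^sup>2\<close>
    and \<open>\<delta> * \<epsilon>\<close> of the denominator are dominated separately.\<close>
  have X1: "1 \<le> X"
  proof -
    have "\<epsilon>\<^sup>2 * (\<delta> * \<epsilon>) \<le> (n * L0\<^sup>2) * \<Delta>"
    proof (rule mult_mono)
      have "\<epsilon>\<^sup>2 \<le> L0\<^sup>2" using \<epsilon>L0 \<epsilon> by (intro power_mono) auto
      also have "\<dots> \<le> n * L0\<^sup>2" using n mult_right_mono[of 1 n "L0\<^sup>2"] by simp
      finally show "\<epsilon>\<^sup>2 \<le> n * L0\<^sup>2" .
    qed (use \<delta>\<epsilon> \<delta> \<epsilon> n in auto)
    then have "\<delta> * \<epsilon> ^ 3 \<le> n * L0\<^sup>2 * \<Delta>" by (simp add: power3_eq_cube power2_eq_square mult_ac)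
    then show ?thesis using \<delta> \<epsilon> by (simp add: X_def)
  qed
  have "10 ^ 12 * X - 1 < real T" unfolding T_def using X1 by (simp add: of_nat_nat)
  \<comment> \<open>Rounding down loses less than 1, hence less than \<open>X\<close>; giving away a
    factor of ten is ample.\<close>
  then have T11: "10 ^ 11 * X \<le> real T" using X1 by simp
  then have T1: "1 \<le> real T" using X1 by simp
  then show "1 \<le> T" by simp
  define a v where "a = sqrt n" and "v = sqrt \<nu>"
  have a: "0 < a" and a2: "a * a = n" and v: "0 < v" and v2: "v * v = \<nu>" using n \<nu> by (auto simp: a_def v_def)
  define b where "b = A * v / (a * L0 * real T)"
  have b: "0 < b" using A a v L0 T1 by (simp add: b_def)
  define y where "y = b powr (1 / 3)"
  have y: "0 < y" using b by (simp add: y_def)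
  have "y ^ 3 = b"
    unfolding y_def powr_powr using powr_realpow[of "b powr (1 / 3)" 3] b by (simp add: powr_powr)
  then have y3: "y * y * y = A * v / (a * L0 * real T)" by (simp add: power3_eq_cube b_def)
  have Dy: "D = y * y"
  proof -
    have "D = b powr (2 / 3)" unfolding D_def b_def A_def a_def v_def ..
    also have "\<dots> = y ^ 2" unfolding y_def using powr_realpow[of "b powr (1 / 3)" 2] b by (simp add: powr_powr)
    finally show ?thesis by (simp add: power2_eq_square)
  qed
  have D: "0 < D" using y by (simp add: Dy)
  define Y where "Y = L0 * a * y / v"
  have Y: "0 < Y" using L0 a v y by (simp add: Y_def)
  \<comment> \<open>Eliminating \<open>T\<close> in favour of \<open>y\<close> turns the terms of
    the bound into monomials, so that field arithmetic recognises them as multiples of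
    \<open>Y\<close>.\<close>
  have T_eq: "real T = A * v / (a * L0 * (y * y * y))"
    unfolding y3 using A a v L0 T1 by (simp add: field_simps)
  have Y3: "Y * Y * Y = L0\<^sup>2 * n * A / (real T * \<nu>)"
    unfolding T_eq Y_def v2[symmetric] a2[symmetric] using A a v L0 y by (simp add: field_simps power2_eq_square)
  \<comment> \<open>Cubes are compared because \<open>Y ^ 3\<close> is free of roots. The bounds
    \<open>A \<le> 2 * \<Delta>\<close> and \<open>\<delta> / 2 \<le> \<nu>\<close> contribute the
    factor 4, and 4 / 10^11 is below the cube of 1 / 2500.\<close>
  have Y_le: "Y \<le> \<epsilon> / 2500"
  proof (rule ccontr)
    assume "\<not> Y \<le> \<epsilon> / 2500"
    then have "(\<epsilon> / 2500) ^ 3 < Y ^ 3" using \<epsilon> by (intro power_strict_mono) auto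
    also have "Y ^ 3 = L0\<^sup>2 * n * A / (real T * \<nu>)" unfolding Y3[symmetric] by (simp add: power3_eq_cube)
    also have "\<dots> \<le> L0\<^sup>2 * n * (2 * \<Delta>) / (10 ^ 11 * X * (\<delta> / 2))"
      using A \<nu> T11 X1 n \<delta> by (intro frac_le mult_mono mult_left_mono mult_nonneg_nonneg mult_pos_pos) auto
    also have "\<dots> = 4 / 10 ^ 11 * \<epsilon> ^ 3"
      unfolding X_def using n L0 \<Delta> \<delta> \<epsilon> by (simp add: field_simps power2_eq_square)
    also have "\<dots> \<le> (\<epsilon> / 2500) ^ 3" using \<epsilon> by (simp add: power_divide)
    finally show False by simp
  qed
  have D\<nu>: "D * (n * L0\<^sup>2) = Y\<^sup>2 * \<nu>"
    unfolding Dy Y_def v2[symmetric] a2[symmetric] using v by (simp add: field_simps power2_eq_square)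
  \<comment> \<open>With \<open>\<nu> / D\<close> at least 2, rounding it down to the block length
    loses at most half.\<close>
  have D_le: "D \<le> \<nu> / 2"
  proof -
    have "Y\<^sup>2 \<le> (\<epsilon> / 2500)\<^sup>2" using Y Y_le by (intro power_mono) auto
    also have "\<dots> \<le> \<epsilon>\<^sup>2 / 2" by (simp add: power_divide)
    also have "\<dots> \<le> n * L0\<^sup>2 / 2"
      using power_mono[OF \<epsilon>L0, of 2] \<epsilon> n mult_right_mono[of 1 n "L0\<^sup>2"] by simp
    finally have "Y\<^sup>2 * \<nu> \<le> n * L0\<^sup>2 / 2 * \<nu>" using \<nu> by (intro mult_right_mono) auto
    then have "D * (n * L0\<^sup>2) \<le> (\<nu> / 2) * (n * L0\<^sup>2)" unfolding D\<nu> by (simp add: mult_ac)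
    then show ?thesis by (rule mult_right_le_imp_le) (use n L0 in simp)
  qed
  have r2: "2 \<le> \<nu> / D" using D_le D by (simp add: field_simps)
  have M_up: "real M \<le> \<nu> / D" unfolding M_def block_length_def using r2 by (simp add: of_nat_nat)
  have M_lo: "\<nu> / (2 * D) \<le> real M"
  proof -
    have "\<nu> / D - 1 < real M" unfolding M_def block_length_def using r2 by (simp add: of_nat_nat)
    moreover have "\<nu> / (2 * D) = (\<nu> / D) / 2" by simp
    ultimately show ?thesis using r2 by linarith
  qed
  have M1: "1 \<le> real M"
  proof -
    have "\<nu> / (2 * D) = (\<nu> / D) / 2" by simp
    then show ?thesis using M_lo r2 by linarith
  qed
  have "real M * D \<le> \<nu>" using M_up D by (simp add: field_simps)
  then show "real M * D + \<rho> \<le> \<delta>" using \<nu>\<rho> by simp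
  \<comment> \<open>At least one block has to fit into the run. Since
    \<open>real T * D * Y = A\<close>, this amounts to \<open>\<nu> * Y \<le> A\<close>, which
    follows from \<open>\<delta> * \<epsilon> \<le> \<Delta>\<close>.\<close>
  have TD: "\<nu> / D \<le> real T"
  proof -
    have "\<nu> * Y \<le> \<delta> * \<epsilon>"
      using \<nu> Y Y_le \<epsilon> by (intro mult_mono) auto
    also have "\<dots> \<le> A" using \<delta>\<epsilon> A by simp
    finally have "\<nu> * Y \<le> A" .
    moreover have "real T * D * Y = A"
      unfolding T_eq Dy Y_def using A a v L0 y by (simp add: field_simps)
    ultimately have "\<nu> * Y \<le> (real T * D) * Y" by simp
    then have "\<nu> \<le> real T * D" using Y by (rule mult_right_le_imp_le)
    then show ?thesis using D by (simp add: field_simps)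
  qed
  have MT: "M \<le> T" using M_up TD by linarith
  have M0: "0 < M" using M1 by simp
  have K_eq: "K = T div M" by (simp add: K_def M_def num_blocks_def)
  then show K1: "1 \<le> K" using MT M0 by (simp add: Suc_le_eq div_greater_zero_iff)
  \<comment> \<open>The discarded remainder is shorter than one block, hence at most half of all
    rounds.\<close>
  have KM: "real T / 2 \<le> real K * real M"
  proof -
    have "T = K * M + T mod M" unfolding K_eq by simp
    moreover have "T mod M < M" using M0 by simp
    moreover have "M \<le> K * M" using K1 by simp
    ultimately have "T \<le> 2 * (K * M)" by linarith
    then have "real T \<le> real (2 * (K * M))" by (simp only: of_nat_le_iff)
    then show ?thesis by simp
  qed
  have \<eta>: "0 < \<eta>" unfolding \<eta>_def using A n L0 T1 by (simp add: A_def)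
  have 1: "A / (D * real K * real M) \<le> 2 * Y"
  proof -
    have "A / (D * real K * real M) \<le> A / (D * (real T / 2))"
      using A D T1 KM K1 M0 by (intro divide_left_mono) (auto simp: mult.assoc intro!: mult_pos_pos mult_left_mono)
    also have "\<dots> = 2 * Y" unfolding T_eq Dy Y_def using A a v L0 y by (simp add: field_simps)
    finally show ?thesis .
  qed
  have 2: "2 * D / (\<eta> * real M) \<le> 4 * Y"
  proof -
    have "2 * D / (\<eta> * real M) \<le> 2 * D / (\<eta> * (\<nu> / (2 * D)))"
      using M_lo M1 D \<eta> \<nu> by (intro divide_left_mono mult_left_mono mult_pos_pos) auto
    also have "\<dots> = 4 * (D * D) / (\<eta> * \<nu>)" using D \<eta> \<nu> by (simp add: field_simps)
    also have "\<dots> = 4 * Y"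
      unfolding \<eta>_def A_def[symmetric] T_eq Dy Y_def v2[symmetric] a2[symmetric]
      using A a v L0 y by (simp add: field_simps power2_eq_square)
    finally show ?thesis .
  qed
  have 3: "23 * n * L0\<^sup>2 * \<eta> / (2 * D) = 23 / 2 * Y"
    unfolding \<eta>_def A_def[symmetric] T_eq Dy Y_def a2[symmetric]
    using A a v L0 y by (simp add: field_simps power2_eq_square)
  have 4: "7 * sqrt (n * real M) * L0 / real M \<le> 10 * Y"
  proof -
    have "7 * sqrt (n * real M) * L0 / real M = 7 * a * L0 / sqrt (real M)"
      using M1 real_sqrt_mult_self[of "real M"] by (simp add: real_sqrt_mult a_def field_simps)
    also have "\<dots> \<le> 7 * a * L0 / sqrt (\<nu> / (2 * D))"
      using M_lo M1 D \<nu> a L0 by (intro divide_left_mono) auto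
    also have "sqrt (\<nu> / (2 * D)) = v / (sqrt 2 * y)"
      using y by (simp add: Dy v_def real_sqrt_divide real_sqrt_mult)
    also have "7 * a * L0 / (v / (sqrt 2 * y)) = 7 * sqrt 2 * Y" by (simp add: Y_def field_simps)
    also have "\<dots> \<le> 10 * Y"
    proof -
      have "sqrt 2 \<le> 10 / 7" by (rule real_le_lsqrt) (auto simp: power2_eq_square)
      then show ?thesis using Y by (intro mult_right_mono) auto
    qed
    finally show ?thesis .
  qed
  have "A / (D * real K * real M) + 2 * D / (\<eta> * real M) + 23 * n * L0\<^sup>2 * \<eta> / (2 * D) + 7 * sqrt (n * real M) * L0 / real M \<le> 2 * Y + 4 * Y + 23 / 2 * Y + 10 * Y"
    using 1 2 3 4 by linarith
  \<comment> \<open>The coefficients add up to 27.5, far below 2500.\<close>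
  also have "\<dots> \<le> \<epsilon>" using Y_le \<epsilon> by simp
  finally show "(\<Delta> + \<rho> * L0) / (D * real K * real M) + 2 * D / (\<eta> * real M)
      + 23 * n * L0\<^sup>2 * \<eta> / (2 * D) + 7 * sqrt (n * real M) * L0 / real M \<le> \<epsilon>" by (simp add: A_def)
qed

text \<open>\<open>T\<close> has to be at least 1 because \<open>D\<close> and \<open>\<eta>\<close>
  divide by it, while the announced bound can be smaller when \<open>L0 < \<epsilon>\<close> or
  \<open>\<Delta> < \<delta> * \<epsilon>\<close>; hence the \<open>max\<close>. The clause on
  \<open>num_blocks\<close> certifies that otherwise a genuine block average is returned and not the
  fallback. Boundedness from below makes \<open>INF\<close> the true infimum.\<close>

theorem theorem5:
  fixes \<Xi> :: "'w measure" and F :: "real^'n \<Rightarrow> 'w \<Rightarrow> real" and L :: "'w \<Rightarrow> real"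
    and f :: "real^'n \<Rightarrow> real" and x0 :: "real^'n" and \<delta> \<epsilon> L0 \<Delta> :: real
  assumes "prob_space \<Xi>"
    and "0 < \<delta>" "\<delta> < 1" and "0 < \<epsilon>" "\<epsilon> < 1" and "0 < L0" and "0 < \<Delta>"
    and "\<forall>x. integrable \<Xi> (F x)"
    and "\<forall>x. f x = (\<integral>\<xi>. F x \<xi> \<partial>\<Xi>)"
    and "\<forall>\<xi>\<in>space \<Xi>. (L \<xi>)-lipschitz_on UNIV (\<lambda>x. F x \<xi>)"
    and "integrable \<Xi> (\<lambda>\<xi>. (L \<xi>)\<^sup>2)" and "(\<integral>\<xi>. (L \<xi>)\<^sup>2 \<partial>\<Xi>) \<le> L0\<^sup>2"
    and "bdd_below (range f)" and "f x0 - (INF x. f x) \<le> \<Delta>"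
  shows "\<exists>T::nat. 1 \<le> T \<and>
    real T \<le> max 1 (iteration_const * (real CARD('n) * L0\<^sup>2 * \<Delta> / (\<delta> * \<epsilon> ^ 3))) \<and>
    (let \<rho> = min (\<delta> / 2) (\<Delta> / L0);
         \<nu> = max (\<delta> / 2) (\<delta> - \<Delta> / L0);
         D = ((\<Delta> + \<rho> * L0) * sqrt \<nu> / (sqrt (real CARD('n)) * L0 * real T)) powr (2 / 3);
         \<eta> = (\<Delta> + \<rho> * L0) / (real CARD('n) * L0\<^sup>2 * real T);
         P = alg_samples \<Xi> \<nu> D T;
         stat = (\<lambda>\<sigma>. norm (min_norm_subgrad \<delta> f (alg_output F x0 \<rho> \<nu> D \<eta> T \<sigma>)))
     in (\<epsilon> \<le> L0 \<and> \<delta> * \<epsilon> \<le> \<Delta> \<longrightarrow> 1 \<le> num_blocks \<nu> D T) \<and>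
        integrable P stat \<and> (\<integral>\<sigma>. stat \<sigma> \<partial>P) \<le> \<epsilon> \<and>
        (\<forall>\<sigma>. alg_evaluations F x0 \<rho> \<nu> D \<eta> T \<sigma> = 2 * T))"
proof -
  define c where "c = (INF x. f x)"
  define \<rho> where "\<rho> = min (\<delta> / 2) (\<Delta> / L0)"
  define \<nu> where "\<nu> = max (\<delta> / 2) (\<delta> - \<Delta> / L0)"
  define X where "X = real CARD('n) * L0\<^sup>2 * \<Delta> / (\<delta> * \<epsilon> ^ 3)"
  define main where "main \<longleftrightarrow> \<epsilon> \<le> L0 \<and> \<delta> * \<epsilon> \<le> \<Delta>"
  \<comment> \<open>Otherwise \<open>L0 < \<epsilon>\<close> or \<open>\<Delta> < \<delta> * \<epsilon>\<close>; then \<open>x0\<close>, the output after one round, is good enough.\<close>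
  define T where "T = (if main then nat \<lfloor>10 ^ 12 * X\<rfloor> else 1)"
  define D where "D = ((\<Delta> + \<rho> * L0) * sqrt \<nu> / (sqrt (real CARD('n)) * L0 * real T)) powr (2 / 3)"
  define \<eta> where "\<eta> = (\<Delta> + \<rho> * L0) / (real CARD('n) * L0\<^sup>2 * real T)"
  define S where "S \<sigma> = norm (min_norm_subgrad \<delta> f (alg_output F x0 \<rho> \<nu> D \<eta> T \<sigma>))" for \<sigma>
  have c: "c \<le> f x" for x unfolding c_def using assms by (intro cINF_lower) auto
  have n1: "1 \<le> real CARD('n)" by (simp add: Suc_le_eq)
  have X0: "0 < X" unfolding X_def using assms n1 by simp
  have \<rho>0: "0 < \<rho>" using assms by (simp add: \<rho>_def)
  have \<nu>0: "0 < \<nu>" using assms by (simp add: \<nu>_def less_max_iff_disj)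
  have A0: "0 < \<Delta> + \<rho> * L0" using assms \<rho>0 by (simp add: add_pos_pos)
  have params: "1 \<le> T" "1 \<le> num_blocks \<nu> D T" "real (block_length \<nu> D) * D + \<rho> \<le> \<delta>"
    "(\<Delta> + \<rho> * L0) / (D * real (num_blocks \<nu> D T) * real (block_length \<nu> D)) + 2 * D / (\<eta> * real (block_length \<nu> D))
      + 23 * real CARD('n) * L0\<^sup>2 * \<eta> / (2 * D) + 7 * sqrt (real CARD('n) * real (block_length \<nu> D)) * L0 / real (block_length \<nu> D) \<le> \<epsilon>"
    if main
  proof -
    have T: "T = nat \<lfloor>10 ^ 12 * (real CARD('n) * L0\<^sup>2 * \<Delta> / (\<delta> * \<epsilon> ^ 3))\<rfloor>" using that by (simp add: T_def X_def)
    have m: "\<epsilon> \<le> L0" "\<delta> * \<epsilon> \<le> \<Delta>" using that by (auto simp: main_def)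
    note pb = parameter_bound[OF n1 \<open>0 < L0\<close> \<open>0 < \<delta>\<close> \<open>0 < \<epsilon>\<close> \<open>0 < \<Delta>\<close> m, folded \<rho>_def \<nu>_def, folded T, folded D_def \<eta>_def]
    show "1 \<le> T" "1 \<le> num_blocks \<nu> D T" "real (block_length \<nu> D) * D + \<rho> \<le> \<delta>"
      "(\<Delta> + \<rho> * L0) / (D * real (num_blocks \<nu> D T) * real (block_length \<nu> D)) + 2 * D / (\<eta> * real (block_length \<nu> D))
      + 23 * real CARD('n) * L0\<^sup>2 * \<eta> / (2 * D) + 7 * sqrt (real CARD('n) * real (block_length \<nu> D)) * L0 / real (block_length \<nu> D) \<le> \<epsilon>"
      using pb by blast+
  qed
  have T1: "1 \<le> T" using params(1) by (cases main) (auto simp: T_def)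
  have T_le: "real T \<le> max 1 (iteration_const * X)"
    using X0 by (auto simp: T_def iteration_const_def of_nat_nat le_max_iff_disj)
  have D0: "0 < D" using A0 \<nu>0 T1 assms n1 by (simp add: D_def)
  have \<eta>0: "0 < \<eta>" using A0 T1 assms n1 by (simp add: \<eta>_def)
  interpret zero_order_run \<Xi> F L f L0 x0 \<rho> D \<eta>
  proof (intro zero_order_run.intro stochastic_objective.intro zero_order_run_axioms.intro)
    show "(L \<xi>)-lipschitz_on UNIV (\<lambda>x. F x \<xi>)" if "\<xi> \<in> space \<Xi>" for \<xi> using assms that by blast
  qed (use assms \<rho>0 D0 \<eta>0 in auto)
  note stat = stat_def[OF \<open>0 < \<delta>\<close>]
  have int: "integrable (alg_samples \<Xi> \<nu> D T) S"
    unfolding S_def using stat_output_integrable[OF \<open>0 < \<delta>\<close>, of \<nu> T] by (simp add: stat)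
  have le: "(\<integral>\<sigma>. S \<sigma> \<partial>alg_samples \<Xi> \<nu> D T) \<le> \<epsilon>"
  proof (cases main)
    case True
    have "(\<integral>\<sigma>. S \<sigma> \<partial>alg_samples \<Xi> \<nu> D T)
      \<le> (f x0 + L0 * \<rho> - c) / (D * real (num_blocks \<nu> D T) * real (block_length \<nu> D)) + 2 * D / (\<eta> * real (block_length \<nu> D))
      + 23 * real CARD('n) * L0\<^sup>2 * \<eta> / (2 * D) + 7 * sqrt (real CARD('n) * real (block_length \<nu> D)) * L0 / real (block_length \<nu> D)"
      unfolding S_def using stat_output_expectation_le[OF \<open>0 < \<delta>\<close> params(2)[OF True] params(3)[OF True] c]
      by (simp only: stat)
    also have "(f x0 + L0 * \<rho> - c) / (D * real (num_blocks \<nu> D T) * real (block_length \<nu> D))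
      \<le> (\<Delta> + \<rho> * L0) / (D * real (num_blocks \<nu> D T) * real (block_length \<nu> D))"
      using assms D0 by (intro divide_right_mono) (auto simp: c_def mult.commute)
    finally show ?thesis using params(4)[OF True] by linarith
  next
    case False
    then have "T = 1" by (simp add: T_def)
    then have "(\<integral>\<sigma>. S \<sigma> \<partial>alg_samples \<Xi> \<nu> D T) = norm (min_norm_subgrad \<delta> f x0)"
      unfolding S_def using stat_output_one_round[OF \<open>0 < \<delta>\<close>, of T \<nu>] by (simp only: stat)
    also have "\<dots> \<le> \<epsilon>"
    proof (cases "\<epsilon> \<le> L0")
      case True
      \<comment> \<open>A minimal norm above \<open>\<epsilon>\<close> would let \<open>f\<close>
        decrease from \<open>x0\<close> by more than \<open>\<delta> * \<epsilon>\<close>, which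
        exceeds the available gap \<open>\<Delta>\<close>.\<close>
      then have "\<Delta> < \<delta> * \<epsilon>" using False by (simp add: main_def)
      moreover have "\<delta> * norm (min_norm_subgrad \<delta> f x0) \<le> f x0 - c"
        by (rule min_norm_subgrad_descent[OF f_lip \<open>0 < \<delta>\<close> c])
      ultimately have "\<delta> * norm (min_norm_subgrad \<delta> f x0) \<le> \<delta> * \<epsilon>"
        using assms(14)[folded c_def] by linarith
      then show ?thesis using \<open>0 < \<delta>\<close> by simp
    next
      case False
      then show ?thesis using norm_min_norm_subgrad_le[OF f_lip \<open>0 < \<delta>\<close>, of x0] by simp
    qed
    finally show ?thesis .
  qed
  show ?thesis
    unfolding Let_def
  proof (intro exI[of _ T] conjI, goal_cases)
    case 1
    show ?case by (rule T1)
  next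
    case 2
    show ?case using T_le by (simp only: X_def)
  next
    case 3
    show ?case using params(2) unfolding D_def[symmetric] \<rho>_def[symmetric] \<nu>_def[symmetric] main_def by blast
  next
    case 4
    show ?case using int unfolding S_def \<rho>_def[symmetric] \<nu>_def[symmetric] D_def[symmetric] \<eta>_def[symmetric] .
  next
    case 5
    show ?case using le unfolding S_def \<rho>_def[symmetric] \<nu>_def[symmetric] D_def[symmetric] \<eta>_def[symmetric] .
  next
    case 6
    show ?case unfolding \<rho>_def[symmetric] \<nu>_def[symmetric] D_def[symmetric] \<eta>_def[symmetric] by (simp add: alg_evaluations_eq)
  qed
qed

end
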